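(* Let $\mathcal M$ be a cofibration $\mathcal V$-category and let $\mathcal C$ be a small locally flat $\mathcal V$-category. Then the diagram category $[\mathcal C,\mathcal M]$, endowed with the projective cofibrations and the pointwise weak equivalences (and with the pointwise action of $\mathcal V$), is a cofibration $\mathcal V$-category.
   Context: **Categories with cofibrations.** All categories of homotopical nature are assumed to have an initial object $0$, and functors between them to preserve it. A left closed class in a category $\mathcal M$ is a subcategory $\mathsf C\subseteq\mathcal M$, whose morphisms are called cofibrations and whose objects are called good, such that: (i) (small) coproducts of good objects exist in $\mathcal M$ and are good, in particular $0$ is good; (ii) every isomorphism with good domain is a cofibration; (iii) a pushout of a cofibration along a map between good objects exists in $\mathcal M$ and is a cofibration; (iv) a transfinite composite of cofibrations exists in $\mathcal M$ and is a cofibration. An object $M$ is cofibrant if $0\to M$ is a cofibration; a strong cofibration is a cofibration between cofibrant objects. **Cofibration categories.** A cofibration category is a category with subcategories $\mathsf C$ (cofibrations) and $\mathsf W$ (weak equivalences) such that: weak equivalences satisfy 2-out-of-3 and contain all isomorphisms; both $\mathsf C$ and $\mathsf W\cap\mathsf C$ (trivial cofibrations) are left closed classes (they share the same good objects); every map with good domain factors as a cofibration followed by a weak equivalence. For the given $\mathcal M$ it is assumed that all good objects are cofibrant (this is not required of $[\mathcal C,\mathcal M]$). **Enrichment.** $\mathcal V$ is a cocomplete symmetric monoidal category with unit $\mathsf I$, whose tensor product preserves colimits in each variable. A cofibration $\mathcal V$-category is a cofibration category equipped with an action $\otimes:\mathcal V\otimes\mathcal M\to\mathcal M$ (associative and unital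 up to coherent isomorphism; $\mathcal M$ need be only tensored); the action on the given $\mathcal M$ preserves existing colimits in each variable. **Flatness.** A map $i:K\to L$ of $\mathcal V$ is flat (with respect to $\mathcal M$) if $i\otimes-:\mathcal M\to\mathcal M^{[1]}$ (the arrow category) is left Quillen, i.e.: for each strong cofibration $M\to N$ in $\mathcal M$, in the square with corners $K\otimes M,\ L\otimes M,\ K\otimes N,\ L\otimes N$ all objects are cofibrant and all four maps, as well as the map $K\otimes N+_{K\otimes M}L\otimes M\to L\otimes N$, are cofibrations; and $K\otimes-$, $L\otimes-$ preserve weak equivalences between cofibrant objects. An object $K$ is flat if $0\to K$ is flat. A $\mathcal V$-category $\mathcal C$ is locally flat if all hom-objects $\mathcal C(c',c)$ are flat. **Diagrams.** $[\mathcal C,\mathcal M]$ is the category of $\mathcal V$-enriched diagrams: families $Xc\in\mathcal M$ with associative and unital maps $\mathcal C(c,c')\otimes Xc\to Xc'$. Write $\mathcal C_c=\mathcal C(c,-)$. Good objects of $[\mathcal C,\mathcal M]$ are the pointwise good diagrams. Projective cofibrations are the maps (with good domain) in the closure of $\{\mathcal C_c\otimes M\to\mathcal C_c\otimes N\mid c\in\mathcal C,\ M\to N\text{ a cofibration in }\mathcal M\}$ under coproducts, cobase change (along maps between good objects) and transfinite composites. Pointwise weak equivalences are maps $f$ with every $f_c$ a weak equivalence. *)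

theory Defs
  imports Main "HOL-Library.FuncSet"
begin

section \<open>Categories, functors and colimits\<close>

text \<open>The composition \<open>g \<cdot> f\<close> is in applicative order. Values of the fields outside of \<open>Obj\<close>
  and \<open>Arr\<close> are irrelevant.\<close>

record ('o, 'a) cat =
  Obj :: "'o set"
  Arr :: "'a set"
  Dom :: "'a \<Rightarrow> 'o"
  Cod :: "'a \<Rightarrow> 'o"
  Ident :: "'o \<Rightarrow> 'a"
  Comp :: "'a \<Rightarrow> 'a \<Rightarrow> 'a"  (infixr "\<cdot>\<index>" 72)

definition hom :: "('o, 'a, 'x) cat_scheme \<Rightarrow> 'o \<Rightarrow> 'o \<Rightarrow> 'a set" where
  "hom C X Y = {f \<in> Arr C. Dom C f = X \<and> Cod C f = Y}"

locale category =
  fixes C :: "('o, 'a, 'x) cat_scheme" (structure)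
  assumes Dom_in_Obj: "f \<in> Arr C \<Longrightarrow> Dom C f \<in> Obj C"
    and Cod_in_Obj: "f \<in> Arr C \<Longrightarrow> Cod C f \<in> Obj C"
    and Ident_in_hom: "X \<in> Obj C \<Longrightarrow> Ident C X \<in> hom C X X"
    and Comp_in_hom: "f \<in> hom C X Y \<Longrightarrow> g \<in> hom C Y Z \<Longrightarrow> g \<cdot> f \<in> hom C X Z"
    and Comp_Ident: "f \<in> hom C X Y \<Longrightarrow> f \<cdot> Ident C X = f"
    and Ident_Comp: "f \<in> hom C X Y \<Longrightarrow> Ident C Y \<cdot> f = f"
    and Comp_assoc: "f \<in> hom C W X \<Longrightarrow> g \<in> hom C X Y \<Longrightarrow> h \<in> hom C Y Z \<Longrightarrow>
      (h \<cdot> g) \<cdot> f = h \<cdot> (g \<cdot> f)"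

definition inverse_arrows :: "('o, 'a, 'x) cat_scheme \<Rightarrow> 'a \<Rightarrow> 'a \<Rightarrow> bool" where
  "inverse_arrows C f g \<longleftrightarrow> f \<in> Arr C \<and> g \<in> hom C (Cod C f) (Dom C f) \<and>
     g \<cdot>\<^bsub>C\<^esub> f = Ident C (Dom C f) \<and> f \<cdot>\<^bsub>C\<^esub> g = Ident C (Cod C f)"

definition iso :: "('o, 'a, 'x) cat_scheme \<Rightarrow> 'a \<Rightarrow> bool" where
  "iso C f \<longleftrightarrow> (\<exists>g. inverse_arrows C f g)"

definition inverse_of :: "('o, 'a, 'x) cat_scheme \<Rightarrow> 'a \<Rightarrow> 'a" where
  "inverse_of C f = (THE g. inverse_arrows C f g)"

definition initial :: "('o, 'a, 'x) cat_scheme \<Rightarrow> 'o \<Rightarrow> bool" where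
  "initial C Z \<longleftrightarrow> Z \<in> Obj C \<and> (\<forall>X\<in>Obj C. \<exists>!f. f \<in> hom C Z X)"

definition coproduct ::
    "('o, 'a, 'x) cat_scheme \<Rightarrow> 'i set \<Rightarrow> ('i \<Rightarrow> 'o) \<Rightarrow> 'o \<Rightarrow> ('i \<Rightarrow> 'a) \<Rightarrow> bool" where
  "coproduct C I X P p \<longleftrightarrow> P \<in> Obj C \<and> (\<forall>i\<in>I. X i \<in> Obj C \<and> p i \<in> hom C (X i) P) \<and>
     (\<forall>Q\<in>Obj C. \<forall>q. (\<forall>i\<in>I. q i \<in> hom C (X i) Q) \<longrightarrow>
        (\<exists>!h. h \<in> hom C P Q \<and> (\<forall>i\<in>I. h \<cdot>\<^bsub>C\<^esub> p i = q i)))"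

text \<open>\<open>pushout C f g p q\<close>: the square \<open>p \<cdot> f = q \<cdot> g\<close> is a pushout, so that \<open>q\<close> is the
  cobase change of \<open>f\<close> along \<open>g\<close>.\<close>

definition commuting_square ::
    "('o, 'a, 'x) cat_scheme \<Rightarrow> 'a \<Rightarrow> 'a \<Rightarrow> 'a \<Rightarrow> 'a \<Rightarrow> bool" where
  "commuting_square C f g p q \<longleftrightarrow> f \<in> Arr C \<and> g \<in> Arr C \<and> p \<in> Arr C \<and> q \<in> Arr C \<and>
     Dom C f = Dom C g \<and> Dom C p = Cod C f \<and> Dom C q = Cod C g \<and> Cod C p = Cod C q \<and>
     p \<cdot>\<^bsub>C\<^esub> f = q \<cdot>\<^bsub>C\<^esub> g"

definition pushout ::
    "('o, 'a, 'x) cat_scheme \<Rightarrow> 'a \<Rightarrow> 'a \<Rightarrow> 'a \<Rightarrow> 'a \<Rightarrow> bool" where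
  "pushout C f g p q \<longleftrightarrow> commuting_square C f g p q \<and>
     (\<forall>p' q'. commuting_square C f g p' q' \<longrightarrow>
        (\<exists>!h. h \<in> hom C (Cod C p) (Cod C p') \<and> h \<cdot>\<^bsub>C\<^esub> p = p' \<and> h \<cdot>\<^bsub>C\<^esub> q = q'))"

definition is_functor ::
    "('j, 'u, 'y) cat_scheme \<Rightarrow> ('o, 'a, 'x) cat_scheme \<Rightarrow> ('j \<Rightarrow> 'o) \<Rightarrow> ('u \<Rightarrow> 'a) \<Rightarrow> bool" where
  "is_functor J C Fo Fa \<longleftrightarrow>
     (\<forall>j\<in>Obj J. Fo j \<in> Obj C \<and> Fa (Ident J j) = Ident C (Fo j)) \<and>
     (\<forall>u\<in>Arr J. Fa u \<in> hom C (Fo (Dom J u)) (Fo (Cod J u))) \<and>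
     (\<forall>u\<in>Arr J. \<forall>v\<in>Arr J. Dom J v = Cod J u \<longrightarrow> Fa (v \<cdot>\<^bsub>J\<^esub> u) = Fa v \<cdot>\<^bsub>C\<^esub> Fa u)"

definition cocone ::
    "('j, 'u, 'y) cat_scheme \<Rightarrow> ('o, 'a, 'x) cat_scheme \<Rightarrow> ('j \<Rightarrow> 'o) \<Rightarrow> ('u \<Rightarrow> 'a) \<Rightarrow>
      'o \<Rightarrow> ('j \<Rightarrow> 'a) \<Rightarrow> bool" where
  "cocone J C Fo Fa Z t \<longleftrightarrow> Z \<in> Obj C \<and> (\<forall>j\<in>Obj J. t j \<in> hom C (Fo j) Z) \<and>
     (\<forall>u\<in>Arr J. t (Cod J u) \<cdot>\<^bsub>C\<^esub> Fa u = t (Dom J u))"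

definition colimit ::
    "('j, 'u, 'y) cat_scheme \<Rightarrow> ('o, 'a, 'x) cat_scheme \<Rightarrow> ('j \<Rightarrow> 'o) \<Rightarrow> ('u \<Rightarrow> 'a) \<Rightarrow>
      'o \<Rightarrow> ('j \<Rightarrow> 'a) \<Rightarrow> bool" where
  "colimit J C Fo Fa Z t \<longleftrightarrow> is_functor J C Fo Fa \<and> cocone J C Fo Fa Z t \<and>
     (\<forall>Z' t'. cocone J C Fo Fa Z' t' \<longrightarrow>
        (\<exists>!h. h \<in> hom C Z Z' \<and> (\<forall>j\<in>Obj J. h \<cdot>\<^bsub>C\<^esub> t j = t' j)))"


section \<open>Smallness\<close>

text \<open>Small means of cardinality less than a fixed uncountable regular cardinal \<open>\<kappa>\<close>; smallness
  relative to a Grothendieck universe is the case of an inaccessible \<open>\<kappa>\<close>. Since every set of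
  cardinality less than \<open>\<kappa>\<close> is in bijection with a subset of the field of \<open>\<kappa>\<close>, index sets,
  shapes of diagrams and ordinals are taken from the type underlying \<open>\<kappa>\<close>.\<close>

definition universe_cardinal :: "'s rel \<Rightarrow> bool" where
  "universe_cardinal \<kappa> \<longleftrightarrow> Card_order \<kappa> \<and> regularCard \<kappa> \<and> (natLeq, \<kappa>) \<in> ordLess"

definition small :: "'s rel \<Rightarrow> 'i set \<Rightarrow> bool" where
  "small \<kappa> I \<longleftrightarrow> (card_of I, \<kappa>) \<in> ordLess"

definition small_category :: "'s rel \<Rightarrow> ('j, 'u, 'y) cat_scheme \<Rightarrow> bool" where
  "small_category \<kappa> J \<longleftrightarrow> category J \<and> small \<kappa> (Obj J) \<and> small \<kappa> (Arr J)"

definition cocomplete :: "'s rel \<Rightarrow> ('o, 'a, 'x) cat_scheme \<Rightarrow> bool" where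
  "cocomplete \<kappa> C \<longleftrightarrow> (\<forall>(J :: ('s, 's) cat) Fo Fa.
     small_category \<kappa> J \<and> is_functor J C Fo Fa \<longrightarrow> (\<exists>Z t. colimit J C Fo Fa Z t))"

definition preserves_colimits ::
    "'s rel \<Rightarrow> ('o, 'a, 'x) cat_scheme \<Rightarrow> ('p, 'b, 'y) cat_scheme \<Rightarrow>
      ('o \<Rightarrow> 'p) \<Rightarrow> ('a \<Rightarrow> 'b) \<Rightarrow> bool" where
  "preserves_colimits \<kappa> C D Ho Ha \<longleftrightarrow> (\<forall>(J :: ('s, 's) cat) Fo Fa Z t.
     small_category \<kappa> J \<and> colimit J C Fo Fa Z t \<longrightarrow>
       colimit J D (Ho \<circ> Fo) (Ha \<circ> Fa) (Ho Z) (Ha \<circ> t))"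


section \<open>Transfinite sequences\<close>

definition order_cat :: "'s rel \<Rightarrow> ('s, 's \<times> 's) cat" where
  "order_cat r = \<lparr>Obj = Field r, Arr = r, Dom = fst, Cod = snd, Ident = (\<lambda>a. (a, a)),
     Comp = (\<lambda>v u. (fst u, snd v))\<rparr>"

definition bottom_elem :: "'s rel \<Rightarrow> 's \<Rightarrow> bool" where
  "bottom_elem r a \<longleftrightarrow> a \<in> Field r \<and> underS r a = {}"

definition succ_elem :: "'s rel \<Rightarrow> 's \<Rightarrow> 's \<Rightarrow> bool" where
  "succ_elem r a b \<longleftrightarrow> a \<in> underS r b \<and> (\<forall>c\<in>underS r b. (c, a) \<in> r)"

definition limit_elem :: "'s rel \<Rightarrow> 's \<Rightarrow> bool" where
  "limit_elem r b \<longleftrightarrow> b \<in> Field r \<and> \<not> bottom_elem r b \<and> (\<nexists>a. succ_elem r a b)"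

text \<open>A colimit-preserving functor \<open>(X, x)\<close> on a nonzero small ordinal, given as a reflexive
  well-order \<open>r\<close>. Its transfinite composite is the leg at the bottom element of a colimit.\<close>

definition transfinite_sequence ::
    "'s rel \<Rightarrow> ('o, 'a, 'x) cat_scheme \<Rightarrow> 's rel \<Rightarrow> ('s \<Rightarrow> 'o) \<Rightarrow> ('s \<times> 's \<Rightarrow> 'a) \<Rightarrow> bool" where
  "transfinite_sequence \<kappa> C r X x \<longleftrightarrow>
     Well_order r \<and> Field r \<noteq> {} \<and> small \<kappa> (Field r) \<and> is_functor (order_cat r) C X x \<and>
     (\<forall>b. limit_elem r b \<longrightarrow>
        colimit (order_cat (Restr r (underS r b))) C X x (X b) (\<lambda>a. x (a, b)))"


section \<open>Cofibration categories\<close>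

definition subcategory :: "('o, 'a, 'x) cat_scheme \<Rightarrow> 'o set \<Rightarrow> 'a set \<Rightarrow> bool" where
  "subcategory M G S \<longleftrightarrow> G \<subseteq> Obj M \<and> S \<subseteq> Arr M \<and>
     (\<forall>f\<in>S. Dom M f \<in> G \<and> Cod M f \<in> G) \<and> (\<forall>X\<in>G. Ident M X \<in> S) \<and>
     (\<forall>f\<in>S. \<forall>g\<in>S. Dom M g = Cod M f \<longrightarrow> g \<cdot>\<^bsub>M\<^esub> f \<in> S)"

definition left_closed ::
    "'s rel \<Rightarrow> ('o, 'a, 'x) cat_scheme \<Rightarrow> 'o set \<Rightarrow> 'a set \<Rightarrow> bool" where
  "left_closed \<kappa> M G S \<longleftrightarrow> subcategory M G S \<and>
     (\<forall>(I :: 's set) X. small \<kappa> I \<and> (\<forall>i\<in>I. X i \<in> G) \<longrightarrow>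
        (\<exists>P p. coproduct M I X P p) \<and> (\<forall>P p. coproduct M I X P p \<longrightarrow> P \<in> G)) \<and>
     (\<forall>f. iso M f \<and> Dom M f \<in> G \<longrightarrow> f \<in> S) \<and>
     (\<forall>f g. f \<in> S \<and> g \<in> Arr M \<and> Dom M g = Dom M f \<and> Cod M g \<in> G \<longrightarrow>
        (\<exists>p q. pushout M f g p q) \<and> (\<forall>p q. pushout M f g p q \<longrightarrow> q \<in> S)) \<and>
     (\<forall>(r :: 's rel) X x a. transfinite_sequence \<kappa> M r X x \<and> bottom_elem r a \<and> X a \<in> G \<and>
        (\<forall>b c. succ_elem r b c \<longrightarrow> x (b, c) \<in> S) \<longrightarrow>
        (\<exists>Z t. colimit (order_cat r) M X x Z t) \<and>
        (\<forall>Z t. colimit (order_cat r) M X x Z t \<longrightarrow> t a \<in> S))"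

definition two_out_of_three :: "('o, 'a, 'x) cat_scheme \<Rightarrow> 'a set \<Rightarrow> bool" where
  "two_out_of_three M W \<longleftrightarrow> (\<forall>f\<in>Arr M. \<forall>g\<in>Arr M. Dom M g = Cod M f \<longrightarrow>
     (f \<in> W \<and> g \<in> W \<longrightarrow> g \<cdot>\<^bsub>M\<^esub> f \<in> W) \<and>
     (f \<in> W \<and> g \<cdot>\<^bsub>M\<^esub> f \<in> W \<longrightarrow> g \<in> W) \<and>
     (g \<in> W \<and> g \<cdot>\<^bsub>M\<^esub> f \<in> W \<longrightarrow> f \<in> W))"

text \<open>The arguments are the category, its good objects, cofibrations and weak equivalences.\<close>

definition cofibration_category ::
    "'s rel \<Rightarrow> ('o, 'a, 'x) cat_scheme \<Rightarrow> 'o set \<Rightarrow> 'a set \<Rightarrow> 'a set \<Rightarrow> bool" where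
  "cofibration_category \<kappa> M G Cf W \<longleftrightarrow> category M \<and> (\<exists>Z. initial M Z) \<and>
     subcategory M (Obj M) W \<and> two_out_of_three M W \<and> (\<forall>f. iso M f \<longrightarrow> f \<in> W) \<and>
     left_closed \<kappa> M G Cf \<and> left_closed \<kappa> M G (W \<inter> Cf) \<and>
     (\<forall>f\<in>Arr M. Dom M f \<in> G \<longrightarrow> (\<exists>i\<in>Cf. \<exists>w\<in>W. Dom M w = Cod M i \<and> f = w \<cdot>\<^bsub>M\<^esub> i))"

definition cofibrant :: "('o, 'a, 'x) cat_scheme \<Rightarrow> 'a set \<Rightarrow> 'o \<Rightarrow> bool" where
  "cofibrant M Cf X \<longleftrightarrow> (\<exists>Z f. initial M Z \<and> f \<in> hom M Z X \<and> f \<in> Cf)"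

definition strong_cofibration :: "('o, 'a, 'x) cat_scheme \<Rightarrow> 'a set \<Rightarrow> 'a \<Rightarrow> bool" where
  "strong_cofibration M Cf f \<longleftrightarrow> f \<in> Cf \<and> cofibrant M Cf (Dom M f) \<and> cofibrant M Cf (Cod M f)"


section \<open>Monoidal categories and their actions\<close>

record ('o, 'a) moncat = "('o, 'a) cat" +
  tensor_obj :: "'o \<Rightarrow> 'o \<Rightarrow> 'o"  (infixl "\<otimes>\<index>" 75)
  tensor_arr :: "'a \<Rightarrow> 'a \<Rightarrow> 'a"  (infixl "\<odot>\<index>" 75)
  unit_obj :: "'o"  ("\<I>\<index>")
  assoc :: "'o \<Rightarrow> 'o \<Rightarrow> 'o \<Rightarrow> 'a"
  lunit :: "'o \<Rightarrow> 'a"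
  runit :: "'o \<Rightarrow> 'a"
  symm :: "'o \<Rightarrow> 'o \<Rightarrow> 'a"

locale symmetric_monoidal_category = category V
  for V :: "('o, 'a, 'x) moncat_scheme" (structure) +
  assumes tensor_Obj: "K \<in> Obj V \<Longrightarrow> L \<in> Obj V \<Longrightarrow> K \<otimes> L \<in> Obj V"
    and tensor_hom: "f \<in> hom V K K' \<Longrightarrow> g \<in> hom V L L' \<Longrightarrow> f \<odot> g \<in> hom V (K \<otimes> L) (K' \<otimes> L')"
    and tensor_Ident: "K \<in> Obj V \<Longrightarrow> L \<in> Obj V \<Longrightarrow> Ident V K \<odot> Ident V L = Ident V (K \<otimes> L)"
    and tensor_Comp: "f \<in> hom V K K' \<Longrightarrow> f' \<in> hom V K' K'' \<Longrightarrow>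
      g \<in> hom V L L' \<Longrightarrow> g' \<in> hom V L' L'' \<Longrightarrow> (f' \<cdot> f) \<odot> (g' \<cdot> g) = (f' \<odot> g') \<cdot> (f \<odot> g)"
    and unit_Obj: "\<I> \<in> Obj V"
    and assoc_hom: "K \<in> Obj V \<Longrightarrow> L \<in> Obj V \<Longrightarrow> N \<in> Obj V \<Longrightarrow>
      assoc V K L N \<in> hom V ((K \<otimes> L) \<otimes> N) (K \<otimes> (L \<otimes> N))"
    and assoc_iso: "K \<in> Obj V \<Longrightarrow> L \<in> Obj V \<Longrightarrow> N \<in> Obj V \<Longrightarrow> iso V (assoc V K L N)"
    and assoc_natural: "f \<in> hom V K K' \<Longrightarrow> g \<in> hom V L L' \<Longrightarrow> h \<in> hom V N N' \<Longrightarrow>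
      assoc V K' L' N' \<cdot> ((f \<odot> g) \<odot> h) = (f \<odot> (g \<odot> h)) \<cdot> assoc V K L N"
    and lunit_hom: "K \<in> Obj V \<Longrightarrow> lunit V K \<in> hom V (\<I> \<otimes> K) K"
    and lunit_iso: "K \<in> Obj V \<Longrightarrow> iso V (lunit V K)"
    and lunit_natural: "f \<in> hom V K K' \<Longrightarrow> lunit V K' \<cdot> (Ident V \<I> \<odot> f) = f \<cdot> lunit V K"
    and runit_hom: "K \<in> Obj V \<Longrightarrow> runit V K \<in> hom V (K \<otimes> \<I>) K"
    and runit_iso: "K \<in> Obj V \<Longrightarrow> iso V (runit V K)"
    and runit_natural: "f \<in> hom V K K' \<Longrightarrow> runit V K' \<cdot> (f \<odot> Ident V \<I>) = f \<cdot> runit V K"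
    and symm_hom: "K \<in> Obj V \<Longrightarrow> L \<in> Obj V \<Longrightarrow> symm V K L \<in> hom V (K \<otimes> L) (L \<otimes> K)"
    and symm_natural: "f \<in> hom V K K' \<Longrightarrow> g \<in> hom V L L' \<Longrightarrow>
      symm V K' L' \<cdot> (f \<odot> g) = (g \<odot> f) \<cdot> symm V K L"
    and symm_symm: "K \<in> Obj V \<Longrightarrow> L \<in> Obj V \<Longrightarrow> symm V L K \<cdot> symm V K L = Ident V (K \<otimes> L)"
    and pentagon: "K \<in> Obj V \<Longrightarrow> L \<in> Obj V \<Longrightarrow> N \<in> Obj V \<Longrightarrow> P \<in> Obj V \<Longrightarrow>
      assoc V K L (N \<otimes> P) \<cdot> assoc V (K \<otimes> L) N P =
      (Ident V K \<odot> assoc V L N P) \<cdot> assoc V K (L \<otimes> N) P \<cdot> (assoc V K L N \<odot> Ident V P)"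
    and triangle: "K \<in> Obj V \<Longrightarrow> L \<in> Obj V \<Longrightarrow>
      (Ident V K \<odot> lunit V L) \<cdot> assoc V K \<I> L = runit V K \<odot> Ident V L"
    and hexagon: "K \<in> Obj V \<Longrightarrow> L \<in> Obj V \<Longrightarrow> N \<in> Obj V \<Longrightarrow>
      assoc V L N K \<cdot> symm V K (L \<otimes> N) \<cdot> assoc V K L N =
      (Ident V L \<odot> symm V K N) \<cdot> assoc V L K N \<cdot> (symm V K L \<odot> Ident V N)"

definition tensor_preserves_colimits :: "'s rel \<Rightarrow> ('o, 'a, 'x) moncat_scheme \<Rightarrow> bool" where
  "tensor_preserves_colimits \<kappa> V \<longleftrightarrow> (\<forall>K\<in>Obj V.
     preserves_colimits \<kappa> V V (\<lambda>L. K \<otimes>\<^bsub>V\<^esub> L) (\<lambda>f. Ident V K \<odot>\<^bsub>V\<^esub> f) \<and>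
     preserves_colimits \<kappa> V V (\<lambda>L. L \<otimes>\<^bsub>V\<^esub> K) (\<lambda>f. f \<odot>\<^bsub>V\<^esub> Ident V K))"

record ('vo, 'va, 'o, 'a) action =
  act_obj :: "'vo \<Rightarrow> 'o \<Rightarrow> 'o"  (infixr "\<star>\<index>" 76)
  act_arr :: "'va \<Rightarrow> 'a \<Rightarrow> 'a"  (infixr "\<diamondop>\<index>" 76)
  act_assoc :: "'vo \<Rightarrow> 'vo \<Rightarrow> 'o \<Rightarrow> 'a"
  act_unit :: "'o \<Rightarrow> 'a"

text \<open>Of the two unit triangles below, \<open>act_lunit\<close> is customarily listed although it follows from
  the other axioms.\<close>

locale monoidal_action = V: symmetric_monoidal_category V + M: category M
  for V :: "('vo, 'va, 'x) moncat_scheme" and M :: "('o, 'a, 'y) cat_scheme" +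
  fixes A :: "('vo, 'va, 'o, 'a) action" (structure)
  assumes act_Obj: "K \<in> Obj V \<Longrightarrow> X \<in> Obj M \<Longrightarrow> K \<star> X \<in> Obj M"
    and act_hom: "k \<in> hom V K K' \<Longrightarrow> f \<in> hom M X X' \<Longrightarrow> k \<diamondop> f \<in> hom M (K \<star> X) (K' \<star> X')"
    and act_Ident: "K \<in> Obj V \<Longrightarrow> X \<in> Obj M \<Longrightarrow> Ident V K \<diamondop> Ident M X = Ident M (K \<star> X)"
    and act_Comp: "k \<in> hom V K K' \<Longrightarrow> k' \<in> hom V K' K'' \<Longrightarrow>
      f \<in> hom M X X' \<Longrightarrow> f' \<in> hom M X' X'' \<Longrightarrow>
      (k' \<cdot>\<^bsub>V\<^esub> k) \<diamondop> (f' \<cdot>\<^bsub>M\<^esub> f) = (k' \<diamondop> f') \<cdot>\<^bsub>M\<^esub> (k \<diamondop> f)"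
    and act_assoc_hom: "K \<in> Obj V \<Longrightarrow> L \<in> Obj V \<Longrightarrow> X \<in> Obj M \<Longrightarrow>
      act_assoc A K L X \<in> hom M ((K \<otimes>\<^bsub>V\<^esub> L) \<star> X) (K \<star> L \<star> X)"
    and act_assoc_iso: "K \<in> Obj V \<Longrightarrow> L \<in> Obj V \<Longrightarrow> X \<in> Obj M \<Longrightarrow> iso M (act_assoc A K L X)"
    and act_assoc_natural: "k \<in> hom V K K' \<Longrightarrow> l \<in> hom V L L' \<Longrightarrow> f \<in> hom M X X' \<Longrightarrow>
      act_assoc A K' L' X' \<cdot>\<^bsub>M\<^esub> ((k \<odot>\<^bsub>V\<^esub> l) \<diamondop> f) = (k \<diamondop> l \<diamondop> f) \<cdot>\<^bsub>M\<^esub> act_assoc A K L X"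
    and act_unit_hom: "X \<in> Obj M \<Longrightarrow> act_unit A X \<in> hom M (\<I>\<^bsub>V\<^esub> \<star> X) X"
    and act_unit_iso: "X \<in> Obj M \<Longrightarrow> iso M (act_unit A X)"
    and act_unit_natural: "f \<in> hom M X X' \<Longrightarrow>
      act_unit A X' \<cdot>\<^bsub>M\<^esub> (Ident V \<I>\<^bsub>V\<^esub> \<diamondop> f) = f \<cdot>\<^bsub>M\<^esub> act_unit A X"
    and act_pentagon: "K \<in> Obj V \<Longrightarrow> L \<in> Obj V \<Longrightarrow> N \<in> Obj V \<Longrightarrow> X \<in> Obj M \<Longrightarrow>
      act_assoc A K L (N \<star> X) \<cdot>\<^bsub>M\<^esub> act_assoc A (K \<otimes>\<^bsub>V\<^esub> L) N X =
      (Ident V K \<diamondop> act_assoc A L N X) \<cdot>\<^bsub>M\<^esub> act_assoc A K (L \<otimes>\<^bsub>V\<^esub> N) X \<cdot>\<^bsub>M\<^esub>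
        (assoc V K L N \<diamondop> Ident M X)"
    and act_triangle: "K \<in> Obj V \<Longrightarrow> X \<in> Obj M \<Longrightarrow>
      (Ident V K \<diamondop> act_unit A X) \<cdot>\<^bsub>M\<^esub> act_assoc A K \<I>\<^bsub>V\<^esub> X = runit V K \<diamondop> Ident M X"
    and act_lunit: "L \<in> Obj V \<Longrightarrow> X \<in> Obj M \<Longrightarrow>
      act_unit A (L \<star> X) \<cdot>\<^bsub>M\<^esub> act_assoc A \<I>\<^bsub>V\<^esub> L X = lunit V L \<diamondop> Ident M X"

definition action_preserves_initial ::
    "('vo, 'va, 'x) moncat_scheme \<Rightarrow> ('o, 'a, 'y) cat_scheme \<Rightarrow> ('vo, 'va, 'o, 'a) action \<Rightarrow> bool"
  where
  "action_preserves_initial V M A \<longleftrightarrow>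
     (\<forall>K\<in>Obj V. \<forall>Z. initial M Z \<longrightarrow> initial M (K \<star>\<^bsub>A\<^esub> Z)) \<and>
     (\<forall>X\<in>Obj M. \<forall>Z. initial V Z \<longrightarrow> initial M (Z \<star>\<^bsub>A\<^esub> X))"

definition action_preserves_colimits ::
    "'s rel \<Rightarrow> ('vo, 'va, 'x) moncat_scheme \<Rightarrow> ('o, 'a, 'y) cat_scheme \<Rightarrow>
      ('vo, 'va, 'o, 'a) action \<Rightarrow> bool" where
  "action_preserves_colimits \<kappa> V M A \<longleftrightarrow>
     (\<forall>K\<in>Obj V. preserves_colimits \<kappa> M M (\<lambda>X. K \<star>\<^bsub>A\<^esub> X) (\<lambda>f. Ident V K \<diamondop>\<^bsub>A\<^esub> f)) \<and>
     (\<forall>X\<in>Obj M. preserves_colimits \<kappa> V M (\<lambda>K. K \<star>\<^bsub>A\<^esub> X) (\<lambda>k. k \<diamondop>\<^bsub>A\<^esub> Ident M X))"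

text \<open>Functors between categories with a homotopical structure are understood to preserve the
  initial object, whence the last conjunct. Preservation of further colimits is not part of the
  notion.\<close>

definition cofibration_V_category ::
    "'s rel \<Rightarrow> ('vo, 'va, 'x) moncat_scheme \<Rightarrow> ('o, 'a, 'y) cat_scheme \<Rightarrow> 'o set \<Rightarrow> 'a set \<Rightarrow>
      'a set \<Rightarrow> ('vo, 'va, 'o, 'a) action \<Rightarrow> bool" where
  "cofibration_V_category \<kappa> V M G Cf W A \<longleftrightarrow> cofibration_category \<kappa> M G Cf W \<and>
     monoidal_action V M A \<and> action_preserves_initial V M A"


section \<open>Enriched categories and flatness\<close>

text \<open>\<open>EHom C c d\<close> is the hom-object \<open>C(c, d)\<close>, and the composition \<open>EComp C b c d\<close> is a map
  \<open>C(c, d) \<otimes> C(b, c) \<rightarrow> C(b, d)\<close>.\<close>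

record ('c, 'vo, 'va) ecat =
  EObj :: "'c set"
  EHom :: "'c \<Rightarrow> 'c \<Rightarrow> 'vo"
  EIdent :: "'c \<Rightarrow> 'va"
  EComp :: "'c \<Rightarrow> 'c \<Rightarrow> 'c \<Rightarrow> 'va"

locale enriched_category = symmetric_monoidal_category V
  for V :: "('vo, 'va, 'x) moncat_scheme" (structure) +
  fixes C :: "('c, 'vo, 'va) ecat"
  assumes EHom_Obj: "c \<in> EObj C \<Longrightarrow> d \<in> EObj C \<Longrightarrow> EHom C c d \<in> Obj V"
    and EIdent_hom: "c \<in> EObj C \<Longrightarrow> EIdent C c \<in> hom V \<I> (EHom C c c)"
    and EComp_hom: "b \<in> EObj C \<Longrightarrow> c \<in> EObj C \<Longrightarrow> d \<in> EObj C \<Longrightarrow>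
      EComp C b c d \<in> hom V (EHom C c d \<otimes> EHom C b c) (EHom C b d)"
    and EComp_assoc: "b \<in> EObj C \<Longrightarrow> c \<in> EObj C \<Longrightarrow> d \<in> EObj C \<Longrightarrow> e \<in> EObj C \<Longrightarrow>
      EComp C b c e \<cdot> (EComp C c d e \<odot> Ident V (EHom C b c)) =
      EComp C b d e \<cdot> (Ident V (EHom C d e) \<odot> EComp C b c d) \<cdot>
        assoc V (EHom C d e) (EHom C c d) (EHom C b c)"
    and EComp_EIdent: "c \<in> EObj C \<Longrightarrow> d \<in> EObj C \<Longrightarrow>
      EComp C c c d \<cdot> (Ident V (EHom C c d) \<odot> EIdent C c) = runit V (EHom C c d)"
    and EIdent_EComp: "c \<in> EObj C \<Longrightarrow> d \<in> EObj C \<Longrightarrow>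
      EComp C c d d \<cdot> (EIdent C d \<odot> Ident V (EHom C c d)) = lunit V (EHom C c d)"

text \<open>In \<open>flat_map\<close>, \<open>h\<close> is the map from the pushout of \<open>K \<star> f\<close> and \<open>i \<star> X\<close> to \<open>L \<star> Y\<close>,
  where \<open>i: K \<rightarrow> L\<close> and \<open>f: X \<rightarrow> Y\<close>.\<close>

definition flat_map ::
    "('vo, 'va, 'x) moncat_scheme \<Rightarrow> ('o, 'a, 'y) cat_scheme \<Rightarrow> 'a set \<Rightarrow> 'a set \<Rightarrow>
      ('vo, 'va, 'o, 'a) action \<Rightarrow> 'va \<Rightarrow> bool" where
  "flat_map V M Cf W A i \<longleftrightarrow> i \<in> Arr V \<and>
     (\<forall>f. strong_cofibration M Cf f \<longrightarrow>
        (let K = Dom V i; L = Cod V i; X = Dom M f; Y = Cod M f;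
             Kf = Ident V K \<diamondop>\<^bsub>A\<^esub> f; Lf = Ident V L \<diamondop>\<^bsub>A\<^esub> f;
             iX = i \<diamondop>\<^bsub>A\<^esub> Ident M X; iY = i \<diamondop>\<^bsub>A\<^esub> Ident M Y
         in cofibrant M Cf (K \<star>\<^bsub>A\<^esub> X) \<and> cofibrant M Cf (L \<star>\<^bsub>A\<^esub> X) \<and>
            cofibrant M Cf (K \<star>\<^bsub>A\<^esub> Y) \<and> cofibrant M Cf (L \<star>\<^bsub>A\<^esub> Y) \<and>
            Kf \<in> Cf \<and> Lf \<in> Cf \<and> iX \<in> Cf \<and> iY \<in> Cf \<and>
            (\<exists>p q h. pushout M Kf iX p q \<and> h \<in> hom M (Cod M p) (L \<star>\<^bsub>A\<^esub> Y) \<and>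
               h \<cdot>\<^bsub>M\<^esub> p = iY \<and> h \<cdot>\<^bsub>M\<^esub> q = Lf \<and> h \<in> Cf))) \<and>
     (\<forall>K\<in>{Dom V i, Cod V i}. \<forall>w\<in>W. cofibrant M Cf (Dom M w) \<and> cofibrant M Cf (Cod M w) \<longrightarrow>
        Ident V K \<diamondop>\<^bsub>A\<^esub> w \<in> W)"

definition flat_object ::
    "('vo, 'va, 'x) moncat_scheme \<Rightarrow> ('o, 'a, 'y) cat_scheme \<Rightarrow> 'a set \<Rightarrow> 'a set \<Rightarrow>
      ('vo, 'va, 'o, 'a) action \<Rightarrow> 'vo \<Rightarrow> bool" where
  "flat_object V M Cf W A K \<longleftrightarrow>
     (\<exists>Z i. initial V Z \<and> i \<in> hom V Z K \<and> flat_map V M Cf W A i)"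

definition locally_flat ::
    "('vo, 'va, 'x) moncat_scheme \<Rightarrow> ('o, 'a, 'y) cat_scheme \<Rightarrow> 'a set \<Rightarrow> 'a set \<Rightarrow>
      ('vo, 'va, 'o, 'a) action \<Rightarrow> ('c, 'vo, 'va) ecat \<Rightarrow> bool" where
  "locally_flat V M Cf W A C \<longleftrightarrow>
     (\<forall>c\<in>EObj C. \<forall>d\<in>EObj C. flat_object V M Cf W A (EHom C c d))"


section \<open>Diagram categories\<close>

text \<open>\<open>dact X (c, d)\<close> is the structure map \<open>C(c, d) \<star> X c \<rightarrow> X d\<close>. Families are made
  extensional so that equality of diagrams, and of their maps, is equality of the families.\<close>

record ('c, 'o, 'a) diag =
  dobj :: "'c \<Rightarrow> 'o"
  dact :: "'c \<times> 'c \<Rightarrow> 'a"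

record ('c, 'o, 'a) diag_map =
  ddom :: "('c, 'o, 'a) diag"
  dcod :: "('c, 'o, 'a) diag"
  dmap :: "'c \<Rightarrow> 'a"

definition diagram ::
    "('vo, 'va, 'x) moncat_scheme \<Rightarrow> ('o, 'a, 'y) cat_scheme \<Rightarrow> ('vo, 'va, 'o, 'a) action \<Rightarrow>
      ('c, 'vo, 'va) ecat \<Rightarrow> ('c, 'o, 'a) diag \<Rightarrow> bool" where
  "diagram V M A C X \<longleftrightarrow>
     dobj X \<in> extensional (EObj C) \<and> dact X \<in> extensional (EObj C \<times> EObj C) \<and>
     (\<forall>c\<in>EObj C. dobj X c \<in> Obj M) \<and>
     (\<forall>c\<in>EObj C. \<forall>d\<in>EObj C. dact X (c, d) \<in> hom M (EHom C c d \<star>\<^bsub>A\<^esub> dobj X c) (dobj X d)) \<and>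
     (\<forall>b\<in>EObj C. \<forall>c\<in>EObj C. \<forall>d\<in>EObj C.
        dact X (b, d) \<cdot>\<^bsub>M\<^esub> (EComp C b c d \<diamondop>\<^bsub>A\<^esub> Ident M (dobj X b)) =
        dact X (c, d) \<cdot>\<^bsub>M\<^esub> (Ident V (EHom C c d) \<diamondop>\<^bsub>A\<^esub> dact X (b, c)) \<cdot>\<^bsub>M\<^esub>
          act_assoc A (EHom C c d) (EHom C b c) (dobj X b)) \<and>
     (\<forall>c\<in>EObj C. dact X (c, c) \<cdot>\<^bsub>M\<^esub> (EIdent C c \<diamondop>\<^bsub>A\<^esub> Ident M (dobj X c)) =
        act_unit A (dobj X c))"

definition diagram_map ::
    "('vo, 'va, 'x) moncat_scheme \<Rightarrow> ('o, 'a, 'y) cat_scheme \<Rightarrow> ('vo, 'va, 'o, 'a) action \<Rightarrow>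
      ('c, 'vo, 'va) ecat \<Rightarrow> ('c, 'o, 'a) diag_map \<Rightarrow> bool" where
  "diagram_map V M A C f \<longleftrightarrow> diagram V M A C (ddom f) \<and> diagram V M A C (dcod f) \<and>
     dmap f \<in> extensional (EObj C) \<and>
     (\<forall>c\<in>EObj C. dmap f c \<in> hom M (dobj (ddom f) c) (dobj (dcod f) c)) \<and>
     (\<forall>c\<in>EObj C. \<forall>d\<in>EObj C.
        dmap f d \<cdot>\<^bsub>M\<^esub> dact (ddom f) (c, d) =
        dact (dcod f) (c, d) \<cdot>\<^bsub>M\<^esub> (Ident V (EHom C c d) \<diamondop>\<^bsub>A\<^esub> dmap f c))"

definition diagram_cat ::
    "('vo, 'va, 'x) moncat_scheme \<Rightarrow> ('o, 'a, 'y) cat_scheme \<Rightarrow> ('vo, 'va, 'o, 'a) action \<Rightarrow>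
      ('c, 'vo, 'va) ecat \<Rightarrow> (('c, 'o, 'a) diag, ('c, 'o, 'a) diag_map) cat" where
  "diagram_cat V M A C =
     \<lparr>Obj = {X. diagram V M A C X}, Arr = {f. diagram_map V M A C f}, Dom = ddom, Cod = dcod,
      Ident = (\<lambda>X. \<lparr>ddom = X, dcod = X, dmap = (\<lambda>c\<in>EObj C. Ident M (dobj X c))\<rparr>),
      Comp = (\<lambda>g f. \<lparr>ddom = ddom f, dcod = dcod g,
                     dmap = (\<lambda>c\<in>EObj C. dmap g c \<cdot>\<^bsub>M\<^esub> dmap f c)\<rparr>)\<rparr>"

text \<open>The diagrams \<open>C(c, -) \<star> X\<close> and the maps \<open>C(c, -) \<star> f\<close> between them.\<close>

definition free_diagram ::
    "('o, 'a, 'y) cat_scheme \<Rightarrow> ('vo, 'va, 'o, 'a) action \<Rightarrow> ('c, 'vo, 'va) ecat \<Rightarrow>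
      'c \<Rightarrow> 'o \<Rightarrow> ('c, 'o, 'a) diag" where
  "free_diagram M A C c X =
     \<lparr>dobj = (\<lambda>d\<in>EObj C. EHom C c d \<star>\<^bsub>A\<^esub> X),
      dact = (\<lambda>(d, e)\<in>EObj C \<times> EObj C. (EComp C c d e \<diamondop>\<^bsub>A\<^esub> Ident M X) \<cdot>\<^bsub>M\<^esub>
        inverse_of M (act_assoc A (EHom C d e) (EHom C c d) X))\<rparr>"

definition free_diagram_map ::
    "('vo, 'va, 'x) moncat_scheme \<Rightarrow> ('o, 'a, 'y) cat_scheme \<Rightarrow> ('vo, 'va, 'o, 'a) action \<Rightarrow>
      ('c, 'vo, 'va) ecat \<Rightarrow> 'c \<Rightarrow> 'a \<Rightarrow> ('c, 'o, 'a) diag_map" where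
  "free_diagram_map V M A C c f =
     \<lparr>ddom = free_diagram M A C c (Dom M f), dcod = free_diagram M A C c (Cod M f),
      dmap = (\<lambda>d\<in>EObj C. Ident V (EHom C c d) \<diamondop>\<^bsub>A\<^esub> f)\<rparr>"

text \<open>The structure maps of \<open>K \<star> X\<close> use the symmetry to move \<open>K\<close> past the hom-objects.\<close>

definition pointwise_act_obj ::
    "('vo, 'va, 'x) moncat_scheme \<Rightarrow> ('o, 'a, 'y) cat_scheme \<Rightarrow> ('vo, 'va, 'o, 'a) action \<Rightarrow>
      ('c, 'vo, 'va) ecat \<Rightarrow> 'vo \<Rightarrow> ('c, 'o, 'a) diag \<Rightarrow> ('c, 'o, 'a) diag" where
  "pointwise_act_obj V M A C K X =
     \<lparr>dobj = (\<lambda>c\<in>EObj C. K \<star>\<^bsub>A\<^esub> dobj X c),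
      dact = (\<lambda>(c, d)\<in>EObj C \<times> EObj C.
        (Ident V K \<diamondop>\<^bsub>A\<^esub> dact X (c, d)) \<cdot>\<^bsub>M\<^esub>
        act_assoc A K (EHom C c d) (dobj X c) \<cdot>\<^bsub>M\<^esub>
        (symm V (EHom C c d) K \<diamondop>\<^bsub>A\<^esub> Ident M (dobj X c)) \<cdot>\<^bsub>M\<^esub>
        inverse_of M (act_assoc A (EHom C c d) K (dobj X c)))\<rparr>"

definition pointwise_action ::
    "('vo, 'va, 'x) moncat_scheme \<Rightarrow> ('o, 'a, 'y) cat_scheme \<Rightarrow> ('vo, 'va, 'o, 'a) action \<Rightarrow>
      ('c, 'vo, 'va) ecat \<Rightarrow> ('vo, 'va, ('c, 'o, 'a) diag, ('c, 'o, 'a) diag_map) action" where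
  "pointwise_action V M A C =
     \<lparr>act_obj = pointwise_act_obj V M A C,
      act_arr = (\<lambda>k f. \<lparr>ddom = pointwise_act_obj V M A C (Dom V k) (ddom f),
                        dcod = pointwise_act_obj V M A C (Cod V k) (dcod f),
                        dmap = (\<lambda>c\<in>EObj C. k \<diamondop>\<^bsub>A\<^esub> dmap f c)\<rparr>),
      act_assoc = (\<lambda>K L X.
        \<lparr>ddom = pointwise_act_obj V M A C (K \<otimes>\<^bsub>V\<^esub> L) X,
         dcod = pointwise_act_obj V M A C K (pointwise_act_obj V M A C L X),
         dmap = (\<lambda>c\<in>EObj C. act_assoc A K L (dobj X c))\<rparr>),
      act_unit = (\<lambda>X.
        \<lparr>ddom = pointwise_act_obj V M A C \<I>\<^bsub>V\<^esub> X, dcod = X,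
         dmap = (\<lambda>c\<in>EObj C. act_unit A (dobj X c))\<rparr>)\<rparr>"

definition pointwise_good ::
    "('vo, 'va, 'x) moncat_scheme \<Rightarrow> ('o, 'a, 'y) cat_scheme \<Rightarrow> ('vo, 'va, 'o, 'a) action \<Rightarrow>
      ('c, 'vo, 'va) ecat \<Rightarrow> 'o set \<Rightarrow> ('c, 'o, 'a) diag set" where
  "pointwise_good V M A C G = {X \<in> Obj (diagram_cat V M A C). \<forall>c\<in>EObj C. dobj X c \<in> G}"

definition pointwise_weq ::
    "('vo, 'va, 'x) moncat_scheme \<Rightarrow> ('o, 'a, 'y) cat_scheme \<Rightarrow> ('vo, 'va, 'o, 'a) action \<Rightarrow>
      ('c, 'vo, 'va) ecat \<Rightarrow> 'a set \<Rightarrow> ('c, 'o, 'a) diag_map set" where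
  "pointwise_weq V M A C W = {f \<in> Arr (diagram_cat V M A C). \<forall>c\<in>EObj C. dmap f c \<in> W}"

text \<open>The closure of a class \<open>S\<close> of maps under coproducts, cobase change along maps between
  objects of \<open>G\<close>, and transfinite composites. A composite of zero maps is an identity; the
  condition \<open>X a \<in> G\<close> keeps it in the class of maps with domain in \<open>G\<close>.\<close>

inductive_set cellular_closure ::
    "'s rel \<Rightarrow> ('o, 'a, 'x) cat_scheme \<Rightarrow> 'o set \<Rightarrow> 'a set \<Rightarrow> 'a set"
  for \<kappa> :: "'s rel" and D :: "('o, 'a, 'x) cat_scheme" and G :: "'o set" and S :: "'a set"
  where
  generator: "f \<in> S \<Longrightarrow> f \<in> cellular_closure \<kappa> D G S"
| coproducts: "\<lbrakk>small \<kappa> (I :: 's set); \<And>i. i \<in> I \<Longrightarrow> f i \<in> cellular_closure \<kappa> D G S;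
    coproduct D I (\<lambda>i. Dom D (f i)) P p; coproduct D I (\<lambda>i. Cod D (f i)) Q q;
    h \<in> hom D P Q; \<And>i. i \<in> I \<Longrightarrow> h \<cdot>\<^bsub>D\<^esub> p i = q i \<cdot>\<^bsub>D\<^esub> f i\<rbrakk>
    \<Longrightarrow> h \<in> cellular_closure \<kappa> D G S"
| cobase_change: "\<lbrakk>f \<in> cellular_closure \<kappa> D G S; Dom D g \<in> G; Cod D g \<in> G; pushout D f g p q\<rbrakk>
    \<Longrightarrow> q \<in> cellular_closure \<kappa> D G S"
| transfinite_composite: "\<lbrakk>transfinite_sequence \<kappa> D r X x; bottom_elem r a; X a \<in> G;
    \<And>b c. succ_elem r b c \<Longrightarrow> x (b, c) \<in> cellular_closure \<kappa> D G S;
    colimit (order_cat r) D X x Z t\<rbrakk>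
    \<Longrightarrow> t a \<in> cellular_closure \<kappa> D G S"

definition projective_cofibrations ::
    "'s rel \<Rightarrow> ('vo, 'va, 'x) moncat_scheme \<Rightarrow> ('o, 'a, 'y) cat_scheme \<Rightarrow>
      ('vo, 'va, 'o, 'a) action \<Rightarrow> ('c, 'vo, 'va) ecat \<Rightarrow> 'o set \<Rightarrow> 'a set \<Rightarrow>
      ('c, 'o, 'a) diag_map set" where
  "projective_cofibrations \<kappa> V M A C G Cf =
     {f \<in> cellular_closure \<kappa> (diagram_cat V M A C) (pointwise_good V M A C G)
            {free_diagram_map V M A C c i | c i. c \<in> EObj C \<and> i \<in> Cf}.
        Dom (diagram_cat V M A C) f \<in> pointwise_good V M A C G}"

end

theory Submission
  imports Defs
begin

text \<open>
  Colimits of diagrams are computed pointwise as soon as the pointwise colimits exist, because the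
  action preserves them. Since coproducts of cofibrations of \<open>M\<close> are cofibrations, and the
  hom-objects are flat, projective cofibrations are pointwise cofibrations, so that the closure
  properties of (trivial) projective cofibrations follow from those of \<open>M\<close>.

  To factor \<open>f : X \<rightarrow> Y\<close>, factor every \<open>f\<^sub>c\<close> in \<open>M\<close> as \<open>X c \<rightarrow> P c \<rightarrow> Y c\<close> and attach the cells
  \<open>C(c, -) \<star> X c \<rightarrow> C(c, -) \<star> P c\<close> to \<open>X\<close>. This gives \<open>X \<rightarrow> X' \<rightarrow> Y\<close> such that \<open>X c \<rightarrow> X' c\<close>
  factors through \<open>P c\<close>. Iterating, one obtains a sequence whose colimit is at every \<open>c\<close> also the
  colimit of the objects \<open>P\<^sub>n c\<close>, all of which are weakly equivalent to \<open>Y c\<close>. Along the way,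
  the \<open>X\<^sub>n c\<close> are enlarged by trivial cofibrations \<open>X\<^sub>n c \<rightarrow> R\<^sub>n c\<close> to make the maps from
  \<open>P\<^sub>n c\<close> to the next stage cofibrations; then neither properness nor homotopy
  invariance of sequential colimits is needed.

  The structure maps of \<open>K \<star> X\<close> are built from the isomorphisms \<open>E \<star> K \<star> X \<cong> K \<star> E \<star> X\<close>. All
  coherence needed is that of these isomorphisms with tensor products, which is the hexagon, and with
  units.
\<close>

section \<open>Categories and colimits\<close>

text \<open>A left closed class supplies colimits of cofibrations that start at a good object, and
  the action preserves a colimit once it exists in \<open>M\<close>. Thus, before a pushout or a
  transfinite composite of diagrams is formed, its maps must be known to be pointwise cofibrations.
  For the generators this comes from flatness: \<open>C(c, d) \<star> -\<close> turns cofibrations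
  into cofibrations.

  Factoring the maps \<open>f\<^sub>c\<close> separately gives objects \<open>P c\<close> without
  structure maps. Free cells restore the structure but spoil the second factor, and the alternation
  of the two operations repairs this only in the limit. Countably many steps suffice, since the
  argument compares two interleaved sequences and, unlike a small object argument, solves no lifting
  problem.

  The closure conditions refer to index sets and orders on the type \<open>'s\<close> underlying the
  cardinal, so families indexed by objects of \<open>C\<close> or by natural numbers are transported
  to \<open>'s\<close>.\<close>

lemma in_hom_iff: "f \<in> hom C X Y \<longleftrightarrow> f \<in> Arr C \<and> Dom C f = X \<and> Cod C f = Y"
  by (auto simp: hom_def)

context category
begin

lemma Arr_Comp [simp]: "f \<in> Arr C \<Longrightarrow> g \<in> Arr C \<Longrightarrow> Dom C g = Cod C f \<Longrightarrow> g \<cdot> f \<in> Arr C"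
  and Dom_Comp [simp]: "f \<in> Arr C \<Longrightarrow> g \<in> Arr C \<Longrightarrow> Dom C g = Cod C f \<Longrightarrow> Dom C (g \<cdot> f) = Dom C f"
  and Cod_Comp [simp]: "f \<in> Arr C \<Longrightarrow> g \<in> Arr C \<Longrightarrow> Dom C g = Cod C f \<Longrightarrow> Cod C (g \<cdot> f) = Cod C g"
  using Comp_in_hom[of f "Dom C f" "Cod C f" g "Cod C g"] by (auto simp: in_hom_iff)

lemma Comp_Comp: "f \<in> Arr C \<Longrightarrow> g \<in> Arr C \<Longrightarrow> h \<in> Arr C \<Longrightarrow> Dom C g = Cod C f \<Longrightarrow>
    Dom C h = Cod C g \<Longrightarrow> (h \<cdot> g) \<cdot> f = h \<cdot> g \<cdot> f"
  by (rule Comp_assoc) (auto simp: in_hom_iff)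

lemma Comp_Ident_Dom [simp]: "f \<in> Arr C \<Longrightarrow> Dom C f = X \<Longrightarrow> f \<cdot> Ident C X = f"
  and Ident_Cod_Comp [simp]: "f \<in> Arr C \<Longrightarrow> Cod C f = X \<Longrightarrow> Ident C X \<cdot> f = f"
  using Comp_Ident[of f X "Cod C f"] Ident_Comp[of f "Dom C f" X] by (auto simp: in_hom_iff)

lemma Arr_Ident [simp]: "X \<in> Obj C \<Longrightarrow> Ident C X \<in> Arr C"
  and Dom_Ident [simp]: "X \<in> Obj C \<Longrightarrow> Dom C (Ident C X) = X"
  and Cod_Ident [simp]: "X \<in> Obj C \<Longrightarrow> Cod C (Ident C X) = X"
  using Ident_in_hom[of X] by (auto simp: in_hom_iff)

lemma Dom_Obj [simp]: "f \<in> Arr C \<Longrightarrow> Dom C f \<in> Obj C"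
  and Cod_Obj [simp]: "f \<in> Arr C \<Longrightarrow> Cod C f \<in> Obj C"
  by (rule Dom_in_Obj Cod_in_Obj; assumption)+

lemma hom_Obj: "f \<in> hom C X Y \<Longrightarrow> X \<in> Obj C \<and> Y \<in> Obj C"
  by (auto simp: in_hom_iff)

text \<open>Composites are kept bracketed to the right, where the first two factors of a longer
  composite are not a subterm. This form and the next carry an identity between short composites
  past a further factor \<open>z\<close>.\<close>

lemma Comp_eq_Comp: "g \<cdot> f = k \<cdot> l \<Longrightarrow> g \<in> Arr C \<Longrightarrow> f \<in> Arr C \<Longrightarrow> k \<in> Arr C \<Longrightarrow> l \<in> Arr C \<Longrightarrow>
    Dom C g = Cod C f \<Longrightarrow> Dom C k = Cod C l \<Longrightarrow> z \<in> Arr C \<Longrightarrow> Cod C z = Dom C f \<Longrightarrow> Dom C f = Dom C l \<Longrightarrow>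
    g \<cdot> f \<cdot> z = k \<cdot> l \<cdot> z"
  by (metis Comp_Comp)

lemma Comp_eq_Arr: "g \<cdot> f = k \<Longrightarrow> g \<in> Arr C \<Longrightarrow> f \<in> Arr C \<Longrightarrow>
    Dom C g = Cod C f \<Longrightarrow> z \<in> Arr C \<Longrightarrow> Cod C z = Dom C f \<Longrightarrow> g \<cdot> f \<cdot> z = k \<cdot> z"
  by (metis Comp_Comp)

section \<open>Isomorphisms and cancellation\<close>

lemma inverse_arrows_unique:
  assumes "inverse_arrows C f g" "inverse_arrows C f h"
  shows "g = h"
proof -
  have a: "f \<in> Arr C" "g \<in> Arr C" "h \<in> Arr C" "Dom C g = Cod C f" "Cod C g = Dom C f"
    "Dom C h = Cod C f" "Cod C h = Dom C f" "g \<cdot> f = Ident C (Dom C f)" "f \<cdot> h = Ident C (Cod C f)"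
    using assms by (auto simp: inverse_arrows_def in_hom_iff)
  have "g = g \<cdot> f \<cdot> h" using a by simp
  also have "\<dots> = (g \<cdot> f) \<cdot> h" by (rule Comp_Comp[symmetric]) (use a in auto)
  also have "\<dots> = h" using a by simp
  finally show ?thesis .
qed

lemma inverse_of_inverse_arrows: "iso C f \<Longrightarrow> inverse_arrows C f (inverse_of C f)"
  unfolding iso_def inverse_of_def
  by (rule theI') (auto intro: inverse_arrows_unique)

lemma iso_Arr: "iso C f \<Longrightarrow> f \<in> Arr C"
  by (auto simp: iso_def inverse_arrows_def)

lemma Arr_inverse_of [simp]: "iso C f \<Longrightarrow> inverse_of C f \<in> Arr C"
  and Dom_inverse_of [simp]: "iso C f \<Longrightarrow> Dom C (inverse_of C f) = Cod C f"
  and Cod_inverse_of [simp]: "iso C f \<Longrightarrow> Cod C (inverse_of C f) = Dom C f"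
  and inverse_of_Comp [simp]: "iso C f \<Longrightarrow> inverse_of C f \<cdot> f = Ident C (Dom C f)"
  and Comp_inverse_of [simp]: "iso C f \<Longrightarrow> f \<cdot> inverse_of C f = Ident C (Cod C f)"
  using inverse_of_inverse_arrows[of f] by (auto simp: inverse_arrows_def in_hom_iff)

lemma inverse_of_Comp_Comp [simp]:
  "iso C f \<Longrightarrow> z \<in> Arr C \<Longrightarrow> Cod C z = Dom C f \<Longrightarrow> inverse_of C f \<cdot> f \<cdot> z = z"
  by (metis Arr_inverse_of Comp_Comp Dom_inverse_of Ident_Cod_Comp inverse_of_Comp iso_Arr)

lemma Comp_inverse_of_Comp [simp]:
  "iso C f \<Longrightarrow> z \<in> Arr C \<Longrightarrow> Cod C z = Cod C f \<Longrightarrow> f \<cdot> inverse_of C f \<cdot> z = z"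
  by (metis Arr_inverse_of Comp_Comp Dom_inverse_of Cod_inverse_of Ident_Cod_Comp Comp_inverse_of iso_Arr)

lemma isoI: "f \<in> Arr C \<Longrightarrow> g \<in> Arr C \<Longrightarrow> Dom C g = Cod C f \<Longrightarrow> Cod C g = Dom C f \<Longrightarrow>
    g \<cdot> f = Ident C (Dom C f) \<Longrightarrow> f \<cdot> g = Ident C (Cod C f) \<Longrightarrow> iso C f"
  by (auto simp: iso_def inverse_arrows_def in_hom_iff)

lemma iso_Ident: "X \<in> Obj C \<Longrightarrow> iso C (Ident C X)"
  by (rule isoI[where g = "Ident C X"]) auto

lemma iso_cancel_right:
  assumes "iso C e" "f \<in> Arr C" "g \<in> Arr C" "Dom C f = Cod C e" "Dom C g = Cod C e" "f \<cdot> e = g \<cdot> e"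
  shows "f = g"
proof -
  have "(f \<cdot> e) \<cdot> inverse_of C e = (g \<cdot> e) \<cdot> inverse_of C e" using assms(6) by simp
  then show ?thesis using assms(1-5) iso_Arr[OF assms(1)] by (simp add: Comp_Comp)
qed

lemma iso_cancel_left:
  assumes "iso C e" "f \<in> Arr C" "g \<in> Arr C" "Cod C f = Dom C e" "Cod C g = Dom C e" "e \<cdot> f = e \<cdot> g"
  shows "f = g"
  by (metis assms inverse_of_Comp_Comp)

section \<open>Universal property of colimits\<close>

lemma colimit_functor: "colimit J C Fo Fa Z t \<Longrightarrow> is_functor J C Fo Fa"
  and colimit_cocone: "colimit J C Fo Fa Z t \<Longrightarrow> cocone J C Fo Fa Z t"
  and colimit_Obj: "colimit J C Fo Fa Z t \<Longrightarrow> Z \<in> Obj C"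
  and colimit_leg: "colimit J C Fo Fa Z t \<Longrightarrow> j \<in> Obj J \<Longrightarrow> t j \<in> hom C (Fo j) Z"
  by (auto simp: colimit_def cocone_def)

lemma colimit_induced:
  assumes "colimit J C Fo Fa Z t" "cocone J C Fo Fa Z' t'"
  obtains h where "h \<in> hom C Z Z'" "\<And>j. j \<in> Obj J \<Longrightarrow> h \<cdot> t j = t' j"
proof -
  have "\<exists>!h. h \<in> hom C Z Z' \<and> (\<forall>j\<in>Obj J. h \<cdot> t j = t' j)"
    using assms unfolding colimit_def by blast
  then show thesis using that by blast
qed

lemma cocone_Comp:
  assumes "is_functor J C Fo Fa" "cocone J C Fo Fa Z t" "h \<in> hom C Z Z'" "category J"
  shows "cocone J C Fo Fa Z' (\<lambda>j. h \<cdot> t j)"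
proof -
  interpret J: category J by fact
  show ?thesis
    using assms hom_Obj[OF assms(3)] unfolding cocone_def is_functor_def in_hom_iff
    by (auto simp: Comp_Comp)
qed

lemma colimit_joint_epi:
  assumes "category J" "colimit J C Fo Fa Z t" "f \<in> hom C Z Y" "g \<in> hom C Z Y"
    and "\<And>j. j \<in> Obj J \<Longrightarrow> f \<cdot> t j = g \<cdot> t j"
  shows "f = g"
proof -
  have "cocone J C Fo Fa Y (\<lambda>j. g \<cdot> t j)"
    using assms by (intro cocone_Comp[of J Fo Fa Z]) (auto simp: colimit_def)
  then have "\<exists>!h. h \<in> hom C Z Y \<and> (\<forall>j\<in>Obj J. h \<cdot> t j = g \<cdot> t j)"
    using assms(2) unfolding colimit_def by blast
  then show ?thesis using assms(3-5) by blast
qed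

lemma colimit_unique:
  assumes "category J" "colimit J C Fo Fa Z t" "colimit J C Fo Fa Z' t'"
  obtains h where "h \<in> hom C Z Z'" "iso C h" "\<And>j. j \<in> Obj J \<Longrightarrow> h \<cdot> t j = t' j"
proof -
  obtain h where h: "h \<in> hom C Z Z'" "\<And>j. j \<in> Obj J \<Longrightarrow> h \<cdot> t j = t' j"
    using colimit_induced[OF assms(2) colimit_cocone[OF assms(3)]] by metis
  obtain k where k: "k \<in> hom C Z' Z" "\<And>j. j \<in> Obj J \<Longrightarrow> k \<cdot> t' j = t j"
    using colimit_induced[OF assms(3) colimit_cocone[OF assms(2)]] by metis
  have "k \<cdot> h = Ident C Z"
    by (rule colimit_joint_epi[OF assms(1,2)])
      (use h k colimit_Obj[OF assms(2)] colimit_leg[OF assms(2)] in \<open>auto simp: in_hom_iff Comp_Comp\<close>)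
  moreover have "h \<cdot> k = Ident C Z'"
    by (rule colimit_joint_epi[OF assms(1,3)])
      (use h k colimit_Obj[OF assms(3)] colimit_leg[OF assms(3)] in \<open>auto simp: in_hom_iff Comp_Comp\<close>)
  ultimately have "iso C h" using h k by (intro isoI[where g = k]) (auto simp: in_hom_iff)
  then show thesis using h that by blast
qed

text \<open>Colimits are determined only up to isomorphism; this moves a known colimit to an
  isomorphic vertex. The legs \<open>t'\<close> are compared on objects of \<open>J\<close> only,
  because values elsewhere are arbitrary.\<close>

lemma colimit_transport:
  assumes "category J" "colimit J C Fo Fa Z t" "iso C h" "h \<in> hom C Z Z'"
    and t': "\<And>j. j \<in> Obj J \<Longrightarrow> t' j = h \<cdot> t j"
  shows "colimit J C Fo Fa Z' t'"
proof -
  note F = colimit_functor[OF assms(2)] and cc = colimit_cocone[OF assms(2)]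
  interpret J: category J by fact
  have "cocone J C Fo Fa Z' (\<lambda>j. h \<cdot> t j)" by (rule cocone_Comp[OF F cc assms(4,1)])
  then have cc': "cocone J C Fo Fa Z' t'" using t' by (auto simp: cocone_def)
  have "\<exists>!k. k \<in> hom C Z' Y \<and> (\<forall>j\<in>Obj J. k \<cdot> t' j = s j)" if s: "cocone J C Fo Fa Y s" for Y s
  proof -
    obtain k where k: "k \<in> hom C Z Y" "\<And>j. j \<in> Obj J \<Longrightarrow> k \<cdot> t j = s j"
      using colimit_induced[OF assms(2) s] by metis
    have leg: "t j \<in> Arr C" "Dom C (t j) = Fo j" "Cod C (t j) = Z" if "j \<in> Obj J" for j
      using colimit_leg[OF assms(2) that] by (auto simp: in_hom_iff)
    show ?thesis
    proof (rule ex1I[where a = "k \<cdot> inverse_of C h"])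
      show "k \<cdot> inverse_of C h \<in> hom C Z' Y \<and> (\<forall>j\<in>Obj J. (k \<cdot> inverse_of C h) \<cdot> t' j = s j)"
        using assms(3,4) k leg by (auto simp: in_hom_iff t' Comp_Comp)
    next
      fix l assume l: "l \<in> hom C Z' Y \<and> (\<forall>j\<in>Obj J. l \<cdot> t' j = s j)"
      have "l \<cdot> h = k"
        by (rule colimit_joint_epi[OF assms(1,2)])
          (use l k assms(3,4) leg t' in \<open>auto simp: in_hom_iff Comp_Comp\<close>)
      then have "(l \<cdot> h) \<cdot> inverse_of C h = k \<cdot> inverse_of C h" by simp
      then show "l = k \<cdot> inverse_of C h"
        using l assms(3,4) by (auto simp: in_hom_iff Comp_Comp)
    qed
  qed
  then show ?thesis using F cc' by (auto simp: colimit_def)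
qed

end

section \<open>Coproducts and pushouts as colimits over ordered sets\<close>

lemma order_cat_simps [simp]:
  "Obj (order_cat r) = Field r" "Arr (order_cat r) = r" "Dom (order_cat r) = fst"
  "Cod (order_cat r) = snd" "Ident (order_cat r) a = (a, a)"
  "Comp (order_cat r) v u = (fst u, snd v)"
  by (auto simp: order_cat_def)

lemma category_order_cat:
  assumes "Refl r" "trans r"
  shows "category (order_cat r)"
  using assms by unfold_locales
    (auto simp: in_hom_iff Field_def refl_on_def dest: transD)

lemma is_functor_order_cat:
  "is_functor (order_cat r) C X x \<longleftrightarrow>
    (\<forall>a\<in>Field r. X a \<in> Obj C \<and> x (a, a) = Ident C (X a)) \<and>
    (\<forall>a b. (a, b) \<in> r \<longrightarrow> x (a, b) \<in> hom C (X a) (X b)) \<and>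
    (\<forall>a b c. (a, b) \<in> r \<longrightarrow> (b, c) \<in> r \<longrightarrow> x (a, c) = x (b, c) \<cdot>\<^bsub>C\<^esub> x (a, b))"
  by (simp add: is_functor_def Ball_def split_paired_All)

lemma cocone_order_cat:
  "cocone (order_cat r) C X x Z t \<longleftrightarrow> Z \<in> Obj C \<and> (\<forall>a\<in>Field r. t a \<in> hom C (X a) Z) \<and>
    (\<forall>a b. (a, b) \<in> r \<longrightarrow> t b \<cdot>\<^bsub>C\<^esub> x (a, b) = t a)"
  by (auto simp: cocone_def)

lemma category_order_cat_Id_on: "category (order_cat (Id_on I))"
  by (rule category_order_cat) (auto simp: refl_on_def Field_def intro: transI)

lemma Field_Id_on [simp]: "Field (Id_on I) = I"
  by (auto simp: Field_def)

text \<open>The order \<open>Id_on I\<close> has only the arrows \<open>(i, i)\<close>, so it is the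
  discrete category on \<open>I\<close> and a cocone is a mere family of maps. Results on general
  colimits then apply to coproducts.\<close>

lemma (in category) coproduct_iff_colimit:
  "coproduct C I X P p \<longleftrightarrow> colimit (order_cat (Id_on I)) C X (\<lambda>u. Ident C (X (fst u))) P p"
proof
  assume co: "coproduct C I X P p"
  have "cocone (order_cat (Id_on I)) C X (\<lambda>u. Ident C (X (fst u))) Q q \<longleftrightarrow>
      Q \<in> Obj C \<and> (\<forall>i\<in>I. q i \<in> hom C (X i) Q)" for Q q
    unfolding cocone_order_cat by (auto simp: in_hom_iff)
  moreover have "is_functor (order_cat (Id_on I)) C X (\<lambda>u. Ident C (X (fst u)))"
    using co by (auto simp: is_functor_order_cat coproduct_def in_hom_iff)
  ultimately show "colimit (order_cat (Id_on I)) C X (\<lambda>u. Ident C (X (fst u))) P p"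
    using co by (auto simp: colimit_def coproduct_def)
next
  assume co: "colimit (order_cat (Id_on I)) C X (\<lambda>u. Ident C (X (fst u))) P p"
  have c: "cocone (order_cat (Id_on I)) C X (\<lambda>u. Ident C (X (fst u))) Q q \<longleftrightarrow>
      Q \<in> Obj C \<and> (\<forall>i\<in>I. q i \<in> hom C (X i) Q)" for Q q
    unfolding cocone_order_cat by (auto simp: in_hom_iff)
  moreover have "\<forall>i\<in>I. X i \<in> Obj C"
    using co by (auto simp: is_functor_order_cat colimit_def)
  ultimately show "coproduct C I X P p"
    using co by (auto simp: colimit_def coproduct_def)
qed

text \<open>The shape of a span is an ordered set too, with \<open>Apex\<close> below
  \<open>Left\<close> and \<open>Right\<close>; so \<open>order_cat\<close> serves for coproducts,
  pushouts, sequences and transfinite composites alike.\<close>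

datatype span = Apex | Left | Right

definition span_rel :: "span rel" where
  "span_rel = {(Apex, Apex), (Left, Left), (Right, Right), (Apex, Left), (Apex, Right)}"

lemma Field_span_rel [simp]: "Field span_rel = {Apex, Left, Right}"
  by (auto simp: span_rel_def Field_def)

lemma category_span: "category (order_cat span_rel)"
  by (rule category_order_cat) (auto simp: span_rel_def refl_on_def Field_def intro!: transI)

definition span_obj :: "('o, 'a, 'x) cat_scheme \<Rightarrow> 'a \<Rightarrow> 'a \<Rightarrow> span \<Rightarrow> 'o" where
  "span_obj C f g n = (if n = Apex then Dom C f else if n = Left then Cod C f else Cod C g)"

definition span_arr :: "('o, 'a, 'x) cat_scheme \<Rightarrow> 'a \<Rightarrow> 'a \<Rightarrow> span \<times> span \<Rightarrow> 'a" where
  "span_arr C f g u = (if u = (Apex, Left) then f else if u = (Apex, Right) then g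
     else Ident C (span_obj C f g (fst u)))"

definition span_leg :: "('o, 'a, 'x) cat_scheme \<Rightarrow> 'a \<Rightarrow> 'a \<Rightarrow> 'a \<Rightarrow> span \<Rightarrow> 'a" where
  "span_leg C f p q n = (if n = Apex then p \<cdot>\<^bsub>C\<^esub> f else if n = Left then p else q)"

context category
begin

lemma span_functor:
  "f \<in> Arr C \<Longrightarrow> g \<in> Arr C \<Longrightarrow> Dom C f = Dom C g \<Longrightarrow>
    is_functor (order_cat span_rel) C (span_obj C f g) (span_arr C f g)"
  unfolding is_functor_order_cat
  by (auto simp: span_rel_def span_obj_def span_arr_def in_hom_iff)

lemma span_cocone:
  assumes fg: "f \<in> Arr C" "g \<in> Arr C" "Dom C f = Dom C g"
  shows "cocone (order_cat span_rel) C (span_obj C f g) (span_arr C f g) Z t \<longleftrightarrow>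
      commuting_square C f g (t Left) (t Right) \<and> Cod C (t Left) = Z \<and> t Apex = t Left \<cdot> f"
    (is "?L \<longleftrightarrow> ?R")
proof
  assume L: ?L
  have e: "(a, b) \<in> span_rel \<Longrightarrow> t b \<cdot> span_arr C f g (a, b) = t a" for a b
    using L unfolding cocone_order_cat by blast
  have "t Left \<cdot> f = t Apex" "t Right \<cdot> g = t Apex"
    using e[of Apex Left] e[of Apex Right] by (simp_all add: span_rel_def span_arr_def)
  then show ?R using L fg unfolding cocone_order_cat
    by (simp add: commuting_square_def in_hom_iff span_obj_def)
next
  assume R: ?R
  then have *: "t Left \<in> Arr C" "t Right \<in> Arr C" "Dom C (t Left) = Cod C f" "Dom C (t Right) = Cod C g"
    "Cod C (t Right) = Z" "Cod C (t Left) = Z" "t Left \<cdot> f = t Apex" "t Right \<cdot> g = t Apex"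
    by (auto simp: commuting_square_def)
  then have **: "t Apex \<in> Arr C" "Dom C (t Apex) = Dom C f" "Cod C (t Apex) = Z"
    using fg Arr_Comp[of f "t Left"] Dom_Comp[of f "t Left"] Cod_Comp[of f "t Left"] by simp_all
  have "t b \<cdot> span_arr C f g (a, b) = t a" if "(a, b) \<in> span_rel" for a b
    using that fg * ** by (auto simp: span_rel_def span_arr_def span_obj_def)
  then show ?L using fg * ** unfolding cocone_order_cat in_hom_iff
    by (auto simp: span_obj_def)
qed

lemma pushout_iff_colimit:
  assumes fg: "f \<in> Arr C" "g \<in> Arr C" "Dom C f = Dom C g"
  shows "colimit (order_cat span_rel) C (span_obj C f g) (span_arr C f g) Z t \<longleftrightarrow>
    pushout C f g (t Left) (t Right) \<and> Cod C (t Left) = Z \<and> t Apex = t Left \<cdot> f" (is "?L \<longleftrightarrow> ?R")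
proof
  assume L: ?L
  then have a: "commuting_square C f g (t Left) (t Right)" "Cod C (t Left) = Z" "t Apex = t Left \<cdot> f"
    using span_cocone[OF fg, of Z t] by (auto simp: colimit_def)
  have "\<exists>!h. h \<in> hom C (Cod C (t Left)) (Cod C p) \<and> h \<cdot> t Left = p \<and> h \<cdot> t Right = q"
    if pq: "commuting_square C f g p q" for p q
  proof -
    have "cocone (order_cat span_rel) C (span_obj C f g) (span_arr C f g) (Cod C p) (span_leg C f p q)"
      using pq span_cocone[OF fg, of "Cod C p" "span_leg C f p q"] by (auto simp: span_leg_def)
    then have "\<exists>!h. h \<in> hom C Z (Cod C p) \<and> (\<forall>j\<in>{Apex, Left, Right}. h \<cdot> t j = span_leg C f p q j)"
      using L by (auto simp: colimit_def)
    moreover have "(h \<in> hom C Z (Cod C p) \<and> (\<forall>j\<in>{Apex, Left, Right}. h \<cdot> t j = span_leg C f p q j)) \<longleftrightarrow>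
      (h \<in> hom C (Cod C (t Left)) (Cod C p) \<and> h \<cdot> t Left = p \<and> h \<cdot> t Right = q)" for h
      using a fg by (auto simp: span_leg_def commuting_square_def in_hom_iff Comp_Comp)
    ultimately show ?thesis by simp
  qed
  then show ?R using a by (auto simp: pushout_def)
next
  assume R: ?R
  then have a: "commuting_square C f g (t Left) (t Right)" "Cod C (t Left) = Z" "t Apex = t Left \<cdot> f"
    by (auto simp: pushout_def)
  have "\<exists>!h. h \<in> hom C Z Y \<and> (\<forall>j\<in>{Apex, Left, Right}. h \<cdot> t j = s j)"
    if s: "cocone (order_cat span_rel) C (span_obj C f g) (span_arr C f g) Y s" for Y s
  proof -
    have b: "commuting_square C f g (s Left) (s Right)" "Cod C (s Left) = Y" "s Apex = s Left \<cdot> f"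
      using s span_cocone[OF fg, of Y s] by auto
    then have "\<exists>!h. h \<in> hom C (Cod C (t Left)) (Cod C (s Left)) \<and> h \<cdot> t Left = s Left \<and> h \<cdot> t Right = s Right"
      using R unfolding pushout_def by blast
    moreover have "(h \<in> hom C Z Y \<and> (\<forall>j\<in>{Apex, Left, Right}. h \<cdot> t j = s j)) \<longleftrightarrow>
      (h \<in> hom C (Cod C (t Left)) (Cod C (s Left)) \<and> h \<cdot> t Left = s Left \<and> h \<cdot> t Right = s Right)" for h
      using a b fg by (auto simp: commuting_square_def in_hom_iff Comp_Comp[symmetric])
    ultimately show ?thesis by simp
  qed
  moreover have "is_functor (order_cat span_rel) C (span_obj C f g) (span_arr C f g)"
    by (rule span_functor[OF fg])
  ultimately show ?L using a span_cocone[OF fg, of Z t] by (auto simp: colimit_def)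
qed

lemma pushoutD:
  assumes "pushout C f g p q"
  shows "f \<in> Arr C" "g \<in> Arr C" "p \<in> Arr C" "q \<in> Arr C" "Dom C f = Dom C g" "Dom C p = Cod C f"
    "Dom C q = Cod C g" "Cod C q = Cod C p" "p \<cdot> f = q \<cdot> g"
  using assms by (auto simp: pushout_def commuting_square_def)

lemma pushout_colimit:
  assumes "pushout C f g p q"
  shows "colimit (order_cat span_rel) C (span_obj C f g) (span_arr C f g) (Cod C p) (span_leg C f p q)"
  by (subst pushout_iff_colimit) (use assms pushoutD[OF assms] in \<open>auto simp: span_leg_def\<close>)

lemma pushout_induced:
  assumes "pushout C f g p q" "p' \<in> hom C (Cod C f) Z" "q' \<in> hom C (Cod C g) Z" "p' \<cdot> f = q' \<cdot> g"
  obtains h where "h \<in> hom C (Cod C p) Z" "h \<cdot> p = p'" "h \<cdot> q = q'"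
proof -
  have "commuting_square C f g p' q'"
    using assms pushoutD[OF assms(1)] by (auto simp: commuting_square_def in_hom_iff)
  then show thesis using assms that unfolding pushout_def in_hom_iff by blast
qed

lemma pushout_joint_epi:
  assumes "pushout C f g p q" "h \<in> hom C (Cod C p) Z" "k \<in> hom C (Cod C p) Z"
    "h \<cdot> p = k \<cdot> p" "h \<cdot> q = k \<cdot> q"
  shows "h = k"
proof -
  note po = pushoutD[OF assms(1)]
  have "commuting_square C f g (h \<cdot> p) (h \<cdot> q)"
    using assms po by (auto simp: commuting_square_def in_hom_iff Comp_Comp)
  moreover have "Cod C (h \<cdot> p) = Z" using assms po by (auto simp: in_hom_iff)
  ultimately have "\<exists>!l. l \<in> hom C (Cod C p) Z \<and> l \<cdot> p = h \<cdot> p \<and> l \<cdot> q = h \<cdot> q"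
    using assms(1) unfolding pushout_def by metis
  then show ?thesis using assms by metis
qed

lemma coproductD:
  assumes "coproduct C I X P p"
  shows "P \<in> Obj C" "i \<in> I \<Longrightarrow> X i \<in> Obj C" "i \<in> I \<Longrightarrow> p i \<in> hom C (X i) P"
  using assms by (auto simp: coproduct_def)

lemma coproduct_induced:
  assumes "coproduct C I X P p" "Q \<in> Obj C" "\<And>i. i \<in> I \<Longrightarrow> q i \<in> hom C (X i) Q"
  obtains h where "h \<in> hom C P Q" "\<And>i. i \<in> I \<Longrightarrow> h \<cdot> p i = q i"
  using assms unfolding coproduct_def by meson

lemma coproduct_joint_epi:
  assumes "coproduct C I X P p" "h \<in> hom C P Q" "k \<in> hom C P Q"
    "\<And>i. i \<in> I \<Longrightarrow> h \<cdot> p i = k \<cdot> p i"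
  shows "h = k"
  by (rule colimit_joint_epi[OF category_order_cat_Id_on assms(1)[unfolded coproduct_iff_colimit] assms(2,3)])
    (use assms in auto)

text \<open>For the empty index set \<open>X\<close> and \<open>p\<close> are arbitrary. Results on
  coproducts of diagrams thereby specialise to initial diagrams.\<close>

lemma initial_iff_coproduct: "initial C Z \<longleftrightarrow> coproduct C {} X Z p"
  by (auto simp: initial_def coproduct_def)

end

section \<open>Change of the index category\<close>

definition shape_iso :: "('j, 'u, 'y) cat_scheme \<Rightarrow> ('k, 'v, 'z) cat_scheme \<Rightarrow> ('j \<Rightarrow> 'k) \<Rightarrow> ('u \<Rightarrow> 'v) \<Rightarrow> bool" where
  "shape_iso J K \<phi> \<psi> \<longleftrightarrow> bij_betw \<phi> (Obj J) (Obj K) \<and> bij_betw \<psi> (Arr J) (Arr K) \<and>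
     (\<forall>j\<in>Obj J. \<psi> (Ident J j) = Ident K (\<phi> j)) \<and>
     (\<forall>u\<in>Arr J. Dom K (\<psi> u) = \<phi> (Dom J u) \<and> Cod K (\<psi> u) = \<phi> (Cod J u)) \<and>
     (\<forall>u\<in>Arr J. \<forall>v\<in>Arr J. Dom J v = Cod J u \<longrightarrow> \<psi> (v \<cdot>\<^bsub>J\<^esub> u) = \<psi> v \<cdot>\<^bsub>K\<^esub> \<psi> u)"

lemma shape_iso_functor:
  assumes iso: "shape_iso J K \<phi> \<psi>" and "category J"
    and Fo: "\<And>j. j \<in> Obj J \<Longrightarrow> Fo' (\<phi> j) = Fo j" and Fa: "\<And>u. u \<in> Arr J \<Longrightarrow> Fa' (\<psi> u) = Fa u"
  shows "is_functor K C Fo' Fa' \<longleftrightarrow> is_functor J C Fo Fa"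
proof -
  interpret J: category J by fact
  have K: "Obj K = \<phi> ` Obj J" "Arr K = \<psi> ` Arr J" and inj: "inj_on \<phi> (Obj J)"
    using iso by (auto simp: shape_iso_def bij_betw_def)
  have D: "Dom K (\<psi> u) = \<phi> (Dom J u)" "Cod K (\<psi> u) = \<phi> (Cod J u)" if "u \<in> Arr J" for u
    using iso that by (auto simp: shape_iso_def)
  have I: "\<psi> (Ident J j) = Ident K (\<phi> j)" if "j \<in> Obj J" for j
    using iso that by (auto simp: shape_iso_def)
  have Cp: "\<psi> (v \<cdot>\<^bsub>J\<^esub> u) = \<psi> v \<cdot>\<^bsub>K\<^esub> \<psi> u" if "u \<in> Arr J" "v \<in> Arr J" "Dom J v = Cod J u" for u v
    using iso that by (auto simp: shape_iso_def)
  have e: "\<phi> (Dom J v) = \<phi> (Cod J u) \<longleftrightarrow> Dom J v = Cod J u" if "u \<in> Arr J" "v \<in> Arr J" for u v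
    using inj that by (auto dest: inj_onD)
  have 1: "(\<forall>j\<in>Obj K. Fo' j \<in> Obj C \<and> Fa' (Ident K j) = Ident C (Fo' j)) \<longleftrightarrow>
      (\<forall>j\<in>Obj J. Fo j \<in> Obj C \<and> Fa (Ident J j) = Ident C (Fo j))"
    unfolding K by (auto simp: I[symmetric] Fo Fa)
  have 2: "(\<forall>u\<in>Arr K. Fa' u \<in> hom C (Fo' (Dom K u)) (Fo' (Cod K u))) \<longleftrightarrow>
      (\<forall>u\<in>Arr J. Fa u \<in> hom C (Fo (Dom J u)) (Fo (Cod J u)))"
    unfolding K by (auto simp: D Fo Fa)
  have 3: "(\<forall>u\<in>Arr K. \<forall>v\<in>Arr K. Dom K v = Cod K u \<longrightarrow> Fa' (v \<cdot>\<^bsub>K\<^esub> u) = Fa' v \<cdot>\<^bsub>C\<^esub> Fa' u) \<longleftrightarrow>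
      (\<forall>u\<in>Arr J. \<forall>v\<in>Arr J. Dom J v = Cod J u \<longrightarrow> Fa (v \<cdot>\<^bsub>J\<^esub> u) = Fa v \<cdot>\<^bsub>C\<^esub> Fa u)"
    unfolding K by (simp add: D e Fa Cp[symmetric] cong: conj_cong imp_cong)
  show ?thesis unfolding is_functor_def 1 2 3 ..
qed

lemma shape_iso_cocone:
  assumes iso: "shape_iso J K \<phi> \<psi>" and "category J"
    and Fo: "\<And>j. j \<in> Obj J \<Longrightarrow> Fo' (\<phi> j) = Fo j" and Fa: "\<And>u. u \<in> Arr J \<Longrightarrow> Fa' (\<psi> u) = Fa u"
    and t: "\<And>j. j \<in> Obj J \<Longrightarrow> t' (\<phi> j) = t j"
  shows "cocone K C Fo' Fa' Z t' \<longleftrightarrow> cocone J C Fo Fa Z t"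
proof -
  interpret J: category J by fact
  have K: "Obj K = \<phi> ` Obj J" "Arr K = \<psi> ` Arr J"
    using iso by (auto simp: shape_iso_def bij_betw_def)
  have D: "Dom K (\<psi> u) = \<phi> (Dom J u)" "Cod K (\<psi> u) = \<phi> (Cod J u)" if "u \<in> Arr J" for u
    using iso that by (auto simp: shape_iso_def)
  show ?thesis unfolding cocone_def K by (simp add: D Fo Fa t cong: conj_cong)
qed

text \<open>Cocones over the two shapes correspond under composition with \<open>\<phi>\<close>,
  hence so do colimits. The functors are compared along \<open>\<phi>\<close> and
  \<open>\<psi>\<close> on objects and arrows, since their other values are irrelevant.\<close>

lemma shape_iso_colimit:
  assumes iso: "shape_iso J K \<phi> \<psi>" and "category J"
    and Fo: "\<And>j. j \<in> Obj J \<Longrightarrow> Fo' (\<phi> j) = Fo j" and Fa: "\<And>u. u \<in> Arr J \<Longrightarrow> Fa' (\<psi> u) = Fa u"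
    and t: "\<And>j. j \<in> Obj J \<Longrightarrow> t' (\<phi> j) = t j"
  shows "colimit K C Fo' Fa' Z t' \<longleftrightarrow> colimit J C Fo Fa Z t"
proof -
  have cc: "cocone K C Fo' Fa' Y s' \<longleftrightarrow> cocone J C Fo Fa Y s"
    if "\<And>j. j \<in> Obj J \<Longrightarrow> s' (\<phi> j) = s j" for Y s s'
    by (rule shape_iso_cocone[OF iso \<open>category J\<close>]) (auto simp: Fo Fa that)
  have K: "Obj K = \<phi> ` Obj J" and inj: "inj_on \<phi> (Obj J)"
    using iso by (auto simp: shape_iso_def bij_betw_def)
  have "(\<forall>Y s. cocone K C Fo' Fa' Y s \<longrightarrow> (\<exists>!h. h \<in> hom C Z Y \<and> (\<forall>k\<in>Obj K. h \<cdot>\<^bsub>C\<^esub> t' k = s k))) \<longleftrightarrow>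
    (\<forall>Y s. cocone J C Fo Fa Y s \<longrightarrow> (\<exists>!h. h \<in> hom C Z Y \<and> (\<forall>j\<in>Obj J. h \<cdot>\<^bsub>C\<^esub> t j = s j)))"
    (is "?L \<longleftrightarrow> ?R")
  proof
    assume L: ?L
    show ?R
    proof (intro allI impI)
      fix Y s assume s: "cocone J C Fo Fa Y s"
      let ?s = "\<lambda>k. s (inv_into (Obj J) \<phi> k)"
      have "cocone K C Fo' Fa' Y ?s"
        by (rule cc[THEN iffD2, OF _ s]) (simp add: inj)
      then have "\<exists>!h. h \<in> hom C Z Y \<and> (\<forall>k\<in>Obj K. h \<cdot>\<^bsub>C\<^esub> t' k = ?s k)" using L by blast
      then show "\<exists>!h. h \<in> hom C Z Y \<and> (\<forall>j\<in>Obj J. h \<cdot>\<^bsub>C\<^esub> t j = s j)"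
        unfolding K by (simp add: inj t)
    qed
  next
    assume R: ?R
    show ?L
    proof (intro allI impI)
      fix Y s assume s: "cocone K C Fo' Fa' Y s"
      have "cocone J C Fo Fa Y (\<lambda>j. s (\<phi> j))"
        by (rule cc[THEN iffD1, OF _ s]) simp
      then have "\<exists>!h. h \<in> hom C Z Y \<and> (\<forall>j\<in>Obj J. h \<cdot>\<^bsub>C\<^esub> t j = s (\<phi> j))" using R by blast
      then show "\<exists>!h. h \<in> hom C Z Y \<and> (\<forall>k\<in>Obj K. h \<cdot>\<^bsub>C\<^esub> t' k = s k)"
        unfolding K by (simp add: t)
    qed
  qed
  then show ?thesis
    unfolding colimit_def using cc[of t' t] t shape_iso_functor[OF iso \<open>category J\<close>, where C = C and Fo = Fo and Fo' = Fo' and Fa = Fa and Fa' = Fa'] Fo Fa by simp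
qed

section \<open>Small sets and small shapes\<close>

lemma small_embedding:
  fixes \<kappa> :: "'s rel"
  assumes "Card_order \<kappa>" "small \<kappa> I"
  obtains \<phi> :: "'i \<Rightarrow> 's" where "inj_on \<phi> I"
proof -
  have "ordLess2 (card_of I) (card_of (Field \<kappa>))"
    using assms card_of_Field_ordIso[of \<kappa>] unfolding small_def
    by (meson ordIso_symmetric ordLess_ordIso_trans)
  then have "ordLeq3 (card_of I) (card_of (Field \<kappa>))" by (rule ordLess_imp_ordLeq)
  then show thesis using that by (auto simp: card_of_ordLeq[symmetric])
qed

lemma small_image: "small \<kappa> I \<Longrightarrow> small \<kappa> (f ` I)"
  unfolding small_def by (rule ordLeq_ordLess_trans[OF card_of_image])

lemma small_subset: "small \<kappa> I \<Longrightarrow> I' \<subseteq> I \<Longrightarrow> small \<kappa> I'"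
  unfolding small_def by (rule ordLeq_ordLess_trans[OF card_of_mono1])

lemma infinite_Field: "universe_cardinal \<kappa> \<Longrightarrow> infinite (Field \<kappa>)"
  unfolding universe_cardinal_def
  by (metis card_of_Field_ordIso infinite_iff_natLeq_ordLeq ordIso_symmetric ordLess_imp_ordLeq ordLess_ordIso_trans)

lemma small_Un: "universe_cardinal \<kappa> \<Longrightarrow> small \<kappa> I \<Longrightarrow> small \<kappa> I' \<Longrightarrow> small \<kappa> (I \<union> I')"
  using infinite_Field[of \<kappa>] unfolding small_def universe_cardinal_def
  by (blast intro: card_of_Un_ordLess_infinite_Field)

lemma small_nat: "universe_cardinal \<kappa> \<Longrightarrow> small \<kappa> (A :: nat set)"
  unfolding small_def universe_cardinal_def
  using card_of_nat card_of_mono1[of A UNIV]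
  by (meson ordIso_ordLess_trans ordLeq_ordLess_trans subset_UNIV)

lemma small_finite: "universe_cardinal \<kappa> \<Longrightarrow> finite A \<Longrightarrow> small \<kappa> A"
  unfolding small_def universe_cardinal_def
  by (meson finite_iff_ordLess_natLeq ordLess_transitive)

text \<open>An infinite set is equinumerous with its square, and finite sets are small because
  \<open>\<kappa>\<close> is uncountable. This bounds the arrows of an order by its field.\<close>

lemma small_Times_self:
  assumes "universe_cardinal \<kappa>" "small \<kappa> I"
  shows "small \<kappa> (I \<times> I)"
proof (cases "finite I")
  case True
  then show ?thesis by (intro small_finite[OF assms(1)] finite_cartesian_product)
next
  case False
  then have "ordIso2 (card_of (I \<times> I)) (card_of I)"
    using card_of_Times_infinite[OF False, of I] assms(2)
    by (metis False card_of_mono1 finite.emptyI subset_refl)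
  then show ?thesis using assms(2) unfolding small_def by (rule ordIso_ordLess_trans)
qed

lemma small_category_order_cat:
  assumes "universe_cardinal \<kappa>" "Refl r" "trans r" "small \<kappa> (Field r)"
  shows "small_category \<kappa> (order_cat r)"
proof -
  have "r \<subseteq> Field r \<times> Field r" by (auto simp: Field_def)
  then have "small \<kappa> r" using small_subset small_Times_self assms by metis
  then show ?thesis using assms category_order_cat by (simp add: small_category_def)
qed

text \<open>Preservation is defined for shapes whose objects and arrows have type \<open>'s\<close>.
  A small category of any type has an isomorphic copy of this kind, because sets smaller than
  \<open>\<kappa>\<close> embed into \<open>'s\<close>.\<close>

lemma preserves_colimitsD:
  fixes \<kappa> :: "'s rel" and J :: "('j, 'u, 'y) cat_scheme"
  assumes pres: "preserves_colimits \<kappa> C D Ho Ha" and "Card_order \<kappa>"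
    and J: "small_category \<kappa> J" and colim: "colimit J C Fo Fa Z t"
  shows "colimit J D (\<lambda>j. Ho (Fo j)) (\<lambda>u. Ha (Fa u)) (Ho Z) (\<lambda>j. Ha (t j))"
proof -
  interpret J: category J using J by (simp add: small_category_def)
  obtain \<phi> :: "'j \<Rightarrow> 's" where \<phi>: "inj_on \<phi> (Obj J)"
    using small_embedding[OF \<open>Card_order \<kappa>\<close>] J by (metis small_category_def)
  obtain \<psi> :: "'u \<Rightarrow> 's" where \<psi>: "inj_on \<psi> (Arr J)"
    using small_embedding[OF \<open>Card_order \<kappa>\<close>] J by (metis small_category_def)
  define \<phi>' where "\<phi>' = inv_into (Obj J) \<phi>"
  define \<psi>' where "\<psi>' = inv_into (Arr J) \<psi>"
  have \<phi>': "\<phi>' (\<phi> j) = j" if "j \<in> Obj J" for j using \<phi> that by (simp add: \<phi>'_def)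
  have \<psi>': "\<psi>' (\<psi> u) = u" if "u \<in> Arr J" for u using \<psi> that by (simp add: \<psi>'_def)
  \<comment> \<open>The copy of \<open>J\<close> on the images of the two embeddings; its operations
    are those of \<open>J\<close>, reached through \<open>\<phi>'\<close> and
    \<open>\<psi>'\<close>.\<close>
  define K :: "('s, 's) cat" where "K = \<lparr>Obj = \<phi> ` Obj J, Arr = \<psi> ` Arr J,
    Dom = (\<lambda>u. \<phi> (Dom J (\<psi>' u))), Cod = (\<lambda>u. \<phi> (Cod J (\<psi>' u))),
    Ident = (\<lambda>k. \<psi> (Ident J (\<phi>' k))), Comp = (\<lambda>v u. \<psi> (\<psi>' v \<cdot>\<^bsub>J\<^esub> \<psi>' u))\<rparr>"
  have \<phi>_eq: "\<phi> i = \<phi> j \<longleftrightarrow> i = j" if "i \<in> Obj J" "j \<in> Obj J" for i j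
    using \<phi> that by (auto dest: inj_onD)
  have K: "category K"
    by unfold_locales
      (auto simp: K_def in_hom_iff \<phi>' \<psi>' \<phi>_eq J.Comp_Comp)
  have iso: "shape_iso J K \<phi> \<psi>"
    using \<phi> \<psi> by (auto simp: shape_iso_def K_def bij_betw_def \<phi>' \<psi>')
  have "small_category \<kappa> K"
    using J K by (auto simp: small_category_def K_def small_image)
  moreover have "colimit K C (Fo \<circ> \<phi>') (Fa \<circ> \<psi>') Z (t \<circ> \<phi>')"
    using colim by (subst shape_iso_colimit[OF iso J.category_axioms]) (auto simp: \<phi>' \<psi>')
  ultimately have "colimit K D (Ho \<circ> (Fo \<circ> \<phi>')) (Ha \<circ> (Fa \<circ> \<psi>')) (Ho Z) (Ha \<circ> (t \<circ> \<phi>'))"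
    using pres unfolding preserves_colimits_def by blast
  then show ?thesis
    by (subst (asm) shape_iso_colimit[OF iso J.category_axioms]) (auto simp: \<phi>' \<psi>')
qed

section \<open>Sequential colimits\<close>

definition seq_colimit ::
    "('o, 'a, 'x) cat_scheme \<Rightarrow> (nat \<Rightarrow> 'o) \<Rightarrow> (nat \<Rightarrow> 'a) \<Rightarrow> 'o \<Rightarrow> (nat \<Rightarrow> 'a) \<Rightarrow> bool" where
  "seq_colimit C X x Z t \<longleftrightarrow> Z \<in> Obj C \<and> (\<forall>n. t n \<in> hom C (X n) Z \<and> t (Suc n) \<cdot>\<^bsub>C\<^esub> x n = t n) \<and>
    (\<forall>Y s. Y \<in> Obj C \<and> (\<forall>n. s n \<in> hom C (X n) Y \<and> s (Suc n) \<cdot>\<^bsub>C\<^esub> x n = s n) \<longrightarrow>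
      (\<exists>!h. h \<in> hom C Z Y \<and> (\<forall>n. h \<cdot>\<^bsub>C\<^esub> t n = s n)))"

lemma functor_order_catD:
  assumes "is_functor (order_cat r) C X F"
  shows "a \<in> Field r \<Longrightarrow> X a \<in> Obj C" "a \<in> Field r \<Longrightarrow> F (a, a) = Ident C (X a)"
    "(a, b) \<in> r \<Longrightarrow> F (a, b) \<in> Arr C" "(a, b) \<in> r \<Longrightarrow> Dom C (F (a, b)) = X a"
    "(a, b) \<in> r \<Longrightarrow> Cod C (F (a, b)) = X b"
    "(a, b) \<in> r \<Longrightarrow> (b, c) \<in> r \<Longrightarrow> F (a, c) = F (b, c) \<cdot>\<^bsub>C\<^esub> F (a, b)"
  using assms unfolding is_functor_order_cat in_hom_iff by blast+

lemma Field_natLeq [simp]: "Field natLeq = UNIV"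
  by (rule Field_natLeq)

lemma category_natLeq: "category (order_cat natLeq)"
  by (rule category_order_cat) (auto simp: refl_on_def natLeq_def intro!: transI)

context category
begin

text \<open>Compatibility with the single steps implies compatibility with every
  \<open>F (m, n)\<close>, by induction on \<open>n\<close>; this is why \<open>seq_colimit\<close>
  mentions only the maps \<open>x n\<close>.\<close>

lemma seq_cocone_iff:
  assumes F: "is_functor (order_cat natLeq) C X F"
  shows "cocone (order_cat natLeq) C X F Z t \<longleftrightarrow>
    Z \<in> Obj C \<and> (\<forall>n. t n \<in> hom C (X n) Z \<and> t (Suc n) \<cdot> F (n, Suc n) = t n)" (is "?L \<longleftrightarrow> ?R")
proof
  show "?L \<Longrightarrow> ?R" unfolding cocone_order_cat Field_natLeq by (simp add: natLeq_def)
next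
  assume R: ?R
  note FD = functor_order_catD[OF F]
  have X: "X n \<in> Obj C" "F (n, n) = Ident C (X n)" for n
    by (rule FD; simp)+
  have F1: "F (m, n) \<in> Arr C" "Dom C (F (m, n)) = X m" "Cod C (F (m, n)) = X n" if "m \<le> n" for m n
    by (rule FD; use that in \<open>simp add: natLeq_def\<close>)+
  have F2: "F (l, n) = F (m, n) \<cdot> F (l, m)" if "l \<le> m" "m \<le> n" for l m n
    by (rule FD; use that in \<open>simp add: natLeq_def\<close>)
  have t: "t n \<in> Arr C" "Dom C (t n) = X n" "Cod C (t n) = Z" "t (Suc n) \<cdot> F (n, Suc n) = t n" for n
    using R by (auto simp: in_hom_iff)
  have "t n \<cdot> F (m, n) = t m" if "m \<le> n" for m n
    using that
  proof (induction n rule: dec_induct)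
    case base then show ?case by (simp add: X t)
  next
    case (step n)
    have "t (Suc n) \<cdot> F (m, Suc n) = t (Suc n) \<cdot> F (n, Suc n) \<cdot> F (m, n)"
      using F2[of m n "Suc n"] step by simp
    also have "\<dots> = t n \<cdot> F (m, n)" by (rule Comp_eq_Arr) (use t F1 step in auto)
    finally show ?case using step by simp
  qed
  then show ?L using R by (auto simp: cocone_order_cat natLeq_def)
qed

lemma seq_colimit_iff:
  assumes F: "is_functor (order_cat natLeq) C X F" and "\<And>n. F (n, Suc n) = x n"
  shows "seq_colimit C X x Z t \<longleftrightarrow> colimit (order_cat natLeq) C X F Z t"
  using assms unfolding colimit_def seq_cocone_iff[OF F] seq_colimit_def by simp

text \<open>The composite of the \<open>k\<close> maps that start at stage \<open>m\<close>.
  Recursion on the length instead of the end point avoids a side condition \<open>m \<le> n\<close>;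
  \<open>Dom C (x m)\<close> stands for the object \<open>X m\<close>, which is not an
  argument.\<close>

primrec chain :: "(nat \<Rightarrow> 'a) \<Rightarrow> nat \<Rightarrow> nat \<Rightarrow> 'a" where
  "chain x m 0 = Ident C (Dom C (x m))"
| "chain x m (Suc k) = x (m + k) \<cdot> chain x m k"

lemma chain_hom:
  assumes "\<And>n. x n \<in> hom C (X n) (X (Suc n))"
  shows "chain x m k \<in> hom C (X m) (X (m + k))"
proof (induction k)
  case 0
  then show ?case using assms[of m] hom_Obj[OF assms[of m]] by (auto simp: in_hom_iff)
next
  case (Suc k)
  then show ?case using assms[of "m + k"] by (auto simp: in_hom_iff)
qed

lemma chain_functor:
  assumes x: "\<And>n. x n \<in> hom C (X n) (X (Suc n))"
  shows "is_functor (order_cat natLeq) C X (\<lambda>(m, n). chain x m (n - m))"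
proof -
  have X: "X n \<in> Obj C" "Dom C (x n) = X n" for n
    using x[of n] hom_Obj[OF x[of n]] by (auto simp: in_hom_iff)
  have ch: "chain x m k \<in> hom C (X m) (X (m + k))" for m k by (rule chain_hom) (rule x)
  have add: "chain x l (i + k) = chain x (l + i) k \<cdot> chain x l i" for l i k
  proof (induction k)
    case 0
    then show ?case using ch[of l i] by (simp add: X in_hom_iff)
  next
    case (Suc k)
    then show ?case using ch[of l i] ch[of "l + i" k] x[of "l + i + k"]
      by (simp add: Comp_Comp in_hom_iff add.assoc)
  qed
  have 1: "chain x l (n - l) = chain x m (n - m) \<cdot> chain x l (m - l)" if "l \<le> m" "m \<le> n" for l m n
    using add[of l "m - l" "n - m"] that by simp
  have 2: "chain x m (n - m) \<in> hom C (X m) (X n)" if "m \<le> n" for m n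
    using ch[of m "n - m"] that by simp
  show ?thesis
    unfolding is_functor_order_cat
  proof (intro conjI ballI allI impI)
    fix l m n assume "(l, m) \<in> natLeq" "(m, n) \<in> natLeq"
    then show "(case (l, n) of (m, n) \<Rightarrow> chain x m (n - m)) = (case (m, n) of (m, n) \<Rightarrow> chain x m (n - m)) \<cdot>
      (case (l, m) of (m, n) \<Rightarrow> chain x m (n - m))"
      unfolding prod.case by (intro 1) (auto simp: natLeq_def)
  qed (auto simp: natLeq_def X 2)
qed

lemma seq_colimit_chain:
  assumes x: "\<And>n. x n \<in> hom C (X n) (X (Suc n))"
  shows "seq_colimit C X x Z t \<longleftrightarrow> colimit (order_cat natLeq) C X (\<lambda>(m, n). chain x m (n - m)) Z t"
proof (rule seq_colimit_iff)
  show "is_functor (order_cat natLeq) C X (\<lambda>(m, n). chain x m (n - m))"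
    by (rule chain_functor) (rule x)
  show "(case (n, Suc n) of (m, n) \<Rightarrow> chain x m (n - m)) = x n" for n
    using x[of n] by (simp add: in_hom_iff)
qed

end

section \<open>Left closed classes\<close>

lemma Well_orderD:
  assumes "Well_order r"
  shows "Refl r" "trans r" "antisym r" "Total r" "wf (r - Id)"
  using assms by (auto simp: well_order_on_def linear_order_on_def partial_order_on_def preorder_on_def)

lemma Well_order_Total: "Well_order r \<Longrightarrow> a \<in> Field r \<Longrightarrow> b \<in> Field r \<Longrightarrow> (a, b) \<in> r \<or> (b, a) \<in> r"
  using Well_orderD(1,4)[of r] by (cases "a = b") (auto simp: total_on_def refl_on_def)

lemma Well_order_trans: "Well_order r \<Longrightarrow> (a, b) \<in> r \<Longrightarrow> (b, c) \<in> r \<Longrightarrow> (a, c) \<in> r"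
  using Well_orderD(2)[of r] by (blast dest: transD)

lemma Well_order_antisym: "Well_order r \<Longrightarrow> (a, b) \<in> r \<Longrightarrow> (b, a) \<in> r \<Longrightarrow> a = b"
  using Well_orderD(3)[of r] by (blast dest: antisymD)

lemma Well_order_refl: "Well_order r \<Longrightarrow> a \<in> Field r \<Longrightarrow> (a, a) \<in> r"
  using Well_orderD(1)[of r] by (blast dest: refl_onD)

lemma underS_Field: "a \<in> underS r b \<Longrightarrow> a \<in> Field r" "a \<in> underS r b \<Longrightarrow> b \<in> Field r"
  by (auto simp: underS_def Field_def)

lemma underS_succ_elem:
  assumes "Well_order r" "succ_elem r b c"
  shows "underS r c = insert b (underS r b)" "(b, c) \<in> r"
  using assms Well_order_trans[of r] Well_order_antisym[of r]
  unfolding succ_elem_def underS_def by blast+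

lemma exists_bottom_elem:
  assumes "Well_order r" "Field r \<noteq> {}"
  shows "\<exists>a. bottom_elem r a"
proof -
  obtain a where a: "a \<in> Field r" "\<And>b. (b, a) \<in> r - Id \<Longrightarrow> b \<notin> Field r"
    using wfE_min[OF Well_orderD(5)[OF assms(1)], of _ "Field r"] assms(2) by (metis all_not_in_conv)
  then show ?thesis unfolding bottom_elem_def underS_def by (auto simp: Field_def)
qed

lemma bottom_elem_le:
  assumes "Well_order r" "bottom_elem r a" "b \<in> Field r"
  shows "(a, b) \<in> r"
  using assms Well_order_Total[of r a b] by (auto simp: bottom_elem_def underS_def)

lemma Restr_Field: "Well_order r \<Longrightarrow> A \<subseteq> Field r \<Longrightarrow> Field (Restr r A) = A"
proof -
  assume r: "Well_order r" and A: "A \<subseteq> Field r"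
  have "(a, a) \<in> Restr r A" if "a \<in> A" for a using Well_order_refl[OF r] A that by auto
  then show ?thesis by (auto simp: Field_def)
qed

lemma coproduct_cong:
  assumes "\<And>i. i \<in> I \<Longrightarrow> X i = X' i" "\<And>i. i \<in> I \<Longrightarrow> p i = p' i"
  shows "coproduct C I X P p \<longleftrightarrow> coproduct C I X' P p'"
  using assms unfolding coproduct_def by simp

lemma embed_nat:
  fixes \<kappa> :: "'s rel"
  assumes "universe_cardinal \<kappa>"
  obtains e :: "nat \<Rightarrow> 's" where "inj e"
proof -
  have "small \<kappa> (UNIV :: nat set)" by (rule small_nat[OF assms])
  then show thesis using small_embedding[of \<kappa> "UNIV :: nat set"] assms that
    unfolding universe_cardinal_def by blast
qed

text \<open>Transfinite sequences are indexed by well-orders on \<open>'s\<close>, so the natural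
  numbers are copied into \<open>'s\<close>. An order of type omega has no limit elements, which
  makes the continuity condition vacuous, and each of its successor steps is one of the given
  maps.\<close>

lemma (in category) sequence_transfinite:
  fixes \<kappa> :: "'s rel"
  assumes univ: "universe_cardinal \<kappa>" and x: "\<And>n. x n \<in> hom C (X n) (X (Suc n))"
  obtains r :: "'s rel" and X' x' a
  where "transfinite_sequence \<kappa> C r X' x'" "bottom_elem r a" "X' a = X 0"
    "\<And>b c. succ_elem r b c \<Longrightarrow> \<exists>n. x' (b, c) = x n"
    "\<And>Z t'. colimit (order_cat r) C X' x' Z t' \<Longrightarrow> \<exists>t. seq_colimit C X x Z t"
    "\<And>Z t. seq_colimit C X x Z t \<Longrightarrow> \<exists>t'. colimit (order_cat r) C X' x' Z t' \<and> t' a = t 0"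
proof -
  obtain e :: "nat \<Rightarrow> 's" where e: "inj e" by (rule embed_nat[OF univ])
  define r where "r = dir_image natLeq e"
  define F where "F = (\<lambda>(m, n). chain x m (n - m))"
  have r: "(e m, e n) \<in> r \<longleftrightarrow> m \<le> n" for m n
    using e by (auto simp: r_def dir_image_def natLeq_def inj_eq)
  have Fr: "Field r = range e" by (simp add: r_def dir_image_Field)
  have WO: "Well_order r"
    unfolding r_def using e natLeq_Well_order by (intro Well_order_dir_image) (auto intro: inj_on_subset)
  have nL: "(m, n) \<in> natLeq \<longleftrightarrow> m \<le> n" for m n by (simp add: natLeq_def)
  have iso: "shape_iso (order_cat natLeq) (order_cat r) e (\<lambda>u. (e (fst u), e (snd u)))"
    using e unfolding shape_iso_def r_def
    by (auto simp: bij_betw_def inj_on_def dir_image_Field) (auto simp: dir_image_def intro: rev_image_eqI)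
  define X' where "X' = (\<lambda>s. X (inv e s))"
  define x' where "x' = (\<lambda>(s, s'). F (inv e s, inv e s'))"
  have X': "X' (e n) = X n" and x': "x' (e m, e n) = F (m, n)" for m n
    using e by (auto simp: X'_def x'_def)
  have Ffun: "is_functor (order_cat natLeq) C X F"
    unfolding F_def by (rule chain_functor) (rule x)
  have colim: "colimit (order_cat r) C X' x' Z t \<longleftrightarrow> seq_colimit C X x Z (\<lambda>n. t (e n))" for Z t
    unfolding seq_colimit_chain[of x X, OF x]
    by (subst shape_iso_colimit[OF iso category_natLeq, of X' X x' F t "\<lambda>n. t (e n)"])
      (auto simp: X' x' F_def)
  have US: "underS r (e n) = e ` {..<n}" for n
    using e by (auto simp: underS_def r_def dir_image_def natLeq_def inj_eq)
  have bot: "bottom_elem r (e 0)"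
    using US[of 0] by (simp add: bottom_elem_def Fr)
  have succ: "succ_elem r (e n) (e (Suc n))" for n
    unfolding succ_elem_def US using r by auto
  \<comment> \<open>If \<open>e n\<close> is the successor of \<open>e m\<close> and
    \<open>n = Suc k\<close>, then \<open>e k\<close> lies strictly below \<open>e n\<close>, hence
    not above \<open>e m\<close>, and \<open>k = m\<close>.\<close>
  have succ_x: "\<exists>n. x' (b, c) = x n" if bc: "succ_elem r b c" for b c
  proof -
    obtain m n where mn: "b = e m" "c = e n"
      using bc underS_Field[of b r c] Fr by (auto simp: succ_elem_def)
    have lt: "m < n" using bc r e by (auto simp: succ_elem_def underS_def mn inj_eq)
    then obtain k where k: "n = Suc k" "m \<le> k" by (cases n) auto
    have "e k \<in> underS r (e n)" using r e k by (auto simp: underS_def inj_eq)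
    then have "(e k, e m) \<in> r" using bc by (auto simp: succ_elem_def mn)
    then have "k = m" using k r by simp
    then show ?thesis using mn k x[of m] by (auto simp: x' F_def in_hom_iff)
  qed
  have nolim: "\<not> limit_elem r b" for b
  proof
    assume l: "limit_elem r b"
    then obtain n where n: "b = e n" by (auto simp: limit_elem_def Fr)
    show False using l bot succ n by (cases n) (auto simp: limit_elem_def)
  qed
  have seq: "transfinite_sequence \<kappa> C r X' x'"
    unfolding transfinite_sequence_def
  proof (intro conjI)
    show "small \<kappa> (Field r)" unfolding Fr by (intro small_image small_nat univ)
    show "is_functor (order_cat r) C X' x'"
      by (subst shape_iso_functor[OF iso category_natLeq, of X' X x' F]) (auto simp: X' x' Ffun)
  qed (use WO Fr nolim in auto)
  show thesis
  proof (rule that[OF seq bot])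
    show "X' (e 0) = X 0" by (rule X')
    show "\<exists>t. seq_colimit C X x Z t" if "colimit (order_cat r) C X' x' Z t'" for Z t'
      using that colim by blast
    show "\<exists>t'. colimit (order_cat r) C X' x' Z t' \<and> t' (e 0) = t 0" if "seq_colimit C X x Z t" for Z t
      using that e by (intro exI[of _ "\<lambda>s. t (inv e s)"]) (simp add: colim)
  qed (rule succ_x)
qed

section \<open>Consequences of left closedness\<close>

locale left_closed_class = category M
  for M :: "('o, 'a, 'x) cat_scheme" (structure) +
  fixes \<kappa> :: "'s rel" and G :: "'o set" and S :: "'a set"
  assumes universe: "universe_cardinal \<kappa>" and left_closed: "left_closed \<kappa> M G S"
begin

lemma subcat: "subcategory M G S"
  using left_closed by (simp add: left_closed_def)

lemma good_Obj: "X \<in> G \<Longrightarrow> X \<in> Obj M"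
  and cof_Arr: "f \<in> S \<Longrightarrow> f \<in> Arr M"
  and cof_Dom: "f \<in> S \<Longrightarrow> Dom M f \<in> G"
  and cof_Cod: "f \<in> S \<Longrightarrow> Cod M f \<in> G"
  and cof_Ident: "X \<in> G \<Longrightarrow> Ident M X \<in> S"
  and cof_Comp: "f \<in> S \<Longrightarrow> g \<in> S \<Longrightarrow> Dom M g = Cod M f \<Longrightarrow> g \<cdot> f \<in> S"
  using subcat unfolding subcategory_def by auto

lemma cof_iso: "iso M f \<Longrightarrow> Dom M f \<in> G \<Longrightarrow> f \<in> S"
  and coproduct_clause: "small \<kappa> (I :: 's set) \<Longrightarrow> \<forall>i\<in>I. X i \<in> G \<Longrightarrow>
    (\<exists>P p. coproduct M I X P p) \<and> (\<forall>P p. coproduct M I X P p \<longrightarrow> P \<in> G)"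
  and pushout_clause: "f \<in> S \<Longrightarrow> g \<in> Arr M \<Longrightarrow> Dom M g = Dom M f \<Longrightarrow> Cod M g \<in> G \<Longrightarrow>
    (\<exists>p q. pushout M f g p q) \<and> (\<forall>p q. pushout M f g p q \<longrightarrow> q \<in> S)"
  and transfinite_clause: "transfinite_sequence \<kappa> M (r :: 's rel) X' x \<Longrightarrow> bottom_elem r a \<Longrightarrow> X' a \<in> G \<Longrightarrow>
    \<forall>b c. succ_elem r b c \<longrightarrow> x (b, c) \<in> S \<Longrightarrow>
    (\<exists>Z t. colimit (order_cat r) M X' x Z t) \<and> (\<forall>Z t. colimit (order_cat r) M X' x Z t \<longrightarrow> t a \<in> S)"
  using left_closed unfolding left_closed_def by simp_all

lemma good_iso: "iso M f \<Longrightarrow> Dom M f \<in> G \<Longrightarrow> Cod M f \<in> G"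
  using cof_iso cof_Cod by blast

lemma cof_pushout_exists:
  assumes "f \<in> S" "g \<in> Arr M" "Dom M g = Dom M f" "Cod M g \<in> G"
  obtains p q where "pushout M f g p q" "q \<in> S"
  using pushout_clause[OF assms] that by blast

lemma cof_pushout: "f \<in> S \<Longrightarrow> Cod M g \<in> G \<Longrightarrow> pushout M f g p q \<Longrightarrow> q \<in> S"
  using pushout_clause[of f g] pushoutD[of f g p q] by simp

lemma good_coproduct_exists_index:
  fixes I :: "'s set"
  assumes "small \<kappa> I" "\<And>i. i \<in> I \<Longrightarrow> X i \<in> G"
  obtains P p where "coproduct M I X P p" "P \<in> G"
proof -
  have "\<exists>P p. coproduct M I X P p" "\<And>P p. coproduct M I X P p \<Longrightarrow> P \<in> G"
    using coproduct_clause[of I X] assms by blast+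
  then show thesis using that by blast
qed

lemma coproduct_reindex:
  assumes "bij_betw \<phi> I J"
  shows "coproduct M J X P p \<longleftrightarrow> coproduct M I (\<lambda>i. X (\<phi> i)) P (\<lambda>i. p (\<phi> i))"
proof -
  have inj: "inj_on \<phi> I" "J = \<phi> ` I" using assms by (auto simp: bij_betw_def)
  have "shape_iso (order_cat (Id_on I)) (order_cat (Id_on J)) \<phi> (\<lambda>u. (\<phi> (fst u), \<phi> (snd u)))"
    using assms unfolding shape_iso_def
    by (auto simp: bij_betw_def inj_on_def intro: rev_image_eqI[OF Id_onI])
  from shape_iso_colimit[OF this category_order_cat_Id_on, where C = M and Z = P and t = "\<lambda>i. p (\<phi> i)", of X "\<lambda>i. X (\<phi> i)" "\<lambda>u. Ident M (X (fst u))" "\<lambda>u. Ident M (X (\<phi> (fst u)))" p]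
  show ?thesis unfolding coproduct_iff_colimit by auto
qed

text \<open>Left closedness provides coproducts over subsets of \<open>'s\<close>, whereas the cells
  are indexed by objects of \<open>C\<close>, of another type. An injection into \<open>'s\<close>
  reindexes the family.\<close>

lemma good_coproduct_exists:
  assumes "small \<kappa> I" "\<And>i. i \<in> I \<Longrightarrow> X i \<in> G"
  obtains P p where "coproduct M I X P p" "P \<in> G"
proof -
  obtain \<phi> :: "'b \<Rightarrow> 's" where \<phi>: "inj_on \<phi> I"
    using small_embedding assms(1) universe unfolding universe_cardinal_def by metis
  obtain P p where P: "coproduct M (\<phi> ` I) (\<lambda>j. X (inv_into I \<phi> j)) P p" "P \<in> G"
  proof (rule good_coproduct_exists_index[OF small_image[OF assms(1), of \<phi>], of "\<lambda>j. X (inv_into I \<phi> j)"])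
    show "X (inv_into I \<phi> j) \<in> G" if "j \<in> \<phi> ` I" for j using assms(2) \<phi> that by auto
  qed
  have "coproduct M I (\<lambda>i. X (inv_into I \<phi> (\<phi> i))) P (\<lambda>i. p (\<phi> i))"
    by (rule coproduct_reindex[OF inj_on_imp_bij_betw[OF \<phi>], where X = "\<lambda>j. X (inv_into I \<phi> j)", THEN iffD1, OF P(1)])
  then have "coproduct M I X P (\<lambda>i. p (\<phi> i))" using \<phi> by (simp add: coproduct_def)
  then show thesis using P(2) that by blast
qed

text \<open>Two coproducts of the same family are isomorphic, and good objects are closed under
  isomorphism, as an isomorphism with good domain is a cofibration.\<close>

lemma good_coproduct:
  assumes "small \<kappa> I" "\<And>i. i \<in> I \<Longrightarrow> X i \<in> G" "coproduct M I X P p"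
  shows "P \<in> G"
proof -
  obtain P' p' where P': "coproduct M I X P' p'" "P' \<in> G"
    using good_coproduct_exists[of I X] assms(1,2) by blast
  show ?thesis
    using colimit_unique[OF category_order_cat_Id_on P'(1)[unfolded coproduct_iff_colimit]
        assms(3)[unfolded coproduct_iff_colimit]] P'(2) good_iso by (metis in_hom_iff)
qed

lemma cof_transfinite:
  fixes r :: "'s rel"
  assumes "transfinite_sequence \<kappa> M r X x" "bottom_elem r a" "X a \<in> G"
    and "\<And>b c. succ_elem r b c \<Longrightarrow> x (b, c) \<in> S"
  shows "\<exists>Z t. colimit (order_cat r) M X x Z t" "\<And>Z t. colimit (order_cat r) M X x Z t \<Longrightarrow> t a \<in> S"
  using transfinite_clause[of r X x a] assms by blast+

lemma cof_sequence:
  assumes X0: "X 0 \<in> G" and x: "\<And>n. x n \<in> S" "\<And>n. x n \<in> hom M (X n) (X (Suc n))"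
  shows "\<exists>Z t. seq_colimit M X x Z t" "\<And>Z t. seq_colimit M X x Z t \<Longrightarrow> t 0 \<in> S"
proof -
  obtain r :: "'s rel" and X' x' a where r: "transfinite_sequence \<kappa> M r X' x'" "bottom_elem r a" "X' a = X 0"
    and succ: "\<And>b c. succ_elem r b c \<Longrightarrow> \<exists>n. x' (b, c) = x n"
    and colim: "\<And>Z t'. colimit (order_cat r) M X' x' Z t' \<Longrightarrow> \<exists>t. seq_colimit M X x Z t"
    "\<And>Z t. seq_colimit M X x Z t \<Longrightarrow> \<exists>t'. colimit (order_cat r) M X' x' Z t' \<and> t' a = t 0"
    using sequence_transfinite[where x = x and X = X, OF universe x(2)] by blast
  have "x' (b, c) \<in> S" if "succ_elem r b c" for b c using succ[OF that] x(1) by auto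
  note T = cof_transfinite[OF r(1,2) _ this]
  show "\<exists>Z t. seq_colimit M X x Z t" using T(1) X0 r(3) colim(1) by metis
  show "t 0 \<in> S" if "seq_colimit M X x Z t" for Z t
    using T(2) X0 r(3) colim(2)[OF that] by metis
qed

lemma iso_between_coproducts:
  assumes "coproduct M I X P p" "coproduct M I X Q q"
  obtains h where "iso M h" "h \<in> hom M P Q" "\<And>i. i \<in> I \<Longrightarrow> h \<cdot> p i = q i"
  using colimit_unique[OF category_order_cat_Id_on assms[unfolded coproduct_iff_colimit]] by auto

end

text \<open>The coproduct of cofibrations \<open>f\<^sub>i : A\<^sub>i \<rightarrow> B\<^sub>i\<close> is a transfinite composite which replaces the
  summands \<open>A\<^sub>i\<close> by \<open>B\<^sub>i\<close> one at a time: \<open>U\<close> is the set of indices already replaced.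
  The indices are a subset of an infinite set, well-ordered as a cardinal, so that no last step
  needs to be adjoined.\<close>

locale coproduct_of_cofibrations = left_closed_class M \<kappa> G S
  for M :: "('o, 'a, 'x) cat_scheme" (structure) and \<kappa> :: "'s rel" and G S +
  fixes I :: "'s set" and f :: "'s \<Rightarrow> 'a"
  assumes small_I: "small \<kappa> I" and cof_f: "\<And>i. i \<in> I \<Longrightarrow> f i \<in> S"
begin

definition F where "F U i = (if i \<in> U then Cod M (f i) else Dom M (f i))"

text \<open>For \<open>U \<subseteq> U'\<close>, the transition from \<open>F U i\<close> to
  \<open>F U' i\<close>: summand \<open>i\<close> moves along \<open>f i\<close> exactly if it is
  replaced between the two stages.\<close>

definition m where "m U U' i = (if i \<in> U then Ident M (Cod M (f i)) else if i \<in> U' then f i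
   else Ident M (Dom M (f i)))"

lemma F_good: "i \<in> I \<Longrightarrow> F U i \<in> G"
  using cof_f cof_Dom cof_Cod by (auto simp: F_def)

lemma m_hom: "i \<in> I \<Longrightarrow> U \<subseteq> U' \<Longrightarrow> m U U' i \<in> hom M (F U i) (F U' i)"
  using cof_f cof_Arr by (auto simp: F_def m_def in_hom_iff)

lemma m_Comp: "i \<in> I \<Longrightarrow> U \<subseteq> U' \<Longrightarrow> U' \<subseteq> U'' \<Longrightarrow> m U' U'' i \<cdot> m U U' i = m U U'' i"
  using cof_f cof_Arr by (auto simp: m_def)

text \<open>A coproduct is chosen for every set \<open>U\<close>, not just for subsets of
  \<open>I\<close>, because the well-order that drives the replacement also contains elements
  outside \<open>I\<close>.\<close>

definition XPp where "XPp U = (SOME Pp. coproduct M I (F U) (fst Pp) (snd Pp))"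
definition XP where "XP U = fst (XPp U)"
definition xp where "xp U = snd (XPp U)"

lemma coproduct_XP: "coproduct M I (F U) (XP U) (xp U)"
proof -
  obtain P p where "coproduct M I (F U) P p"
    by (rule good_coproduct_exists[OF small_I, of "F U"]) (auto intro: F_good)
  then have "coproduct M I (F U) (fst (P, p)) (snd (P, p))" by simp
  then show ?thesis unfolding XP_def xp_def XPp_def by (rule someI)
qed

lemma XP_good: "XP U \<in> G"
  by (rule good_coproduct[OF small_I _ coproduct_XP]) (rule F_good)

lemma xp: "i \<in> I \<Longrightarrow> xp U i \<in> Arr M" "i \<in> I \<Longrightarrow> Dom M (xp U i) = F U i" "i \<in> I \<Longrightarrow> Cod M (xp U i) = XP U"
  using coproductD(3)[OF coproduct_XP] by (auto simp: in_hom_iff)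

definition xx where "xx U U' = (SOME h. h \<in> hom M (XP U) (XP U') \<and> (\<forall>i\<in>I. h \<cdot> xp U i = xp U' i \<cdot> m U U' i))"

lemma xx:
  assumes "U \<subseteq> U'"
  shows "xx U U' \<in> Arr M" "Dom M (xx U U') = XP U" "Cod M (xx U U') = XP U'"
    "i \<in> I \<Longrightarrow> xx U U' \<cdot> xp U i = xp U' i \<cdot> m U U' i"
proof -
  have "xp U' i \<cdot> m U U' i \<in> hom M (F U i) (XP U')" if "i \<in> I" for i
    using m_hom[OF that assms] xp[OF that] by (auto simp: in_hom_iff)
  then obtain h where "h \<in> hom M (XP U) (XP U')" "\<And>i. i \<in> I \<Longrightarrow> h \<cdot> xp U i = xp U' i \<cdot> m U U' i"
    using coproduct_induced[OF coproduct_XP, of "XP U'" "\<lambda>i. xp U' i \<cdot> m U U' i"] XP_good good_Obj by metis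
  then have "\<exists>h. h \<in> hom M (XP U) (XP U') \<and> (\<forall>i\<in>I. h \<cdot> xp U i = xp U' i \<cdot> m U U' i)" by blast
  note * = someI_ex[OF this, folded xx_def]
  show "xx U U' \<in> Arr M" "Dom M (xx U U') = XP U" "Cod M (xx U U') = XP U'"
    "i \<in> I \<Longrightarrow> xx U U' \<cdot> xp U i = xp U' i \<cdot> m U U' i"
    using * unfolding in_hom_iff by auto
qed

lemma joint_epi:
  assumes "h \<in> Arr M" "k \<in> Arr M" "Dom M h = XP U" "Dom M k = XP U" "Cod M h = Cod M k"
    and "\<And>i. i \<in> I \<Longrightarrow> h \<cdot> xp U i = k \<cdot> xp U i"
  shows "h = k"
  by (rule coproduct_joint_epi[OF coproduct_XP, of h U "Cod M k" k]) (use assms in \<open>auto simp: in_hom_iff\<close>)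

lemma xx_self: "xx U U = Ident M (XP U)"
proof (rule joint_epi[of _ _ U])
  fix i assume "i \<in> I"
  then show "xx U U \<cdot> xp U i = Ident M (XP U) \<cdot> xp U i"
    using xx(4)[of U U i] xp[of i U] cof_Arr[OF cof_f] by (auto simp: m_def F_def)
qed (use xx[of U U] XP_good[of U] good_Obj in auto)

lemma xx_Comp:
  assumes "U \<subseteq> U'" "U' \<subseteq> U''"
  shows "xx U' U'' \<cdot> xx U U' = xx U U''"
proof (rule joint_epi[of _ _ U])
  note X = xx[OF assms(1)] xx[OF assms(2)] xx[OF subset_trans[OF assms]]
  fix i assume i: "i \<in> I"
  note m = m_hom[OF i assms(1), unfolded in_hom_iff] m_hom[OF i assms(2), unfolded in_hom_iff]
  have "(xx U' U'' \<cdot> xx U U') \<cdot> xp U i = xx U' U'' \<cdot> xp U' i \<cdot> m U U' i"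
    using X xp[OF i] i by (simp add: Comp_Comp)
  also have "\<dots> = xp U'' i \<cdot> m U' U'' i \<cdot> m U U' i"
    by (rule Comp_eq_Comp) (use X xp[OF i] i m in auto)
  also have "\<dots> = xx U U'' \<cdot> xp U i" using X i m_Comp[OF i assms] by simp
  finally show "(xx U' U'' \<cdot> xx U U') \<cdot> xp U i = xx U U'' \<cdot> xp U i" .
qed (use xx[OF assms(1)] xx[OF assms(2)] xx[OF subset_trans[OF assms]] in auto)

text \<open>The summands other than \<open>j\<close> stay unchanged. So a map from the new coproduct
  amounts to a map from the old one together with an extension along \<open>f j\<close> of its
  restriction to summand \<open>j\<close>.\<close>

lemma pushout_xx:
  assumes j: "j \<in> I" "j \<notin> U"
  shows "pushout M (f j) (xp U j) (xp (insert j U) j) (xx U (insert j U))"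
  unfolding pushout_def
proof (intro conjI allI impI)
  let ?U = "insert j U"
  note X = xx[of U ?U, OF subset_insertI]
  have mj: "m U ?U j = f j" "F U j = Dom M (f j)" "F ?U j = Cod M (f j)" using j by (auto simp: m_def F_def)
  note fj = cof_Arr[OF cof_f[OF j(1)]]
  show "commuting_square M (f j) (xp U j) (xp ?U j) (xx U ?U)"
    using X j xp[OF j(1)] mj fj by (auto simp: commuting_square_def)
  fix p q assume "commuting_square M (f j) (xp U j) p q"
  then have pq: "p \<in> Arr M" "q \<in> Arr M" "Dom M p = Cod M (f j)" "Dom M q = XP U" "Cod M q = Cod M p"
    "p \<cdot> f j = q \<cdot> xp U j" using xp j by (auto simp: commuting_square_def)
  define g where "g i = (if i = j then p else q \<cdot> xp U i)" for i
  have F: "F ?U i = F U i" "m U ?U i = Ident M (F U i)" if "i \<noteq> j" for i using that by (auto simp: F_def m_def)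
  have "g i \<in> hom M (F ?U i) (Cod M p)" if "i \<in> I" for i
    using that pq xp[OF that] F mj by (auto simp: g_def in_hom_iff)
  then obtain h where h: "h \<in> hom M (XP ?U) (Cod M p)" "\<And>i. i \<in> I \<Longrightarrow> h \<cdot> xp ?U i = g i"
    using coproduct_induced[OF coproduct_XP, of "Cod M p" g ?U] pq by auto
  note h1 = h(1)[unfolded in_hom_iff]
  have hq: "h \<cdot> xx U ?U = q"
  proof (rule joint_epi[of _ _ U])
    fix i assume i: "i \<in> I"
    note mi = m_hom[OF i subset_insertI, of U j, unfolded in_hom_iff]
    have "(h \<cdot> xx U ?U) \<cdot> xp U i = h \<cdot> xp ?U i \<cdot> m U ?U i"
      using X xp[OF i] i h1 by (simp add: Comp_Comp)
    also have "\<dots> = g i \<cdot> m U ?U i"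
      by (rule Comp_eq_Arr) (use xp[OF i] h1 h(2)[OF i] mi in auto)
    also have "\<dots> = q \<cdot> xp U i"
      using pq mj F[of i] xp[OF i] by (auto simp: g_def)
    finally show "(h \<cdot> xx U ?U) \<cdot> xp U i = q \<cdot> xp U i" .
  qed (use X h1 pq in auto)
  show "\<exists>!h. h \<in> hom M (Cod M (xp ?U j)) (Cod M p) \<and> h \<cdot> xp ?U j = p \<and> h \<cdot> xx U ?U = q"
  proof (rule ex1I[of _ h])
    show "h \<in> hom M (Cod M (xp ?U j)) (Cod M p) \<and> h \<cdot> xp ?U j = p \<and> h \<cdot> xx U ?U = q"
      using h hq j xp by (auto simp: g_def)
  next
    fix k assume k: "k \<in> hom M (Cod M (xp ?U j)) (Cod M p) \<and> k \<cdot> xp ?U j = p \<and> k \<cdot> xx U ?U = q"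
    show "k = h"
    proof (rule joint_epi[of _ _ ?U])
      fix i assume i: "i \<in> I"
      show "k \<cdot> xp ?U i = h \<cdot> xp ?U i"
      proof (cases "i = j")
        case True then show ?thesis using k h(2)[OF i] by (simp add: g_def)
      next
        case False
        then have "xp ?U i = xx U ?U \<cdot> xp U i" using X(4)[OF i] F[of i] xp[OF i] by simp
        moreover have "k \<cdot> xx U ?U \<cdot> xp U i = q \<cdot> xp U i" "h \<cdot> xx U ?U \<cdot> xp U i = q \<cdot> xp U i"
          by (rule Comp_eq_Arr; use X xp[OF i] xp[OF j(1)] k h1 hq in \<open>auto simp: in_hom_iff\<close>)+
        ultimately show ?thesis by simp
      qed
    qed (use k h1 xp j in \<open>auto simp: in_hom_iff\<close>)
  qed
qed

text \<open>Elements outside \<open>I\<close> affect no summand. Together with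
  \<open>pushout_xx\<close> this makes every step a cofibration, whether or not it replaces
  anything.\<close>

lemma iso_xx:
  assumes "\<And>i. i \<in> I \<Longrightarrow> i \<in> U \<longleftrightarrow> i \<in> U'" "U \<subseteq> U'"
  shows "iso M (xx U U')"
proof -
  have F: "F U' i = F U i" "m U U' i = Ident M (F U i)" if "i \<in> I" for i
    using assms that by (auto simp: F_def m_def)
  have "coproduct M I (F U) (XP U') (xp U')"
    using coproduct_XP[of U'] F by (auto simp: coproduct_def)
  then obtain h where h: "iso M h" "h \<in> hom M (XP U) (XP U')" "\<And>i. i \<in> I \<Longrightarrow> h \<cdot> xp U i = xp U' i"
    using iso_between_coproducts[OF coproduct_XP[of U]] by blast
  have "xx U U' = h"
    by (rule joint_epi[of _ _ U]) (use h xx[OF assms(2)] xp F in \<open>auto simp: in_hom_iff\<close>)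
  then show ?thesis using h by simp
qed

lemma cof_xx_insert: "xx U (insert j U) \<in> S"
proof (cases "j \<in> I \<and> j \<notin> U")
  case True
  then show ?thesis using cof_pushout[OF cof_f _ pushout_xx] xp XP_good by auto
next
  case False
  then have "iso M (xx U (insert j U))" by (intro iso_xx) auto
  then show ?thesis using xx[OF subset_insertI] XP_good by (intro cof_iso) auto
qed

lemma functor_xx:
  assumes "Well_order r"
  shows "is_functor (order_cat r) M (\<lambda>j. XP (underS r j)) (\<lambda>(j, k). xx (underS r j) (underS r k))"
proof -
  have mono: "underS r j \<subseteq> underS r k" if "(j, k) \<in> r" for j k
    using assms that Well_order_trans[of r] Well_order_antisym[of r] by (auto simp: underS_def)
  show ?thesis unfolding is_functor_order_cat
    using XP_good good_Obj xx[OF mono] by (auto simp: xx_self in_hom_iff xx_Comp[OF mono mono])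
qed

text \<open>Each summand changes at most once, so it is constant from some stage in \<open>K\<close>
  on, and a cocone determines a map on each summand of \<open>XP U\<close>. With \<open>K\<close>
  the segment below a limit element this is continuity of the sequence; with \<open>K\<close> the
  whole field it gives the transfinite composite.\<close>

lemma colimit_xx:
  assumes r: "Well_order r" and K: "K \<subseteq> Field r" "K \<noteq> {}" and U: "U = (\<Union>j\<in>K. underS r j)"
  shows "colimit (order_cat (Restr r K)) M (\<lambda>j. XP (underS r j)) (\<lambda>(j, k). xx (underS r j) (underS r k))
     (XP U) (\<lambda>j. xx (underS r j) U)"
  unfolding colimit_def
proof (intro conjI allI impI)
  have mono: "underS r j \<subseteq> underS r k" if "(j, k) \<in> r" for j k
    using assms that Well_order_trans[of r] Well_order_antisym[of r] by (auto simp: underS_def)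
  have sub: "underS r j \<subseteq> U" if "j \<in> K" for j using that U by auto
  have FK: "Field (Restr r K) = K" by (rule Restr_Field[OF r K(1)])
  have tot: "(j, k) \<in> r \<or> (k, j) \<in> r" if "j \<in> K" "k \<in> K" for j k
    using Well_order_Total[OF r] that K by blast
  show "is_functor (order_cat (Restr r K)) M (\<lambda>j. XP (underS r j)) (\<lambda>(j, k). xx (underS r j) (underS r k))"
    unfolding is_functor_order_cat
    using XP_good good_Obj xx[OF mono] by (auto simp: xx_self in_hom_iff xx_Comp[OF mono mono])
  show "cocone (order_cat (Restr r K)) M (\<lambda>j. XP (underS r j)) (\<lambda>(j, k). xx (underS r j) (underS r k))
      (XP U) (\<lambda>j. xx (underS r j) U)"
    unfolding cocone_order_cat FK
    using XP_good good_Obj xx[OF sub] by (auto simp: in_hom_iff xx_Comp[OF mono sub])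
  fix Y s
  assume "cocone (order_cat (Restr r K)) M (\<lambda>j. XP (underS r j)) (\<lambda>(j, k). xx (underS r j) (underS r k)) Y s"
  then have Y: "Y \<in> Obj M"
    and s: "\<And>j. j \<in> K \<Longrightarrow> s j \<in> Arr M" "\<And>j. j \<in> K \<Longrightarrow> Dom M (s j) = XP (underS r j)"
      "\<And>j. j \<in> K \<Longrightarrow> Cod M (s j) = Y"
    and s_xx: "\<And>j k. j \<in> K \<Longrightarrow> k \<in> K \<Longrightarrow> (j, k) \<in> r \<Longrightarrow> s k \<cdot> xx (underS r j) (underS r k) = s j"
    unfolding cocone_order_cat FK by (auto simp: in_hom_iff)
  have s_m: "s k \<cdot> xp (underS r k) i \<cdot> m (underS r j) (underS r k) i = s j \<cdot> xp (underS r j) i"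
    if "j \<in> K" "k \<in> K" "(j, k) \<in> r" "i \<in> I" for i j k
  proof -
    note X = xx[OF mono[OF that(3)]]
    have "s k \<cdot> xp (underS r k) i \<cdot> m (underS r j) (underS r k) i = s k \<cdot> xx (underS r j) (underS r k) \<cdot> xp (underS r j) i"
      using X(4)[OF that(4)] by simp
    also have "\<dots> = s j \<cdot> xp (underS r j) i"
      by (rule Comp_eq_Arr) (use s_xx that s X xp in auto)
    finally show ?thesis .
  qed
  \<comment> \<open>A stage in \<open>K\<close> at which summand \<open>i\<close> has its final
    form. If \<open>i\<close> is never replaced, any element of the nonempty set \<open>K\<close>
    will do.\<close>
  define jj where "jj i = (SOME j. j \<in> K \<and> (i \<in> U \<longrightarrow> i \<in> underS r j))" for i
  have jj: "jj i \<in> K \<and> (i \<in> U \<longrightarrow> i \<in> underS r (jj i))" for i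
    unfolding jj_def by (rule someI_ex) (use K(2) U in auto)
  define g where "g i = s (jj i) \<cdot> xp (underS r (jj i)) i" for i
  have Fjj: "F (underS r (jj i)) i = F U i" for i
    using jj[of i] sub[of "jj i"] by (auto simp: F_def)
  have g: "g i \<in> Arr M" "Dom M (g i) = F U i" "Cod M (g i) = Y" if "i \<in> I" for i
    using jj[of i] s[of "jj i"] xp[OF that] Fjj by (auto simp: g_def)
  \<comment> \<open>The map on summand \<open>i\<close> does not depend on the chosen stage: any two
    stages are comparable, and the cocone absorbs the transition between them.\<close>
  have g_m: "g i \<cdot> m (underS r j) U i = s j \<cdot> xp (underS r j) i" if j: "j \<in> K" and i: "i \<in> I" for i j
  proof (cases "(j, jj i) \<in> r")
    case True
    have e: "m (underS r j) U i = m (underS r j) (underS r (jj i)) i"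
      using jj[of i] sub[of "jj i"] by (auto simp: m_def)
    have "g i \<cdot> m (underS r j) U i = s (jj i) \<cdot> xp (underS r (jj i)) i \<cdot> m (underS r j) (underS r (jj i)) i"
      unfolding g_def e using jj[of i] s[of "jj i"] xp[OF i] m_hom[OF i mono[OF True]]
      by (intro Comp_Comp) (auto simp: in_hom_iff)
    then show ?thesis using s_m[OF j _ True i] jj[of i] by simp
  next
    case False
    then have le: "(jj i, j) \<in> r" using tot j jj[of i] by blast
    have ij: "i \<in> underS r j \<longleftrightarrow> i \<in> U" using mono[OF le] jj[of i] sub[OF j] by auto
    have "m (underS r (jj i)) (underS r j) i = Ident M (F (underS r j) i)"
      using ij jj[of i] mono[OF le] by (auto simp: m_def F_def)
    then have "g i = s j \<cdot> xp (underS r j) i"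
      using s_m[OF _ j le i] jj[of i] xp[OF i, of "underS r j"] by (simp add: g_def)
    moreover have "m (underS r j) U i = Ident M (F U i)" using ij by (auto simp: m_def F_def)
    ultimately show ?thesis using g[OF i] by simp
  qed
  obtain h where h: "h \<in> hom M (XP U) Y" "\<And>i. i \<in> I \<Longrightarrow> h \<cdot> xp U i = g i"
    using coproduct_induced[OF coproduct_XP Y, of g U] g by (auto simp: in_hom_iff)
  note h1 = h(1)[unfolded in_hom_iff]
  show "\<exists>!h. h \<in> hom M (XP U) Y \<and> (\<forall>j\<in>Obj (order_cat (Restr r K)). h \<cdot> xx (underS r j) U = s j)"
    unfolding order_cat_simps FK
  proof (rule ex1I[of _ h])
    have "h \<cdot> xx (underS r j) U = s j" if j: "j \<in> K" for j
    proof (rule joint_epi[of _ _ "underS r j"])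
      note X = xx[OF sub[OF j]]
      fix i assume i: "i \<in> I"
      note mi = m_hom[OF i sub[OF j], unfolded in_hom_iff]
      have "(h \<cdot> xx (underS r j) U) \<cdot> xp (underS r j) i = h \<cdot> xp U i \<cdot> m (underS r j) U i"
        using X xp[OF i] i h1 by (simp add: Comp_Comp)
      also have "\<dots> = g i \<cdot> m (underS r j) U i"
        by (rule Comp_eq_Arr) (use xp[OF i] h1 h(2)[OF i] mi in auto)
      finally show "(h \<cdot> xx (underS r j) U) \<cdot> xp (underS r j) i = s j \<cdot> xp (underS r j) i"
        using g_m[OF j i] by simp
    qed (use xx[OF sub[OF j]] h1 s[OF j] in auto)
    then show "h \<in> hom M (XP U) Y \<and> (\<forall>j\<in>K. h \<cdot> xx (underS r j) U = s j)" using h by blast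
  next
    fix k assume k: "k \<in> hom M (XP U) Y \<and> (\<forall>j\<in>K. k \<cdot> xx (underS r j) U = s j)"
    show "k = h"
    proof (rule joint_epi[of _ _ U])
      fix i assume i: "i \<in> I"
      let ?j = "jj i"
      have j: "?j \<in> K" using jj by blast
      note X = xx[OF sub[OF j]]
      have "m (underS r ?j) U i = Ident M (F U i)" using jj[of i] sub[OF j] by (auto simp: m_def F_def)
      then have e: "xp U i = xx (underS r ?j) U \<cdot> xp (underS r ?j) i" using X(4)[OF i] xp[OF i] by simp
      have "k \<cdot> xx (underS r ?j) U \<cdot> xp (underS r ?j) i = s ?j \<cdot> xp (underS r ?j) i"
        by (rule Comp_eq_Arr; use X xp[OF i] k j in \<open>auto simp: in_hom_iff\<close>)
      then show "k \<cdot> xp U i = h \<cdot> xp U i" using e h(2)[OF i] by (simp add: g_def)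
    qed (use k h1 in \<open>auto simp: in_hom_iff\<close>)
  qed
qed

text \<open>Between \<open>i\<close> and a limit element \<open>b\<close> above it lies some
  \<open>j\<close>, and \<open>i\<close> belongs to \<open>underS r j\<close>. Hence the indices
  replaced at \<open>b\<close> are those replaced at an earlier stage.\<close>

lemma underS_limit_elem:
  assumes r: "Well_order r" and b: "limit_elem r b"
  shows "underS r b \<noteq> {}" "underS r b = (\<Union>j\<in>underS r b. underS r j)"
proof -
  show "underS r b \<noteq> {}" using b by (auto simp: limit_elem_def bottom_elem_def)
  have "\<exists>j\<in>underS r b. i \<in> underS r j" if i: "i \<in> underS r b" for i
  proof -
    have "\<not> succ_elem r i b" using b by (auto simp: limit_elem_def)
    then obtain c where c: "c \<in> underS r b" "(c, i) \<notin> r" using i by (auto simp: succ_elem_def)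
    then have "(i, c) \<in> r" "i \<noteq> c"
      using Well_order_Total[OF r] Well_order_refl[OF r] underS_Field[OF i] underS_Field[OF c(1)] by blast+
    then show ?thesis using c by (auto simp: underS_def)
  qed
  moreover have "i \<in> underS r b" if "j \<in> underS r b" "i \<in> underS r j" for i j
    using that Well_order_trans[OF r] Well_order_antisym[OF r] unfolding underS_def by blast
  ultimately show "underS r b = (\<Union>j\<in>underS r b. underS r j)" by blast
qed

lemma cof_xx_all: "\<exists>U. I \<subseteq> U \<and> xx {} U \<in> S"
proof -
  obtain e :: "nat \<Rightarrow> 's" where e: "inj e" by (rule embed_nat[OF universe])
  \<comment> \<open>At stage \<open>j\<close> only the indices strictly below \<open>j\<close> have
    been replaced, so a largest element of the order would be left over. The copy of the natural
    numbers makes the set infinite, and an infinite cardinal has no largest element.\<close>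
  define r where "r = card_of (I \<union> range e)"
  have inf: "infinite (I \<union> range e)" using e by (simp add: finite_image_iff)
  have Fr: "Field r = I \<union> range e" by (simp add: r_def Field_card_of)
  have r: "Well_order r" unfolding r_def by (rule card_of_Well_order)
  have nomax: "\<exists>b\<in>Field r. a \<in> underS r b" if "a \<in> Field r" for a
    using infinite_Card_order_limit[of r a] that inf Fr card_of_Card_order[of "I \<union> range e"]
    unfolding underS_def r_def[symmetric] by auto
  have lim: "colimit (order_cat (Restr r (underS r b))) M (\<lambda>j. XP (underS r j))
      (\<lambda>(j, k). xx (underS r j) (underS r k)) (XP (underS r b)) (\<lambda>j. xx (underS r j) (underS r b))"
    if b: "limit_elem r b" for b
    by (rule colimit_xx[OF r]) (use underS_limit_elem[OF r b] in \<open>auto intro: underS_Field\<close>)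
  obtain a where a: "bottom_elem r a" using exists_bottom_elem[OF r] inf Fr by (metis finite.emptyI)
  have "small \<kappa> (range e)" by (intro small_image small_nat universe)
  then have sm: "small \<kappa> (Field r)" unfolding Fr using small_Un[OF universe small_I] by blast
  have "transfinite_sequence \<kappa> M r (\<lambda>j. XP (underS r j)) (\<lambda>(j, k). xx (underS r j) (underS r k))"
    unfolding transfinite_sequence_def
    using r sm lim functor_xx[OF r] inf Fr by (auto simp del: infinite_Un finite_Un)
  moreover have "(\<lambda>(j, k). xx (underS r j) (underS r k)) (b, c) \<in> S" if "succ_elem r b c" for b c
    using underS_succ_elem[OF r that] cof_xx_insert by simp
  moreover have "colimit (order_cat r) M (\<lambda>j. XP (underS r j)) (\<lambda>(j, k). xx (underS r j) (underS r k))
      (XP (Field r)) (\<lambda>j. xx (underS r j) (Field r))"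
  proof -
    have "Field r = (\<Union>j\<in>Field r. underS r j)" using nomax by (auto intro: underS_Field)
    moreover have "Field r \<noteq> {}" using inf Fr by (metis finite.emptyI)
    ultimately have "colimit (order_cat (Restr r (Field r))) M (\<lambda>j. XP (underS r j))
        (\<lambda>(j, k). xx (underS r j) (underS r k)) (XP (Field r)) (\<lambda>j. xx (underS r j) (Field r))"
      by (intro colimit_xx[OF r]) auto
    moreover have "Restr r (Field r) = r" by (auto simp: Field_def)
    ultimately show ?thesis by simp
  qed
  ultimately have "xx (underS r a) (Field r) \<in> S"
    using cof_transfinite(2) a XP_good by blast
  then show ?thesis using a Fr by (intro exI[of _ "Field r"]) (auto simp: bottom_elem_def)
qed

text \<open>The given coproducts need not be the chosen ones, so \<open>h\<close> is written as the
  transfinite composite \<open>xx {} U\<close> between two isomorphisms. Since \<open>U\<close>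
  contains \<open>I\<close>, the summands of \<open>XP U\<close> are the codomains of the
  \<open>f i\<close>.\<close>

lemma cof_coproduct:
  assumes P: "coproduct M I (\<lambda>i. Dom M (f i)) P p" and Q: "coproduct M I (\<lambda>i. Cod M (f i)) Q q"
    and h: "h \<in> hom M P Q" "\<And>i. i \<in> I \<Longrightarrow> h \<cdot> p i = q i \<cdot> f i"
  shows "h \<in> S"
proof -
  obtain U where U: "I \<subseteq> U" "xx {} U \<in> S" using cof_xx_all by blast
  have "coproduct M I (F {}) P p" using P by (simp add: F_def[abs_def])
  then obtain a where a: "iso M a" "a \<in> hom M P (XP {})" "\<And>i. i \<in> I \<Longrightarrow> a \<cdot> p i = xp {} i"
    using iso_between_coproducts[OF _ coproduct_XP] by blast
  have "coproduct M I (F U) Q q" using Q U by (subst coproduct_cong[of I _ "\<lambda>i. Cod M (f i)" _ q]) (auto simp: F_def)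
  then obtain b where b: "iso M b" "b \<in> hom M (XP U) Q" "\<And>i. i \<in> I \<Longrightarrow> b \<cdot> xp U i = q i"
    using iso_between_coproducts[OF coproduct_XP] by blast
  have PG: "P \<in> G" using good_coproduct[OF small_I _ P] cof_f cof_Dom by blast
  note X = xx[of "{}" U, OF empty_subsetI]
  note p = coproductD(3)[OF P, unfolded in_hom_iff]
  note q = coproductD(3)[OF Q, unfolded in_hom_iff]
  have "h = b \<cdot> xx {} U \<cdot> a"
  proof (rule coproduct_joint_epi[OF P h(1)])
    show "b \<cdot> xx {} U \<cdot> a \<in> hom M P Q" using a b X by (auto simp: in_hom_iff)
    fix i assume i: "i \<in> I"
    have mi: "m {} U i = f i" using i U by (auto simp: m_def)
    have "(b \<cdot> xx {} U \<cdot> a) \<cdot> p i = b \<cdot> xx {} U \<cdot> xp {} i"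
      using a b X p[OF i] i by (auto simp: in_hom_iff Comp_Comp)
    also have "\<dots> = b \<cdot> xp U i \<cdot> f i" using X(4)[OF i] mi by simp
    also have "\<dots> = q i \<cdot> f i"
      by (rule Comp_eq_Arr) (use b X xp[OF i] i cof_f cof_Arr U in \<open>auto simp: in_hom_iff F_def\<close>)
    finally show "h \<cdot> p i = (b \<cdot> xx {} U \<cdot> a) \<cdot> p i" using h(2)[OF i] by simp
  qed
  moreover have "a \<in> S" "b \<in> S" using cof_iso a b PG XP_good by (auto simp: in_hom_iff)
  ultimately show ?thesis using U a b X by (auto simp: in_hom_iff intro!: cof_Comp)
qed

end

lemma (in left_closed_class) cof_coproduct:
  fixes I :: "'s set"
  assumes "small \<kappa> I" "\<And>i. i \<in> I \<Longrightarrow> f i \<in> S"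
    and "coproduct M I (\<lambda>i. Dom M (f i)) P p" "coproduct M I (\<lambda>i. Cod M (f i)) Q q"
    and "h \<in> hom M P Q" "\<And>i. i \<in> I \<Longrightarrow> h \<cdot> p i = q i \<cdot> f i"
  shows "h \<in> S"
proof -
  interpret coproduct_of_cofibrations M \<kappa> G S I f by unfold_locales (use assms in auto)
  show ?thesis using cof_coproduct assms by blast
qed

section \<open>Enriched diagrams\<close>

context symmetric_monoidal_category
begin

lemma tensor_Obj' [simp]: "K \<in> Obj V \<Longrightarrow> L \<in> Obj V \<Longrightarrow> K \<otimes> L \<in> Obj V"
  by (rule tensor_Obj)

lemma unit_Obj' [simp]: "\<I> \<in> Obj V"
  by (rule unit_Obj)

lemma tensor_typing [simp]:
  assumes "f \<in> Arr V" "g \<in> Arr V"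
  shows "f \<odot> g \<in> Arr V" "Dom V (f \<odot> g) = Dom V f \<otimes> Dom V g" "Cod V (f \<odot> g) = Cod V f \<otimes> Cod V g"
  using tensor_hom[of f "Dom V f" "Cod V f" g "Dom V g" "Cod V g"] assms by (auto simp: in_hom_iff)

lemma assoc_typing [simp]:
  assumes "K \<in> Obj V" "L \<in> Obj V" "N \<in> Obj V"
  shows "assoc V K L N \<in> Arr V" "Dom V (assoc V K L N) = (K \<otimes> L) \<otimes> N"
    "Cod V (assoc V K L N) = K \<otimes> (L \<otimes> N)" "iso V (assoc V K L N)"
  using assoc_hom[OF assms] assoc_iso[OF assms] by (auto simp: in_hom_iff)

lemma unitor_typing [simp]:
  assumes "K \<in> Obj V"
  shows "lunit V K \<in> Arr V" "Dom V (lunit V K) = \<I> \<otimes> K" "Cod V (lunit V K) = K" "iso V (lunit V K)"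
    "runit V K \<in> Arr V" "Dom V (runit V K) = K \<otimes> \<I>" "Cod V (runit V K) = K" "iso V (runit V K)"
  using lunit_hom[OF assms] lunit_iso[OF assms] runit_hom[OF assms] runit_iso[OF assms] by (auto simp: in_hom_iff)

lemma symm_typing [simp]:
  assumes "K \<in> Obj V" "L \<in> Obj V"
  shows "symm V K L \<in> Arr V" "Dom V (symm V K L) = K \<otimes> L" "Cod V (symm V K L) = L \<otimes> K"
  using symm_hom[OF assms] by (auto simp: in_hom_iff)

end

context monoidal_action
begin

abbreviation comp_M (infixr "\<bullet>" 72) where "g \<bullet> f \<equiv> g \<cdot>\<^bsub>M\<^esub> f"
abbreviation whisker_left (infixr "\<rhd>" 76) where "K \<rhd> f \<equiv> Ident V K \<diamondop> f"
abbreviation whisker_right (infixr "\<lhd>" 76) where "k \<lhd> X \<equiv> k \<diamondop> Ident M X"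

lemma act_Obj' [simp]: "K \<in> Obj V \<Longrightarrow> X \<in> Obj M \<Longrightarrow> K \<star> X \<in> Obj M"
  by (rule act_Obj)

lemma act_typing [simp]:
  assumes "k \<in> Arr V" "f \<in> Arr M"
  shows "k \<diamondop> f \<in> Arr M" "Dom M (k \<diamondop> f) = Dom V k \<star> Dom M f" "Cod M (k \<diamondop> f) = Cod V k \<star> Cod M f"
  using act_hom[of k "Dom V k" "Cod V k" f "Dom M f" "Cod M f"] assms by (auto simp: in_hom_iff)

lemma act_interchange:
  assumes "k \<in> Arr V" "k' \<in> Arr V" "f \<in> Arr M" "f' \<in> Arr M" "Dom V k' = Cod V k" "Dom M f' = Cod M f"
  shows "(k' \<diamondop> f') \<bullet> (k \<diamondop> f) = (k' \<cdot>\<^bsub>V\<^esub> k) \<diamondop> (f' \<bullet> f)"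
  using act_Comp[of k "Dom V k" "Cod V k" k' "Cod V k'" f "Dom M f" "Cod M f" f' "Cod M f'"] assms
  by (auto simp: in_hom_iff)

lemma whisker_left_Comp:
  "K \<in> Obj V \<Longrightarrow> f \<in> Arr M \<Longrightarrow> g \<in> Arr M \<Longrightarrow> Dom M g = Cod M f \<Longrightarrow> (K \<rhd> g) \<bullet> (K \<rhd> f) = K \<rhd> (g \<bullet> f)"
  by (simp add: act_interchange)

lemma act_Ident' [simp]: "K \<in> Obj V \<Longrightarrow> X \<in> Obj M \<Longrightarrow> K \<rhd> Ident M X = Ident M (K \<star> X)"
  by (rule act_Ident)

lemma act_assoc_typing [simp]:
  assumes "K \<in> Obj V" "L \<in> Obj V" "X \<in> Obj M"
  shows "act_assoc A K L X \<in> Arr M" "Dom M (act_assoc A K L X) = (K \<otimes>\<^bsub>V\<^esub> L) \<star> X"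
    "Cod M (act_assoc A K L X) = K \<star> L \<star> X" "iso M (act_assoc A K L X)"
  using act_assoc_hom[OF assms] act_assoc_iso[OF assms] by (auto simp: in_hom_iff)

lemma act_unit_typing [simp]:
  assumes "X \<in> Obj M"
  shows "act_unit A X \<in> Arr M" "Dom M (act_unit A X) = \<I>\<^bsub>V\<^esub> \<star> X" "Cod M (act_unit A X) = X" "iso M (act_unit A X)"
  using act_unit_hom[OF assms] act_unit_iso[OF assms] by (auto simp: in_hom_iff)

lemma act_assoc_nat:
  assumes "k \<in> Arr V" "l \<in> Arr V" "f \<in> Arr M" "K = Dom V k" "L = Dom V l" "X = Dom M f"
    "K' = Cod V k" "L' = Cod V l" "X' = Cod M f"
  shows "act_assoc A K' L' X' \<bullet> ((k \<odot>\<^bsub>V\<^esub> l) \<diamondop> f) = (k \<diamondop> l \<diamondop> f) \<bullet> act_assoc A K L X"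
  by (rule act_assoc_natural) (use assms in \<open>auto simp: in_hom_iff\<close>)

lemma act_unit_nat:
  assumes "f \<in> Arr M" "X = Dom M f" "X' = Cod M f"
  shows "act_unit A X' \<bullet> (\<I>\<^bsub>V\<^esub> \<rhd> f) = f \<bullet> act_unit A X"
  by (rule act_unit_natural) (use assms in \<open>auto simp: in_hom_iff\<close>)

end

section \<open>The category of diagrams\<close>

locale enriched_diagrams = monoidal_action V M A + enriched_category V C
  for V :: "('vo, 'va, 'x) moncat_scheme" and M :: "('o, 'a, 'y) cat_scheme"
    and A :: "('vo, 'va, 'o, 'a) action" (structure) and C :: "('c, 'vo, 'va) ecat"
begin

abbreviation "D \<equiv> diagram_cat V M A C"
abbreviation "H \<equiv> EHom C"

lemma EHom_Obj' [simp]: "c \<in> EObj C \<Longrightarrow> d \<in> EObj C \<Longrightarrow> H c d \<in> Obj V"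
  by (rule EHom_Obj)

lemma EIdent_typing [simp]:
  assumes "c \<in> EObj C"
  shows "EIdent C c \<in> Arr V" "Dom V (EIdent C c) = \<I>\<^bsub>V\<^esub>" "Cod V (EIdent C c) = H c c"
  using EIdent_hom[OF assms] by (auto simp: in_hom_iff)

lemma EComp_typing [simp]:
  assumes "b \<in> EObj C" "c \<in> EObj C" "d \<in> EObj C"
  shows "EComp C b c d \<in> Arr V" "Dom V (EComp C b c d) = H c d \<otimes>\<^bsub>V\<^esub> H b c" "Cod V (EComp C b c d) = H b d"
  using EComp_hom[OF assms] by (auto simp: in_hom_iff)

lemma D_simps:
  "Obj D = {X. diagram V M A C X}" "Arr D = {f. diagram_map V M A C f}" "Dom D = ddom" "Cod D = dcod"
  "Ident D X = \<lparr>ddom = X, dcod = X, dmap = (\<lambda>c\<in>EObj C. Ident M (dobj X c))\<rparr>"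
  "Comp D g f = \<lparr>ddom = ddom f, dcod = dcod g, dmap = (\<lambda>c\<in>EObj C. dmap g c \<bullet> dmap f c)\<rparr>"
  by (auto simp: diagram_cat_def)

lemma Dom_D [simp]: "Dom D = ddom" and Cod_D [simp]: "Cod D = dcod"
  by (auto simp: D_simps)

lemma dmap_Ident [simp]: "c \<in> EObj C \<Longrightarrow> dmap (Ident D X) c = Ident M (dobj X c)"
  by (simp add: D_simps)

lemma dmap_Comp [simp]: "c \<in> EObj C \<Longrightarrow> dmap (g \<cdot>\<^bsub>D\<^esub> f) c = dmap g c \<bullet> dmap f c"
  by (simp add: D_simps)

lemma diagramD:
  assumes "X \<in> Obj D" "c \<in> EObj C"
  shows "dobj X c \<in> Obj M" "d \<in> EObj C \<Longrightarrow> dact X (c, d) \<in> Arr M"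
    "d \<in> EObj C \<Longrightarrow> Dom M (dact X (c, d)) = H c d \<star> dobj X c"
    "d \<in> EObj C \<Longrightarrow> Cod M (dact X (c, d)) = dobj X d"
    "d \<in> EObj C \<Longrightarrow> e \<in> EObj C \<Longrightarrow> dact X (c, e) \<bullet> (EComp C c d e \<lhd> dobj X c) =
       dact X (d, e) \<bullet> (H d e \<rhd> dact X (c, d)) \<bullet> act_assoc A (H d e) (H c d) (dobj X c)"
    "dact X (c, c) \<bullet> (EIdent C c \<lhd> dobj X c) = act_unit A (dobj X c)"
proof -
  have X: "diagram V M A C X" using assms(1) by (simp add: D_simps)
  have 1: "\<forall>c\<in>EObj C. dobj X c \<in> Obj M" using X unfolding diagram_def by (elim conjE)
  have 2: "\<forall>c\<in>EObj C. \<forall>d\<in>EObj C. dact X (c, d) \<in> hom M (H c d \<star> dobj X c) (dobj X d)"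
    using X unfolding diagram_def by (elim conjE)
  have 3: "\<forall>b\<in>EObj C. \<forall>c\<in>EObj C. \<forall>d\<in>EObj C. dact X (b, d) \<bullet> (EComp C b c d \<lhd> dobj X b) =
       dact X (c, d) \<bullet> (H c d \<rhd> dact X (b, c)) \<bullet> act_assoc A (H c d) (H b c) (dobj X b)"
    using X unfolding diagram_def by (elim conjE)
  have 4: "\<forall>c\<in>EObj C. dact X (c, c) \<bullet> (EIdent C c \<lhd> dobj X c) = act_unit A (dobj X c)"
    using X unfolding diagram_def by (elim conjE)
  show "dobj X c \<in> Obj M" using 1 assms(2) by blast
  show "d \<in> EObj C \<Longrightarrow> dact X (c, d) \<in> Arr M"
    "d \<in> EObj C \<Longrightarrow> Dom M (dact X (c, d)) = H c d \<star> dobj X c"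
    "d \<in> EObj C \<Longrightarrow> Cod M (dact X (c, d)) = dobj X d"
    using 2 assms(2) unfolding in_hom_iff by blast+
  show "d \<in> EObj C \<Longrightarrow> e \<in> EObj C \<Longrightarrow> dact X (c, e) \<bullet> (EComp C c d e \<lhd> dobj X c) =
       dact X (d, e) \<bullet> (H d e \<rhd> dact X (c, d)) \<bullet> act_assoc A (H d e) (H c d) (dobj X c)"
    using 3 assms(2) by blast
  show "dact X (c, c) \<bullet> (EIdent C c \<lhd> dobj X c) = act_unit A (dobj X c)"
    using 4 assms(2) by blast
qed

lemmas diagram_typing [simp] = diagramD(1-4)

lemma diagram_mapD:
  assumes "f \<in> Arr D"
  shows "ddom f \<in> Obj D" "dcod f \<in> Obj D" "c \<in> EObj C \<Longrightarrow> dmap f c \<in> Arr M"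
    "c \<in> EObj C \<Longrightarrow> Dom M (dmap f c) = dobj (ddom f) c"
    "c \<in> EObj C \<Longrightarrow> Cod M (dmap f c) = dobj (dcod f) c"
    "c \<in> EObj C \<Longrightarrow> d \<in> EObj C \<Longrightarrow>
      dmap f d \<bullet> dact (ddom f) (c, d) = dact (dcod f) (c, d) \<bullet> (H c d \<rhd> dmap f c)"
proof -
  have f: "diagram_map V M A C f" using assms by (simp add: D_simps)
  have 1: "diagram V M A C (ddom f)" "diagram V M A C (dcod f)"
    using f unfolding diagram_map_def by blast+
  have 2: "\<forall>c\<in>EObj C. dmap f c \<in> hom M (dobj (ddom f) c) (dobj (dcod f) c)"
    using f unfolding diagram_map_def by (elim conjE)
  have 3: "\<forall>c\<in>EObj C. \<forall>d\<in>EObj C. dmap f d \<bullet> dact (ddom f) (c, d) = dact (dcod f) (c, d) \<bullet> (H c d \<rhd> dmap f c)"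
    using f unfolding diagram_map_def by (elim conjE)
  show "ddom f \<in> Obj D" "dcod f \<in> Obj D" using 1 by (simp_all add: D_simps)
  show "c \<in> EObj C \<Longrightarrow> dmap f c \<in> Arr M" "c \<in> EObj C \<Longrightarrow> Dom M (dmap f c) = dobj (ddom f) c"
    "c \<in> EObj C \<Longrightarrow> Cod M (dmap f c) = dobj (dcod f) c"
    using 2 unfolding in_hom_iff by blast+
  show "c \<in> EObj C \<Longrightarrow> d \<in> EObj C \<Longrightarrow>
      dmap f d \<bullet> dact (ddom f) (c, d) = dact (dcod f) (c, d) \<bullet> (H c d \<rhd> dmap f c)"
    using 3 by blast
qed

lemmas diagram_map_typing [simp] = diagram_mapD(1-5)

lemma diagramI:
  assumes "\<And>c. c \<in> EObj C \<Longrightarrow> x c \<in> Obj M"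
    and "\<And>c d. c \<in> EObj C \<Longrightarrow> d \<in> EObj C \<Longrightarrow> a c d \<in> hom M (H c d \<star> x c) (x d)"
    and "\<And>b c d. b \<in> EObj C \<Longrightarrow> c \<in> EObj C \<Longrightarrow> d \<in> EObj C \<Longrightarrow> a b d \<bullet> (EComp C b c d \<lhd> x b) =
       a c d \<bullet> (H c d \<rhd> a b c) \<bullet> act_assoc A (H c d) (H b c) (x b)"
    and "\<And>c. c \<in> EObj C \<Longrightarrow> a c c \<bullet> (EIdent C c \<lhd> x c) = act_unit A (x c)"
  shows "\<lparr>dobj = (\<lambda>c\<in>EObj C. x c), dact = (\<lambda>(c, d)\<in>EObj C \<times> EObj C. a c d)\<rparr> \<in> Obj D"
  unfolding D_simps mem_Collect_eq diagram_def
  by (intro conjI ballI) (simp_all add: assms(1,2), simp_all only: assms(3,4))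

lemma diagram_mapI:
  assumes "X \<in> Obj D" "Y \<in> Obj D"
    and "\<And>c. c \<in> EObj C \<Longrightarrow> f c \<in> hom M (dobj X c) (dobj Y c)"
    and "\<And>c d. c \<in> EObj C \<Longrightarrow> d \<in> EObj C \<Longrightarrow> f d \<bullet> dact X (c, d) = dact Y (c, d) \<bullet> (H c d \<rhd> f c)"
  shows "\<lparr>ddom = X, dcod = Y, dmap = (\<lambda>c\<in>EObj C. f c)\<rparr> \<in> hom D X Y"
  using assms(1-3) unfolding D_simps diagram_map_def in_hom_iff mem_Collect_eq
  by (simp add: assms(4))

text \<open>The families are extensional on \<open>EObj C\<close>, so agreement at the objects of
  \<open>C\<close> suffices. Identities between maps of diagrams are thereby reduced to identities
  in \<open>M\<close>.\<close>

lemma diagram_map_eqI: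
  assumes "f \<in> Arr D" "g \<in> Arr D" "ddom f = ddom g" "dcod f = dcod g"
    and "\<And>c. c \<in> EObj C \<Longrightarrow> dmap f c = dmap g c"
  shows "f = g"
proof -
  have "dmap f = dmap g"
    by (rule extensionalityI[of _ "EObj C"]) (use assms in \<open>auto simp: D_simps diagram_map_def\<close>)
  then show ?thesis using assms by (intro diag_map.equality) auto
qed

lemma Ident_D: "X \<in> Obj D \<Longrightarrow> Ident D X \<in> hom D X X"
  unfolding D_simps(5) by (rule diagram_mapI) (auto simp: in_hom_iff)

lemma Comp_D:
  assumes "f \<in> hom D X Y" "g \<in> hom D Y Z"
  shows "g \<cdot>\<^bsub>D\<^esub> f \<in> hom D X Z"
proof -
  have f: "f \<in> Arr D" "ddom f = X" "dcod f = Y" and g: "g \<in> Arr D" "ddom g = Y" "dcod g = Z"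
    using assms by (auto simp: in_hom_iff)
  have XYZ: "X \<in> Obj D" "Y \<in> Obj D" "Z \<in> Obj D"
    using diagram_mapD(1,2)[OF f(1)] diagram_mapD(1,2)[OF g(1)] f g by auto
  have "(dmap g d \<bullet> dmap f d) \<bullet> dact X (c, d) = dact Z (c, d) \<bullet> (H c d \<rhd> (dmap g c \<bullet> dmap f c))"
    if c: "c \<in> EObj C" and d: "d \<in> EObj C" for c d
  proof -
    have "(dmap g d \<bullet> dmap f d) \<bullet> dact X (c, d) = dmap g d \<bullet> dmap f d \<bullet> dact X (c, d)"
      using XYZ f g c d by (simp add: M.Comp_Comp)
    also have "\<dots> = dmap g d \<bullet> dact Y (c, d) \<bullet> (H c d \<rhd> dmap f c)"
      using diagram_mapD(6)[OF f(1) c d] f by simp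
    also have "\<dots> = dact Z (c, d) \<bullet> (H c d \<rhd> dmap g c) \<bullet> (H c d \<rhd> dmap f c)"
      using diagram_mapD(6)[OF g(1) c d] f g XYZ c d by (intro M.Comp_eq_Comp) auto
    finally show ?thesis using f g c d by (simp add: whisker_left_Comp)
  qed
  then have "\<lparr>ddom = X, dcod = Z, dmap = (\<lambda>c\<in>EObj C. dmap g c \<bullet> dmap f c)\<rparr> \<in> hom D X Z"
    using f g XYZ by (intro diagram_mapI) (auto simp: in_hom_iff)
  then show ?thesis using f g by (simp add: D_simps)
qed

lemma category_D: "category D"
proof
  fix f g h W X Y Z
  show "f \<in> Arr D \<Longrightarrow> Dom D f \<in> Obj D" "f \<in> Arr D \<Longrightarrow> Cod D f \<in> Obj D" by auto
  show "X \<in> Obj D \<Longrightarrow> Ident D X \<in> hom D X X" by (rule Ident_D)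
  show "f \<in> hom D X Y \<Longrightarrow> g \<in> hom D Y Z \<Longrightarrow> g \<cdot>\<^bsub>D\<^esub> f \<in> hom D X Z" by (rule Comp_D)
  show "f \<cdot>\<^bsub>D\<^esub> Ident D X = f" if f: "f \<in> hom D X Y"
  proof -
    have "X \<in> Obj D" using f diagram_mapD(1)[of f] by (auto simp: in_hom_iff)
    then show ?thesis using Comp_D[OF Ident_D f] f
      by (intro diagram_map_eqI) (auto simp: in_hom_iff)
  qed
  show "Ident D Y \<cdot>\<^bsub>D\<^esub> f = f" if f: "f \<in> hom D X Y"
  proof -
    have "Y \<in> Obj D" using f diagram_mapD(2)[of f] by (auto simp: in_hom_iff)
    then show ?thesis using Comp_D[OF f Ident_D] f
      by (intro diagram_map_eqI) (auto simp: in_hom_iff)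
  qed
  show "(h \<cdot>\<^bsub>D\<^esub> g) \<cdot>\<^bsub>D\<^esub> f = h \<cdot>\<^bsub>D\<^esub> g \<cdot>\<^bsub>D\<^esub> f"
    if f: "f \<in> hom D W X" and g: "g \<in> hom D X Y" and h: "h \<in> hom D Y Z"
  proof (rule diagram_map_eqI)
    show "dmap ((h \<cdot>\<^bsub>D\<^esub> g) \<cdot>\<^bsub>D\<^esub> f) c = dmap (h \<cdot>\<^bsub>D\<^esub> g \<cdot>\<^bsub>D\<^esub> f) c" if "c \<in> EObj C" for c
      using f g h that by (auto simp: in_hom_iff M.Comp_Comp)
  qed (use Comp_D[OF f Comp_D[OF g h]] Comp_D[OF Comp_D[OF f g] h] in \<open>auto simp: in_hom_iff\<close>)
qed

sublocale D: category D
  by (rule category_D)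

lemma ddom_Comp [simp]: "f \<in> Arr D \<Longrightarrow> g \<in> Arr D \<Longrightarrow> ddom g = dcod f \<Longrightarrow> ddom (g \<cdot>\<^bsub>D\<^esub> f) = ddom f"
  and dcod_Comp [simp]: "f \<in> Arr D \<Longrightarrow> g \<in> Arr D \<Longrightarrow> ddom g = dcod f \<Longrightarrow> dcod (g \<cdot>\<^bsub>D\<^esub> f) = dcod g"
  and Arr_Comp_D [simp]: "f \<in> Arr D \<Longrightarrow> g \<in> Arr D \<Longrightarrow> ddom g = dcod f \<Longrightarrow> g \<cdot>\<^bsub>D\<^esub> f \<in> Arr D"
  using D.Dom_Comp[of f g] D.Cod_Comp[of f g] D.Arr_Comp[of f g] by auto

lemma ddom_Ident [simp]: "ddom (Ident D X) = X"
  and dcod_Ident [simp]: "dcod (Ident D X) = X"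
  by (auto simp: D_simps)

lemma iso_pointwise:
  assumes "iso D f" "c \<in> EObj C"
  shows "iso M (dmap f c)"
proof (rule M.isoI)
  let ?g = "inverse_of D f"
  note f = D.iso_Arr[OF assms(1)]
  have g: "?g \<in> Arr D" "ddom ?g = dcod f" "dcod ?g = ddom f"
    using D.Arr_inverse_of[OF assms(1)] D.Dom_inverse_of[OF assms(1)] D.Cod_inverse_of[OF assms(1)] by auto
  have e: "dmap (?g \<cdot>\<^bsub>D\<^esub> f) c = Ident M (dobj (ddom f) c)" "dmap (f \<cdot>\<^bsub>D\<^esub> ?g) c = Ident M (dobj (dcod f) c)"
    using assms by (simp_all add: D.inverse_of_Comp D.Comp_inverse_of)
  show "dmap f c \<in> Arr M" "dmap ?g c \<in> Arr M" "Dom M (dmap ?g c) = Cod M (dmap f c)"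
    "Cod M (dmap ?g c) = Dom M (dmap f c)" "dmap ?g c \<bullet> dmap f c = Ident M (Dom M (dmap f c))"
    "dmap f c \<bullet> dmap ?g c = Ident M (Cod M (dmap f c))"
    using f g e assms(2) by auto
qed

text \<open>The pointwise inverses form a map of diagrams: the naturality square at
  \<open>(c, d)\<close> may be tested after composition with the isomorphism at
  \<open>d\<close>.\<close>

lemma isoI_pointwise:
  assumes f: "f \<in> Arr D" and iso: "\<And>c. c \<in> EObj C \<Longrightarrow> iso M (dmap f c)"
  shows "iso D f"
proof -
  let ?X = "ddom f" and ?Y = "dcod f"
  let ?g = "\<lparr>ddom = ?Y, dcod = ?X, dmap = (\<lambda>c\<in>EObj C. inverse_of M (dmap f c))\<rparr>"
  have "inverse_of M (dmap f d) \<bullet> dact ?Y (c, d) = dact ?X (c, d) \<bullet> (H c d \<rhd> inverse_of M (dmap f c))"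
    if c: "c \<in> EObj C" and d: "d \<in> EObj C" for c d
  proof (rule M.iso_cancel_left[OF iso[OF d]])
    have e: "(H c d \<rhd> dmap f c) \<bullet> (H c d \<rhd> inverse_of M (dmap f c)) = Ident M (H c d \<star> dobj ?Y c)"
      using f c d iso[OF c] by (simp add: whisker_left_Comp)
    have "dmap f d \<bullet> dact ?X (c, d) \<bullet> (H c d \<rhd> inverse_of M (dmap f c)) =
        dact ?Y (c, d) \<bullet> (H c d \<rhd> dmap f c) \<bullet> (H c d \<rhd> inverse_of M (dmap f c))"
      using f c d iso[OF c] diagram_mapD(6)[OF f c d] by (intro M.Comp_eq_Comp) auto
    also have "\<dots> = dact ?Y (c, d)" using e f c d by simp
    finally show "dmap f d \<bullet> inverse_of M (dmap f d) \<bullet> dact ?Y (c, d) =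
      dmap f d \<bullet> dact ?X (c, d) \<bullet> (H c d \<rhd> inverse_of M (dmap f c))"
      using f c d iso[OF d] by simp
  qed (use f c d iso[OF c] iso[OF d] in auto)
  then have g: "?g \<in> hom D ?Y ?X"
    using f iso by (intro diagram_mapI) (auto simp: in_hom_iff)
  show ?thesis
  proof (rule D.isoI[OF f, of ?g])
    show "?g \<in> Arr D" "Dom D ?g = Cod D f" "Cod D ?g = Dom D f" using g by (auto simp: in_hom_iff)
    show "?g \<cdot>\<^bsub>D\<^esub> f = Ident D (Dom D f)"
      by (rule diagram_map_eqI) (use f g iso in \<open>auto simp: in_hom_iff\<close>)
    show "f \<cdot>\<^bsub>D\<^esub> ?g = Ident D (Cod D f)"
      by (rule diagram_map_eqI) (use f g iso in \<open>auto simp: in_hom_iff\<close>)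
  qed
qed

lemma eval_functor:
  assumes "is_functor J D Fo Fa" "c \<in> EObj C"
  shows "is_functor J M (\<lambda>j. dobj (Fo j) c) (\<lambda>u. dmap (Fa u) c)"
proof -
  have 1: "Fo j \<in> Obj D" "Fa (Ident J j) = Ident D (Fo j)" if "j \<in> Obj J" for j
    using assms(1) that unfolding is_functor_def by blast+
  have 2: "Fa u \<in> hom D (Fo (Dom J u)) (Fo (Cod J u))" if "u \<in> Arr J" for u
    using assms(1) that unfolding is_functor_def by blast
  have 3: "Fa (v \<cdot>\<^bsub>J\<^esub> u) = Fa v \<cdot>\<^bsub>D\<^esub> Fa u" if "u \<in> Arr J" "v \<in> Arr J" "Dom J v = Cod J u" for u v
    using assms(1) that unfolding is_functor_def by blast
  show ?thesis using assms(2) 1 2 3 by (auto simp: is_functor_def in_hom_iff)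
qed

lemma eval_cocone:
  assumes "cocone J D Fo Fa Z t" "c \<in> EObj C"
  shows "cocone J M (\<lambda>j. dobj (Fo j) c) (\<lambda>u. dmap (Fa u) c) (dobj Z c) (\<lambda>j. dmap (t j) c)"
proof -
  have "dmap (t (Cod J u)) c \<bullet> dmap (Fa u) c = dmap (t (Dom J u)) c" if "u \<in> Arr J" for u
    using assms that dmap_Comp[OF assms(2), of "t (Cod J u)" "Fa u"] by (simp add: cocone_def)
  then show ?thesis using assms by (auto simp: cocone_def in_hom_iff)
qed

end

section \<open>Pointwise colimits\<close>

locale cocontinuous_diagrams = enriched_diagrams V M A C
  for V :: "('vo, 'va, 'x) moncat_scheme" and M :: "('o, 'a, 'y) cat_scheme"
    and A :: "('vo, 'va, 'o, 'a) action" (structure) and C :: "('c, 'vo, 'va) ecat" +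
  fixes \<kappa> :: "'s rel"
  assumes universe_\<kappa>: "universe_cardinal \<kappa>" and preserves: "action_preserves_colimits \<kappa> V M A"
begin

lemma act_colimit:
  assumes "small_category \<kappa> J" "colimit J M Fo Fa Z t" "K \<in> Obj V"
  shows "colimit J M (\<lambda>j. K \<star> Fo j) (\<lambda>u. K \<rhd> Fa u) (K \<star> Z) (\<lambda>j. K \<rhd> t j)"
proof (rule preserves_colimitsD[where \<kappa> = \<kappa> and C = M, OF _ _ assms(1,2)])
  show "preserves_colimits \<kappa> M M (\<lambda>X. K \<star> X) (\<lambda>f. K \<rhd> f)"
    using preserves assms(3) unfolding action_preserves_colimits_def by blast
  show "Card_order \<kappa>" using universe_\<kappa> unfolding universe_cardinal_def by blast
qed

text \<open>Since \<open>K \<star> -\<close> preserves the colimit, maps out of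
  \<open>K \<star> Z\<close> can be compared stage by stage. In this way the axioms for the
  structure maps of a colimit are inherited from the diagrams in it.\<close>

lemma act_joint_epi:
  assumes "small_category \<kappa> J" "colimit J M Fo Fa Z t" "K \<in> Obj V"
    and "f \<in> hom M (K \<star> Z) Y" "g \<in> hom M (K \<star> Z) Y"
    and "\<And>j. j \<in> Obj J \<Longrightarrow> f \<bullet> (K \<rhd> t j) = g \<bullet> (K \<rhd> t j)"
  shows "f = g"
  using M.colimit_joint_epi[OF _ act_colimit[OF assms(1-3)] assms(4,5)] assms(1,6)
  by (auto simp: small_category_def)

end

text \<open>A colimit in \<open>M\<close> is fixed for every \<open>c\<close>. The structure maps
  between these objects are then forced by the universal properties, and the whole is a colimit of
  diagrams.\<close>

locale pointwise_colimits = cocontinuous_diagrams V M A C \<kappa>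
  for V :: "('vo, 'va, 'x) moncat_scheme" and M :: "('o, 'a, 'y) cat_scheme"
    and A :: "('vo, 'va, 'o, 'a) action" (structure) and C :: "('c, 'vo, 'va) ecat" and \<kappa> :: "'s rel" +
  fixes J :: "('j, 'u, 'z) cat_scheme" and Fo :: "'j \<Rightarrow> ('c, 'o, 'a) diag" and Fa :: "'u \<Rightarrow> ('c, 'o, 'a) diag_map"
    and Z :: "'c \<Rightarrow> 'o" and t :: "'c \<Rightarrow> 'j \<Rightarrow> 'a"
  assumes small_J: "small_category \<kappa> J" and F_functor: "is_functor J D Fo Fa"
    and colim: "\<And>c. c \<in> EObj C \<Longrightarrow> colimit J M (\<lambda>j. dobj (Fo j) c) (\<lambda>u. dmap (Fa u) c) (Z c) (t c)"
begin

lemma category_J: "category J"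
  using small_J by (simp add: small_category_def)

lemma Fo_D [simp]: "j \<in> Obj J \<Longrightarrow> Fo j \<in> Obj D"
  using F_functor unfolding is_functor_def by blast

lemma Fa_D [simp]:
  assumes "u \<in> Arr J"
  shows "Fa u \<in> Arr D" "ddom (Fa u) = Fo (Dom J u)" "dcod (Fa u) = Fo (Cod J u)"
  using F_functor assms unfolding is_functor_def in_hom_iff Dom_D Cod_D by blast+

lemma Z [simp]: "c \<in> EObj C \<Longrightarrow> Z c \<in> Obj M"
  using M.colimit_Obj[OF colim] .

lemma t [simp]:
  assumes "c \<in> EObj C" "j \<in> Obj J"
  shows "t c j \<in> Arr M" "Dom M (t c j) = dobj (Fo j) c" "Cod M (t c j) = Z c"
  using M.colimit_leg[OF colim[OF assms(1)] assms(2)] by (auto simp: in_hom_iff)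

lemma t_Fa: "c \<in> EObj C \<Longrightarrow> u \<in> Arr J \<Longrightarrow> t c (Cod J u) \<bullet> dmap (Fa u) c = t c (Dom J u)"
  using M.colimit_cocone[OF colim] by (simp add: cocone_def)

lemma joint_epi:
  assumes "c \<in> EObj C" "K \<in> Obj V" "f \<in> hom M (K \<star> Z c) Y" "g \<in> hom M (K \<star> Z c) Y"
    and "\<And>j. j \<in> Obj J \<Longrightarrow> f \<bullet> (K \<rhd> t c j) = g \<bullet> (K \<rhd> t c j)"
  shows "f = g"
  by (rule act_joint_epi[OF small_J colim]) (use assms in auto)

text \<open>The object \<open>C(c, d) \<star> Z c\<close> is the colimit of the objects
  \<open>C(c, d) \<star> Fo j c\<close>. The structure maps of the diagrams \<open>Fo j\<close>,
  followed by \<open>t d j\<close>, form a cocone on them because the \<open>Fa u\<close> are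
  natural.\<close>

lemma structure_map_exists:
  assumes c: "c \<in> EObj C" and d: "d \<in> EObj C"
  shows "\<exists>a. a \<in> hom M (H c d \<star> Z c) (Z d) \<and>
    (\<forall>j\<in>Obj J. a \<bullet> (H c d \<rhd> t c j) = t d j \<bullet> dact (Fo j) (c, d))"
proof -
  interpret J: category J by (rule category_J)
  have "t d (Cod J u) \<bullet> dact (Fo (Cod J u)) (c, d) \<bullet> (H c d \<rhd> dmap (Fa u) c) =
      t d (Dom J u) \<bullet> dact (Fo (Dom J u)) (c, d)" if u: "u \<in> Arr J" for u
  proof -
    have "t d (Cod J u) \<bullet> dact (Fo (Cod J u)) (c, d) \<bullet> (H c d \<rhd> dmap (Fa u) c) =
        t d (Cod J u) \<bullet> dmap (Fa u) d \<bullet> dact (Fo (Dom J u)) (c, d)"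
      using diagram_mapD(6)[of "Fa u" c d] u c d by simp
    also have "\<dots> = t d (Dom J u) \<bullet> dact (Fo (Dom J u)) (c, d)"
      by (rule M.Comp_eq_Arr) (use u c d t_Fa[OF d u] in auto)
    finally show ?thesis .
  qed
  then have "cocone J M (\<lambda>j. H c d \<star> dobj (Fo j) c) (\<lambda>u. H c d \<rhd> dmap (Fa u) c) (Z d)
      (\<lambda>j. t d j \<bullet> dact (Fo j) (c, d))"
    using c d by (auto simp: cocone_def in_hom_iff M.Comp_Comp)
  from M.colimit_induced[OF act_colimit[OF small_J colim[OF c] EHom_Obj'[OF c d]] this]
  show ?thesis by metis
qed

definition a where "a c d = (SOME a. a \<in> hom M (H c d \<star> Z c) (Z d) \<and>
    (\<forall>j\<in>Obj J. a \<bullet> (H c d \<rhd> t c j) = t d j \<bullet> dact (Fo j) (c, d)))"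

lemma a:
  assumes "c \<in> EObj C" "d \<in> EObj C"
  shows "a c d \<in> Arr M" "Dom M (a c d) = H c d \<star> Z c" "Cod M (a c d) = Z d"
    "j \<in> Obj J \<Longrightarrow> a c d \<bullet> (H c d \<rhd> t c j) = t d j \<bullet> dact (Fo j) (c, d)"
  using someI_ex[OF structure_map_exists[OF assms], folded a_def] by (auto simp: in_hom_iff)

lemmas a_typing [simp] = a(1-3)

lemma a_assoc:
  assumes b: "b \<in> EObj C" and c: "c \<in> EObj C" and d: "d \<in> EObj C"
  shows "a b d \<bullet> (EComp C b c d \<lhd> Z b) = a c d \<bullet> (H c d \<rhd> a b c) \<bullet> act_assoc A (H c d) (H b c) (Z b)"
\<comment> \<open>Both sides are brought to the source
  \<open>(C(c, d) \<otimes> C(b, c)) \<star> Z b\<close>, so the colimit is tested after acting with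
  the tensor product of the two hom-objects.\<close>
proof (rule joint_epi[OF b, where K = "H c d \<otimes>\<^bsub>V\<^esub> H b c" and Y = "Z d"])
  fix j assume j: "j \<in> Obj J"
  note X = Fo_D[OF j]
  have "(a b d \<bullet> (EComp C b c d \<lhd> Z b)) \<bullet> ((H c d \<otimes>\<^bsub>V\<^esub> H b c) \<rhd> t b j) =
      a b d \<bullet> (H b d \<rhd> t b j) \<bullet> (EComp C b c d \<lhd> dobj (Fo j) b)"
    using b c d j X by (simp add: M.Comp_Comp act_interchange)
  also have "\<dots> = t d j \<bullet> dact (Fo j) (b, d) \<bullet> (EComp C b c d \<lhd> dobj (Fo j) b)"
    by (rule M.Comp_eq_Comp[OF a(4)[OF b d j]]) (use b c d j X in auto)
  also have "\<dots> = t d j \<bullet> dact (Fo j) (c, d) \<bullet> (H c d \<rhd> dact (Fo j) (b, c)) \<bullet>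
      act_assoc A (H c d) (H b c) (dobj (Fo j) b)"
    using diagramD(5)[OF X b c d] by simp
  also have "\<dots> = a c d \<bullet> (H c d \<rhd> t c j) \<bullet> (H c d \<rhd> dact (Fo j) (b, c)) \<bullet>
      act_assoc A (H c d) (H b c) (dobj (Fo j) b)"
    by (rule M.Comp_eq_Comp[OF a(4)[OF c d j, symmetric]]) (use b c d j X in auto)
  also have "(H c d \<rhd> t c j) \<bullet> (H c d \<rhd> dact (Fo j) (b, c)) \<bullet> act_assoc A (H c d) (H b c) (dobj (Fo j) b) =
      (H c d \<rhd> a b c) \<bullet> (H c d \<rhd> H b c \<rhd> t b j) \<bullet> act_assoc A (H c d) (H b c) (dobj (Fo j) b)"
    by (rule M.Comp_eq_Comp) (use b c d j X a(4)[OF b c j] in \<open>auto simp: whisker_left_Comp\<close>)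
  also have "(H c d \<rhd> H b c \<rhd> t b j) \<bullet> act_assoc A (H c d) (H b c) (dobj (Fo j) b) =
      act_assoc A (H c d) (H b c) (Z b) \<bullet> ((H c d \<otimes>\<^bsub>V\<^esub> H b c) \<rhd> t b j)"
    using b c d j X act_assoc_nat[of "Ident V (H c d)" "Ident V (H b c)" "t b j" "H c d" "H b c"
        "dobj (Fo j) b" "H c d" "H b c" "Z b"] by (simp add: V.tensor_Ident)
  finally show "(a b d \<bullet> (EComp C b c d \<lhd> Z b)) \<bullet> ((H c d \<otimes>\<^bsub>V\<^esub> H b c) \<rhd> t b j) =
      (a c d \<bullet> (H c d \<rhd> a b c) \<bullet> act_assoc A (H c d) (H b c) (Z b)) \<bullet> ((H c d \<otimes>\<^bsub>V\<^esub> H b c) \<rhd> t b j)"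
    using b c d j X by (simp add: M.Comp_Comp)
qed (use b c d in \<open>auto simp: in_hom_iff\<close>)

lemma a_unit:
  assumes c: "c \<in> EObj C"
  shows "a c c \<bullet> (EIdent C c \<lhd> Z c) = act_unit A (Z c)"
proof (rule joint_epi[OF c, where K = "\<I>\<^bsub>V\<^esub>" and Y = "Z c"])
  fix j assume j: "j \<in> Obj J"
  note X = Fo_D[OF j]
  have "(a c c \<bullet> (EIdent C c \<lhd> Z c)) \<bullet> (\<I>\<^bsub>V\<^esub> \<rhd> t c j) =
      a c c \<bullet> (H c c \<rhd> t c j) \<bullet> (EIdent C c \<lhd> dobj (Fo j) c)"
    using c j X by (simp add: M.Comp_Comp act_interchange)
  also have "\<dots> = t c j \<bullet> dact (Fo j) (c, c) \<bullet> (EIdent C c \<lhd> dobj (Fo j) c)"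
    by (rule M.Comp_eq_Comp[OF a(4)[OF c c j]]) (use c j X in auto)
  also have "\<dots> = t c j \<bullet> act_unit A (dobj (Fo j) c)" using diagramD(6)[OF X c] by simp
  also have "\<dots> = act_unit A (Z c) \<bullet> (\<I>\<^bsub>V\<^esub> \<rhd> t c j)"
    using c j act_unit_nat[of "t c j" "dobj (Fo j) c" "Z c"] by simp
  finally show "(a c c \<bullet> (EIdent C c \<lhd> Z c)) \<bullet> (\<I>\<^bsub>V\<^esub> \<rhd> t c j) = act_unit A (Z c) \<bullet> (\<I>\<^bsub>V\<^esub> \<rhd> t c j)" .
qed (use c in \<open>auto simp: in_hom_iff\<close>)

definition ZD where "ZD = \<lparr>dobj = (\<lambda>c\<in>EObj C. Z c), dact = (\<lambda>(c, d)\<in>EObj C \<times> EObj C. a c d)\<rparr>"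

definition tD where "tD j = \<lparr>ddom = Fo j, dcod = ZD, dmap = (\<lambda>c\<in>EObj C. t c j)\<rparr>"

lemma ZD: "ZD \<in> Obj D"
  unfolding ZD_def by (rule diagramI) (use a_assoc a_unit in \<open>auto simp: in_hom_iff\<close>)

lemma dobj_ZD [simp]: "c \<in> EObj C \<Longrightarrow> dobj ZD c = Z c"
  and dact_ZD [simp]: "c \<in> EObj C \<Longrightarrow> d \<in> EObj C \<Longrightarrow> dact ZD (c, d) = a c d"
  by (auto simp: ZD_def)

lemma dmap_tD [simp]: "c \<in> EObj C \<Longrightarrow> dmap (tD j) c = t c j"
  by (auto simp: tD_def)

lemma tD: "j \<in> Obj J \<Longrightarrow> tD j \<in> hom D (Fo j) ZD"
  unfolding tD_def by (rule diagram_mapI) (use ZD a(4) in \<open>auto simp: in_hom_iff\<close>)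

lemma cocone_D: "cocone J D Fo Fa ZD tD"
  unfolding cocone_def
proof (intro conjI ballI ZD tD)
  interpret J: category J by (rule category_J)
  fix u assume u: "u \<in> Arr J"
  show "tD (Cod J u) \<cdot>\<^bsub>D\<^esub> Fa u = tD (Dom J u)"
    using u tD[of "Cod J u"] tD[of "Dom J u"] t_Fa
    by (intro diagram_map_eqI) (auto simp: in_hom_iff)
qed

text \<open>The maps induced at each \<open>c\<close> form a map of diagrams: composed with the
  legs, their naturality becomes that of the maps in the given cocone.\<close>

lemma colimit_D: "colimit J D Fo Fa ZD tD"
  unfolding colimit_def
proof (intro conjI allI impI F_functor cocone_D)
  fix Y s assume Ys: "cocone J D Fo Fa Y s"
  then have Y: "Y \<in> Obj D" by (simp add: cocone_def)
  have s: "s j \<in> Arr D" "ddom (s j) = Fo j" "dcod (s j) = Y" if "j \<in> Obj J" for j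
    using Ys that by (auto simp: cocone_def in_hom_iff)
  have "\<exists>h. h \<in> hom M (Z c) (dobj Y c) \<and> (\<forall>j\<in>Obj J. h \<bullet> t c j = dmap (s j) c)" if c: "c \<in> EObj C" for c
    using M.colimit_induced[OF colim[OF c] eval_cocone[OF Ys c]] by metis
  then obtain h where "\<And>c. c \<in> EObj C \<Longrightarrow> h c \<in> hom M (Z c) (dobj Y c) \<and> (\<forall>j\<in>Obj J. h c \<bullet> t c j = dmap (s j) c)"
    by metis
  then have h: "\<And>c. c \<in> EObj C \<Longrightarrow> h c \<in> Arr M" "\<And>c. c \<in> EObj C \<Longrightarrow> Dom M (h c) = Z c"
    "\<And>c. c \<in> EObj C \<Longrightarrow> Cod M (h c) = dobj Y c"
    "\<And>c j. c \<in> EObj C \<Longrightarrow> j \<in> Obj J \<Longrightarrow> h c \<bullet> t c j = dmap (s j) c"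
    by (auto simp: in_hom_iff)
  define hD where "hD = \<lparr>ddom = ZD, dcod = Y, dmap = (\<lambda>c\<in>EObj C. h c)\<rparr>"
  have hD: "hD \<in> hom D ZD Y"
    unfolding hD_def
  proof (rule diagram_mapI[OF ZD Y])
    fix c d assume c: "c \<in> EObj C" and d: "d \<in> EObj C"
    show "h d \<bullet> dact ZD (c, d) = dact Y (c, d) \<bullet> (H c d \<rhd> h c)"
    proof (rule joint_epi[OF c, where K = "H c d" and Y = "dobj Y d"])
      fix j assume j: "j \<in> Obj J"
      have "(h d \<bullet> dact ZD (c, d)) \<bullet> (H c d \<rhd> t c j) = h d \<bullet> t d j \<bullet> dact (Fo j) (c, d)"
        using c d j h a(4)[OF c d j] by (simp add: M.Comp_Comp)
      also have "\<dots> = dmap (s j) d \<bullet> dact (Fo j) (c, d)"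
        by (rule M.Comp_eq_Arr[OF h(4)[OF d j]]) (use c d j h Fo_D[OF j] in auto)
      also have "\<dots> = dact Y (c, d) \<bullet> (H c d \<rhd> dmap (s j) c)"
        using diagram_mapD(6)[of "s j" c d] s[OF j] c d by simp
      also have "\<dots> = (dact Y (c, d) \<bullet> (H c d \<rhd> h c)) \<bullet> (H c d \<rhd> t c j)"
        using c d j h Y by (simp add: M.Comp_Comp whisker_left_Comp)
      finally show "(h d \<bullet> dact ZD (c, d)) \<bullet> (H c d \<rhd> t c j) = (dact Y (c, d) \<bullet> (H c d \<rhd> h c)) \<bullet> (H c d \<rhd> t c j)" .
    qed (use c d h Y in \<open>auto simp: in_hom_iff\<close>)
  qed (use h in \<open>auto simp: in_hom_iff\<close>)
  note hD1 = hD[unfolded in_hom_iff Dom_D Cod_D]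
  have tD1: "tD j \<in> Arr D" "ddom (tD j) = Fo j" "dcod (tD j) = ZD" if "j \<in> Obj J" for j
    using tD[OF that] by (auto simp: in_hom_iff)
  show "\<exists>!h. h \<in> hom D ZD Y \<and> (\<forall>j\<in>Obj J. h \<cdot>\<^bsub>D\<^esub> tD j = s j)"
  proof (rule ex1I[of _ hD])
    have "hD \<cdot>\<^bsub>D\<^esub> tD j = s j" if j: "j \<in> Obj J" for j
    proof (rule diagram_map_eqI)
      show "dmap (hD \<cdot>\<^bsub>D\<^esub> tD j) c = dmap (s j) c" if "c \<in> EObj C" for c
        using that j h(4) by (simp add: hD_def)
    qed (use hD1 tD1[OF j] s[OF j] in auto)
    then show "hD \<in> hom D ZD Y \<and> (\<forall>j\<in>Obj J. hD \<cdot>\<^bsub>D\<^esub> tD j = s j)" using hD by blast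
  next
    fix k assume k: "k \<in> hom D ZD Y \<and> (\<forall>j\<in>Obj J. k \<cdot>\<^bsub>D\<^esub> tD j = s j)"
    then have k1: "k \<in> Arr D" "ddom k = ZD" "dcod k = Y" by (auto simp: in_hom_iff)
    show "k = hD"
    proof (rule diagram_map_eqI)
      fix c assume c: "c \<in> EObj C"
      show "dmap k c = dmap hD c"
      proof (rule M.colimit_joint_epi[OF category_J colim[OF c]])
        show "dmap k c \<in> hom M (Z c) (dobj Y c)" "dmap hD c \<in> hom M (Z c) (dobj Y c)"
          using k1 hD1 c by (auto simp: in_hom_iff)
        fix j assume j: "j \<in> Obj J"
        have "dmap (k \<cdot>\<^bsub>D\<^esub> tD j) c = dmap (s j) c" using k j by simp
        then show "dmap k c \<bullet> t c j = dmap hD c \<bullet> t c j"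
          using c j h(4)[OF c j] by (simp add: hD_def)
      qed
    qed (use hD1 k1 in auto)
  qed
qed

end

context cocontinuous_diagrams
begin

lemma pointwise_colimit_exists:
  assumes "small_category \<kappa> J" "is_functor J D Fo Fa"
    and "\<And>c. c \<in> EObj C \<Longrightarrow> colimit J M (\<lambda>j. dobj (Fo j) c) (\<lambda>u. dmap (Fa u) c) (Z c) (t c)"
  obtains Zd td where "colimit J D Fo Fa Zd td" "\<And>c. c \<in> EObj C \<Longrightarrow> dobj Zd c = Z c"
    "\<And>c j. c \<in> EObj C \<Longrightarrow> dmap (td j) c = t c j"
proof -
  interpret pointwise_colimits V M A C \<kappa> J Fo Fa Z t by unfold_locales (use assms in auto)
  show thesis using that[OF colimit_D] by simp
qed

text \<open>The closure properties concern arbitrary colimits in \<open>D\<close>. Such a colimit is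
  isomorphic to the one built from pointwise colimits, and the isomorphism can be evaluated at
  \<open>c\<close>.\<close>

lemma colimit_pointwise:
  assumes J: "small_category \<kappa> J" and colim: "colimit J D Fo Fa Z t"
    and ex: "\<And>c. c \<in> EObj C \<Longrightarrow> \<exists>Z t. colimit J M (\<lambda>j. dobj (Fo j) c) (\<lambda>u. dmap (Fa u) c) Z t"
    and c: "c \<in> EObj C"
  shows "colimit J M (\<lambda>j. dobj (Fo j) c) (\<lambda>u. dmap (Fa u) c) (dobj Z c) (\<lambda>j. dmap (t j) c)"
proof -
  have cJ: "category J" using J by (simp add: small_category_def)
  obtain Z' t' where Z': "\<And>c. c \<in> EObj C \<Longrightarrow> colimit J M (\<lambda>j. dobj (Fo j) c) (\<lambda>u. dmap (Fa u) c) (Z' c) (t' c)"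
    using ex by metis
  obtain Zd td where Zd: "colimit J D Fo Fa Zd td" "\<And>c. c \<in> EObj C \<Longrightarrow> dobj Zd c = Z' c"
    "\<And>c j. c \<in> EObj C \<Longrightarrow> dmap (td j) c = t' c j"
    using pointwise_colimit_exists[OF J D.colimit_functor[OF colim] Z'] by metis
  obtain h where h: "h \<in> hom D Zd Z" "iso D h" "\<And>j. j \<in> Obj J \<Longrightarrow> h \<cdot>\<^bsub>D\<^esub> td j = t j"
    using D.colimit_unique[OF cJ Zd(1) colim] by blast
  show ?thesis
  proof (rule M.colimit_transport[OF cJ Z'[OF c] iso_pointwise[OF h(2) c]])
    show "dmap h c \<in> hom M (Z' c) (dobj Z c)" using h(1) c Zd(2)[OF c] by (auto simp: in_hom_iff)
    show "dmap (t j) c = dmap h c \<bullet> t' c j" if "j \<in> Obj J" for j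
      using dmap_Comp[OF c, of h "td j"] h(3)[OF that] Zd(3)[OF c, of j] by simp
  qed
qed

lemma D_coproduct_exists:
  assumes "small \<kappa> I" "\<And>i. i \<in> I \<Longrightarrow> X i \<in> Obj D"
    and "\<And>c. c \<in> EObj C \<Longrightarrow> \<exists>P p. coproduct M I (\<lambda>i. dobj (X i) c) P p"
  shows "\<exists>P p. coproduct D I X P p"
proof -
  have J: "small_category \<kappa> (order_cat (Id_on I))"
    using assms(1) universe_\<kappa> by (intro small_category_order_cat) (auto simp: refl_on_def intro: transI)
  obtain P p where "\<And>c. c \<in> EObj C \<Longrightarrow> coproduct M I (\<lambda>i. dobj (X i) c) (P c) (p c)"
    using assms(3) by metis
  then have "colimit (order_cat (Id_on I)) M (\<lambda>i. dobj (X i) c) (\<lambda>u. dmap (Ident D (X (fst u))) c) (P c) (p c)"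
    if "c \<in> EObj C" for c
    using that by (simp add: M.coproduct_iff_colimit)
  moreover have "is_functor (order_cat (Id_on I)) D X (\<lambda>u. Ident D (X (fst u)))"
    using assms(2) by (auto simp: is_functor_order_cat in_hom_iff simp del: D_simps)
  ultimately show ?thesis
    using pointwise_colimit_exists[OF J] unfolding D.coproduct_iff_colimit by metis
qed

lemma D_coproduct_pointwise:
  assumes "small \<kappa> I" "coproduct D I X P p" "c \<in> EObj C"
    and "\<And>c. c \<in> EObj C \<Longrightarrow> \<exists>P p. coproduct M I (\<lambda>i. dobj (X i) c) P p"
  shows "coproduct M I (\<lambda>i. dobj (X i) c) (dobj P c) (\<lambda>i. dmap (p i) c)"
proof -
  have J: "small_category \<kappa> (order_cat (Id_on I))"
    using assms(1) universe_\<kappa> by (intro small_category_order_cat) (auto simp: refl_on_def intro: transI)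
  show ?thesis
    using colimit_pointwise[OF J assms(2)[unfolded D.coproduct_iff_colimit] _ assms(3)] assms(3,4)
    by (simp add: M.coproduct_iff_colimit)
qed

lemma small_span: "small_category \<kappa> (order_cat span_rel)"
  using category_span universe_\<kappa>
  by (auto simp: small_category_def span_rel_def intro!: small_finite)

lemma span_eval:
  assumes "f \<in> Arr D" "g \<in> Arr D" "ddom f = ddom g" "c \<in> EObj C"
  shows "dobj (span_obj D f g j) c = span_obj M (dmap f c) (dmap g c) j"
    "dmap (span_arr D f g u) c = span_arr M (dmap f c) (dmap g c) u"
  using assms by (auto simp: span_obj_def span_arr_def)

lemma D_pushout_exists:
  assumes fg: "f \<in> Arr D" "g \<in> Arr D" "ddom f = ddom g"
    and ex: "\<And>c. c \<in> EObj C \<Longrightarrow> \<exists>p q. pushout M (dmap f c) (dmap g c) p q"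
  shows "\<exists>p q. pushout D f g p q"
proof -
  obtain p q where pq: "\<And>c. c \<in> EObj C \<Longrightarrow> pushout M (dmap f c) (dmap g c) (p c) (q c)"
    using ex by metis
  obtain Zd td where "colimit (order_cat span_rel) D (span_obj D f g) (span_arr D f g) Zd td"
  proof (rule pointwise_colimit_exists[OF small_span D.span_functor])
    fix c assume c: "c \<in> EObj C"
    show "colimit (order_cat span_rel) M (\<lambda>j. dobj (span_obj D f g j) c) (\<lambda>u. dmap (span_arr D f g u) c)
      (Cod M (p c)) (span_leg M (dmap f c) (p c) (q c))"
      using M.pushout_colimit[OF pq[OF c]] by (simp add: span_eval[OF fg c])
  qed (use fg in auto)
  then show ?thesis using D.pushout_iff_colimit[of f g] fg by auto
qed

lemma D_pushout_pointwise:
  assumes po: "pushout D f g p q" and c: "c \<in> EObj C"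
    and ex: "\<And>c. c \<in> EObj C \<Longrightarrow> \<exists>p q. pushout M (dmap f c) (dmap g c) p q"
  shows "pushout M (dmap f c) (dmap g c) (dmap p c) (dmap q c)"
proof -
  note P = D.pushoutD[OF po]
  have fg: "f \<in> Arr D" "g \<in> Arr D" "ddom f = ddom g" using P by auto
  have M: "dmap f c \<in> Arr M" "dmap g c \<in> Arr M" "Dom M (dmap f c) = Dom M (dmap g c)" if "c \<in> EObj C" for c
    using fg that by auto
  have ex': "\<exists>Z t. colimit (order_cat span_rel) M (\<lambda>j. dobj (span_obj D f g j) c) (\<lambda>u. dmap (span_arr D f g u) c) Z t"
    if c: "c \<in> EObj C" for c
    using ex[OF c] M.pushout_colimit by (simp add: span_eval[OF fg c]) blast
  show ?thesis
    using colimit_pointwise[OF small_span D.pushout_colimit[OF po] ex' c]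
    by (simp add: span_eval[OF fg c] M.pushout_iff_colimit[OF M[OF c]]) (simp add: span_leg_def)
qed

lemma small_natLeq: "small_category \<kappa> (order_cat natLeq)"
  using universe_\<kappa> by (intro small_category_order_cat) (auto simp: natLeq_def refl_on_def Field_def intro!: transI small_nat)

lemma D_seq_colimit_pointwise:
  assumes x: "\<And>n. x n \<in> hom D (X n) (X (Suc n))" and colim: "seq_colimit D X x Z t" and c: "c \<in> EObj C"
    and ex: "\<And>c. c \<in> EObj C \<Longrightarrow> \<exists>Z t. seq_colimit M (\<lambda>n. dobj (X n) c) (\<lambda>n. dmap (x n) c) Z t"
  shows "seq_colimit M (\<lambda>n. dobj (X n) c) (\<lambda>n. dmap (x n) c) (dobj Z c) (\<lambda>n. dmap (t n) c)"
proof -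
  define F where "F = (\<lambda>(m, n). D.chain x m (n - m))"
  have F: "is_functor (order_cat natLeq) D X F" unfolding F_def by (rule D.chain_functor) (rule x)
  have FS: "F (n, Suc n) = x n" for n using x[of n] by (simp add: F_def in_hom_iff)
  have s: "seq_colimit M (\<lambda>n. dobj (X n) c) (\<lambda>n. dmap (x n) c) Z t \<longleftrightarrow>
    colimit (order_cat natLeq) M (\<lambda>n. dobj (X n) c) (\<lambda>u. dmap (F u) c) Z t" if "c \<in> EObj C" for c Z t
    by (rule M.seq_colimit_iff[OF eval_functor[OF F that]]) (simp add: FS)
  have "colimit (order_cat natLeq) D X F Z t"
    using colim D.seq_colimit_iff[OF F FS] by blast
  from colimit_pointwise[OF small_natLeq this _ c] show ?thesis using ex s c by blast
qed

lemma D_initial_pointwise: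
  assumes ex: "\<exists>Z. initial M Z" and Z: "initial D Z" and c: "c \<in> EObj C"
  shows "initial M (dobj Z c)"
proof -
  obtain Z0 where Z0: "initial M Z0" using ex by blast
  have "coproduct D {} (\<lambda>i. Z) Z (\<lambda>i. undefined)" using Z D.initial_iff_coproduct by blast
  moreover have "small \<kappa> ({} :: 's set)" by (rule small_finite[OF universe_\<kappa>]) simp
  moreover have "\<exists>P p. coproduct M ({} :: 's set) (\<lambda>i. dobj Z c) P p" for c
    using Z0 M.initial_iff_coproduct by blast
  ultimately show ?thesis
    using D_coproduct_pointwise[of "{} :: 's set" "\<lambda>_. Z" Z "\<lambda>_. undefined" c] c
      M.initial_iff_coproduct D.initial_iff_coproduct by blast
qed

lemma D_initial_exists: "\<exists>Z. initial M Z \<Longrightarrow> \<exists>Z. initial D Z"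
  using D_coproduct_exists[of "{} :: 's set" "\<lambda>_. undefined"] M.initial_iff_coproduct D.initial_iff_coproduct
    small_finite[OF universe_\<kappa>, of "{} :: 's set"] by blast

text \<open>Some initial diagram exists and is pointwise initial, so its map to \<open>Z\<close> is
  a pointwise isomorphism, along which initiality is transported.\<close>

lemma D_initialI:
  assumes "\<exists>Z. initial M Z" "Z \<in> Obj D" "\<And>c. c \<in> EObj C \<Longrightarrow> initial M (dobj Z c)"
  shows "initial D Z"
proof -
  obtain Z' where Z': "initial D Z'" using D_initial_exists assms(1) by blast
  then obtain h where h: "h \<in> hom D Z' Z" using assms(2) unfolding initial_def by blast
  have "iso M (dmap h c)" if c: "c \<in> EObj C" for c
  proof -
    have "coproduct M {} X (dobj Z' c) p" "coproduct M {} X (dobj Z c) p" for X p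
      using D_initial_pointwise[OF assms(1) Z' c] assms(3)[OF c] M.initial_iff_coproduct by blast+
    note co = this[of "\<lambda>_::unit. undefined" "\<lambda>_. undefined"]
    obtain k where k: "k \<in> hom M (dobj Z' c) (dobj Z c)" "iso M k"
      using M.colimit_unique[OF category_order_cat_Id_on co[unfolded M.coproduct_iff_colimit]] by blast
    moreover have "dmap h c = k"
      by (rule M.coproduct_joint_epi[OF co(1)]) (use h k c in \<open>auto simp: in_hom_iff\<close>)
    ultimately show ?thesis by simp
  qed
  then have iso: "iso D h" using h by (intro isoI_pointwise) (auto simp: in_hom_iff)
  have co: "coproduct D {} X Z' p" for X :: "unit \<Rightarrow> _" and p
    using Z' D.initial_iff_coproduct by blast
  have "colimit (order_cat (Id_on {})) D (\<lambda>_::unit. Z) (\<lambda>u. Ident D Z) Z (\<lambda>_. undefined)"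
    by (rule D.colimit_transport[OF category_order_cat_Id_on co[unfolded D.coproduct_iff_colimit] iso h]) auto
  then show ?thesis using D.coproduct_iff_colimit[of "{}" "\<lambda>_::unit. Z" Z] D.initial_iff_coproduct by blast
qed

end

section \<open>Free diagrams and the Yoneda lemma\<close>

context enriched_diagrams
begin

lemma iso_inverse_naturality:
  assumes "iso M e" "iso M e'" "f \<in> Arr M" "g \<in> Arr M" "Dom M f = Dom M e" "Cod M f = Dom M e'"
    "Dom M g = Cod M e" "Cod M g = Cod M e'" "e' \<bullet> f = g \<bullet> e"
  shows "f \<bullet> inverse_of M e = inverse_of M e' \<bullet> g"
proof (rule M.iso_cancel_right[OF assms(1)])
  have a: "e \<in> Arr M" "e' \<in> Arr M" using assms M.iso_Arr by auto
  have 1: "(inverse_of M e' \<bullet> g) \<bullet> e = inverse_of M e' \<bullet> e' \<bullet> f" using assms a by (simp add: M.Comp_Comp)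
  have 2: "(f \<bullet> inverse_of M e) \<bullet> e = f" "inverse_of M e' \<bullet> e' \<bullet> f = f"
    using assms(1-8) a by (simp_all add: M.Comp_Comp)
  show "(f \<bullet> inverse_of M e) \<bullet> e = (inverse_of M e' \<bullet> g) \<bullet> e" unfolding 1 2 ..
qed (use assms M.iso_Arr in auto)

lemma free_diagram_simps [simp]:
  "d \<in> EObj C \<Longrightarrow> dobj (free_diagram M A C c X) d = H c d \<star> X"
  "d \<in> EObj C \<Longrightarrow> e \<in> EObj C \<Longrightarrow> dact (free_diagram M A C c X) (d, e) =
    (EComp C c d e \<lhd> X) \<bullet> inverse_of M (act_assoc A (H d e) (H c d) X)"
  by (auto simp: free_diagram_def)

text \<open>The axioms of the diagram are those of composition in \<open>C\<close>, applied to
  \<open>X\<close>. The pentagon of the action and, for the unit axiom, the triangle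
  \<open>act_lunit\<close> handle the associators whose inverses occur in the structure
  maps.\<close>

lemma free_diagram_D [simp]:
  assumes a: "a \<in> EObj C" and X: "X \<in> Obj M"
  shows "free_diagram M A C a X \<in> Obj D"
  unfolding free_diagram_def
proof (rule diagramI)
  let ?\<alpha> = "\<lambda>K L. act_assoc A K L X"
  fix b c d assume b: "b \<in> EObj C" and c: "c \<in> EObj C" and d: "d \<in> EObj C"
  let ?K = "H c d" and ?L = "H b c" and ?N = "H a b"
  let ?\<beta> = "act_assoc A (?K \<otimes>\<^bsub>V\<^esub> ?L) ?N X"
  show "((EComp C a b d \<lhd> X) \<bullet> inverse_of M (?\<alpha> (H b d) ?N)) \<bullet> (EComp C b c d \<lhd> (?N \<star> X)) =
    ((EComp C a c d \<lhd> X) \<bullet> inverse_of M (?\<alpha> ?K (H a c))) \<bullet>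
      (?K \<rhd> ((EComp C a b c \<lhd> X) \<bullet> inverse_of M (?\<alpha> ?L ?N))) \<bullet> act_assoc A ?K ?L (?N \<star> X)"
    (is "?l = ?r")
  \<comment> \<open>Composition with this associator cancels the inverse on the left-hand side and
    produces one side of the pentagon on the right-hand side.\<close>
  proof (rule M.iso_cancel_right[of ?\<beta>])
    have n1: "(EComp C b c d \<lhd> (?N \<star> X)) \<bullet> ?\<beta> = ?\<alpha> (H b d) ?N \<bullet> ((EComp C b c d \<odot>\<^bsub>V\<^esub> Ident V ?N) \<lhd> X)"
      using act_assoc_nat[of "EComp C b c d" "Ident V ?N" "Ident M X" "?K \<otimes>\<^bsub>V\<^esub> ?L" ?N X "H b d" ?N X] a b c d X
      by simp
    have "?l \<bullet> ?\<beta> = (EComp C a b d \<lhd> X) \<bullet> ((EComp C b c d \<odot>\<^bsub>V\<^esub> Ident V ?N) \<lhd> X)"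
      using a b c d X n1 by (simp add: M.Comp_Comp)
    also have "\<dots> = (EComp C a b d \<cdot>\<^bsub>V\<^esub> (EComp C b c d \<odot>\<^bsub>V\<^esub> Ident V ?N)) \<lhd> X"
      using a b c d X by (simp add: act_interchange)
    also have "\<dots> = (EComp C a c d \<cdot>\<^bsub>V\<^esub> (Ident V ?K \<odot>\<^bsub>V\<^esub> EComp C a b c) \<cdot>\<^bsub>V\<^esub> assoc V ?K ?L ?N) \<lhd> X"
      using EComp_assoc[OF a b c d] by simp
    also have "\<dots> = (EComp C a c d \<lhd> X) \<bullet> ((Ident V ?K \<odot>\<^bsub>V\<^esub> EComp C a b c) \<lhd> X) \<bullet> (assoc V ?K ?L ?N \<lhd> X)"
      using a b c d X by (simp add: act_interchange)
    finally have l: "?l \<bullet> ?\<beta> = (EComp C a c d \<lhd> X) \<bullet> ((Ident V ?K \<odot>\<^bsub>V\<^esub> EComp C a b c) \<lhd> X) \<bullet> (assoc V ?K ?L ?N \<lhd> X)" .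
    have n2: "(?K \<rhd> EComp C a b c \<lhd> X) \<bullet> ?\<alpha> ?K (?L \<otimes>\<^bsub>V\<^esub> ?N) = ?\<alpha> ?K (H a c) \<bullet> ((Ident V ?K \<odot>\<^bsub>V\<^esub> EComp C a b c) \<lhd> X)"
      using act_assoc_nat[of "Ident V ?K" "EComp C a b c" "Ident M X" ?K "?L \<otimes>\<^bsub>V\<^esub> ?N" X ?K "H a c" X] a b c d X
      by simp
    have "?r \<bullet> ?\<beta> = (EComp C a c d \<lhd> X) \<bullet> inverse_of M (?\<alpha> ?K (H a c)) \<bullet> (?K \<rhd> EComp C a b c \<lhd> X) \<bullet>
        (?K \<rhd> inverse_of M (?\<alpha> ?L ?N)) \<bullet> act_assoc A ?K ?L (?N \<star> X) \<bullet> ?\<beta>"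
      using a b c d X by (simp add: M.Comp_Comp whisker_left_Comp[symmetric])
    also have "act_assoc A ?K ?L (?N \<star> X) \<bullet> ?\<beta> = (?K \<rhd> ?\<alpha> ?L ?N) \<bullet> ?\<alpha> ?K (?L \<otimes>\<^bsub>V\<^esub> ?N) \<bullet> (assoc V ?K ?L ?N \<lhd> X)"
      using act_pentagon[of ?K ?L ?N X] a b c d X by simp
    also have "(?K \<rhd> inverse_of M (?\<alpha> ?L ?N)) \<bullet> (?K \<rhd> ?\<alpha> ?L ?N) \<bullet> ?\<alpha> ?K (?L \<otimes>\<^bsub>V\<^esub> ?N) \<bullet> (assoc V ?K ?L ?N \<lhd> X) =
        Ident M (?K \<star> (?L \<otimes>\<^bsub>V\<^esub> ?N) \<star> X) \<bullet> ?\<alpha> ?K (?L \<otimes>\<^bsub>V\<^esub> ?N) \<bullet> (assoc V ?K ?L ?N \<lhd> X)"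
      using a b c d X by (intro M.Comp_eq_Arr) (auto simp: whisker_left_Comp)
    also have "\<dots> = ?\<alpha> ?K (?L \<otimes>\<^bsub>V\<^esub> ?N) \<bullet> (assoc V ?K ?L ?N \<lhd> X)"
      using a b c d X by simp
    also have "(?K \<rhd> EComp C a b c \<lhd> X) \<bullet> \<dots> = ?\<alpha> ?K (H a c) \<bullet> ((Ident V ?K \<odot>\<^bsub>V\<^esub> EComp C a b c) \<lhd> X) \<bullet> (assoc V ?K ?L ?N \<lhd> X)"
      using a b c d X by (intro M.Comp_eq_Comp n2) auto
    finally show "?l \<bullet> ?\<beta> = ?r \<bullet> ?\<beta>" using l a b c d X by simp
  qed (use a b c d X in auto)
next
  fix d assume d: "d \<in> EObj C"
  let ?N = "H a d"
  show "((EComp C a d d \<lhd> X) \<bullet> inverse_of M (act_assoc A (H d d) ?N X)) \<bullet> (EIdent C d \<lhd> (?N \<star> X)) = act_unit A (?N \<star> X)"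
  proof (rule M.iso_cancel_right[of "act_assoc A \<I>\<^bsub>V\<^esub> ?N X"])
    have n: "(EIdent C d \<lhd> (?N \<star> X)) \<bullet> act_assoc A \<I>\<^bsub>V\<^esub> ?N X = act_assoc A (H d d) ?N X \<bullet> ((EIdent C d \<odot>\<^bsub>V\<^esub> Ident V ?N) \<lhd> X)"
      using act_assoc_nat[of "EIdent C d" "Ident V ?N" "Ident M X" "\<I>\<^bsub>V\<^esub>" ?N X "H d d" ?N X] a d X by simp
    show "(((EComp C a d d \<lhd> X) \<bullet> inverse_of M (act_assoc A (H d d) ?N X)) \<bullet> (EIdent C d \<lhd> (?N \<star> X))) \<bullet> act_assoc A \<I>\<^bsub>V\<^esub> ?N X =
      act_unit A (?N \<star> X) \<bullet> act_assoc A \<I>\<^bsub>V\<^esub> ?N X"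
      using a d X n act_lunit[of ?N X] EIdent_EComp[OF a d] by (simp add: M.Comp_Comp act_interchange)
  qed (use a d X in auto)
qed (use a X in \<open>auto simp: in_hom_iff\<close>)

lemma free_diagram_map_simps [simp]:
  "ddom (free_diagram_map V M A C c f) = free_diagram M A C c (Dom M f)"
  "dcod (free_diagram_map V M A C c f) = free_diagram M A C c (Cod M f)"
  "d \<in> EObj C \<Longrightarrow> dmap (free_diagram_map V M A C c f) d = H c d \<rhd> f"
  by (auto simp: free_diagram_map_def)

lemma free_diagram_map_D [simp]:
  assumes c: "c \<in> EObj C" and f: "f \<in> Arr M"
  shows "free_diagram_map V M A C c f \<in> Arr D"
proof -
  have "free_diagram_map V M A C c f \<in> hom D (free_diagram M A C c (Dom M f)) (free_diagram M A C c (Cod M f))"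
    unfolding free_diagram_map_def
  proof (rule diagram_mapI)
    fix d e assume d: "d \<in> EObj C" and e: "e \<in> EObj C"
    let ?\<alpha> = "\<lambda>X. act_assoc A (H d e) (H c d) X"
    have "((H d e \<otimes>\<^bsub>V\<^esub> H c d) \<rhd> f) \<bullet> inverse_of M (?\<alpha> (Dom M f)) = inverse_of M (?\<alpha> (Cod M f)) \<bullet> (H d e \<rhd> H c d \<rhd> f)"
      using c d e f act_assoc_nat[of "Ident V (H d e)" "Ident V (H c d)" f "H d e" "H c d" "Dom M f" "H d e" "H c d" "Cod M f"]
      by (intro iso_inverse_naturality) (auto simp: V.tensor_Ident)
    moreover have "(H c e \<rhd> f) \<bullet> (EComp C c d e \<lhd> Dom M f) \<bullet> inverse_of M (?\<alpha> (Dom M f)) =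
        (EComp C c d e \<lhd> Cod M f) \<bullet> ((H d e \<otimes>\<^bsub>V\<^esub> H c d) \<rhd> f) \<bullet> inverse_of M (?\<alpha> (Dom M f))"
      using c d e f by (intro M.Comp_eq_Comp) (auto simp: act_interchange)
    ultimately show "(H c e \<rhd> f) \<bullet> dact (free_diagram M A C c (Dom M f)) (d, e) =
        dact (free_diagram M A C c (Cod M f)) (d, e) \<bullet> (H d e \<rhd> H c d \<rhd> f)"
      using c d e f by (simp add: M.Comp_Comp)
  qed (use c f in \<open>auto simp: in_hom_iff\<close>)
  then show ?thesis by (simp add: in_hom_iff)
qed

text \<open>The map \<open>C(c, -) \<star> N \<rightarrow> X\<close> corresponding to \<open>u : N \<rightarrow> X c\<close> by the Yoneda lemma.\<close>

definition transpose where
  "transpose c X u = \<lparr>ddom = free_diagram M A C c (Dom M u), dcod = X,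
     dmap = (\<lambda>d\<in>EObj C. dact X (c, d) \<bullet> (H c d \<rhd> u))\<rparr>"

lemma transpose_simps [simp]:
  "ddom (transpose c X u) = free_diagram M A C c (Dom M u)" "dcod (transpose c X u) = X"
  "d \<in> EObj C \<Longrightarrow> dmap (transpose c X u) d = dact X (c, d) \<bullet> (H c d \<rhd> u)"
  by (auto simp: transpose_def)

lemma transpose_D [simp]:
  assumes c: "c \<in> EObj C" and X: "X \<in> Obj D" and u: "u \<in> Arr M" "Cod M u = dobj X c"
  shows "transpose c X u \<in> Arr D"
proof -
  have "transpose c X u \<in> hom D (free_diagram M A C c (Dom M u)) X"
    unfolding transpose_def
  proof (rule diagram_mapI)
    fix d e assume d: "d \<in> EObj C" and e: "e \<in> EObj C"
    let ?N = "Dom M u"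
    let ?\<alpha> = "\<lambda>X. act_assoc A (H d e) (H c d) X"
    have 1: "((H d e \<otimes>\<^bsub>V\<^esub> H c d) \<rhd> u) \<bullet> inverse_of M (?\<alpha> ?N) = inverse_of M (?\<alpha> (dobj X c)) \<bullet> (H d e \<rhd> H c d \<rhd> u)"
      using c d e u X act_assoc_nat[of "Ident V (H d e)" "Ident V (H c d)" u "H d e" "H c d" ?N "H d e" "H c d" "dobj X c"]
      by (intro iso_inverse_naturality) (auto simp: V.tensor_Ident)
    have "(dact X (c, e) \<bullet> (H c e \<rhd> u)) \<bullet> dact (free_diagram M A C c ?N) (d, e) =
        dact X (c, e) \<bullet> (H c e \<rhd> u) \<bullet> (EComp C c d e \<lhd> ?N) \<bullet> inverse_of M (?\<alpha> ?N)"
      using c d e u X by (simp add: M.Comp_Comp)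
    also have "(H c e \<rhd> u) \<bullet> (EComp C c d e \<lhd> ?N) \<bullet> inverse_of M (?\<alpha> ?N) =
        (EComp C c d e \<lhd> dobj X c) \<bullet> ((H d e \<otimes>\<^bsub>V\<^esub> H c d) \<rhd> u) \<bullet> inverse_of M (?\<alpha> ?N)"
      using c d e u X by (intro M.Comp_eq_Comp) (auto simp: act_interchange)
    also have "\<dots> = (EComp C c d e \<lhd> dobj X c) \<bullet> inverse_of M (?\<alpha> (dobj X c)) \<bullet> (H d e \<rhd> H c d \<rhd> u)"
      using 1 by simp
    also have "dact X (c, e) \<bullet> \<dots> = (dact X (d, e) \<bullet> (H d e \<rhd> dact X (c, d)) \<bullet> ?\<alpha> (dobj X c)) \<bullet>
        inverse_of M (?\<alpha> (dobj X c)) \<bullet> (H d e \<rhd> H c d \<rhd> u)"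
      using c d e u X diagramD(5)[OF X c d e] by (intro M.Comp_eq_Arr) auto
    also have "\<dots> = dact X (d, e) \<bullet> (H d e \<rhd> (dact X (c, d) \<bullet> (H c d \<rhd> u)))"
      using c d e u X by (simp add: M.Comp_Comp whisker_left_Comp)
    finally show "(dact X (c, e) \<bullet> (H c e \<rhd> u)) \<bullet> dact (free_diagram M A C c ?N) (d, e) =
        dact X (d, e) \<bullet> (H d e \<rhd> (dact X (c, d) \<bullet> (H c d \<rhd> u)))" .
  qed (use c u X in \<open>auto simp: in_hom_iff\<close>)
  then show ?thesis by (simp add: in_hom_iff)
qed

lemma transpose_Comp_free:
  assumes "c \<in> EObj C" "X \<in> Obj D" "u \<in> Arr M" "Cod M u = dobj X c" "i \<in> Arr M" "Cod M i = Dom M u"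
  shows "transpose c X u \<cdot>\<^bsub>D\<^esub> free_diagram_map V M A C c i = transpose c X (u \<bullet> i)"
  by (rule diagram_map_eqI) (use assms in \<open>auto simp: M.Comp_Comp whisker_left_Comp\<close>)

lemma Comp_transpose:
  assumes g: "g \<in> Arr D" and c: "c \<in> EObj C" and u: "u \<in> Arr M" "Cod M u = dobj (ddom g) c"
  shows "g \<cdot>\<^bsub>D\<^esub> transpose c (ddom g) u = transpose c (dcod g) (dmap g c \<bullet> u)"
proof (rule diagram_map_eqI)
  fix d assume d: "d \<in> EObj C"
  have "dmap g d \<bullet> dact (ddom g) (c, d) \<bullet> (H c d \<rhd> u) = dact (dcod g) (c, d) \<bullet> (H c d \<rhd> dmap g c) \<bullet> (H c d \<rhd> u)"
    using g c u d diagram_mapD(6)[OF g c d] by (intro M.Comp_eq_Comp) auto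
  then show "dmap (g \<cdot>\<^bsub>D\<^esub> transpose c (ddom g) u) d = dmap (transpose c (dcod g) (dmap g c \<bullet> u)) d"
    using g c u d by (simp add: whisker_left_Comp)
qed (use assms in auto)

text \<open>The map \<open>N -> C(c, c) \<star> N\<close> given by the identity of \<open>c\<close>:
  the unit of the adjunction between free diagrams at \<open>c\<close> and evaluation at
  \<open>c\<close>.\<close>

definition free_unit where "free_unit c N = (EIdent C c \<lhd> N) \<bullet> inverse_of M (act_unit A N)"

lemma free_unit_typing [simp]:
  assumes "c \<in> EObj C" "N \<in> Obj M"
  shows "free_unit c N \<in> Arr M" "Dom M (free_unit c N) = N" "Cod M (free_unit c N) = H c c \<star> N"
  using assms by (auto simp: free_unit_def)

text \<open>The triangle identity that recovers \<open>u\<close> from its transpose. It comes from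
  the unit axiom of \<open>X\<close> and the naturality of the unit isomorphism of the
  action.\<close>

lemma transpose_free_unit:
  assumes "c \<in> EObj C" "X \<in> Obj D" "u \<in> Arr M" "Cod M u = dobj X c" "N = Dom M u"
  shows "dmap (transpose c X u) c \<bullet> free_unit c N = u"
proof -
  have "(dact X (c, c) \<bullet> (H c c \<rhd> u)) \<bullet> (EIdent C c \<lhd> N) \<bullet> inverse_of M (act_unit A N) =
      dact X (c, c) \<bullet> (H c c \<rhd> u) \<bullet> (EIdent C c \<lhd> N) \<bullet> inverse_of M (act_unit A N)"
    using assms by (simp add: M.Comp_Comp)
  also have "(H c c \<rhd> u) \<bullet> (EIdent C c \<lhd> N) \<bullet> inverse_of M (act_unit A N) =
      (EIdent C c \<lhd> dobj X c) \<bullet> (\<I>\<^bsub>V\<^esub> \<rhd> u) \<bullet> inverse_of M (act_unit A N)"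
    using assms by (intro M.Comp_eq_Comp) (auto simp: act_interchange)
  also have "dact X (c, c) \<bullet> \<dots> = act_unit A (dobj X c) \<bullet> (\<I>\<^bsub>V\<^esub> \<rhd> u) \<bullet> inverse_of M (act_unit A N)"
    using assms diagramD(6)[OF assms(2,1)] by (intro M.Comp_eq_Arr) auto
  also have "\<dots> = u \<bullet> act_unit A N \<bullet> inverse_of M (act_unit A N)"
    using assms act_unit_nat[of u N "dobj X c"] by (intro M.Comp_eq_Comp) auto
  also have "\<dots> = u" using assms by simp
  finally show ?thesis using assms by (simp add: free_unit_def)
qed

lemma free_unit_natural:
  assumes "c \<in> EObj C" "f \<in> Arr M"
  shows "(H c c \<rhd> f) \<bullet> free_unit c (Dom M f) = free_unit c (Cod M f) \<bullet> f"
proof -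
  have "(\<I>\<^bsub>V\<^esub> \<rhd> f) \<bullet> inverse_of M (act_unit A (Dom M f)) = inverse_of M (act_unit A (Cod M f)) \<bullet> f"
    using assms act_unit_nat[of f "Dom M f" "Cod M f"] by (intro iso_inverse_naturality) auto
  moreover have "(H c c \<rhd> f) \<bullet> (EIdent C c \<lhd> Dom M f) \<bullet> inverse_of M (act_unit A (Dom M f)) =
      (EIdent C c \<lhd> Cod M f) \<bullet> (\<I>\<^bsub>V\<^esub> \<rhd> f) \<bullet> inverse_of M (act_unit A (Dom M f))"
    using assms by (intro M.Comp_eq_Comp) (auto simp: act_interchange)
  ultimately show ?thesis using assms by (simp add: free_unit_def M.Comp_Comp)
qed

end

section \<open>Transfinite composites of diagrams\<close>

context cocontinuous_diagrams
begin

text \<open>An initial segment is closed downwards, so its elements have the same predecessors in it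
  as in \<open>r\<close>. This allows a transfinite sequence to be cut off below a limit
  element.\<close>

lemma limit_elem_Restr:
  assumes r: "Well_order r" and b: "b' \<in> underS r b"
  shows "underS (Restr r (underS r b)) b' = underS r b'"
    "limit_elem (Restr r (underS r b)) b' \<Longrightarrow> limit_elem r b'"
    "succ_elem (Restr r (underS r b)) a b' \<longleftrightarrow> succ_elem r a b'"
    "bottom_elem (Restr r (underS r b)) b' \<longleftrightarrow> bottom_elem r b'"
proof -
  let ?r = "Restr r (underS r b)"
  have down: "a \<in> underS r b" if "a \<in> underS r b'" for a
    using that b Well_order_trans[OF r] Well_order_antisym[OF r] unfolding underS_def by blast
  show U: "underS ?r b' = underS r b'" using down b by (auto simp: underS_def)
  have F: "b' \<in> Field ?r" "b' \<in> Field r"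
    using b Restr_Field[OF r, of "underS r b"] by (auto intro: underS_Field)
  show S: "succ_elem ?r a b' \<longleftrightarrow> succ_elem r a b'" for a
    unfolding succ_elem_def U using down by auto
  show B: "bottom_elem ?r b' \<longleftrightarrow> bottom_elem r b'" unfolding bottom_elem_def U using F by simp
  show "limit_elem ?r b' \<Longrightarrow> limit_elem r b'" unfolding limit_elem_def B S using F by simp
qed

lemma is_functor_Restr: "is_functor (order_cat r) E X x \<Longrightarrow> is_functor (order_cat (Restr r B)) E X x"
  unfolding is_functor_order_cat by (auto simp: Field_def)

lemma small_category_Well_order: "Well_order r \<Longrightarrow> small \<kappa> (Field r) \<Longrightarrow> small_category \<kappa> (order_cat r)"
  by (rule small_category_order_cat[OF universe_\<kappa>]) (auto dest: Well_orderD)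

text \<open>Continuity at \<open>b\<close> in \<open>M\<close> requires the pointwise colimit of the
  part below \<open>b\<close> to exist. A left closed class provides it if this part is a
  transfinite sequence in \<open>M\<close>, that is, if continuity holds at all smaller limit
  elements; hence the well-founded induction.\<close>

lemma transfinite_limits_pointwise:
  fixes r :: "'s rel"
  assumes lc: "left_closed_class M \<kappa> G S" and seq: "transfinite_sequence \<kappa> D r X x"
    and a: "bottom_elem r a" "\<And>c. c \<in> EObj C \<Longrightarrow> dobj (X a) c \<in> G"
    and succ: "\<And>b b' c. succ_elem r b b' \<Longrightarrow> c \<in> EObj C \<Longrightarrow> dmap (x (b, b')) c \<in> S"
    and b: "limit_elem r b"
  shows "\<forall>c\<in>EObj C. colimit (order_cat (Restr r (underS r b))) M (\<lambda>j. dobj (X j) c) (\<lambda>u. dmap (x u) c)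
    (dobj (X b) c) (\<lambda>j. dmap (x (j, b)) c)"
proof -
  have "wf (r - Id)" using seq by (auto simp: transfinite_sequence_def dest: Well_orderD)
  then show ?thesis using b
  proof (induction b rule: wf_induct_rule)
    case (less b)
    interpret S: left_closed_class M \<kappa> G S by (rule lc)
    have r: "Well_order r" and sm: "small \<kappa> (Field r)" and F: "is_functor (order_cat r) D X x"
      and lim: "\<And>b. limit_elem r b \<Longrightarrow> colimit (order_cat (Restr r (underS r b))) D X x (X b) (\<lambda>a. x (a, b))"
      using seq by (auto simp: transfinite_sequence_def)
    let ?r = "Restr r (underS r b)"
    have r': "Well_order ?r" by (rule Well_order_Restr[OF r])
    have sub: "underS r b \<subseteq> Field r" by (auto intro: underS_Field)
    have F': "Field ?r = underS r b" by (rule Restr_Field[OF r sub])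
    have bF: "b \<in> Field r" and nb: "\<not> bottom_elem r b" using less by (auto simp: limit_elem_def)
    \<comment> \<open>A limit element is not the bottom, so the part below \<open>b\<close> still
      starts at \<open>a\<close>, where the objects are good.\<close>
    have ab: "a \<in> underS r b"
      using bottom_elem_le[OF r a(1) bF] nb a(1) by (auto simp: underS_def)
    have bot: "bottom_elem ?r a" using limit_elem_Restr(4)[OF r ab] a(1) by simp
    have sm': "small \<kappa> (Field ?r)" unfolding F' by (rule small_subset[OF sm sub])
    have ex: "\<exists>Z t. colimit (order_cat ?r) M (\<lambda>j. dobj (X j) c) (\<lambda>u. dmap (x u) c) Z t" if c: "c \<in> EObj C" for c
    proof (rule S.cof_transfinite(1)[OF _ bot])
      show "transfinite_sequence \<kappa> M ?r (\<lambda>j. dobj (X j) c) (\<lambda>u. dmap (x u) c)"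
        unfolding transfinite_sequence_def
      proof (intro conjI allI impI)
        show "is_functor (order_cat ?r) M (\<lambda>j. dobj (X j) c) (\<lambda>u. dmap (x u) c)"
          by (rule is_functor_Restr[OF eval_functor[OF F c]])
        fix b' assume l: "limit_elem ?r b'"
        then have b': "b' \<in> underS r b" by (simp add: limit_elem_def F')
        have "Restr ?r (underS ?r b') = Restr r (underS r b')"
          unfolding limit_elem_Restr(1)[OF r b']
          using b' Well_order_trans[OF r] Well_order_antisym[OF r] unfolding underS_def by blast
        then show "colimit (order_cat (Restr ?r (underS ?r b'))) M (\<lambda>j. dobj (X j) c) (\<lambda>u. dmap (x u) c)
            (dobj (X b') c) (\<lambda>a. dmap (x (a, b')) c)"
          using less(1)[of b'] limit_elem_Restr(2)[OF r b' l] b' c by (simp add: underS_def)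
      qed (use r' F' ab sm' in auto)
      show "dobj (X a) c \<in> G" by (rule a(2)[OF c])
      fix b' c' assume s: "succ_elem ?r b' c'"
      then have "c' \<in> Field ?r" using underS_Field(2)[of b' ?r c'] by (simp add: succ_elem_def)
      then have "succ_elem r b' c'" using s limit_elem_Restr(3)[OF r, of c' b b'] F' by simp
      then show "dmap (x (b', c')) c \<in> S" using succ c by blast
    qed
    show ?case
      using colimit_pointwise[OF small_category_Well_order[OF r' sm'] lim[OF less(2)] ex] by blast
  qed
qed

lemma transfinite_sequence_pointwise:
  fixes r :: "'s rel"
  assumes lc: "left_closed_class M \<kappa> G S" and seq: "transfinite_sequence \<kappa> D r X x"
    and a: "bottom_elem r a" "\<And>c. c \<in> EObj C \<Longrightarrow> dobj (X a) c \<in> G"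
    and succ: "\<And>b b' c. succ_elem r b b' \<Longrightarrow> c \<in> EObj C \<Longrightarrow> dmap (x (b, b')) c \<in> S"
  shows "c \<in> EObj C \<Longrightarrow> transfinite_sequence \<kappa> M r (\<lambda>j. dobj (X j) c) (\<lambda>u. dmap (x u) c)"
  using transfinite_limits_pointwise[OF assms] seq eval_functor
  unfolding transfinite_sequence_def by blast

lemma transfinite_pointwise:
  fixes r :: "'s rel"
  assumes lc: "left_closed_class M \<kappa> G S" and seq: "transfinite_sequence \<kappa> D r X x"
    and a: "bottom_elem r a" "\<And>c. c \<in> EObj C \<Longrightarrow> dobj (X a) c \<in> G"
    and succ: "\<And>b b' c. succ_elem r b b' \<Longrightarrow> c \<in> EObj C \<Longrightarrow> dmap (x (b, b')) c \<in> S"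
  shows "\<exists>Z t. colimit (order_cat r) D X x Z t"
    and "\<And>Z t c. colimit (order_cat r) D X x Z t \<Longrightarrow> c \<in> EObj C \<Longrightarrow> dmap (t a) c \<in> S"
proof -
  interpret S: left_closed_class M \<kappa> G S by (rule lc)
  have r: "Well_order r" and sm: "small \<kappa> (Field r)" and F: "is_functor (order_cat r) D X x"
    using seq by (auto simp: transfinite_sequence_def)
  have seqM: "transfinite_sequence \<kappa> M r (\<lambda>j. dobj (X j) c) (\<lambda>u. dmap (x u) c)" if "c \<in> EObj C" for c
    by (rule transfinite_sequence_pointwise[OF lc seq a(1) _ _ that]) (use a(2) succ in auto)
  have T: "\<exists>Z t. colimit (order_cat r) M (\<lambda>j. dobj (X j) c) (\<lambda>u. dmap (x u) c) Z t"
    "\<And>Z t. colimit (order_cat r) M (\<lambda>j. dobj (X j) c) (\<lambda>u. dmap (x u) c) Z t \<Longrightarrow> t a \<in> S"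
    if c: "c \<in> EObj C" for c
    using S.cof_transfinite[OF seqM[OF c] a(1) a(2)[OF c] succ[OF _ c]] by blast+
  note J = small_category_Well_order[OF r sm]
  have ex: "\<exists>Z t. colimit (order_cat r) M (\<lambda>j. dobj (X j) c) (\<lambda>u. dmap (x u) c) Z t" if "c \<in> EObj C" for c
    using T(1) that by blast
  show "\<exists>Z t. colimit (order_cat r) D X x Z t"
  proof -
    obtain Z t where "\<And>c. c \<in> EObj C \<Longrightarrow> colimit (order_cat r) M (\<lambda>j. dobj (X j) c) (\<lambda>u. dmap (x u) c) (Z c) (t c)"
      using ex by metis
    then show ?thesis using pointwise_colimit_exists[OF J F] by metis
  qed
  show "dmap (t a) c \<in> S" if "colimit (order_cat r) D X x Z t" "c \<in> EObj C" for Z t c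
    using T(2)[OF that(2) colimit_pointwise[OF J that(1) ex that(2)]] .
qed

end

section \<open>Projective cofibrations\<close>

locale projective_diagrams = cocontinuous_diagrams V M A C \<kappa>
  for V :: "('vo, 'va, 'x) moncat_scheme" and M :: "('o, 'a, 'y) cat_scheme"
    and A :: "('vo, 'va, 'o, 'a) action" (structure) and C :: "('c, 'vo, 'va) ecat" and \<kappa> :: "'s rel" +
  fixes G :: "'o set" and Cf W :: "'a set"
  assumes cofibration_M: "cofibration_category \<kappa> M G Cf W"
    and good_cofibrant: "\<And>X. X \<in> G \<Longrightarrow> cofibrant M Cf X"
    and small_C: "small \<kappa> (EObj C)" and flat_C: "locally_flat V M Cf W A C"
begin

sublocale Cf: left_closed_class M \<kappa> G Cf
  using cofibration_M universe_\<kappa> M.category_axioms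
  by (simp add: left_closed_class_def left_closed_class_axioms_def cofibration_category_def)

sublocale T: left_closed_class M \<kappa> G "W \<inter> Cf"
  using cofibration_M universe_\<kappa> M.category_axioms
  by (simp add: left_closed_class_def left_closed_class_axioms_def cofibration_category_def)

lemma initial_M: "\<exists>Z. initial M Z"
  using cofibration_M by (simp add: cofibration_category_def)

lemma W_subcategory: "subcategory M (Obj M) W" and W_two_out_of_three: "two_out_of_three M W"
  and W_iso: "iso M f \<Longrightarrow> f \<in> W"
  using cofibration_M by (simp_all add: cofibration_category_def)

lemma W_Arr: "f \<in> W \<Longrightarrow> f \<in> Arr M"
  using W_subcategory by (auto simp: subcategory_def)

lemma W_Comp: "f \<in> W \<Longrightarrow> g \<in> W \<Longrightarrow> Dom M g = Cod M f \<Longrightarrow> g \<bullet> f \<in> W"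
  and W_cancel_right: "f \<in> W \<Longrightarrow> g \<in> Arr M \<Longrightarrow> Dom M g = Cod M f \<Longrightarrow> g \<bullet> f \<in> W \<Longrightarrow> g \<in> W"
  and W_cancel_left: "g \<in> W \<Longrightarrow> f \<in> Arr M \<Longrightarrow> Dom M g = Cod M f \<Longrightarrow> g \<bullet> f \<in> W \<Longrightarrow> f \<in> W"
  using W_two_out_of_three W_Arr unfolding two_out_of_three_def by blast+

lemma factorization_M:
  assumes "f \<in> Arr M" "Dom M f \<in> G"
  obtains i w where "i \<in> Cf" "w \<in> W" "Dom M w = Cod M i" "f = w \<bullet> i"
  using cofibration_M assms unfolding cofibration_category_def by blast

lemma strong_Cf: "f \<in> Cf \<Longrightarrow> strong_cofibration M Cf f"
  using good_cofibrant Cf.cof_Dom Cf.cof_Cod by (simp add: strong_cofibration_def)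

text \<open>Here flatness enters: the hom-object is the codomain of the flat map from the initial
  object, and every cofibration is strong because good objects are cofibrant.\<close>

lemma hom_act_cof:
  assumes "c \<in> EObj C" "d \<in> EObj C" "f \<in> Cf"
  shows "H c d \<rhd> f \<in> Cf"
proof -
  obtain Z i where i: "i \<in> hom V Z (H c d)" "flat_map V M Cf W A i"
    using flat_C assms(1,2) unfolding locally_flat_def flat_object_def by blast
  then have "\<forall>f. strong_cofibration M Cf f \<longrightarrow> Ident V (Cod V i) \<diamondop> f \<in> Cf"
    unfolding flat_map_def Let_def by blast
  then show ?thesis using strong_Cf[OF assms(3)] i(1) by (simp add: in_hom_iff)
qed

section \<open>Cells and pointwise cofibrations\<close>

abbreviation "GD \<equiv> pointwise_good V M A C G"
abbreviation "generators \<equiv> {free_diagram_map V M A C c i | c i. c \<in> EObj C \<and> i \<in> Cf}"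
abbreviation "cells \<equiv> cellular_closure \<kappa> D GD generators"
abbreviation "CfD \<equiv> projective_cofibrations \<kappa> V M A C G Cf"
abbreviation "WD \<equiv> pointwise_weq V M A C W"

lemma GD_iff: "X \<in> GD \<longleftrightarrow> X \<in> Obj D \<and> (\<forall>c\<in>EObj C. dobj X c \<in> G)"
  by (simp add: pointwise_good_def)

lemma WD_iff: "f \<in> WD \<longleftrightarrow> f \<in> Arr D \<and> (\<forall>c\<in>EObj C. dmap f c \<in> W)"
  by (simp add: pointwise_weq_def)

text \<open>Stated for any left closed class of \<open>M\<close> with good objects \<open>G\<close>,
  so as to serve for cofibrations and for trivial cofibrations.\<close>

lemma pushout_D:
  assumes lc: "left_closed_class M \<kappa> G S" and f: "f \<in> Arr D" "\<And>c. c \<in> EObj C \<Longrightarrow> dmap f c \<in> S"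
    and g: "g \<in> Arr D" "ddom g = ddom f" "\<And>c. c \<in> EObj C \<Longrightarrow> dobj (dcod g) c \<in> G"
  shows "\<exists>p q. pushout D f g p q"
    and "pushout D f g p q \<Longrightarrow> c \<in> EObj C \<Longrightarrow> pushout M (dmap f c) (dmap g c) (dmap p c) (dmap q c)"
    and "pushout D f g p q \<Longrightarrow> c \<in> EObj C \<Longrightarrow> dmap q c \<in> S"
proof -
  interpret S: left_closed_class M \<kappa> G S by (rule lc)
  have ex: "\<exists>p q. pushout M (dmap f c) (dmap g c) p q" if "c \<in> EObj C" for c
    by (rule S.cof_pushout_exists[OF f(2)[OF that], of "dmap g c"]) (use f(1) g that in auto)
  show "\<exists>p q. pushout D f g p q"
    by (rule D_pushout_exists) (use f(1) g(1,2) ex in auto)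
  show *: "pushout M (dmap f c) (dmap g c) (dmap p c) (dmap q c)" if "pushout D f g p q" "c \<in> EObj C" for c
    by (rule D_pushout_pointwise[OF that ex])
  show "dmap q c \<in> S" if "pushout D f g p q" "c \<in> EObj C"
    by (rule S.cof_pushout[OF f(2)[OF that(2)] _ *[OF that]]) (use g that(2) in auto)
qed

text \<open>The induction hypothesis makes the next colimit pointwise: coproducts of good objects,
  and pushouts and transfinite composites of cofibrations, exist in \<open>M\<close>. The colimit in
  \<open>D\<close> therefore agrees with them, and \<open>Cf\<close> is closed under the
  operation.\<close>

lemma cells_pointwise: "f \<in> cells \<Longrightarrow> f \<in> Arr D \<and> (\<forall>c\<in>EObj C. dmap f c \<in> Cf)"
proof (induction rule: cellular_closure.induct)
  case (generator f)
  then show ?case using hom_act_cof Cf.cof_Arr by auto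
next
  case (coproducts I f P p Q q h)
  have f: "f i \<in> Arr D" "\<And>c. c \<in> EObj C \<Longrightarrow> dmap (f i) c \<in> Cf" if "i \<in> I" for i
    using coproducts.IH[OF that] by auto
  have d: "dobj (ddom (f i)) c \<in> G" "dobj (dcod (f i)) c \<in> G" if "i \<in> I" "c \<in> EObj C" for i c
    using Cf.cof_Dom[OF f(2)[OF that]] Cf.cof_Cod[OF f(2)[OF that]] f(1)[OF that(1)] that(2) by auto
  have hp: "h \<in> Arr D" "ddom h = P" "dcod h = Q" using coproducts.hyps by (auto simp: in_hom_iff)
  have "dmap h c \<in> Cf" if c: "c \<in> EObj C" for c
  proof (rule Cf.cof_coproduct)
    show "small \<kappa> I" by (rule coproducts.hyps)
    show "dmap (f i) c \<in> Cf" if "i \<in> I" for i using f that c by blast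
    have P: "coproduct M I (\<lambda>i. dobj (ddom (f i)) c) (dobj P c) (\<lambda>i. dmap (p i) c)"
    proof (rule D_coproduct_pointwise[OF coproducts.hyps(1) _ c])
      show "\<exists>P p. coproduct M I (\<lambda>i. dobj (ddom (f i)) c) P p" if "c \<in> EObj C" for c
        by (rule Cf.good_coproduct_exists_index[OF coproducts.hyps(1), of "\<lambda>i. dobj (ddom (f i)) c"])
          (use d that in auto)
    qed (use coproducts.hyps in simp)
    have Q: "coproduct M I (\<lambda>i. dobj (dcod (f i)) c) (dobj Q c) (\<lambda>i. dmap (q i) c)"
    proof (rule D_coproduct_pointwise[OF coproducts.hyps(1) _ c])
      show "\<exists>P p. coproduct M I (\<lambda>i. dobj (dcod (f i)) c) P p" if "c \<in> EObj C" for c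
        by (rule Cf.good_coproduct_exists_index[OF coproducts.hyps(1), of "\<lambda>i. dobj (dcod (f i)) c"])
          (use d that in auto)
    qed (use coproducts.hyps in simp)
    show "coproduct M I (\<lambda>i. Dom M (dmap (f i) c)) (dobj P c) (\<lambda>i. dmap (p i) c)"
      using P f c by (subst coproduct_cong[where X' = "\<lambda>i. dobj (ddom (f i)) c"]) auto
    show "coproduct M I (\<lambda>i. Cod M (dmap (f i) c)) (dobj Q c) (\<lambda>i. dmap (q i) c)"
      using Q f c by (subst coproduct_cong[where X' = "\<lambda>i. dobj (dcod (f i)) c"]) auto
    show "dmap h c \<in> hom M (dobj P c) (dobj Q c)" using hp c by (auto simp: in_hom_iff)
    show "dmap h c \<bullet> dmap (p i) c = dmap (q i) c \<bullet> dmap (f i) c" if "i \<in> I" for i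
      using coproducts.hyps(6)[OF that] dmap_Comp[OF c] by metis
  qed
  then show ?case using hp by blast
next
  case (cobase_change f g p q)
  note P = D.pushoutD[OF cobase_change.hyps(4)]
  have g: "\<And>c. c \<in> EObj C \<Longrightarrow> dobj (dcod g) c \<in> G"
    using cobase_change.hyps(3) by (simp add: GD_iff)
  have "dmap q c \<in> Cf" if "c \<in> EObj C" for c
    by (rule pushout_D(3)[OF Cf.left_closed_class_axioms _ _ _ _ g cobase_change.hyps(4) that])
      (use cobase_change.IH P in auto)
  then show ?case using P by simp
next
  case (transfinite_composite r X x a Z t)
  have "dmap (t a) c \<in> Cf" if "c \<in> EObj C" for c
    by (rule transfinite_pointwise(2)[OF Cf.left_closed_class_axioms transfinite_composite.hyps(1,2)])
      (use transfinite_composite that in \<open>auto simp: GD_iff\<close>)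
  moreover have "t a \<in> Arr D"
    using D.colimit_leg[OF transfinite_composite.hyps(5)] transfinite_composite.hyps(2)
    by (simp add: bottom_elem_def in_hom_iff)
  ultimately show ?case by blast
qed

lemma cells_Arr: "f \<in> cells \<Longrightarrow> f \<in> Arr D"
  and cells_cof: "f \<in> cells \<Longrightarrow> c \<in> EObj C \<Longrightarrow> dmap f c \<in> Cf"
  using cells_pointwise by blast+

lemma cells_good: "f \<in> cells \<Longrightarrow> ddom f \<in> GD" "f \<in> cells \<Longrightarrow> dcod f \<in> GD"
  using cells_Arr Cf.cof_Dom[OF cells_cof] Cf.cof_Cod[OF cells_cof] by (auto simp: GD_iff)

lemma CfD_iff: "f \<in> CfD \<longleftrightarrow> f \<in> cells"
  using cells_good by (auto simp: projective_cofibrations_def)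

text \<open>An isomorphism is a transfinite composite over an order with a single element: for the
  constant sequence at its domain, \<open>f\<close> exhibits its codomain as a colimit.\<close>

lemma iso_cells:
  assumes f: "iso D f" and G: "ddom f \<in> GD"
  shows "f \<in> cells"
proof -
  \<comment> \<open>Any element of the type can be the only index.\<close>
  fix a :: 's
  let ?r = "{(a, a)}"
  let ?X = "\<lambda>_::'s. ddom f" and ?x = "\<lambda>_::'s \<times> 's. Ident D (ddom f)"
  have fA: "f \<in> Arr D" using D.iso_Arr[OF f] .
  have X: "ddom f \<in> Obj D" using fA by simp
  have F: "Field ?r = {a}" by (simp add: Field_def)
  have bot: "bottom_elem ?r a" by (auto simp: bottom_elem_def underS_def)
  have Xfun: "is_functor (order_cat ?r) D ?X ?x" using X by (auto simp: is_functor_order_cat in_hom_iff)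
  have seq: "transfinite_sequence \<kappa> D ?r ?X ?x"
    unfolding transfinite_sequence_def
  proof (intro conjI allI impI)
    show "Well_order ?r"
      by (auto simp: well_order_on_def linear_order_on_def partial_order_on_def preorder_on_def
          refl_on_def trans_def antisym_def total_on_def Field_def wf_def)
    show "small \<kappa> (Field ?r)" unfolding F by (rule small_finite[OF universe_\<kappa>]) simp
    show "colimit (order_cat (Restr ?r (underS ?r b))) D ?X ?x (?X b) (\<lambda>a. ?x (a, b))" if "limit_elem ?r b" for b
      using that bot by (auto simp: limit_elem_def)
  qed (use Xfun F in auto)
  have "colimit (order_cat ?r) D ?X ?x (dcod f) (\<lambda>_. f)"
    unfolding colimit_def
  proof (intro conjI Xfun allI impI)
    show "cocone (order_cat ?r) D ?X ?x (dcod f) (\<lambda>_. f)"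
      unfolding cocone_order_cat using fA by (auto simp: in_hom_iff)
    fix Y s assume s: "cocone (order_cat ?r) D ?X ?x Y s"
    then have sa: "s a \<in> Arr D" "ddom (s a) = ddom f" "dcod (s a) = Y"
      unfolding cocone_order_cat by (auto simp: in_hom_iff)
    show "\<exists>!h. h \<in> hom D (dcod f) Y \<and> (\<forall>j\<in>Obj (order_cat ?r). h \<cdot>\<^bsub>D\<^esub> f = s j)"
    proof (rule ex1I[of _ "s a \<cdot>\<^bsub>D\<^esub> inverse_of D f"])
      show "s a \<cdot>\<^bsub>D\<^esub> inverse_of D f \<in> hom D (dcod f) Y \<and> (\<forall>j\<in>Obj (order_cat ?r). (s a \<cdot>\<^bsub>D\<^esub> inverse_of D f) \<cdot>\<^bsub>D\<^esub> f = s j)"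
        using sa f fA D.Arr_inverse_of[OF f] D.Dom_inverse_of[OF f] D.Cod_inverse_of[OF f] D.inverse_of_Comp[OF f]
          D.Comp_Ident_Dom[of "s a"]
        by (auto simp: in_hom_iff D.Comp_Comp)
      fix h assume h: "h \<in> hom D (dcod f) Y \<and> (\<forall>j\<in>Obj (order_cat ?r). h \<cdot>\<^bsub>D\<^esub> f = s j)"
      then have "s a \<cdot>\<^bsub>D\<^esub> inverse_of D f = (h \<cdot>\<^bsub>D\<^esub> f) \<cdot>\<^bsub>D\<^esub> inverse_of D f" by (simp add: F)
      also have "\<dots> = h \<cdot>\<^bsub>D\<^esub> f \<cdot>\<^bsub>D\<^esub> inverse_of D f"
        using h fA D.Arr_inverse_of[OF f] D.Dom_inverse_of[OF f] D.Cod_inverse_of[OF f]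
        by (intro D.Comp_Comp) (auto simp: in_hom_iff)
      also have "\<dots> = h" using h D.Comp_inverse_of[OF f] D.Comp_Ident_Dom[of h] by (auto simp: in_hom_iff)
      finally show "h = s a \<cdot>\<^bsub>D\<^esub> inverse_of D f" by simp
    qed
  qed
  from cellular_closure.transfinite_composite[OF seq bot _ _ this]
  show ?thesis using G by (auto simp: succ_elem_def underS_def)
qed

text \<open>Binary composites arise as transfinite ones: the sequence \<open>f\<close>,
  \<open>g\<close>, identity, identity, and so on has the codomain of \<open>g\<close> as its
  colimit, and its leg at the start is the composite.\<close>

lemma Comp_cells:
  assumes f: "f \<in> cells" and g: "g \<in> cells" and fg: "ddom g = dcod f"
  shows "g \<cdot>\<^bsub>D\<^esub> f \<in> cells"
proof -
  let ?Z = "dcod g"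
  define X where "X n = (if n = 0 then ddom f else if n = 1 then dcod f else ?Z)" for n :: nat
  define x where "x n = (if n = 0 then f else if n = 1 then g else Ident D ?Z)" for n :: nat
  define t where "t n = (if n = 0 then g \<cdot>\<^bsub>D\<^esub> f else if n = 1 then g else Ident D ?Z)" for n :: nat
  have fA: "f \<in> Arr D" and gA: "g \<in> Arr D" using f g cells_Arr by auto
  have Z: "?Z \<in> Obj D" using gA by simp
  note I = D.Arr_Ident[OF Z] D.Ident_Cod_Comp[of g ?Z] D.Ident_Cod_Comp[of "Ident D ?Z" ?Z]
  have x: "x n \<in> hom D (X n) (X (Suc n))" for n
    using fA gA fg I by (auto simp: x_def X_def in_hom_iff)
  have colim: "seq_colimit D X x ?Z t"
    unfolding seq_colimit_def
  proof (intro conjI allI impI Z)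
    show "t n \<in> hom D (X n) ?Z" "t (Suc n) \<cdot>\<^bsub>D\<^esub> x n = t n" for n
      using fA gA fg I by (auto simp: x_def X_def t_def in_hom_iff)
    fix Y s assume s: "Y \<in> Obj D \<and> (\<forall>n. s n \<in> hom D (X n) Y \<and> s (Suc n) \<cdot>\<^bsub>D\<^esub> x n = s n)"
    have sA: "s n \<in> Arr D" "ddom (s n) = X n" "dcod (s n) = Y" for n using s by (auto simp: in_hom_iff)
    have s0: "s 1 \<cdot>\<^bsub>D\<^esub> f = s 0" and s1: "s 2 \<cdot>\<^bsub>D\<^esub> g = s 1"
    proof -
      have "s (Suc 0) \<cdot>\<^bsub>D\<^esub> x 0 = s 0" "s (Suc 1) \<cdot>\<^bsub>D\<^esub> x 1 = s 1" using s by blast+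
      then show "s 1 \<cdot>\<^bsub>D\<^esub> f = s 0" "s 2 \<cdot>\<^bsub>D\<^esub> g = s 1" by (simp_all add: x_def numeral_2_eq_2)
    qed
    have s2: "s n = s 2" if "n \<ge> 2" for n
      using that
    proof (induction n rule: dec_induct)
      case (step n)
      have "s (Suc n) \<cdot>\<^bsub>D\<^esub> x n = s n" using s by blast
      then have "s (Suc n) \<cdot>\<^bsub>D\<^esub> Ident D ?Z = s n" using step by (simp add: x_def)
      then show ?case using step D.Comp_Ident_Dom[of "s (Suc n)" ?Z] sA[of "Suc n"] by (simp add: X_def)
    qed simp
    have h: "s 2 \<cdot>\<^bsub>D\<^esub> t n = s n" for n
    proof -
      consider "n = 0" | "n = 1" | "n \<ge> 2" by linarith
      then show ?thesis
      proof cases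
        case 1
        have "s 2 \<cdot>\<^bsub>D\<^esub> g \<cdot>\<^bsub>D\<^esub> f = s 1 \<cdot>\<^bsub>D\<^esub> f"
          by (rule D.Comp_eq_Arr[OF s1]) (use sA[of 2] gA fA fg in \<open>auto simp: X_def\<close>)
        then show ?thesis using 1 s0 by (simp add: t_def)
      next
        case 2 then show ?thesis using s1 by (simp add: t_def)
      next
        case 3
        then show ?thesis using s2[OF 3] D.Comp_Ident_Dom[of "s 2" ?Z] sA[of 2] by (simp add: t_def X_def)
      qed
    qed
    show "\<exists>!h. h \<in> hom D ?Z Y \<and> (\<forall>n. h \<cdot>\<^bsub>D\<^esub> t n = s n)"
    proof (rule ex1I[of _ "s 2"])
      show "s 2 \<in> hom D ?Z Y \<and> (\<forall>n. s 2 \<cdot>\<^bsub>D\<^esub> t n = s n)" using h sA[of 2] by (auto simp: in_hom_iff X_def)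
      fix k assume k: "k \<in> hom D ?Z Y \<and> (\<forall>n. k \<cdot>\<^bsub>D\<^esub> t n = s n)"
      then have "k \<cdot>\<^bsub>D\<^esub> t 2 = s 2" by blast
      then have "k \<cdot>\<^bsub>D\<^esub> Ident D ?Z = s 2" by (simp add: t_def)
      then show "k = s 2" using D.Comp_Ident_Dom[of k ?Z] k by (simp add: in_hom_iff)
    qed
  qed
  obtain r :: "'s rel" and X' x' a where r: "transfinite_sequence \<kappa> D r X' x'" "bottom_elem r a" "X' a = X 0"
    "\<And>b c. succ_elem r b c \<Longrightarrow> \<exists>n. x' (b, c) = x n"
    "\<And>Z t. seq_colimit D X x Z t \<Longrightarrow> \<exists>t'. colimit (order_cat r) D X' x' Z t' \<and> t' a = t 0"
    using D.sequence_transfinite[where x = x and X = X, OF universe_\<kappa> x] by metis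
  obtain t' where t': "colimit (order_cat r) D X' x' ?Z t'" "t' a = t 0" using r(5)[OF colim] by blast
  have xc: "x n \<in> cells" for n
    using f g iso_cells[OF D.iso_Ident[OF Z]] cells_good(2)[OF g] by (auto simp: x_def)
  have "t' a \<in> cells"
  proof (rule cellular_closure.transfinite_composite[OF r(1,2) _ _ t'(1)])
    have "X 0 = ddom f" by (simp add: X_def)
    then show "X' a \<in> GD" using r(3) cells_good(1)[OF f] by (simp only:)
    show "x' (b, c) \<in> cells" if bc: "succ_elem r b c" for b c
    proof -
      obtain n where "x' (b, c) = x n" using r(4)[OF bc] by blast
      then show ?thesis using xc[of n] by (simp only:)
    qed
  qed
  then show ?thesis using t'(2) by (simp add: t_def)
qed

lemma GD_coproduct:
  assumes I: "small \<kappa> (I :: 's set)" and X: "\<And>i. i \<in> I \<Longrightarrow> X i \<in> GD"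
  shows "\<exists>P p. coproduct D I X P p" "coproduct D I X P p \<Longrightarrow> P \<in> GD"
proof -
  have XG: "X i \<in> Obj D" "c \<in> EObj C \<Longrightarrow> dobj (X i) c \<in> G" if "i \<in> I" for i c
    using X[OF that] by (auto simp: GD_iff)
  have ex: "\<exists>P p. coproduct M I (\<lambda>i. dobj (X i) c) P p" if "c \<in> EObj C" for c
    by (rule Cf.good_coproduct_exists_index[OF I, of "\<lambda>i. dobj (X i) c"]) (use XG that in auto)
  show "\<exists>P p. coproduct D I X P p" by (rule D_coproduct_exists[OF I XG(1) ex])
  show "P \<in> GD" if P: "coproduct D I X P p"
  proof -
    have "dobj P c \<in> G" if c: "c \<in> EObj C" for c
      by (rule Cf.good_coproduct[OF I _ D_coproduct_pointwise[OF I P c ex]]) (use XG c in auto)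
    then show ?thesis using D.coproductD(1)[OF P] by (simp add: GD_iff)
  qed
qed

text \<open>With \<open>S\<close> the cofibrations or the trivial cofibrations of \<open>M\<close>,
  the class \<open>SD\<close> consists of the projective cofibrations or the trivial ones. Existence
  of colimits and membership in \<open>S\<close> are pointwise matters, and membership in
  \<open>cells\<close> is a rule of the closure, up to the two lemmas on isomorphisms and
  composites.\<close>

lemma left_closed_D_generic:
  assumes lc: "left_closed_class M \<kappa> G S"
    and S: "\<And>f. f \<in> SD \<longleftrightarrow> f \<in> cells \<and> (\<forall>c\<in>EObj C. dmap f c \<in> S)"
  shows "left_closed \<kappa> D GD SD"
  unfolding left_closed_def
proof (intro conjI allI impI)
  interpret S: left_closed_class M \<kappa> G S by (rule lc)
  have SA: "f \<in> Arr D" if "f \<in> SD" for f using that S cells_Arr by blast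
  have iso: "f \<in> SD" if "iso D f" "ddom f \<in> GD" for f
    unfolding S using iso_cells[OF that] S.cof_iso[OF iso_pointwise[OF that(1)]] D.iso_Arr[OF that(1)] that(2)
    by (auto simp: GD_iff)
  show "subcategory D GD SD"
    unfolding subcategory_def
  proof (intro conjI ballI impI)
    show "GD \<subseteq> Obj D" by (auto simp: GD_iff)
    show "SD \<subseteq> Arr D" using SA by blast
    show "Dom D f \<in> GD" "Cod D f \<in> GD" if "f \<in> SD" for f using that S cells_good by auto
    show "Ident D X \<in> SD" if "X \<in> GD" for X
      using that by (intro iso D.iso_Ident) (auto simp: GD_iff)
    show "g \<cdot>\<^bsub>D\<^esub> f \<in> SD" if "f \<in> SD" "g \<in> SD" "Dom D g = Cod D f" for f g
      using that SA[of f] SA[of g] Comp_cells[of f g] unfolding S by (auto intro!: S.cof_Comp)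
  qed
  show "f \<in> SD" if "iso D f \<and> Dom D f \<in> GD" for f using that iso by simp
  show "\<exists>P p. coproduct D I X P p" if "small \<kappa> I \<and> (\<forall>i\<in>I. X i \<in> GD)" for I :: "'s set" and X
    using GD_coproduct(1)[of I X] that by blast
  show "P \<in> GD" if "small \<kappa> I \<and> (\<forall>i\<in>I. X i \<in> GD)" "coproduct D I X P p" for I :: "'s set" and X P p
    using GD_coproduct(2)[of I X P p] that by blast
  show "\<exists>p q. pushout D f g p q" if "f \<in> SD \<and> g \<in> Arr D \<and> Dom D g = Dom D f \<and> Cod D g \<in> GD" for f g
    by (rule pushout_D(1)[OF lc]) (use that S SA in \<open>auto simp: GD_iff\<close>)
  show "q \<in> SD" if fg: "f \<in> SD \<and> g \<in> Arr D \<and> Dom D g = Dom D f \<and> Cod D g \<in> GD" and po: "pushout D f g p q" for f g p q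
    unfolding S
  proof (intro conjI ballI)
    show "q \<in> cells"
      by (rule cellular_closure.cobase_change[OF _ _ _ po]) (use fg S cells_good in auto)
    show "dmap q c \<in> S" if "c \<in> EObj C" for c
      by (rule pushout_D(3)[OF lc _ _ _ _ _ po that]) (use fg S SA in \<open>auto simp: GD_iff\<close>)
  qed
next
  fix r :: "'s rel" and X x a
  assume *: "transfinite_sequence \<kappa> D r X x \<and> bottom_elem r a \<and> X a \<in> GD \<and> (\<forall>b c. succ_elem r b c \<longrightarrow> x (b, c) \<in> SD)"
  then have 1: "transfinite_sequence \<kappa> D r X x" and 2: "bottom_elem r a" and 3: "X a \<in> GD"
    and 4: "\<And>b c. succ_elem r b c \<Longrightarrow> x (b, c) \<in> SD" by auto
  have 5: "\<And>c. c \<in> EObj C \<Longrightarrow> dobj (X a) c \<in> G" using 3 by (simp add: GD_iff)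
  have 6: "\<And>b b' c. succ_elem r b b' \<Longrightarrow> c \<in> EObj C \<Longrightarrow> dmap (x (b, b')) c \<in> S" using 4 S by blast
  show "\<exists>Z t. colimit (order_cat r) D X x Z t"
    by (rule transfinite_pointwise(1)[OF lc 1 2 5 6])
  show "t a \<in> SD" if "colimit (order_cat r) D X x Z t" for Z t
    unfolding S
  proof (intro conjI ballI)
    show "t a \<in> cells"
      by (rule cellular_closure.transfinite_composite[OF 1 2 3 _ that]) (use 4 S in blast)
    show "dmap (t a) c \<in> S" if "c \<in> EObj C" for c
      by (rule transfinite_pointwise(2)[OF lc 1 2 5 6 \<open>colimit (order_cat r) D X x Z t\<close> that])
  qed
qed

lemma left_closed_CfD: "left_closed \<kappa> D GD CfD"
  by (rule left_closed_D_generic[OF Cf.left_closed_class_axioms]) (use CfD_iff cells_cof in blast)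

lemma left_closed_trivial_CfD: "left_closed \<kappa> D GD (WD \<inter> CfD)"
  by (rule left_closed_D_generic[OF T.left_closed_class_axioms]) (use CfD_iff cells_cof cells_Arr WD_iff in blast)

lemma W_D: "subcategory D (Obj D) WD" "two_out_of_three D WD" "iso D f \<Longrightarrow> f \<in> WD"
proof -
  have "Ident D X \<in> WD" if "X \<in> Obj D" for X
    using that D.Arr_Ident[OF that] W_iso[OF M.iso_Ident] by (simp add: WD_iff)
  then show "subcategory D (Obj D) WD"
    using W_Comp by (auto simp: subcategory_def WD_iff)
  show "two_out_of_three D WD"
    unfolding two_out_of_three_def WD_iff
  proof (intro ballI impI conjI; (elim conjE)?)
    fix f g c assume fg: "f \<in> Arr D" "g \<in> Arr D" "Dom D g = Cod D f" and c: "c \<in> EObj C"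
    note fg' = fg[unfolded Dom_D Cod_D]
    show "dmap (g \<cdot>\<^bsub>D\<^esub> f) c \<in> W" if "\<forall>c\<in>EObj C. dmap f c \<in> W" "\<forall>c\<in>EObj C. dmap g c \<in> W"
      using that fg' c W_Comp[of "dmap f c" "dmap g c"] by simp
    show "dmap g c \<in> W" if "\<forall>c\<in>EObj C. dmap f c \<in> W" "\<forall>c\<in>EObj C. dmap (g \<cdot>\<^bsub>D\<^esub> f) c \<in> W"
      using that fg' c W_cancel_right[of "dmap f c" "dmap g c"] by simp
    show "dmap f c \<in> W" if "\<forall>c\<in>EObj C. dmap g c \<in> W" "\<forall>c\<in>EObj C. dmap (g \<cdot>\<^bsub>D\<^esub> f) c \<in> W"
      using that fg' c W_cancel_left[of "dmap g c" "dmap f c"] by simp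
  qed auto
  show "iso D f \<Longrightarrow> f \<in> WD"
    using D.iso_Arr[of f] W_iso[OF iso_pointwise, of f] by (simp add: WD_iff)
qed

text \<open>Makes reindexing of coproducts and composites of sequences available for
  diagrams.\<close>

sublocale CfD: left_closed_class D \<kappa> GD CfD
  by (simp add: left_closed_class_def left_closed_class_axioms_def universe_\<kappa> left_closed_CfD D.category_axioms)

end

section \<open>Factorizations\<close>

lemma seq_colimit_ex1:
  assumes "seq_colimit C X x Z t" "Y \<in> Obj C" "\<And>n. s n \<in> hom C (X n) Y" "\<And>n. s (Suc n) \<cdot>\<^bsub>C\<^esub> x n = s n"
  shows "\<exists>!h. h \<in> hom C Z Y \<and> (\<forall>n. h \<cdot>\<^bsub>C\<^esub> t n = s n)"
  using assms unfolding seq_colimit_def by simp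

section \<open>Pasting of pushouts\<close>

context category
begin

lemma commuting_square_sym: "commuting_square C f g p q \<longleftrightarrow> commuting_square C g f q p"
  unfolding commuting_square_def by metis

lemma pushout_sym:
  assumes po: "pushout C f g p q"
  shows "pushout C g f q p"
  unfolding pushout_def
proof (intro conjI allI impI)
  show "commuting_square C g f q p"
    using po commuting_square_sym by (simp add: pushout_def)
  fix q' p' assume "commuting_square C g f q' p'"
  then have s: "commuting_square C f g p' q'" using commuting_square_sym by blast
  have e: "Cod C q = Cod C p" "Cod C q' = Cod C p'"
    using po s by (auto simp: pushout_def commuting_square_def)
  have "\<exists>!h. h \<in> hom C (Cod C p) (Cod C p') \<and> h \<cdot> p = p' \<and> h \<cdot> q = q'"
    using po s unfolding pushout_def by blast
  then show "\<exists>!h. h \<in> hom C (Cod C q) (Cod C q') \<and> h \<cdot> q = q' \<and> h \<cdot> p = p'"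
    unfolding e by (simp add: conj_commute)
qed

text \<open>Pasting: when the pushout of \<open>k \<cdot> j\<close> along \<open>x\<close> is split
  at the pushout of \<open>j\<close>, the remaining square shows \<open>l\<close> as the cobase
  change of \<open>k\<close> along \<open>p\<close>. Properties of \<open>k\<close> thus pass to
  \<open>l\<close>.\<close>

lemma pushout_cancel:
  assumes inner: "pushout C j x p q" and outer: "pushout C (k \<cdot> j) x p1 q1"
    and k: "k \<in> Arr C" "Dom C k = Cod C j" and l: "l \<in> hom C (Cod C p) (Cod C p1)" "l \<cdot> p = p1 \<cdot> k" "l \<cdot> q = q1"
  shows "pushout C k p p1 l"
  unfolding pushout_def
proof (intro conjI allI impI)
  note I = pushoutD[OF inner] and O = pushoutD[OF outer]
  have lA: "l \<in> Arr C" "Dom C l = Cod C p" "Cod C l = Cod C p1" using l by (auto simp: in_hom_iff)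
  have kj: "Cod C (k \<cdot> j) = Cod C k" using k I by simp
  show "commuting_square C k p p1 l"
    using I O k l lA kj by (auto simp: commuting_square_def)
  fix a b assume "commuting_square C k p a b"
  then have ab: "a \<in> Arr C" "b \<in> Arr C" "Dom C a = Cod C k" "Dom C b = Cod C p" "Cod C b = Cod C a" "a \<cdot> k = b \<cdot> p"
    by (auto simp: commuting_square_def)
  have "a \<cdot> k \<cdot> j = b \<cdot> p \<cdot> j"
    by (rule Comp_eq_Comp[OF ab(6)]) (use ab I k in auto)
  also have "\<dots> = b \<cdot> q \<cdot> x" using I by simp
  finally have "a \<cdot> k \<cdot> j = (b \<cdot> q) \<cdot> x" using ab I by (simp add: Comp_Comp)
  then obtain h where h: "h \<in> hom C (Cod C p1) (Cod C a)" "h \<cdot> p1 = a" "h \<cdot> q1 = b \<cdot> q"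
    using pushout_induced[OF outer, of a "Cod C a" "b \<cdot> q"] ab I k kj by (auto simp: in_hom_iff)
  have hA: "h \<in> Arr C" "Dom C h = Cod C p1" "Cod C h = Cod C a" using h by (auto simp: in_hom_iff)
  show "\<exists>!h. h \<in> hom C (Cod C p1) (Cod C a) \<and> h \<cdot> p1 = a \<and> h \<cdot> l = b"
  proof (rule ex1I[of _ h])
    have "h \<cdot> l = b"
    proof (rule pushout_joint_epi[OF inner])
      have "(h \<cdot> l) \<cdot> p = h \<cdot> p1 \<cdot> k" using hA lA I l by (simp add: Comp_Comp)
      also have "\<dots> = a \<cdot> k" by (rule Comp_eq_Arr[OF h(2)]) (use hA O k kj in auto)
      finally show "(h \<cdot> l) \<cdot> p = b \<cdot> p" using ab by simp
      show "(h \<cdot> l) \<cdot> q = b \<cdot> q" using hA lA I l h by (simp add: Comp_Comp)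
    qed (use hA lA ab in \<open>auto simp: in_hom_iff\<close>)
    then show "h \<in> hom C (Cod C p1) (Cod C a) \<and> h \<cdot> p1 = a \<and> h \<cdot> l = b" using h by blast
    fix h' assume h': "h' \<in> hom C (Cod C p1) (Cod C a) \<and> h' \<cdot> p1 = a \<and> h' \<cdot> l = b"
    then have h'A: "h' \<in> Arr C" "Dom C h' = Cod C p1" by (auto simp: in_hom_iff)
    have "h' \<cdot> l \<cdot> q = b \<cdot> q" by (rule Comp_eq_Arr) (use h' h'A lA I in auto)
    then have "h' \<cdot> q1 = h \<cdot> q1" by (simp only: l(3) h(3))
    moreover have "h' \<cdot> p1 = h \<cdot> p1" using h' by (simp only: h(2))
    moreover have "h' \<in> hom C (Cod C p1) (Cod C a)" using h' by blast
    ultimately show "h' = h" by (intro pushout_joint_epi[OF outer _ h(1)])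
  qed
qed

end

section \<open>The relative mapping cylinder of one step\<close>

context projective_diagrams
begin

text \<open>Since the units \<open>I \<rightarrow> C(c, c)\<close> are not assumed to be flat, the map \<open>q : P \<rightarrow> X'\<close> of a
  stage of the construction need not be a cofibration. It becomes one, \<open>s : P \<rightarrow> R'\<close>, after a
  replacement of \<open>X'\<close> by a trivial cofibration \<open>j' : X' \<rightarrow> R'\<close> with retraction \<open>v\<close>.\<close>

lemma cylinder_step:
  assumes j: "j \<in> W \<inter> Cf" and x: "x \<in> Cf" "Dom M x = Dom M j" and k: "k \<in> Cf" "Dom M k = Cod M j"
    and q: "q \<in> hom M (Cod M k) (Cod M x)" "q \<bullet> k \<bullet> j = x"
  obtains s j' v where "s \<in> Cf" "Dom M s = Cod M k" "Cod M s = Cod M j'" "j' \<in> W \<inter> Cf" "Dom M j' = Cod M x"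
    "v \<in> hom M (Cod M j') (Cod M x)" "v \<bullet> j' = Ident M (Cod M x)" "v \<bullet> s = q"
    "s \<bullet> k \<bullet> j = j' \<bullet> x"
    "\<And>a b. pushout M j x a b \<Longrightarrow>
      \<exists>l. l \<in> W \<inter> Cf \<and> l \<in> hom M (Cod M a) (Cod M j') \<and> l \<bullet> a = s \<bullet> k \<and> l \<bullet> b = j'"
proof -
  have jA: "j \<in> Arr M" and xA: "x \<in> Arr M" and kA: "k \<in> Arr M" using j x k Cf.cof_Arr by auto
  have qA: "q \<in> Arr M" "Dom M q = Cod M k" "Cod M q = Cod M x" using q by (auto simp: in_hom_iff)
  have i: "k \<bullet> j \<in> Cf" using j k by (intro Cf.cof_Comp) auto
  have iA: "k \<bullet> j \<in> Arr M" "Dom M (k \<bullet> j) = Dom M j" "Cod M (k \<bullet> j) = Cod M k" using jA kA k by auto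
  \<comment> \<open>Write \<open>j : X -> R\<close>, \<open>k : R -> P\<close> and
    \<open>x : X -> X'\<close>. This is the pushout of \<open>P\<close> and \<open>X'\<close> under
    \<open>X\<close>, and factoring the map \<open>m\<close> below, which is \<open>q\<close> on
    \<open>P\<close> and the identity on \<open>X'\<close>, yields a mapping cylinder of
    \<open>q\<close> relative to \<open>X\<close>.\<close>
  obtain p1 q1 where po: "pushout M (k \<bullet> j) x p1 q1" "q1 \<in> Cf"
    using Cf.cof_pushout_exists[OF i xA] x iA Cf.cof_Cod[OF x(1)] by auto
  note PO = M.pushoutD[OF po(1)]
  have p1: "p1 \<in> Cf"
    using Cf.cof_pushout[OF x(1) _ M.pushout_sym[OF po(1)]] Cf.cof_Cod[OF i] by auto
  obtain m where m: "m \<in> hom M (Cod M p1) (Cod M x)" "m \<bullet> p1 = q" "m \<bullet> q1 = Ident M (Cod M x)"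
    using M.pushout_induced[OF po(1), of q "Cod M x" "Ident M (Cod M x)"] q iA xA by (auto simp: in_hom_iff)
  have mA: "m \<in> Arr M" "Dom M m = Cod M p1" "Cod M m = Cod M x" using m by (auto simp: in_hom_iff)
  have "Dom M m \<in> G" using mA p1 Cf.cof_Cod by simp
  then obtain e v where e: "e \<in> Cf" and v: "v \<in> W" "Dom M v = Cod M e" "m = v \<bullet> e"
    using factorization_M[OF mA(1)] by blast
  have eA: "e \<in> Arr M" and vA: "v \<in> Arr M" using e v Cf.cof_Arr W_Arr by auto
  have eD: "Dom M e = Cod M p1" "Cod M v = Cod M x" using mA v eA vA by auto
  define s where "s = e \<bullet> p1"
  define j' where "j' = e \<bullet> q1"
  have s: "s \<in> Cf" "Dom M s = Cod M k" "Cod M s = Cod M e"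
    using e p1 eA PO eD iA by (auto simp: s_def intro!: Cf.cof_Comp)
  have j': "j' \<in> Cf" "Dom M j' = Cod M x" "Cod M j' = Cod M e"
    using e po eA PO eD by (auto simp: j'_def intro!: Cf.cof_Comp)
  have vj': "v \<bullet> j' = Ident M (Cod M x)"
    using m(3) v eA vA PO eD by (simp add: j'_def M.Comp_Comp)
  have vs: "v \<bullet> s = q" using m(2) v eA vA PO eD by (simp add: s_def M.Comp_Comp)
  \<comment> \<open>\<open>j'\<close> is a section of the weak equivalence \<open>v\<close>, so
    two-out-of-three applies.\<close>
  have j'W: "j' \<in> W"
    by (rule W_cancel_left[OF v(1)]) (use vj' W_iso M.iso_Ident xA Cf.cof_Arr j' v in auto)
  have sq: "s \<bullet> k \<bullet> j = j' \<bullet> x"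
    using eA PO eD iA xA by (simp add: s_def j'_def M.Comp_Comp)
  \<comment> \<open>The comparison map from the pushout of \<open>R\<close> and \<open>X'\<close> is
    \<open>e \<bullet> l1\<close>, where \<open>l1\<close> is a cobase change of \<open>k\<close>;
    so it is a cofibration. It is a weak equivalence because \<open>b\<close> and \<open>j'\<close>
    are.\<close>
  have latch: "\<exists>l. l \<in> W \<inter> Cf \<and> l \<in> hom M (Cod M a) (Cod M j') \<and> l \<bullet> a = s \<bullet> k \<and> l \<bullet> b = j'"
    if ab: "pushout M j x a b" for a b
  proof -
    note AB = M.pushoutD[OF ab]
    have "p1 \<bullet> k \<bullet> j = q1 \<bullet> x" using PO by simp
    then have "(p1 \<bullet> k) \<bullet> j = q1 \<bullet> x" using PO jA kA k iA by (simp add: M.Comp_Comp)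
    then obtain l1 where l1: "l1 \<in> hom M (Cod M a) (Cod M p1)" "l1 \<bullet> a = p1 \<bullet> k" "l1 \<bullet> b = q1"
      using M.pushout_induced[OF ab, of "p1 \<bullet> k" "Cod M p1" q1] PO jA kA k iA by (auto simp: in_hom_iff)
    have l1A: "l1 \<in> Arr M" "Dom M l1 = Cod M a" "Cod M l1 = Cod M p1" using l1 by (auto simp: in_hom_iff)
    have b: "b \<in> W \<inter> Cf" using T.cof_pushout[OF j _ ab] Cf.cof_Cod[OF x(1)] by simp
    have aG: "Cod M a \<in> G" using b Cf.cof_Cod AB by (metis IntD2)
    have "l1 \<in> Cf"
      by (rule Cf.cof_pushout[OF k(1) aG]) (rule M.pushout_cancel[OF ab po(1) kA k(2) l1])
    then have l: "e \<bullet> l1 \<in> Cf" using e l1A eD by (intro Cf.cof_Comp) auto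
    have lb: "(e \<bullet> l1) \<bullet> b = j'" using l1 l1A eA eD AB by (simp add: j'_def M.Comp_Comp)
    have la: "(e \<bullet> l1) \<bullet> a = s \<bullet> k" using l1 l1A eA eD AB PO kA iA by (simp add: s_def M.Comp_Comp)
    have "e \<bullet> l1 \<in> W"
      by (rule W_cancel_right[of b]) (use b l Cf.cof_Arr lb j'W l1A eA eD AB in auto)
    then show ?thesis using l la lb l1A eA eD j' by (intro exI[of _ "e \<bullet> l1"]) (auto simp: in_hom_iff)
  qed
  show thesis
    by (rule that[OF s(1,2) _ _ j'(2) _ vj' vs sq latch])
      (use s j' j'W vA v eD in \<open>auto simp: in_hom_iff\<close>)
qed

end

text \<open>A sequence \<open>X\<^sub>n \<rightarrow> R\<^sub>n \<rightarrow> P\<^sub>n \<rightarrow> R\<^bsub>n+1\<^esub>\<close> over \<open>Y\<close>, in which \<open>X\<^sub>n \<rightarrow> R\<^sub>n\<close> and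
  \<open>P\<^sub>n \<rightarrow> Y\<close> are weak equivalences, exhibits the map from the colimit \<open>Z\<close> of the \<open>X\<^sub>n\<close> to \<open>Y\<close> as
  a weak equivalence: the pushouts \<open>E\<^sub>n\<close> of \<open>R\<^sub>n\<close> along \<open>X\<^sub>n \<rightarrow> Z\<close> are related by trivial
  cofibrations, and their colimit is also the colimit of the \<open>P\<^sub>n\<close>.\<close>

locale telescope = projective_diagrams V M A C \<kappa> G Cf W
  for V :: "('vo, 'va, 'x) moncat_scheme" and M :: "('o, 'a, 'y) cat_scheme"
    and A :: "('vo, 'va, 'o, 'a) action" (structure) and C :: "('c, 'vo, 'va) ecat" and \<kappa> :: "'s rel"
    and G :: "'o set" and Cf W :: "'a set" +
  fixes X :: "nat \<Rightarrow> 'o" and x :: "nat \<Rightarrow> 'a" and Z :: 'o and t j k s r :: "nat \<Rightarrow> 'a" and Y :: 'o and f :: 'a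
  assumes x: "\<And>n. x n \<in> Cf" "\<And>n. Dom M (x n) = X n" "\<And>n. Cod M (x n) = X (Suc n)"
    and Z: "seq_colimit M X x Z t"
    and j: "\<And>n. j n \<in> W \<inter> Cf" "\<And>n. Dom M (j n) = X n"
    and k: "\<And>n. k n \<in> Cf" "\<And>n. Dom M (k n) = Cod M (j n)"
    and s: "\<And>n. s n \<in> Cf" "\<And>n. Dom M (s n) = Cod M (k n)" "\<And>n. Cod M (s n) = Cod M (j (Suc n))"
    and square: "\<And>n. s n \<bullet> k n \<bullet> j n = j (Suc n) \<bullet> x n"
    and latching: "\<And>n a b. pushout M (j n) (x n) a b \<Longrightarrow>
      \<exists>l. l \<in> W \<inter> Cf \<and> l \<in> hom M (Cod M a) (Cod M (j (Suc n))) \<and> l \<bullet> a = s n \<bullet> k n \<and> l \<bullet> b = j (Suc n)"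
    and r: "\<And>n. r n \<in> hom M (Cod M (j n)) Y"
    and rs: "\<And>n. r (Suc n) \<bullet> s n \<in> W" "\<And>n. (r (Suc n) \<bullet> s n) \<bullet> k n = r n"
    and f: "f \<in> hom M Z Y" "\<And>n. f \<bullet> t n = r n \<bullet> j n"
begin

lemma typing [simp]:
  "x n \<in> Arr M" "Dom M (x n) = X n" "Cod M (x n) = X (Suc n)"
  "j n \<in> Arr M" "Dom M (j n) = X n" "k n \<in> Arr M" "Dom M (k n) = Cod M (j n)"
  "s n \<in> Arr M" "Dom M (s n) = Cod M (k n)" "Cod M (s n) = Cod M (j (Suc n))"
  "r n \<in> Arr M" "Dom M (r n) = Cod M (j n)" "Cod M (r n) = Y"
  "t n \<in> Arr M" "Dom M (t n) = X n" "Cod M (t n) = Z" "Z \<in> Obj M"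
  "f \<in> Arr M" "Dom M f = Z" "Cod M f = Y"
  using x j k s r Z f Cf.cof_Arr by (auto simp: in_hom_iff seq_colimit_def)

lemma t_x: "t (Suc n) \<bullet> x n = t n"
  using Z by (simp add: seq_colimit_def)

lemma Z_induced:
  assumes "\<And>n. \<rho> n \<in> hom M (X n) T" "\<And>n. \<rho> (Suc n) \<bullet> x n = \<rho> n"
  obtains h where "h \<in> hom M Z T" "\<And>n. h \<bullet> t n = \<rho> n"
proof -
  have "T \<in> Obj M" using M.hom_Obj[OF assms(1)] by blast
  then have "\<exists>!h. h \<in> hom M Z T \<and> (\<forall>n. h \<bullet> t n = \<rho> n)"
    using assms by (intro seq_colimit_ex1[OF Z])
  then show thesis using that by blast
qed

lemma Z_joint_epi:
  assumes "g \<in> hom M Z T" "h \<in> hom M Z T" "\<And>n. g \<bullet> t n = h \<bullet> t n"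
  shows "g = h"
proof -
  have a: "g \<in> Arr M" "Dom M g = Z" "Cod M g = T" using assms by (auto simp: in_hom_iff)
  have "\<forall>n. h \<bullet> t n \<in> hom M (X n) T \<and> (h \<bullet> t (Suc n)) \<bullet> x n = h \<bullet> t n"
    using assms t_x by (auto simp: in_hom_iff M.Comp_Comp)
  moreover have "T \<in> Obj M" using M.hom_Obj[OF assms(1)] by blast
  ultimately have "\<exists>!l. l \<in> hom M Z T \<and> (\<forall>n. l \<bullet> t n = h \<bullet> t n)"
    by (intro seq_colimit_ex1[OF Z, where s = "\<lambda>n. h \<bullet> t n"]) simp_all
  then show ?thesis using assms by blast
qed

text \<open>The leg at stage 0 is a cofibration, being a transfinite composite of cofibrations, so
  its codomain is good.\<close>

lemma Z_good: "Z \<in> G"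
proof -
  have "X 0 \<in> G" using Cf.cof_Dom[OF x(1)[of 0]] by simp
  then have "t 0 \<in> Cf" by (rule Cf.cof_sequence(2)[OF _ x(1) _ Z]) (simp add: in_hom_iff)
  then show ?thesis using Cf.cof_Cod by fastforce
qed

definition pq where "pq n = (SOME (a, b). pushout M (j n) (t n) a b)"
definition p where "p n = fst (pq n)"
definition q where "q n = snd (pq n)"

lemma pushout_E: "pushout M (j n) (t n) (p n) (q n)"
proof -
  obtain a b where "pushout M (j n) (t n) a b"
    by (rule T.cof_pushout_exists[OF j(1), of "t n" n]) (use Z_good in auto)
  then have "case (a, b) of (a, b) \<Rightarrow> pushout M (j n) (t n) a b" by simp
  then have "case pq n of (a, b) \<Rightarrow> pushout M (j n) (t n) a b"
    unfolding pq_def by (rule someI)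
  then show ?thesis by (simp add: p_def q_def case_prod_unfold)
qed

lemma pq_typing [simp]: "p n \<in> Arr M" "q n \<in> Arr M" "Dom M (p n) = Cod M (j n)" "Dom M (q n) = Z"
  "Cod M (q n) = Cod M (p n)"
  using M.pushoutD[OF pushout_E] by auto

lemma p_j: "p n \<bullet> j n = q n \<bullet> t n"
  using M.pushoutD[OF pushout_E] by auto

lemma q_trivial: "q n \<in> W \<inter> Cf"
  using T.cof_pushout[OF j(1) _ pushout_E] Z_good by simp

lemma e_exists:
  "\<exists>e. e \<in> W \<inter> Cf \<and> e \<in> hom M (Cod M (p n)) (Cod M (p (Suc n))) \<and>
    e \<bullet> p n = p (Suc n) \<bullet> s n \<bullet> k n \<and> e \<bullet> q n = q (Suc n)"
proof -
  obtain a b where ab: "pushout M (j n) (x n) a b" "b \<in> W \<inter> Cf"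
    by (rule T.cof_pushout_exists[OF j(1), of "x n" n]) (use Cf.cof_Cod[OF x(1), of n] in auto)
  note AB = M.pushoutD[OF ab(1)]
  obtain l where l: "l \<in> W \<inter> Cf" "l \<in> hom M (Cod M a) (Cod M (j (Suc n)))" "l \<bullet> a = s n \<bullet> k n" "l \<bullet> b = j (Suc n)"
    using latching[OF ab(1)] by blast
  have lA: "l \<in> Arr M" "Dom M l = Cod M a" "Cod M l = Cod M (j (Suc n))" using l by (auto simp: in_hom_iff)
  have "p n \<bullet> j n = (q n \<bullet> t (Suc n)) \<bullet> x n" using p_j t_x by (simp add: M.Comp_Comp)
  then obtain u where u: "u \<in> hom M (Cod M a) (Cod M (p n))" "u \<bullet> a = p n" "u \<bullet> b = q n \<bullet> t (Suc n)"
    using M.pushout_induced[OF ab(1), of "p n" "Cod M (p n)" "q n \<bullet> t (Suc n)"] by (auto simp: in_hom_iff)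
  have uA: "u \<in> Arr M" "Dom M u = Cod M a" "Cod M u = Cod M (p n)" using u by (auto simp: in_hom_iff)
  have 1: "pushout M (t (Suc n)) b (q n) u"
    by (rule M.pushout_cancel[OF M.pushout_sym[OF ab(1)], of _ _ "p n"])
      (use M.pushout_sym[OF pushout_E] t_x u uA AB in \<open>auto simp: in_hom_iff\<close>)
  have "(p (Suc n) \<bullet> s n \<bullet> k n) \<bullet> j n = p (Suc n) \<bullet> j (Suc n) \<bullet> x n"
    using square by (simp add: M.Comp_Comp)
  also have "\<dots> = q (Suc n) \<bullet> t (Suc n) \<bullet> x n"
    by (rule M.Comp_eq_Comp[OF p_j]) auto
  also have "\<dots> = q (Suc n) \<bullet> t n" using t_x by simp
  finally obtain e where e: "e \<in> hom M (Cod M (p n)) (Cod M (p (Suc n)))" "e \<bullet> p n = p (Suc n) \<bullet> s n \<bullet> k n"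
    "e \<bullet> q n = q (Suc n)"
    using M.pushout_induced[OF pushout_E, of "p (Suc n) \<bullet> s n \<bullet> k n" n "Cod M (p (Suc n))" "q (Suc n)"]
    by (auto simp: in_hom_iff)
  have eA: "e \<in> Arr M" "Dom M e = Cod M (p n)" "Cod M e = Cod M (p (Suc n))" using e by (auto simp: in_hom_iff)
  have eu: "e \<bullet> u = p (Suc n) \<bullet> l"
  proof (rule M.pushout_joint_epi[OF ab(1)])
    show "(e \<bullet> u) \<bullet> a = (p (Suc n) \<bullet> l) \<bullet> a"
      using eA uA AB lA u e l by (simp add: M.Comp_Comp)
    have "(e \<bullet> u) \<bullet> b = e \<bullet> q n \<bullet> t (Suc n)" using eA uA AB u by (simp add: M.Comp_Comp)
    also have "\<dots> = q (Suc n) \<bullet> t (Suc n)" by (rule M.Comp_eq_Arr[OF e(3)]) (use eA in auto)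
    finally show "(e \<bullet> u) \<bullet> b = (p (Suc n) \<bullet> l) \<bullet> b"
      using lA AB l p_j by (simp add: M.Comp_Comp)
  qed (use eA uA lA in \<open>auto simp: in_hom_iff\<close>)
  have "pushout M l u (p (Suc n)) e"
    by (rule M.pushout_cancel[OF M.pushout_sym[OF 1], of l "p (Suc n)" "q (Suc n)"])
      (use l lA AB e eu pushout_E[of "Suc n"] uA in \<open>auto simp: in_hom_iff\<close>)
  then have "e \<in> W \<inter> Cf"
    using T.cof_pushout[OF l(1), of u] uA T.cof_Cod[OF q_trivial[of n]] by simp
  then show ?thesis using e by blast
qed

definition e where "e n = (SOME e. e \<in> W \<inter> Cf \<and> e \<in> hom M (Cod M (p n)) (Cod M (p (Suc n))) \<and>
    e \<bullet> p n = p (Suc n) \<bullet> s n \<bullet> k n \<and> e \<bullet> q n = q (Suc n))"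

lemma e: "e n \<in> W \<inter> Cf" "e n \<in> hom M (Cod M (p n)) (Cod M (p (Suc n)))"
    "e n \<bullet> p n = p (Suc n) \<bullet> s n \<bullet> k n" "e n \<bullet> q n = q (Suc n)"
  using someI_ex[OF e_exists[of n], folded e_def] by auto

lemma e_typing [simp]: "e n \<in> Arr M" "Dom M (e n) = Cod M (p n)" "Cod M (e n) = Cod M (p (Suc n))"
  using e(2)[of n] by (auto simp: in_hom_iff)

text \<open>The map \<open>f\<close> factors as \<open>Z -> E\<^sub>0 -> E -> Y\<close> with
  \<open>E\<close> the colimit of the \<open>E\<^sub>n\<close>. The first two maps are trivial
  cofibrations. The last one is compared with the weak equivalences \<open>w n\<close> from the
  \<open>P\<^sub>n\<close> to \<open>Y\<close>.\<close>

lemma weak_equivalence: "f \<in> W"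
proof -
  let ?E = "\<lambda>n. Cod M (p n)"
  have E0: "?E 0 \<in> G" using T.cof_Cod[OF q_trivial[of 0]] by simp
  obtain E \<tau> where E: "seq_colimit M ?E e E \<tau>"
    using T.cof_sequence(1)[of ?E, OF E0 e(1,2)] by blast
  have \<tau>0: "\<tau> 0 \<in> W \<inter> Cf" by (rule T.cof_sequence(2)[OF E0 e(1,2) E])
  have \<tau>: "\<tau> n \<in> Arr M" "Dom M (\<tau> n) = ?E n" "Cod M (\<tau> n) = E" "\<tau> (Suc n) \<bullet> e n = \<tau> n" for n
    using E by (auto simp: seq_colimit_def in_hom_iff)
  have EO: "E \<in> Obj M" using E by (simp add: seq_colimit_def)
  have \<tau>q: "\<tau> (Suc n) \<bullet> q (Suc n) = \<tau> n \<bullet> q n" for n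
  proof -
    have "\<tau> (Suc n) \<bullet> e n \<bullet> q n = \<tau> n \<bullet> q n" by (rule M.Comp_eq_Arr[OF \<tau>(4)]) (use \<tau> in auto)
    then show ?thesis by (simp add: e(4))
  qed
  have \<tau>q0: "\<tau> n \<bullet> q n = \<tau> 0 \<bullet> q 0" for n by (induction n) (auto simp: \<tau>q)
  have \<tau>p: "\<tau> n \<bullet> p n = \<tau> (Suc n) \<bullet> p (Suc n) \<bullet> s n \<bullet> k n" for n
  proof -
    have "\<tau> (Suc n) \<bullet> e n \<bullet> p n = \<tau> n \<bullet> p n" by (rule M.Comp_eq_Arr[OF \<tau>(4)]) (use \<tau> in auto)
    then show ?thesis by (simp add: e(3))
  qed
  let ?P = "\<lambda>n. Cod M (k n)"
  define y where "y n = k (Suc n) \<bullet> s n" for n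
  define w where "w n = r (Suc n) \<bullet> s n" for n
  define \<sigma> where "\<sigma> n = \<tau> (Suc n) \<bullet> p (Suc n) \<bullet> s n" for n
  have yA: "y n \<in> hom M (?P n) (?P (Suc n))" for n by (simp add: y_def in_hom_iff)
  have wA: "w n \<in> Arr M" "Dom M (w n) = ?P n" "Cod M (w n) = Y" "w n \<in> W" for n
    using rs by (auto simp: w_def)
  have wk: "w n \<bullet> k n = r n" for n using rs by (simp add: w_def)
  have wy: "w (Suc n) \<bullet> y n = w n" for n
  proof -
    have "w (Suc n) \<bullet> k (Suc n) \<bullet> s n = r (Suc n) \<bullet> s n"
      by (rule M.Comp_eq_Arr[OF wk]) (use wA in auto)
    then show ?thesis by (simp add: y_def w_def)
  qed
  have yT: "y n \<in> W \<inter> Cf" for n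
  proof -
    have "y n \<in> Cf" unfolding y_def by (rule Cf.cof_Comp) (use k s in auto)
    moreover have "y n \<in> W"
      by (rule W_cancel_left[OF wA(4)[of "Suc n"]]) (use yA[of n] wA wy in \<open>auto simp: in_hom_iff\<close>)
    ultimately show ?thesis by blast
  qed
  have \<sigma>A: "\<sigma> n \<in> Arr M" "Dom M (\<sigma> n) = ?P n" "Cod M (\<sigma> n) = E" for n
    using \<tau> by (auto simp: \<sigma>_def)
  have \<sigma>k: "\<sigma> n \<bullet> k n = \<tau> n \<bullet> p n" for n
    using \<tau>p[of n] \<tau> by (simp add: \<sigma>_def M.Comp_Comp)
  have \<sigma>y: "\<sigma> (Suc n) \<bullet> y n = \<sigma> n" for n
  proof -
    have "\<sigma> (Suc n) \<bullet> k (Suc n) \<bullet> s n = (\<tau> (Suc n) \<bullet> p (Suc n)) \<bullet> s n"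
      using \<sigma>A \<tau> by (subst M.Comp_Comp[symmetric]) (auto simp: \<sigma>k)
    then show ?thesis using \<tau> by (simp add: y_def \<sigma>_def M.Comp_Comp)
  qed
  \<comment> \<open>A cocone on the \<open>P\<^sub>n\<close> restricts to one on the
    \<open>X\<^sub>n\<close> and so gives \<open>\<zeta>\<close> on \<open>Z\<close>. Together with
    its restrictions to the \<open>R\<^sub>n\<close> this defines compatible maps
    \<open>\<epsilon> n\<close> on the pushouts \<open>E\<^sub>n\<close>, and hence a map from
    \<open>E\<close>.\<close>
  have colim_P: "seq_colimit M ?P y E \<sigma>"
    unfolding seq_colimit_def
  proof (intro conjI allI impI EO \<sigma>y)
    show "\<sigma> n \<in> hom M (?P n) E" for n using \<sigma>A by (simp add: in_hom_iff)
    fix T \<rho> assume "T \<in> Obj M \<and> (\<forall>n. \<rho> n \<in> hom M (?P n) T \<and> \<rho> (Suc n) \<bullet> y n = \<rho> n)"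
    then have T: "T \<in> Obj M" and \<rho>: "\<And>n. \<rho> n \<in> Arr M" "\<And>n. Dom M (\<rho> n) = ?P n" "\<And>n. Cod M (\<rho> n) = T"
      and \<rho>y: "\<And>n. \<rho> (Suc n) \<bullet> y n = \<rho> n"
      by (auto simp: in_hom_iff)
    have \<rho>ks: "\<rho> (Suc n) \<bullet> k (Suc n) \<bullet> s n = \<rho> n" for n using \<rho>y by (simp add: y_def)
    have "(\<rho> (Suc n) \<bullet> k (Suc n) \<bullet> j (Suc n)) \<bullet> x n = \<rho> n \<bullet> k n \<bullet> j n" for n
    proof -
      have "(\<rho> (Suc n) \<bullet> k (Suc n) \<bullet> j (Suc n)) \<bullet> x n = \<rho> (Suc n) \<bullet> k (Suc n) \<bullet> s n \<bullet> k n \<bullet> j n"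
        using \<rho> square[of n] by (simp add: M.Comp_Comp)
      also have "\<dots> = (\<rho> (Suc n) \<bullet> k (Suc n) \<bullet> s n) \<bullet> k n \<bullet> j n"
        using \<rho> by (simp add: M.Comp_Comp)
      finally show ?thesis by (simp add: \<rho>ks)
    qed
    then obtain \<zeta> where \<zeta>: "\<zeta> \<in> hom M Z T" "\<And>n. \<zeta> \<bullet> t n = \<rho> n \<bullet> k n \<bullet> j n"
      using Z_induced[of "\<lambda>n. \<rho> n \<bullet> k n \<bullet> j n" T] \<rho> by (auto simp: in_hom_iff)
    have "\<exists>h. h \<in> hom M (?E n) T \<and> h \<bullet> p n = \<rho> n \<bullet> k n \<and> h \<bullet> q n = \<zeta>" for n
      by (rule M.pushout_induced[OF pushout_E, of "\<rho> n \<bullet> k n" n T \<zeta>])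
        (use \<zeta> \<rho> in \<open>auto simp: in_hom_iff M.Comp_Comp\<close>)
    then obtain \<epsilon> where "\<And>n. \<epsilon> n \<in> hom M (?E n) T \<and> \<epsilon> n \<bullet> p n = \<rho> n \<bullet> k n \<and> \<epsilon> n \<bullet> q n = \<zeta>" by metis
    then have \<epsilon>: "\<And>n. \<epsilon> n \<in> Arr M" "\<And>n. Dom M (\<epsilon> n) = ?E n" "\<And>n. Cod M (\<epsilon> n) = T"
      "\<And>n. \<epsilon> n \<bullet> p n = \<rho> n \<bullet> k n" "\<And>n. \<epsilon> n \<bullet> q n = \<zeta>" by (auto simp: in_hom_iff)
    have \<epsilon>ps: "\<epsilon> (Suc n) \<bullet> p (Suc n) \<bullet> s n = \<rho> n" for n
    proof -
      have "\<epsilon> (Suc n) \<bullet> p (Suc n) \<bullet> s n = (\<epsilon> (Suc n) \<bullet> p (Suc n)) \<bullet> s n"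
        using \<epsilon>(1-3) by (simp add: M.Comp_Comp)
      also have "\<dots> = \<rho> (Suc n) \<bullet> k (Suc n) \<bullet> s n" unfolding \<epsilon>(4) using \<rho> by (simp add: M.Comp_Comp)
      finally show ?thesis by (simp add: \<rho>ks)
    qed
    have "\<epsilon> (Suc n) \<bullet> e n = \<epsilon> n" for n
    proof (rule M.pushout_joint_epi[OF pushout_E])
      have "(\<epsilon> (Suc n) \<bullet> e n) \<bullet> p n = (\<epsilon> (Suc n) \<bullet> p (Suc n) \<bullet> s n) \<bullet> k n"
        using \<epsilon>(1-3) by (simp add: M.Comp_Comp e(3))
      then show "(\<epsilon> (Suc n) \<bullet> e n) \<bullet> p n = \<epsilon> n \<bullet> p n" unfolding \<epsilon>ps \<epsilon>(4) .
      show "(\<epsilon> (Suc n) \<bullet> e n) \<bullet> q n = \<epsilon> n \<bullet> q n"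
        using \<epsilon> by (simp add: M.Comp_Comp e(4))
    qed (use \<epsilon> in \<open>auto simp: in_hom_iff\<close>)
    then have "\<exists>!h. h \<in> hom M E T \<and> (\<forall>n. h \<bullet> \<tau> n = \<epsilon> n)"
      using T \<epsilon> by (intro seq_colimit_ex1[OF E]) (simp_all add: in_hom_iff)
    then obtain h where h: "h \<in> hom M E T" "\<And>n. h \<bullet> \<tau> n = \<epsilon> n"
      and h_unique: "\<And>h'. h' \<in> hom M E T \<Longrightarrow> (\<And>n. h' \<bullet> \<tau> n = \<epsilon> n) \<Longrightarrow> h' = h" by blast
    have hA: "h \<in> Arr M" "Dom M h = E" "Cod M h = T" using h by (auto simp: in_hom_iff)
    show "\<exists>!h. h \<in> hom M E T \<and> (\<forall>n. h \<bullet> \<sigma> n = \<rho> n)"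
    proof (rule ex1I[of _ h])
      have "h \<bullet> \<sigma> n = \<rho> n" for n
      proof -
        have "h \<bullet> \<sigma> n = (h \<bullet> \<tau> (Suc n)) \<bullet> p (Suc n) \<bullet> s n"
          using hA \<tau>(1-3) by (simp add: \<sigma>_def M.Comp_Comp)
        then show ?thesis by (simp add: h(2) \<epsilon>ps)
      qed
      then show "h \<in> hom M E T \<and> (\<forall>n. h \<bullet> \<sigma> n = \<rho> n)" using h by blast
    next
      fix h' assume h': "h' \<in> hom M E T \<and> (\<forall>n. h' \<bullet> \<sigma> n = \<rho> n)"
      then have h'A: "h' \<in> Arr M" "Dom M h' = E" "Cod M h' = T" by (auto simp: in_hom_iff)
      have h'p: "h' \<bullet> \<tau> n \<bullet> p n = \<rho> n \<bullet> k n" for n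
      proof -
        have "h' \<bullet> \<tau> n \<bullet> p n = (h' \<bullet> \<sigma> n) \<bullet> k n"
          using h'A \<sigma>A \<sigma>k by (simp add: M.Comp_Comp)
        then show ?thesis using h' by simp
      qed
      have h'q: "h' \<bullet> \<tau> n \<bullet> q n = \<zeta>" for n
      proof (rule Z_joint_epi)
        fix m
        have "(h' \<bullet> \<tau> n \<bullet> q n) \<bullet> t m = (h' \<bullet> \<tau> m \<bullet> q m) \<bullet> t m"
          using \<tau>q0[of n] \<tau>q0[of m] by simp
        also have "\<dots> = (h' \<bullet> \<tau> m \<bullet> p m) \<bullet> j m"
          using h'A \<tau>(1-3) p_j[of m] by (simp add: M.Comp_Comp)
        also have "\<dots> = \<zeta> \<bullet> t m" unfolding h'p \<zeta>(2) using \<rho> by (simp add: M.Comp_Comp)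
        finally show "(h' \<bullet> \<tau> n \<bullet> q n) \<bullet> t m = \<zeta> \<bullet> t m" .
      qed (use h'A \<tau> \<zeta> in \<open>auto simp: in_hom_iff\<close>)
      show "h' = h"
      proof (rule h_unique)
        show "h' \<bullet> \<tau> n = \<epsilon> n" for n
          by (rule M.pushout_joint_epi[OF pushout_E])
            (use h'A \<tau>(1-3) \<epsilon> h'p h'q in \<open>auto simp: in_hom_iff M.Comp_Comp\<close>)
      qed (use h' in blast)
    qed
  qed
  have P0: "?P 0 \<in> G" using Cf.cof_Cod[OF k(1)] .
  have \<sigma>0: "\<sigma> 0 \<in> W" using T.cof_sequence(2)[OF P0 yT yA colim_P] by blast
  have "Y \<in> Obj M" using M.Cod_Obj[of f] by simp
  then have "\<exists>!g. g \<in> hom M E Y \<and> (\<forall>n. g \<bullet> \<sigma> n = w n)"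
    using wA wy by (intro seq_colimit_ex1[OF colim_P]) (simp_all add: in_hom_iff)
  then obtain g where g: "g \<in> hom M E Y" "\<And>n. g \<bullet> \<sigma> n = w n" by blast
  have gA: "g \<in> Arr M" "Dom M g = E" "Cod M g = Y" using g by (auto simp: in_hom_iff)
  have gW: "g \<in> W" by (rule W_cancel_right[OF \<sigma>0]) (use gA \<sigma>A g wA in auto)
  \<comment> \<open>The composites \<open>\<tau> n \<bullet> q n\<close> all coincide, so the leg
    \<open>t n\<close> can be tested in the \<open>n\<close>-th pushout, where it passes through
    \<open>R\<^sub>n\<close> and \<open>P\<^sub>n\<close>.\<close>
  have "f = g \<bullet> \<tau> 0 \<bullet> q 0"
  proof (rule Z_joint_epi)
    fix n
    have "(g \<bullet> \<tau> 0 \<bullet> q 0) \<bullet> t n = (g \<bullet> \<tau> n \<bullet> q n) \<bullet> t n" using \<tau>q0[of n] by simp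
    also have "\<dots> = (g \<bullet> \<tau> n \<bullet> p n) \<bullet> j n" using gA \<tau>(1-3) p_j[of n] by (simp add: M.Comp_Comp)
    also have "\<dots> = ((g \<bullet> \<sigma> n) \<bullet> k n) \<bullet> j n" using gA \<sigma>A \<sigma>k[of n] by (simp add: M.Comp_Comp)
    also have "\<dots> = f \<bullet> t n" unfolding g(2) wk f(2) ..
    finally show "f \<bullet> t n = (g \<bullet> \<tau> 0 \<bullet> q 0) \<bullet> t n" by simp
  qed (use f gA \<tau> in \<open>auto simp: in_hom_iff\<close>)
  moreover have "\<tau> 0 \<bullet> q 0 \<in> W" using \<tau>0 q_trivial[of 0] \<tau>(2)[of 0] by (intro W_Comp) auto
  ultimately show ?thesis using gW gA \<tau>(1-3)[of 0] by (auto intro!: W_Comp)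
qed

end

section \<open>Construction of the factorization\<close>

context projective_diagrams
begin

text \<open>The cells are indexed by objects of \<open>C\<close>, but the closure has coproducts
  over subsets of \<open>'s\<close>; the family is transported along an injection.\<close>

lemma coproduct_of_cells:
  assumes g: "\<And>c. c \<in> EObj C \<Longrightarrow> g c \<in> cells"
  obtains P p Q q h where "coproduct D (EObj C) (\<lambda>c. ddom (g c)) P p" "coproduct D (EObj C) (\<lambda>c. dcod (g c)) Q q"
    "h \<in> hom D P Q" "\<And>c. c \<in> EObj C \<Longrightarrow> h \<cdot>\<^bsub>D\<^esub> p c = q c \<cdot>\<^bsub>D\<^esub> g c" "h \<in> cells"
proof -
  obtain \<phi> :: "'c \<Rightarrow> 's" where \<phi>: "inj_on \<phi> (EObj C)"
    using small_embedding[OF _ small_C] universe_\<kappa> unfolding universe_cardinal_def by blast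
  let ?I = "\<phi> ` EObj C" and ?\<psi> = "inv_into (EObj C) \<phi>"
  have \<psi>: "?\<psi> (\<phi> c) = c" if "c \<in> EObj C" for c using \<phi> that by simp
  have \<psi>I: "?\<psi> i \<in> EObj C" if "i \<in> ?I" for i using that by (rule inv_into_into)
  have bij: "bij_betw ?\<psi> ?I (EObj C)" by (rule bij_betw_inv_into[OF inj_on_imp_bij_betw[OF \<phi>]])
  have sm: "small \<kappa> ?I" by (rule small_image[OF small_C])
  obtain P p where P: "coproduct D (EObj C) (\<lambda>c. ddom (g c)) P p"
    by (rule CfD.good_coproduct_exists[OF small_C, of "\<lambda>c. ddom (g c)"]) (use g cells_good in auto)
  obtain Q q where Q: "coproduct D (EObj C) (\<lambda>c. dcod (g c)) Q q"
    by (rule CfD.good_coproduct_exists[OF small_C, of "\<lambda>c. dcod (g c)"]) (use g cells_good in auto)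
  have p: "p c \<in> Arr D" "ddom (p c) = ddom (g c)" "dcod (p c) = P" if "c \<in> EObj C" for c
    using D.coproductD(3)[OF P that] by (auto simp: in_hom_iff)
  have q: "q c \<in> Arr D" "ddom (q c) = dcod (g c)" "dcod (q c) = Q" if "c \<in> EObj C" for c
    using D.coproductD(3)[OF Q that] by (auto simp: in_hom_iff)
  have gA: "g c \<in> Arr D" if "c \<in> EObj C" for c using g[OF that] cells_Arr by blast
  have "q c \<cdot>\<^bsub>D\<^esub> g c \<in> hom D (ddom (g c)) Q" if "c \<in> EObj C" for c
    using q[OF that] gA[OF that] by (auto simp: in_hom_iff)
  then obtain h where h: "h \<in> hom D P Q" "\<And>c. c \<in> EObj C \<Longrightarrow> h \<cdot>\<^bsub>D\<^esub> p c = q c \<cdot>\<^bsub>D\<^esub> g c"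
    by (rule D.coproduct_induced[OF P D.coproductD(1)[OF Q], where q = "\<lambda>c. q c \<cdot>\<^bsub>D\<^esub> g c"]) (assumption | (rule that; assumption))+
  have "h \<in> cells"
  proof (rule cellular_closure.coproducts[OF sm, of "\<lambda>i. g (?\<psi> i)"])
    show "g (?\<psi> i) \<in> cells" if "i \<in> ?I" for i using g[OF \<psi>I[OF that]] .
    show "coproduct D ?I (\<lambda>i. Dom D (g (?\<psi> i))) P (\<lambda>i. p (?\<psi> i))"
      using P CfD.coproduct_reindex[OF bij, of "\<lambda>c. ddom (g c)" P p] by simp
    show "coproduct D ?I (\<lambda>i. Cod D (g (?\<psi> i))) Q (\<lambda>i. q (?\<psi> i))"
      using Q CfD.coproduct_reindex[OF bij, of "\<lambda>c. dcod (g c)" Q q] by simp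
    show "h \<in> hom D P Q" by (rule h)
    show "h \<cdot>\<^bsub>D\<^esub> p (?\<psi> i) = q (?\<psi> i) \<cdot>\<^bsub>D\<^esub> g (?\<psi> i)" if "i \<in> ?I" for i
      using h(2)[OF \<psi>I[OF that]] .
  qed
  then show thesis using that[OF P Q h] by blast
qed

text \<open>Attaching the cells \<open>C(c, -) \<star> i\<^sub>c\<close> along the counit factors every \<open>f\<^sub>c\<close> through \<open>i\<^sub>c\<close>.\<close>

lemma attach_cells:
  assumes f: "f \<in> Arr D" "ddom f \<in> GD"
    and i: "\<And>c. c \<in> EObj C \<Longrightarrow> i c \<in> Cf" "\<And>c. c \<in> EObj C \<Longrightarrow> Dom M (i c) = dobj (ddom f) c"
    and w: "\<And>c. c \<in> EObj C \<Longrightarrow> w c \<in> hom M (Cod M (i c)) (dobj (dcod f) c)"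
      "\<And>c. c \<in> EObj C \<Longrightarrow> w c \<bullet> i c = dmap f c"
  obtains x f' q where "x \<in> cells" "ddom x = ddom f" "f' \<in> hom D (dcod x) (dcod f)" "f' \<cdot>\<^bsub>D\<^esub> x = f"
    "\<And>c. c \<in> EObj C \<Longrightarrow> q c \<in> hom M (Cod M (i c)) (dobj (dcod x) c)"
    "\<And>c. c \<in> EObj C \<Longrightarrow> q c \<bullet> i c = dmap x c" "\<And>c. c \<in> EObj C \<Longrightarrow> dmap f' c \<bullet> q c = w c"
proof -
  let ?X = "ddom f" and ?Y = "dcod f"
  have XD: "?X \<in> Obj D" and YD: "?Y \<in> Obj D" using f by auto
  have iA: "i c \<in> Arr M" if "c \<in> EObj C" for c using i(1)[OF that] Cf.cof_Arr by blast
  have wA: "w c \<in> Arr M" "Dom M (w c) = Cod M (i c)" "Cod M (w c) = dobj ?Y c" if "c \<in> EObj C" for c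
    using w(1)[OF that] by (auto simp: in_hom_iff)
  let ?g = "\<lambda>c. free_diagram_map V M A C c (i c)"
  have gc: "?g c \<in> cells" if "c \<in> EObj C" for c
    by (rule cellular_closure.generator) (use i(1)[OF that] that in blast)
  obtain P p Q b h where P: "coproduct D (EObj C) (\<lambda>c. ddom (?g c)) P p"
    and Q: "coproduct D (EObj C) (\<lambda>c. dcod (?g c)) Q b"
    and h: "h \<in> hom D P Q" "\<And>c. c \<in> EObj C \<Longrightarrow> h \<cdot>\<^bsub>D\<^esub> p c = b c \<cdot>\<^bsub>D\<^esub> ?g c" "h \<in> cells"
    by (rule coproduct_of_cells[of ?g, OF gc]) (assumption | (rule that; assumption))+
  have p: "p c \<in> Arr D" "ddom (p c) = free_diagram M A C c (dobj ?X c)" "dcod (p c) = P" if "c \<in> EObj C" for c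
    using D.coproductD(3)[OF P that] i(2)[OF that] by (auto simp: in_hom_iff)
  have b: "b c \<in> Arr D" "ddom (b c) = free_diagram M A C c (Cod M (i c))" "dcod (b c) = Q" if "c \<in> EObj C" for c
    using D.coproductD(3)[OF Q that] by (auto simp: in_hom_iff)
  have hA: "h \<in> Arr D" "ddom h = P" "dcod h = Q" using h(1) by (auto simp: in_hom_iff)
  \<comment> \<open>The counit \<open>C(c, -) \<star> X c -> X\<close>. These maps together attach
    the coproduct of all cells to \<open>X\<close>.\<close>
  let ?cu = "\<lambda>c. transpose c ?X (Ident M (dobj ?X c))"
  have cu: "?cu c \<in> Arr D" if "c \<in> EObj C" for c
    using XD that by (intro transpose_D) auto
  have "?cu c \<in> hom D (ddom (?g c)) ?X" if "c \<in> EObj C" for c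
    using cu[OF that] XD that i(2)[OF that] by (simp add: in_hom_iff)
  then obtain a where a: "a \<in> hom D P ?X" "\<And>c. c \<in> EObj C \<Longrightarrow> a \<cdot>\<^bsub>D\<^esub> p c = ?cu c"
    by (rule D.coproduct_induced[OF P XD, where q = ?cu]) (assumption | (rule that; assumption))+
  have aA: "a \<in> Arr D" "ddom a = P" "dcod a = ?X" using a by (auto simp: in_hom_iff)
  obtain d x where po: "pushout D h a d x"
    using pushout_D(1)[OF Cf.left_closed_class_axioms, of h a] hA aA cells_cof[OF h(3)] f(2) by (auto simp: GD_iff)
  note PO = D.pushoutD[OF po]
  have x: "x \<in> cells"
    by (rule cellular_closure.cobase_change[OF h(3) _ _ po]) (use aA hA cells_good(1)[OF h(3)] f(2) in auto)
  have xA: "x \<in> Arr D" "ddom x = ?X" "dcod x = dcod d" "d \<in> Arr D" "ddom d = Q" "d \<cdot>\<^bsub>D\<^esub> h = x \<cdot>\<^bsub>D\<^esub> a"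
    using PO aA hA by auto
  \<comment> \<open>The second factor on the new cell is the map adjoint to
    \<open>w c\<close>.\<close>
  let ?tw = "\<lambda>c. transpose c ?Y (w c)"
  have tw: "?tw c \<in> Arr D" if "c \<in> EObj C" for c using YD that wA[OF that] by (intro transpose_D) auto
  have "?tw c \<in> hom D (dcod (?g c)) ?Y" if "c \<in> EObj C" for c
    using tw[OF that] wA[OF that] by (simp add: in_hom_iff)
  then obtain l where l: "l \<in> hom D Q ?Y" "\<And>c. c \<in> EObj C \<Longrightarrow> l \<cdot>\<^bsub>D\<^esub> b c = ?tw c"
    by (rule D.coproduct_induced[OF Q YD, where q = ?tw]) (assumption | (rule that; assumption))+
  have lA: "l \<in> Arr D" "ddom l = Q" "dcod l = ?Y" using l by (auto simp: in_hom_iff)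
  have "l \<cdot>\<^bsub>D\<^esub> h = f \<cdot>\<^bsub>D\<^esub> a"
  proof (rule D.coproduct_joint_epi[OF P])
    fix c assume c: "c \<in> EObj C"
    have "(l \<cdot>\<^bsub>D\<^esub> h) \<cdot>\<^bsub>D\<^esub> p c = l \<cdot>\<^bsub>D\<^esub> b c \<cdot>\<^bsub>D\<^esub> ?g c"
      using lA hA p[OF c] h(2)[OF c] by (simp add: D.Comp_Comp)
    also have "\<dots> = ?tw c \<cdot>\<^bsub>D\<^esub> ?g c"
      by (rule D.Comp_eq_Arr[OF l(2)[OF c]]) (use lA b[OF c] c iA in auto)
    also have "\<dots> = transpose c ?Y (w c \<bullet> i c)"
      using c YD wA[OF c] iA[OF c] by (intro transpose_Comp_free) auto
    also have "\<dots> = transpose c ?Y (dmap f c \<bullet> Ident M (dobj ?X c))" using f c w(2)[OF c] by simp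
    also have "\<dots> = f \<cdot>\<^bsub>D\<^esub> ?cu c" using c f by (intro Comp_transpose[symmetric]) auto
    also have "\<dots> = (f \<cdot>\<^bsub>D\<^esub> a) \<cdot>\<^bsub>D\<^esub> p c" using a(2)[OF c] f aA p[OF c] by (simp add: D.Comp_Comp)
    finally show "(l \<cdot>\<^bsub>D\<^esub> h) \<cdot>\<^bsub>D\<^esub> p c = (f \<cdot>\<^bsub>D\<^esub> a) \<cdot>\<^bsub>D\<^esub> p c" .
  qed (use lA hA aA f in \<open>auto simp: in_hom_iff\<close>)
  then obtain f' where f': "f' \<in> hom D (dcod d) ?Y" "f' \<cdot>\<^bsub>D\<^esub> d = l" "f' \<cdot>\<^bsub>D\<^esub> x = f"
    using D.pushout_induced[OF po, of l ?Y f] lA hA aA f by (auto simp: in_hom_iff)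
  have f'A: "f' \<in> Arr D" "ddom f' = dcod d" "dcod f' = ?Y" using f' by (auto simp: in_hom_iff)
  \<comment> \<open>The unit leads from \<open>P c\<close> to the value at \<open>c\<close> of the
    new cell \<open>C(c, -) \<star> P c\<close>, which maps to \<open>X'\<close>. Since the
    \<open>P c\<close> carry no structure maps, the \<open>q c\<close> are a mere family.\<close>
  define q where "q c = dmap (d \<cdot>\<^bsub>D\<^esub> b c) c \<bullet> free_unit c (Cod M (i c))" for c
  have db: "d \<cdot>\<^bsub>D\<^esub> b c \<in> Arr D" "ddom (d \<cdot>\<^bsub>D\<^esub> b c) = free_diagram M A C c (Cod M (i c))" "dcod (d \<cdot>\<^bsub>D\<^esub> b c) = dcod d"
    if "c \<in> EObj C" for c using b[OF that] xA by auto
  have q: "q c \<in> hom M (Cod M (i c)) (dobj (dcod x) c)" if c: "c \<in> EObj C" for c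
    using db[OF c] iA[OF c] c xA diagram_map_typing(3-5)[OF db(1)[OF c] c] by (simp add: q_def in_hom_iff del: dmap_Comp)
  \<comment> \<open>Naturality of the unit exchanges it with \<open>i c\<close>, the pushout square
    then leads to \<open>x\<close> after the counit, and the triangle identity cancels counit and
    unit.\<close>
  have qi: "q c \<bullet> i c = dmap x c" if c: "c \<in> EObj C" for c
  proof -
    note T = diagram_map_typing(3-5)[OF db(1)[OF c] c]
    have "q c \<bullet> i c = dmap (d \<cdot>\<^bsub>D\<^esub> b c) c \<bullet> free_unit c (Cod M (i c)) \<bullet> i c"
      unfolding q_def using T db[OF c] iA[OF c] c by (intro M.Comp_Comp) auto
    also have "\<dots> = dmap (d \<cdot>\<^bsub>D\<^esub> b c) c \<bullet> dmap (?g c) c \<bullet> free_unit c (dobj ?X c)"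
      using free_unit_natural[OF c iA[OF c]] c i(2)[OF c] by simp
    also have "\<dots> = dmap ((d \<cdot>\<^bsub>D\<^esub> b c) \<cdot>\<^bsub>D\<^esub> ?g c) c \<bullet> free_unit c (dobj ?X c)"
      using T db[OF c] iA[OF c] c i(2)[OF c] XD by (simp add: M.Comp_Comp del: dmap_Comp)
        (simp add: M.Comp_Comp dmap_Comp[of c "d \<cdot>\<^bsub>D\<^esub> b c" "?g c"] del: dmap_Comp)
    also have "(d \<cdot>\<^bsub>D\<^esub> b c) \<cdot>\<^bsub>D\<^esub> ?g c = d \<cdot>\<^bsub>D\<^esub> h \<cdot>\<^bsub>D\<^esub> p c"
      using b[OF c] xA iA[OF c] c h(2)[OF c] by (simp add: D.Comp_Comp)
    also have "\<dots> = x \<cdot>\<^bsub>D\<^esub> a \<cdot>\<^bsub>D\<^esub> p c"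
      by (rule D.Comp_eq_Comp[OF xA(6)]) (use xA hA aA p[OF c] in auto)
    also have "\<dots> = x \<cdot>\<^bsub>D\<^esub> ?cu c" using a(2)[OF c] by simp
    also have "dmap \<dots> c = dmap x c \<bullet> dmap (?cu c) c" using c by (rule dmap_Comp)
    also have "(dmap x c \<bullet> dmap (?cu c) c) \<bullet> free_unit c (dobj ?X c) =
        dmap x c \<bullet> dmap (?cu c) c \<bullet> free_unit c (dobj ?X c)"
      using xA c XD diagram_map_typing(3-5)[OF cu[OF c] c] by (intro M.Comp_Comp) auto
    also have "dmap (?cu c) c \<bullet> free_unit c (dobj ?X c) = Ident M (dobj ?X c)"
      by (rule transpose_free_unit) (use c XD in auto)
    also have "dmap x c \<bullet> \<dots> = dmap x c" using xA c by simp
    finally show ?thesis .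
  qed
  have f'q: "dmap f' c \<bullet> q c = w c" if c: "c \<in> EObj C" for c
  proof -
    note T = diagram_map_typing(3-5)[OF db(1)[OF c] c]
    have "dmap f' c \<bullet> q c = (dmap f' c \<bullet> dmap (d \<cdot>\<^bsub>D\<^esub> b c) c) \<bullet> free_unit c (Cod M (i c))"
      unfolding q_def using T db[OF c] iA[OF c] c f'A by (intro M.Comp_Comp[symmetric]) auto
    also have "dmap f' c \<bullet> dmap (d \<cdot>\<^bsub>D\<^esub> b c) c = dmap (f' \<cdot>\<^bsub>D\<^esub> d \<cdot>\<^bsub>D\<^esub> b c) c"
      by (rule dmap_Comp[OF c, symmetric])
    also have "f' \<cdot>\<^bsub>D\<^esub> d \<cdot>\<^bsub>D\<^esub> b c = l \<cdot>\<^bsub>D\<^esub> b c"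
      by (rule D.Comp_eq_Arr[OF f'(2)]) (use f'A xA b[OF c] in auto)
    also have "\<dots> = ?tw c" by (rule l(2)[OF c])
    also have "dmap \<dots> c \<bullet> free_unit c (Cod M (i c)) = w c"
      by (rule transpose_free_unit) (use c YD wA[OF c] in auto)
    finally show ?thesis .
  qed
  show thesis
    by (rule that[OF x xA(2) _ f'(3) q qi f'q]) (use f'(1) xA in auto)
qed

text \<open>A stage over \<open>Y\<close> consists of a map \<open>f : X \<rightarrow> Y\<close> of diagrams and, for each \<open>c\<close>, of a factorization
  of \<open>f\<^sub>c\<close> as a trivial cofibration \<open>j\<^sub>c : X c \<rightarrow> R c\<close> followed by an arbitrary map \<open>r\<^sub>c : R c \<rightarrow> Y c\<close>.
  The next stage consists of \<open>x : X \<rightarrow> X'\<close>, of cofibrations \<open>k\<^sub>c : R c \<rightarrow> P c\<close> and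
  \<open>s\<^sub>c : P c \<rightarrow> R' c\<close>, and of a weak equivalence \<open>P c \<rightarrow> Y c\<close>; the map to \<open>R' c\<close> from the
  pushout of \<open>R c\<close> and \<open>X' c\<close> under \<open>X c\<close> is a trivial cofibration.\<close>

definition stage where
  "stage Y S \<longleftrightarrow> (case S of (f, j, r) \<Rightarrow> f \<in> Arr D \<and> dcod f = Y \<and> ddom f \<in> GD \<and>
     (\<forall>c\<in>EObj C. j c \<in> W \<inter> Cf \<and> Dom M (j c) = dobj (ddom f) c \<and> r c \<in> hom M (Cod M (j c)) (dobj Y c) \<and>
        r c \<bullet> j c = dmap f c))"

definition next_stage where
  "next_stage S S' x k s \<longleftrightarrow> (case S of (f, j, r) \<Rightarrow> case S' of (f', j', r') \<Rightarrow>
     x \<in> CfD \<and> ddom x = ddom f \<and> dcod x = ddom f' \<and> f' \<cdot>\<^bsub>D\<^esub> x = f \<and>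
     (\<forall>c\<in>EObj C. k c \<in> Cf \<and> Dom M (k c) = Cod M (j c) \<and> s c \<in> Cf \<and> Dom M (s c) = Cod M (k c) \<and>
        Cod M (s c) = Cod M (j' c) \<and> s c \<bullet> k c \<bullet> j c = j' c \<bullet> dmap x c \<and>
        (\<forall>a b. pushout M (j c) (dmap x c) a b \<longrightarrow>
          (\<exists>l. l \<in> W \<inter> Cf \<and> l \<in> hom M (Cod M a) (Cod M (j' c)) \<and> l \<bullet> a = s c \<bullet> k c \<and> l \<bullet> b = j' c)) \<and>
        r' c \<bullet> s c \<in> W \<and> (r' c \<bullet> s c) \<bullet> k c = r c))"

text \<open>Factoring \<open>r c\<close> in \<open>M\<close> supplies \<open>P c\<close>, attaching
  cells produces the next diagram, and \<open>cylinder_step\<close> replaces the resulting maps from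
  \<open>P c\<close> by cofibrations into a new \<open>R c\<close>.\<close>

lemma factorization_step:
  assumes "stage Y (f, j, r)"
  shows "\<exists>S' x k s. stage Y S' \<and> next_stage (f, j, r) S' x k s"
proof -
  have f: "f \<in> Arr D" "dcod f = Y" "ddom f \<in> GD"
    and j: "\<And>c. c \<in> EObj C \<Longrightarrow> j c \<in> W \<inter> Cf" "\<And>c. c \<in> EObj C \<Longrightarrow> Dom M (j c) = dobj (ddom f) c"
    and r: "\<And>c. c \<in> EObj C \<Longrightarrow> r c \<in> Arr M" "\<And>c. c \<in> EObj C \<Longrightarrow> Dom M (r c) = Cod M (j c)"
      "\<And>c. c \<in> EObj C \<Longrightarrow> Cod M (r c) = dobj Y c" "\<And>c. c \<in> EObj C \<Longrightarrow> r c \<bullet> j c = dmap f c"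
    using assms by (auto simp: stage_def in_hom_iff)
  have jA: "j c \<in> Arr M" if "c \<in> EObj C" for c using j(1)[OF that] Cf.cof_Arr by blast
  have "\<exists>k w. k \<in> Cf \<and> w \<in> W \<and> Dom M w = Cod M k \<and> r c = w \<bullet> k" if c: "c \<in> EObj C" for c
    using factorization_M[OF r(1)[OF c]] Cf.cof_Cod[of "j c"] j(1)[OF c] r(2)[OF c] by (metis IntD2)
  then obtain k w where kw: "\<And>c. c \<in> EObj C \<Longrightarrow> k c \<in> Cf \<and> w c \<in> W \<and> Dom M (w c) = Cod M (k c) \<and> r c = w c \<bullet> k c"
    by metis
  have k: "k c \<in> Cf" "k c \<in> Arr M" "Dom M (k c) = Cod M (j c)"
    and w: "w c \<in> W" "w c \<in> Arr M" "Dom M (w c) = Cod M (k c)" "Cod M (w c) = dobj Y c" "w c \<bullet> k c = r c"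
    if c: "c \<in> EObj C" for c
  proof -
    show k: "k c \<in> Cf" "k c \<in> Arr M" using kw[OF c] Cf.cof_Arr by auto
    show w: "w c \<in> W" "w c \<in> Arr M" "Dom M (w c) = Cod M (k c)" "w c \<bullet> k c = r c" using kw[OF c] W_Arr by auto
    show "Dom M (k c) = Cod M (j c)" "Cod M (w c) = dobj Y c"
      using r(2,3)[OF c] k w M.Dom_Comp[of "k c" "w c"] M.Cod_Comp[of "k c" "w c"] by auto
  qed
  \<comment> \<open>The cells are attached along the composite \<open>X c -> R c -> P c\<close>,
    since the counit is available for the values of the diagram \<open>X\<close>, and the
    \<open>R c\<close> form no diagram.\<close>
  let ?i = "\<lambda>c. k c \<bullet> j c"
  have i: "?i c \<in> Cf" "Dom M (?i c) = dobj (ddom f) c" "Cod M (?i c) = Cod M (k c)" if c: "c \<in> EObj C" for c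
    using k[OF c] j[OF c] jA[OF c] by (auto intro!: Cf.cof_Comp)
  obtain x f' q where x: "x \<in> cells" "ddom x = ddom f" and f': "f' \<in> hom D (dcod x) (dcod f)" "f' \<cdot>\<^bsub>D\<^esub> x = f"
    and q: "\<And>c. c \<in> EObj C \<Longrightarrow> q c \<in> hom M (Cod M (?i c)) (dobj (dcod x) c)"
      "\<And>c. c \<in> EObj C \<Longrightarrow> q c \<bullet> ?i c = dmap x c" "\<And>c. c \<in> EObj C \<Longrightarrow> dmap f' c \<bullet> q c = w c"
  proof (rule attach_cells[OF f(1,3), of ?i w])
    show "?i c \<in> Cf" "Dom M (?i c) = dobj (ddom f) c" if "c \<in> EObj C" for c using i[OF that] by auto
    show "w c \<in> hom M (Cod M (?i c)) (dobj (dcod f) c)" if "c \<in> EObj C" for c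
      using w[OF that] i[OF that] f by (simp add: in_hom_iff)
    show "w c \<bullet> ?i c = dmap f c" if c: "c \<in> EObj C" for c
      using M.Comp_eq_Arr[OF w(5)[OF c], of "j c"] w[OF c] k[OF c] jA[OF c] r(4)[OF c] by simp
  qed (rule that; assumption)
  have xA: "x \<in> Arr D" using x cells_Arr by blast
  have f'A: "f' \<in> Arr D" "ddom f' = dcod x" "dcod f' = Y" using f' f by (auto simp: in_hom_iff)
  have "\<exists>s j' v. s \<in> Cf \<and> Dom M s = Cod M (k c) \<and> Cod M s = Cod M j' \<and> j' \<in> W \<inter> Cf \<and> Dom M j' = dobj (dcod x) c \<and>
      v \<in> hom M (Cod M j') (dobj (dcod x) c) \<and> v \<bullet> j' = Ident M (dobj (dcod x) c) \<and> v \<bullet> s = q c \<and>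
      s \<bullet> k c \<bullet> j c = j' \<bullet> dmap x c \<and>
      (\<forall>a b. pushout M (j c) (dmap x c) a b \<longrightarrow>
        (\<exists>l. l \<in> W \<inter> Cf \<and> l \<in> hom M (Cod M a) (Cod M j') \<and> l \<bullet> a = s \<bullet> k c \<and> l \<bullet> b = j'))"
    if c: "c \<in> EObj C" for c
  proof -
    have xc: "Cod M (dmap x c) = dobj (dcod x) c" using xA c by simp
    have q': "q c \<in> hom M (Cod M (k c)) (Cod M (dmap x c))" using q(1)[OF c] i(3)[OF c] xc by simp
    have dx: "Dom M (dmap x c) = Dom M (j c)" using xA x c j(2)[OF c] by simp
    show ?thesis
      by (rule cylinder_step[OF j(1)[OF c] cells_cof[OF x(1) c] dx k(1,3)[OF c] q' q(2)[OF c]])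
        (unfold xc, blast)
  qed
  then obtain s j' v where S: "\<And>c. c \<in> EObj C \<Longrightarrow> s c \<in> Cf \<and> Dom M (s c) = Cod M (k c) \<and> Cod M (s c) = Cod M (j' c) \<and>
      j' c \<in> W \<inter> Cf \<and> Dom M (j' c) = dobj (dcod x) c \<and>
      v c \<in> hom M (Cod M (j' c)) (dobj (dcod x) c) \<and> v c \<bullet> j' c = Ident M (dobj (dcod x) c) \<and> v c \<bullet> s c = q c \<and>
      s c \<bullet> k c \<bullet> j c = j' c \<bullet> dmap x c \<and>
      (\<forall>a b. pushout M (j c) (dmap x c) a b \<longrightarrow>
        (\<exists>l. l \<in> W \<inter> Cf \<and> l \<in> hom M (Cod M a) (Cod M (j' c)) \<and> l \<bullet> a = s c \<bullet> k c \<and> l \<bullet> b = j' c))"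
    by metis
  \<comment> \<open>Composition with the retraction \<open>v c\<close> makes
    \<open>r' c \<bullet> j' c\<close> the map \<open>f'\<close> at \<open>c\<close>, and makes
    \<open>r' c \<bullet> s c\<close> the weak equivalence \<open>w c\<close>.\<close>
  define r' where "r' c = dmap f' c \<bullet> v c" for c
  have vA: "v c \<in> Arr M" "Dom M (v c) = Cod M (j' c)" "Cod M (v c) = dobj (dcod x) c"
    "v c \<bullet> j' c = Ident M (dobj (dcod x) c)" "v c \<bullet> s c = q c" if "c \<in> EObj C" for c
    using S[OF that] by (auto simp: in_hom_iff)
  have sA: "s c \<in> Arr M" "j' c \<in> Arr M" "Dom M (j' c) = dobj (dcod x) c" "Cod M (s c) = Cod M (j' c)" if "c \<in> EObj C" for c
    using S[OF that] Cf.cof_Arr by auto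
  have r'j': "r' c \<bullet> j' c = dmap f' c" if c: "c \<in> EObj C" for c
  proof -
    have "r' c \<bullet> j' c = dmap f' c \<bullet> v c \<bullet> j' c"
      unfolding r'_def using vA(1-3)[OF c] sA[OF c] f'A c by (simp add: M.Comp_Comp)
    then show ?thesis using vA(4)[OF c] f'A c by simp
  qed
  have r's: "r' c \<bullet> s c = w c" if c: "c \<in> EObj C" for c
  proof -
    have "r' c \<bullet> s c = dmap f' c \<bullet> v c \<bullet> s c"
      unfolding r'_def using vA(1-3)[OF c] sA[OF c] f'A c by (simp add: M.Comp_Comp)
    then show ?thesis using vA(5)[OF c] q(3)[OF c] by simp
  qed
  have "stage Y (f', j', r')"
    unfolding stage_def prod.case
  proof (intro conjI ballI)
    show "ddom f' \<in> GD" using f'A cells_good(2)[OF x(1)] by simp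
    show "r' c \<in> hom M (Cod M (j' c)) (dobj Y c)" if "c \<in> EObj C" for c
      using that vA[OF that] f'A by (simp add: r'_def in_hom_iff)
    show "j' c \<in> W \<inter> Cf" "Dom M (j' c) = dobj (ddom f') c" if "c \<in> EObj C" for c
      using S[OF that] f'A by simp_all
  qed (use f'A r'j' in auto)
  moreover have "next_stage (f, j, r) (f', j', r') x k s"
    unfolding next_stage_def prod.case
  proof (intro conjI ballI)
    fix c assume c: "c \<in> EObj C"
    show "r' c \<bullet> s c \<in> W" "(r' c \<bullet> s c) \<bullet> k c = r c" using r's[OF c] w[OF c] by auto
    show "k c \<in> Cf" "Dom M (k c) = Cod M (j c)" using k[OF c] by auto
    show "s c \<in> Cf" "Dom M (s c) = Cod M (k c)" "Cod M (s c) = Cod M (j' c)"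
      "s c \<bullet> k c \<bullet> j c = j' c \<bullet> dmap x c"
      "\<forall>a b. pushout M (j c) (dmap x c) a b \<longrightarrow>
        (\<exists>l. l \<in> W \<inter> Cf \<and> l \<in> hom M (Cod M a) (Cod M (j' c)) \<and> l \<bullet> a = s c \<bullet> k c \<and> l \<bullet> b = j' c)"
      using S[OF c] by blast+
  qed (use x f' f'A CfD_iff in auto)
  ultimately show ?thesis by blast
qed

lemma factorization_D:
  assumes f: "f \<in> Arr D" "ddom f \<in> GD"
  shows "\<exists>i\<in>CfD. \<exists>w\<in>WD. Dom D w = Cod D i \<and> f = w \<cdot>\<^bsub>D\<^esub> i"
proof -
  let ?Y = "dcod f"
  \<comment> \<open>At the start \<open>R c\<close> is \<open>X c\<close> itself, and the trivial
    cofibration is the identity.\<close>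
  define S0 where "S0 = (f, \<lambda>c. Ident M (dobj (ddom f) c), \<lambda>c. dmap f c)"
  have "stage ?Y S0"
    using f T.cof_Ident by (auto simp: stage_def S0_def GD_iff in_hom_iff)
  \<comment> \<open>The initial value is built into the predicate, because dependent choice would
    otherwise give a sequence that starts at an unspecified stage.\<close>
  then have "\<exists>S. \<forall>n. (stage ?Y (S n) \<and> (n = 0 \<longrightarrow> S n = S0)) \<and> (\<exists>x k s. next_stage (S n) (S (Suc n)) x k s)"
  proof (intro dependent_nat_choice)
    fix T :: "('c, 'o, 'a) diag_map \<times> ('c \<Rightarrow> 'a) \<times> ('c \<Rightarrow> 'a)" and n :: nat
    assume "stage ?Y T \<and> (n = 0 \<longrightarrow> T = S0)"
    then show "\<exists>T'. (stage ?Y T' \<and> (Suc n = 0 \<longrightarrow> T' = S0)) \<and> (\<exists>x k s. next_stage T T' x k s)"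
      using factorization_step by (cases T) blast
  qed blast
  then obtain S where S: "\<And>n. stage ?Y (S n)" "S 0 = S0" "\<And>n. \<exists>x k s. next_stage (S n) (S (Suc n)) x k s"
    by metis
  then obtain x k s where N: "\<And>n. next_stage (S n) (S (Suc n)) (x n) (k n) (s n)" by metis
  define g where "g n = fst (S n)" for n
  define j where "j n = fst (snd (S n))" for n
  define r where "r n = snd (snd (S n))" for n
  have Sn: "S n = (g n, j n, r n)" for n by (simp add: g_def j_def r_def)
  have g: "g n \<in> Arr D" "dcod (g n) = ?Y" "ddom (g n) \<in> GD" for n
    using S(1)[of n] by (auto simp: stage_def Sn)
  have jr: "j n c \<in> W \<inter> Cf" "Dom M (j n c) = dobj (ddom (g n)) c" "r n c \<in> hom M (Cod M (j n c)) (dobj ?Y c)"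
    "r n c \<bullet> j n c = dmap (g n) c" if "c \<in> EObj C" for n c
    using S(1)[of n] that by (auto simp: stage_def Sn)
  have x: "x n \<in> CfD" "ddom (x n) = ddom (g n)" "dcod (x n) = ddom (g (Suc n))" "g (Suc n) \<cdot>\<^bsub>D\<^esub> x n = g n" for n
    using N[of n] by (auto simp: next_stage_def Sn)
  have ks: "k n c \<in> Cf \<and> Dom M (k n c) = Cod M (j n c) \<and> s n c \<in> Cf \<and> Dom M (s n c) = Cod M (k n c) \<and>
        Cod M (s n c) = Cod M (j (Suc n) c) \<and> s n c \<bullet> k n c \<bullet> j n c = j (Suc n) c \<bullet> dmap (x n) c \<and>
        (\<forall>a b. pushout M (j n c) (dmap (x n) c) a b \<longrightarrow>
          (\<exists>l. l \<in> W \<inter> Cf \<and> l \<in> hom M (Cod M a) (Cod M (j (Suc n) c)) \<and> l \<bullet> a = s n c \<bullet> k n c \<and> l \<bullet> b = j (Suc n) c)) \<and>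
        r (Suc n) c \<bullet> s n c \<in> W \<and> (r (Suc n) c \<bullet> s n c) \<bullet> k n c = r n c" if "c \<in> EObj C" for n c
    using N[of n] that unfolding next_stage_def Sn prod.case by blast
  let ?X = "\<lambda>n. ddom (g n)"
  have xA: "x n \<in> Arr D" for n using x(1) CfD_iff cells_Arr by blast
  have xh: "x n \<in> hom D (?X n) (?X (Suc n))" for n using x[of n] xA by (simp add: in_hom_iff)
  obtain Z t where Z: "seq_colimit D ?X x Z t" using CfD.cof_sequence(1)[of ?X, OF g(3) x(1) xh] by blast
  have t0: "t 0 \<in> CfD" by (rule CfD.cof_sequence(2)[of ?X, OF g(3) x(1) xh Z])
  have t: "t n \<in> Arr D" "ddom (t n) = ?X n" "dcod (t n) = Z" for n
    using Z by (auto simp: seq_colimit_def in_hom_iff)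
  have "?Y \<in> Obj D" using f by simp
  then have "\<exists>!h. h \<in> hom D Z ?Y \<and> (\<forall>n. h \<cdot>\<^bsub>D\<^esub> t n = g n)"
    using g x by (intro seq_colimit_ex1[OF Z]) (simp_all add: in_hom_iff)
  then obtain h where h: "h \<in> hom D Z ?Y" "\<And>n. h \<cdot>\<^bsub>D\<^esub> t n = g n" by blast
  have hA: "h \<in> Arr D" "ddom h = Z" "dcod h = ?Y" using h by (auto simp: in_hom_iff)
  have xc: "dmap (x n) c \<in> Cf" if "c \<in> EObj C" for n c using x(1)[of n] CfD_iff cells_cof that by blast
  have "dmap h c \<in> W" if c: "c \<in> EObj C" for c
  proof -
    have Zc: "seq_colimit M (\<lambda>n. dobj (?X n) c) (\<lambda>n. dmap (x n) c) (dobj Z c) (\<lambda>n. dmap (t n) c)"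
    proof (rule D_seq_colimit_pointwise[OF xh Z c])
      fix d assume d: "d \<in> EObj C"
      show "\<exists>Z t. seq_colimit M (\<lambda>n. dobj (?X n) d) (\<lambda>n. dmap (x n) d) Z t"
        by (rule Cf.cof_sequence(1)) (use g(3) xc d x xA in \<open>auto simp: GD_iff in_hom_iff\<close>)
    qed
    interpret telescope V M A C \<kappa> G Cf W "\<lambda>n. dobj (?X n) c" "\<lambda>n. dmap (x n) c" "dobj Z c" "\<lambda>n. dmap (t n) c"
      "\<lambda>n. j n c" "\<lambda>n. k n c" "\<lambda>n. s n c" "\<lambda>n. r n c" "dobj ?Y c" "dmap h c"
    proof unfold_locales
      fix n
      show "dmap (x n) c \<in> Cf" by (rule xc[OF c])
      show "Dom M (dmap (x n) c) = dobj (?X n) c" "Cod M (dmap (x n) c) = dobj (?X (Suc n)) c"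
        using xA x c by auto
      show "dmap h c \<in> hom M (dobj Z c) (dobj ?Y c)" using hA c by (simp add: in_hom_iff)
      show "dmap h c \<bullet> dmap (t n) c = r n c \<bullet> j n c"
        using h(2)[of n] dmap_Comp[OF c, of h "t n"] jr(4)[OF c] by simp
      show "j n c \<in> W \<inter> Cf" "Dom M (j n c) = dobj (?X n) c" "r n c \<in> hom M (Cod M (j n c)) (dobj ?Y c)"
        using jr[OF c] by auto
      show "k n c \<in> Cf" "Dom M (k n c) = Cod M (j n c)" "s n c \<in> Cf" "Dom M (s n c) = Cod M (k n c)"
        "Cod M (s n c) = Cod M (j (Suc n) c)" "s n c \<bullet> k n c \<bullet> j n c = j (Suc n) c \<bullet> dmap (x n) c"
        "r (Suc n) c \<bullet> s n c \<in> W" "(r (Suc n) c \<bullet> s n c) \<bullet> k n c = r n c"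
        using ks[OF c, of n] by blast+
      show "\<exists>l. l \<in> W \<inter> Cf \<and> l \<in> hom M (Cod M a) (Cod M (j (Suc n) c)) \<and> l \<bullet> a = s n c \<bullet> k n c \<and> l \<bullet> b = j (Suc n) c"
        if "pushout M (j n c) (dmap (x n) c) a b" for a b
        using ks[OF c, of n] that by blast
    qed (rule Zc)
    show ?thesis by (rule weak_equivalence)
  qed
  then have "h \<in> WD" using hA by (simp add: WD_iff)
  moreover have "f = h \<cdot>\<^bsub>D\<^esub> t 0" using h(2)[of 0] S(2) by (simp add: Sn S0_def)
  ultimately show ?thesis using t0 t hA by (intro bexI[of _ "t 0"] bexI[of _ h]) auto
qed

lemma cofibration_category_D: "cofibration_category \<kappa> D GD CfD WD"
  unfolding cofibration_category_def
  using D.category_axioms D_initial_exists[OF initial_M] W_D left_closed_CfD left_closed_trivial_CfD factorization_D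
  by simp

end

section \<open>The pointwise action\<close>

context monoidal_action
begin

text \<open>The structure maps of \<open>K \<star> X\<close> consist of this map followed by
  \<open>K\<close> acting on the structure maps of \<open>X\<close>; their axioms become identities
  about \<open>swap\<close>.\<close>

definition swap where
  "swap E K X = act_assoc A K E X \<bullet> (symm V E K \<lhd> X) \<bullet> inverse_of M (act_assoc A E K X)"

lemma swap_typing [simp]:
  assumes "E \<in> Obj V" "K \<in> Obj V" "X \<in> Obj M"
  shows "swap E K X \<in> Arr M" "Dom M (swap E K X) = E \<star> K \<star> X" "Cod M (swap E K X) = K \<star> E \<star> X"
  using assms by (simp_all add: swap_def)

lemma swap_act_assoc:
  assumes "E \<in> Obj V" "K \<in> Obj V" "X \<in> Obj M"
  shows "swap E K X \<bullet> act_assoc A E K X = act_assoc A K E X \<bullet> (symm V E K \<lhd> X)"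
  using assms by (simp add: swap_def M.Comp_Comp)

lemma iso_whisker_left:
  assumes "K \<in> Obj V" "iso M f"
  shows "iso M (K \<rhd> f)"
  using assms M.iso_Arr[OF assms(2)]
  by (intro M.isoI[where g = "K \<rhd> inverse_of M f"]) (auto simp: whisker_left_Comp)


lemma swap_natural:
  assumes e: "e \<in> Arr V" and k: "k \<in> Arr V" and f: "f \<in> Arr M"
    and eqs: "E = Dom V e" "K = Dom V k" "X = Dom M f" "E' = Cod V e" "K' = Cod V k" "X' = Cod M f"
  shows "swap E' K' X' \<bullet> (e \<diamondop> k \<diamondop> f) = (k \<diamondop> e \<diamondop> f) \<bullet> swap E K X"
proof (rule M.iso_cancel_right[of "act_assoc A E K X"])
  note T = e k f eqs
  have 1: "(e \<diamondop> k \<diamondop> f) \<bullet> act_assoc A E K X = act_assoc A E' K' X' \<bullet> ((e \<odot>\<^bsub>V\<^esub> k) \<diamondop> f)"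
    using act_assoc_nat[OF e k f] eqs by simp
  have 2: "symm V E' K' \<cdot>\<^bsub>V\<^esub> (e \<odot>\<^bsub>V\<^esub> k) = (k \<odot>\<^bsub>V\<^esub> e) \<cdot>\<^bsub>V\<^esub> symm V E K"
    using V.symm_natural[of e E E' k K K'] T by (simp add: in_hom_iff)
  have "(swap E' K' X' \<bullet> (e \<diamondop> k \<diamondop> f)) \<bullet> act_assoc A E K X = swap E' K' X' \<bullet> act_assoc A E' K' X' \<bullet> ((e \<odot>\<^bsub>V\<^esub> k) \<diamondop> f)"
    using T 1 by (simp add: M.Comp_Comp)
  also have "\<dots> = act_assoc A K' E' X' \<bullet> (symm V E' K' \<lhd> X') \<bullet> ((e \<odot>\<^bsub>V\<^esub> k) \<diamondop> f)"
    using T swap_act_assoc[of E' K' X'] M.Comp_eq_Comp[OF swap_act_assoc[of E' K' X'], of "(e \<odot>\<^bsub>V\<^esub> k) \<diamondop> f"]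
    by (simp add: M.Comp_Comp)
  also have "(symm V E' K' \<lhd> X') \<bullet> ((e \<odot>\<^bsub>V\<^esub> k) \<diamondop> f) = ((k \<odot>\<^bsub>V\<^esub> e) \<diamondop> f) \<bullet> (symm V E K \<lhd> X)"
    using T 2 by (simp add: act_interchange)
  also have "act_assoc A K' E' X' \<bullet> \<dots> = (k \<diamondop> e \<diamondop> f) \<bullet> act_assoc A K E X \<bullet> (symm V E K \<lhd> X)"
    using T act_assoc_nat[OF k e f, of K E X K' E' X'] by (intro M.Comp_eq_Comp) auto
  also have "\<dots> = ((k \<diamondop> e \<diamondop> f) \<bullet> swap E K X) \<bullet> act_assoc A E K X"
    using T swap_act_assoc[of E K X] by (simp add: M.Comp_Comp)
  finally show "(swap E' K' X' \<bullet> (e \<diamondop> k \<diamondop> f)) \<bullet> act_assoc A E K X = ((k \<diamondop> e \<diamondop> f) \<bullet> swap E K X) \<bullet> act_assoc A E K X" .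
qed (use assms in auto)

lemma swap_swap:
  assumes "E \<in> Obj V" "K \<in> Obj V" "X \<in> Obj M"
  shows "swap K E X \<bullet> swap E K X = Ident M (E \<star> K \<star> X)"
proof (rule M.iso_cancel_right[of "act_assoc A E K X"])
  have "(swap K E X \<bullet> swap E K X) \<bullet> act_assoc A E K X = swap K E X \<bullet> act_assoc A K E X \<bullet> (symm V E K \<lhd> X)"
    using assms swap_act_assoc[of E K X] by (simp add: M.Comp_Comp)
  also have "\<dots> = act_assoc A E K X \<bullet> (symm V K E \<lhd> X) \<bullet> (symm V E K \<lhd> X)"
    by (rule M.Comp_eq_Comp[OF swap_act_assoc]) (use assms in auto)
  also have "\<dots> = Ident M (E \<star> K \<star> X) \<bullet> act_assoc A E K X"
    using assms V.symm_symm[of E K] by (simp add: act_interchange)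
  finally show "(swap K E X \<bullet> swap E K X) \<bullet> act_assoc A E K X = Ident M (E \<star> K \<star> X) \<bullet> act_assoc A E K X" .
qed (use assms in auto)

lemma iso_swap: "E \<in> Obj V \<Longrightarrow> K \<in> Obj V \<Longrightarrow> X \<in> Obj M \<Longrightarrow> iso M (swap E K X)"
  by (rule M.isoI[where g = "swap K E X"]) (auto simp: swap_swap)

text \<open>The hexagon, transported to the action by means of its pentagons. It expresses that the
  associator of the pointwise action is a map of diagrams.\<close>

lemma swap_tensor_right:
  assumes E: "E \<in> Obj V" and L: "L \<in> Obj V" and N: "N \<in> Obj V" and X: "X \<in> Obj M"
  shows "act_assoc A L N (E \<star> X) \<bullet> swap E (L \<otimes>\<^bsub>V\<^esub> N) X =
    (L \<rhd> swap E N X) \<bullet> swap E L (N \<star> X) \<bullet> (E \<rhd> act_assoc A L N X)"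
proof -
  note O = E L N X
  let ?\<alpha> = "act_assoc A"
  let ?\<theta> = "?\<alpha> E (L \<otimes>\<^bsub>V\<^esub> N) X"
  let ?a = "assoc V E L N \<lhd> X"
  let ?w = "(assoc V L E N \<lhd> X) \<bullet> ((symm V E L \<odot>\<^bsub>V\<^esub> Ident V N) \<lhd> X)"
  have iso_a: "iso M ?a"
  proof (rule M.isoI[where g = "inverse_of V (assoc V E L N) \<lhd> X"])
  qed (use O in \<open>auto simp: act_interchange\<close>)
  have l: "(?\<alpha> L N (E \<star> X) \<bullet> swap E (L \<otimes>\<^bsub>V\<^esub> N) X) \<bullet> ?\<theta> \<bullet> ?a =
      (L \<rhd> ?\<alpha> N E X) \<bullet> ?\<alpha> L (N \<otimes>\<^bsub>V\<^esub> E) X \<bullet> ((Ident V L \<odot>\<^bsub>V\<^esub> symm V E N) \<lhd> X) \<bullet> ?w"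
  proof -
    have "(?\<alpha> L N (E \<star> X) \<bullet> swap E (L \<otimes>\<^bsub>V\<^esub> N) X) \<bullet> ?\<theta> \<bullet> ?a =
        ?\<alpha> L N (E \<star> X) \<bullet> swap E (L \<otimes>\<^bsub>V\<^esub> N) X \<bullet> ?\<theta> \<bullet> ?a"
      using O by (simp add: M.Comp_Comp)
    also have "swap E (L \<otimes>\<^bsub>V\<^esub> N) X \<bullet> ?\<theta> \<bullet> ?a = ?\<alpha> (L \<otimes>\<^bsub>V\<^esub> N) E X \<bullet> (symm V E (L \<otimes>\<^bsub>V\<^esub> N) \<lhd> X) \<bullet> ?a"
      by (rule M.Comp_eq_Comp[OF swap_act_assoc]) (use O in auto)
    also have "?\<alpha> L N (E \<star> X) \<bullet> \<dots> = ((L \<rhd> ?\<alpha> N E X) \<bullet> ?\<alpha> L (N \<otimes>\<^bsub>V\<^esub> E) X \<bullet> (assoc V L N E \<lhd> X)) \<bullet>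
        (symm V E (L \<otimes>\<^bsub>V\<^esub> N) \<lhd> X) \<bullet> ?a"
      by (rule M.Comp_eq_Arr[OF act_pentagon]) (use O in auto)
    also have "\<dots> = (L \<rhd> ?\<alpha> N E X) \<bullet> ?\<alpha> L (N \<otimes>\<^bsub>V\<^esub> E) X \<bullet>
        ((assoc V L N E \<cdot>\<^bsub>V\<^esub> symm V E (L \<otimes>\<^bsub>V\<^esub> N) \<cdot>\<^bsub>V\<^esub> assoc V E L N) \<lhd> X)"
      using O by (simp add: M.Comp_Comp act_interchange)
    also have "assoc V L N E \<cdot>\<^bsub>V\<^esub> symm V E (L \<otimes>\<^bsub>V\<^esub> N) \<cdot>\<^bsub>V\<^esub> assoc V E L N =
        (Ident V L \<odot>\<^bsub>V\<^esub> symm V E N) \<cdot>\<^bsub>V\<^esub> assoc V L E N \<cdot>\<^bsub>V\<^esub> (symm V E L \<odot>\<^bsub>V\<^esub> Ident V N)"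
      by (rule V.hexagon[OF E L N])
    finally show ?thesis using O by (simp add: act_interchange)
  qed
  have r: "((L \<rhd> swap E N X) \<bullet> swap E L (N \<star> X) \<bullet> (E \<rhd> ?\<alpha> L N X)) \<bullet> ?\<theta> \<bullet> ?a =
      (L \<rhd> ?\<alpha> N E X) \<bullet> ?\<alpha> L (N \<otimes>\<^bsub>V\<^esub> E) X \<bullet> ((Ident V L \<odot>\<^bsub>V\<^esub> symm V E N) \<lhd> X) \<bullet> ?w"
  proof -
    have "((L \<rhd> swap E N X) \<bullet> swap E L (N \<star> X) \<bullet> (E \<rhd> ?\<alpha> L N X)) \<bullet> ?\<theta> \<bullet> ?a =
        (L \<rhd> swap E N X) \<bullet> swap E L (N \<star> X) \<bullet> (E \<rhd> ?\<alpha> L N X) \<bullet> ?\<theta> \<bullet> ?a"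
      using O by (simp add: M.Comp_Comp)
    also have "(E \<rhd> ?\<alpha> L N X) \<bullet> ?\<theta> \<bullet> ?a = ?\<alpha> E L (N \<star> X) \<bullet> ?\<alpha> (E \<otimes>\<^bsub>V\<^esub> L) N X"
      by (rule act_pentagon[symmetric]) (use O in auto)
    also have "swap E L (N \<star> X) \<bullet> \<dots> = ?\<alpha> L E (N \<star> X) \<bullet> (symm V E L \<lhd> (N \<star> X)) \<bullet> ?\<alpha> (E \<otimes>\<^bsub>V\<^esub> L) N X"
      by (rule M.Comp_eq_Comp[OF swap_act_assoc]) (use O in auto)
    also have "(symm V E L \<lhd> (N \<star> X)) \<bullet> ?\<alpha> (E \<otimes>\<^bsub>V\<^esub> L) N X = ?\<alpha> (L \<otimes>\<^bsub>V\<^esub> E) N X \<bullet> ((symm V E L \<odot>\<^bsub>V\<^esub> Ident V N) \<lhd> X)"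
      using act_assoc_nat[of "symm V E L" "Ident V N" "Ident M X"] O by simp
    also have "?\<alpha> L E (N \<star> X) \<bullet> \<dots> = ((L \<rhd> ?\<alpha> E N X) \<bullet> ?\<alpha> L (E \<otimes>\<^bsub>V\<^esub> N) X \<bullet> (assoc V L E N \<lhd> X)) \<bullet>
        ((symm V E L \<odot>\<^bsub>V\<^esub> Ident V N) \<lhd> X)"
      by (rule M.Comp_eq_Arr[OF act_pentagon]) (use O in auto)
    also have "\<dots> = (L \<rhd> ?\<alpha> E N X) \<bullet> ?\<alpha> L (E \<otimes>\<^bsub>V\<^esub> N) X \<bullet> ?w"
      using O by (simp add: M.Comp_Comp)
    also have "(L \<rhd> swap E N X) \<bullet> \<dots> = (L \<rhd> ?\<alpha> N E X) \<bullet> (L \<rhd> symm V E N \<lhd> X) \<bullet> ?\<alpha> L (E \<otimes>\<^bsub>V\<^esub> N) X \<bullet> ?w"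
      using O swap_act_assoc[of E N X] by (intro M.Comp_eq_Comp) (auto simp: whisker_left_Comp)
    also have "(L \<rhd> symm V E N \<lhd> X) \<bullet> ?\<alpha> L (E \<otimes>\<^bsub>V\<^esub> N) X \<bullet> ?w =
        ?\<alpha> L (N \<otimes>\<^bsub>V\<^esub> E) X \<bullet> ((Ident V L \<odot>\<^bsub>V\<^esub> symm V E N) \<lhd> X) \<bullet> ?w"
      using O act_assoc_nat[of "Ident V L" "symm V E N" "Ident M X" L "E \<otimes>\<^bsub>V\<^esub> N" X L "N \<otimes>\<^bsub>V\<^esub> E" X]
      by (intro M.Comp_eq_Comp) auto
    finally show ?thesis .
  qed
  \<comment> \<open>Both sides were computed on
    \<open>((E \<otimes> L) \<otimes> N) \<star> X\<close>, where the hexagon starts; this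
    isomorphism leads back to the source of the claim.\<close>
  have iso: "iso M (?\<theta> \<bullet> ?a)"
    by (rule M.isoI[where g = "inverse_of M ?a \<bullet> inverse_of M ?\<theta>"]) (use O iso_a in \<open>auto simp: M.Comp_Comp\<close>)
  show ?thesis
    by (rule M.iso_cancel_right[OF iso]) (use O l r in auto)
qed

text \<open>The inverse form of \<open>swap_tensor_right\<close>, as \<open>swap E K X\<close> and
  \<open>swap K E X\<close> are mutually inverse. It is what associativity of the structure maps of
  \<open>K \<star> X\<close> requires.\<close>

lemma swap_tensor_left:
  assumes E: "E \<in> Obj V" and F: "F \<in> Obj V" and K: "K \<in> Obj V" and X: "X \<in> Obj M"
  shows "(K \<rhd> act_assoc A E F X) \<bullet> swap (E \<otimes>\<^bsub>V\<^esub> F) K X =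
    swap E K (F \<star> X) \<bullet> (E \<rhd> swap F K X) \<bullet> act_assoc A E F (K \<star> X)"
proof (rule M.iso_cancel_right[OF iso_swap[of K "E \<otimes>\<^bsub>V\<^esub> F" X]])
  note O = E F K X
  have "(swap E K (F \<star> X) \<bullet> (E \<rhd> swap F K X) \<bullet> act_assoc A E F (K \<star> X)) \<bullet> swap K (E \<otimes>\<^bsub>V\<^esub> F) X =
      swap E K (F \<star> X) \<bullet> (E \<rhd> swap F K X) \<bullet> act_assoc A E F (K \<star> X) \<bullet> swap K (E \<otimes>\<^bsub>V\<^esub> F) X"
    using O by (simp add: M.Comp_Comp)
  also have "act_assoc A E F (K \<star> X) \<bullet> swap K (E \<otimes>\<^bsub>V\<^esub> F) X =
      (E \<rhd> swap K F X) \<bullet> swap K E (F \<star> X) \<bullet> (K \<rhd> act_assoc A E F X)"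
    by (rule swap_tensor_right[OF K E F X])
  also have "(E \<rhd> swap F K X) \<bullet> \<dots> = Ident M (E \<star> K \<star> F \<star> X) \<bullet> swap K E (F \<star> X) \<bullet> (K \<rhd> act_assoc A E F X)"
    by (rule M.Comp_eq_Arr) (use O in \<open>auto simp: whisker_left_Comp swap_swap\<close>)
  also have "\<dots> = swap K E (F \<star> X) \<bullet> (K \<rhd> act_assoc A E F X)" using O by simp
  also have "swap E K (F \<star> X) \<bullet> \<dots> = Ident M (K \<star> E \<star> F \<star> X) \<bullet> (K \<rhd> act_assoc A E F X)"
    by (rule M.Comp_eq_Arr[OF swap_swap]) (use O in auto)
  also have "\<dots> = ((K \<rhd> act_assoc A E F X) \<bullet> swap (E \<otimes>\<^bsub>V\<^esub> F) K X) \<bullet> swap K (E \<otimes>\<^bsub>V\<^esub> F) X"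
    using O by (simp add: M.Comp_Comp swap_swap)
  finally show "((K \<rhd> act_assoc A E F X) \<bullet> swap (E \<otimes>\<^bsub>V\<^esub> F) K X) \<bullet> swap K (E \<otimes>\<^bsub>V\<^esub> F) X =
      (swap E K (F \<star> X) \<bullet> (E \<rhd> swap F K X) \<bullet> act_assoc A E F (K \<star> X)) \<bullet> swap K (E \<otimes>\<^bsub>V\<^esub> F) X" by simp
qed (use assms in auto)

text \<open>Coherence of the symmetry with the units. For objects of the form \<open>I \<star> X\<close> it follows from
  the hexagon for \<open>I \<otimes> I\<close>, and every \<open>X\<close> is isomorphic to one of these.\<close>

lemma swap_unit_right:
  assumes E: "E \<in> Obj V" and X: "X \<in> Obj M"
  shows "act_unit A (E \<star> X) \<bullet> swap E \<I>\<^bsub>V\<^esub> X = E \<rhd> act_unit A X"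
proof -
  let ?I = "\<I>\<^bsub>V\<^esub>" and ?u = "act_unit A" and ?\<alpha> = "act_assoc A"
  have I: "?I \<in> Obj V" by simp
  \<comment> \<open>The composite of \<open>swap E (?I \<otimes> ?I) X\<close> with
    \<open>lunit\<close> is computed by naturality and again by \<open>swap_tensor_right\<close>;
    the common factor \<open>swap E ?I X\<close> then cancels.\<close>
  have 1: "?u (E \<star> ?I \<star> X) \<bullet> swap E ?I (?I \<star> X) = E \<rhd> ?u (?I \<star> X)"
  proof (rule M.iso_cancel_right[OF iso_whisker_left[of E "?\<alpha> ?I ?I X"]])
    show "(?u (E \<star> ?I \<star> X) \<bullet> swap E ?I (?I \<star> X)) \<bullet> (E \<rhd> ?\<alpha> ?I ?I X) = (E \<rhd> ?u (?I \<star> X)) \<bullet> (E \<rhd> ?\<alpha> ?I ?I X)"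
    proof (rule M.iso_cancel_left[OF iso_swap[OF E I X]])
      have "swap E ?I X \<bullet> (E \<rhd> ?u (?I \<star> X)) \<bullet> (E \<rhd> ?\<alpha> ?I ?I X) = swap E ?I X \<bullet> (E \<rhd> lunit V ?I \<lhd> X)"
        using E X act_lunit[of ?I X] by (simp add: whisker_left_Comp)
      also have "\<dots> = (lunit V ?I \<lhd> (E \<star> X)) \<bullet> swap E (?I \<otimes>\<^bsub>V\<^esub> ?I) X"
        using E X swap_natural[of "Ident V E" "lunit V ?I" "Ident M X" E "?I \<otimes>\<^bsub>V\<^esub> ?I" X E ?I X] by simp
      also have "\<dots> = (?u (?I \<star> E \<star> X) \<bullet> ?\<alpha> ?I ?I (E \<star> X)) \<bullet> swap E (?I \<otimes>\<^bsub>V\<^esub> ?I) X"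
        using E X act_lunit[of ?I "E \<star> X"] by simp
      also have "\<dots> = ?u (?I \<star> E \<star> X) \<bullet> ?\<alpha> ?I ?I (E \<star> X) \<bullet> swap E (?I \<otimes>\<^bsub>V\<^esub> ?I) X"
        using E X by (simp add: M.Comp_Comp)
      also have "\<dots> = ?u (?I \<star> E \<star> X) \<bullet> (?I \<rhd> swap E ?I X) \<bullet> swap E ?I (?I \<star> X) \<bullet> (E \<rhd> ?\<alpha> ?I ?I X)"
        using swap_tensor_right[OF E I I X] by simp
      also have "\<dots> = swap E ?I X \<bullet> ?u (E \<star> ?I \<star> X) \<bullet> swap E ?I (?I \<star> X) \<bullet> (E \<rhd> ?\<alpha> ?I ?I X)"
        using E X act_unit_nat[of "swap E ?I X" "E \<star> ?I \<star> X" "?I \<star> E \<star> X"] by (intro M.Comp_eq_Comp) auto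
      finally show "swap E ?I X \<bullet> (?u (E \<star> ?I \<star> X) \<bullet> swap E ?I (?I \<star> X)) \<bullet> (E \<rhd> ?\<alpha> ?I ?I X) =
          swap E ?I X \<bullet> (E \<rhd> ?u (?I \<star> X)) \<bullet> (E \<rhd> ?\<alpha> ?I ?I X)"
        using E X by (simp add: M.Comp_Comp)
    qed (use E X in auto)
  qed (use E X in auto)
  show ?thesis
  proof (rule M.iso_cancel_right[OF iso_whisker_left[OF E iso_whisker_left[OF I act_unit_typing(4)[OF X]]]])
    have "(?u (E \<star> X) \<bullet> swap E ?I X) \<bullet> (E \<rhd> ?I \<rhd> ?u X) = ?u (E \<star> X) \<bullet> (?I \<rhd> E \<rhd> ?u X) \<bullet> swap E ?I (?I \<star> X)"
      using E X swap_natural[of "Ident V E" "Ident V ?I" "?u X" E ?I "?I \<star> X" E ?I X] by (simp add: M.Comp_Comp)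
    also have "\<dots> = (E \<rhd> ?u X) \<bullet> ?u (E \<star> ?I \<star> X) \<bullet> swap E ?I (?I \<star> X)"
      using E X act_unit_nat[of "E \<rhd> ?u X" "E \<star> ?I \<star> X" "E \<star> X"] by (intro M.Comp_eq_Comp) auto
    also have "\<dots> = (E \<rhd> ?u X) \<bullet> (E \<rhd> ?u (?I \<star> X))" using 1 by simp
    also have "\<dots> = (E \<rhd> ?u X) \<bullet> (E \<rhd> ?I \<rhd> ?u X)"
      using E X act_unit_nat[of "?u X" "?I \<star> X" X] by (simp add: whisker_left_Comp)
    finally show "(?u (E \<star> X) \<bullet> swap E ?I X) \<bullet> (E \<rhd> ?I \<rhd> ?u X) = (E \<rhd> ?u X) \<bullet> (E \<rhd> ?I \<rhd> ?u X)" .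
  qed (use E X in auto)
qed

lemma swap_unit_left:
  assumes K: "K \<in> Obj V" and X: "X \<in> Obj M"
  shows "(K \<rhd> act_unit A X) \<bullet> swap \<I>\<^bsub>V\<^esub> K X = act_unit A (K \<star> X)"
  using assms by (simp add: swap_unit_right[symmetric] M.Comp_Comp swap_swap)

end

section \<open>The pointwise action on diagrams\<close>

context enriched_diagrams
begin

abbreviation "AD \<equiv> pointwise_action V M A C"
abbreviation "P \<equiv> pointwise_act_obj V M A C"

lemma P_simps [simp]:
  "c \<in> EObj C \<Longrightarrow> dobj (P K X) c = K \<star> dobj X c"
  "c \<in> EObj C \<Longrightarrow> d \<in> EObj C \<Longrightarrow> dact (P K X) (c, d) = (K \<rhd> dact X (c, d)) \<bullet> swap (H c d) K (dobj X c)"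
  by (auto simp: pointwise_act_obj_def swap_def)

text \<open>Naturality of \<open>swap\<close> brings composition and identities of \<open>C\<close>
  past \<open>K\<close>. Associativity then follows from that of \<open>X\<close> and
  \<open>swap_tensor_left\<close>, the unit axiom from \<open>swap_unit_left\<close>.\<close>

lemma P_D [simp]:
  assumes K: "K \<in> Obj V" and X: "X \<in> Obj D"
  shows "P K X \<in> Obj D"
proof -
  have "P K X = \<lparr>dobj = (\<lambda>c\<in>EObj C. K \<star> dobj X c),
      dact = (\<lambda>(c, d)\<in>EObj C \<times> EObj C. (K \<rhd> dact X (c, d)) \<bullet> swap (H c d) K (dobj X c))\<rparr>"
    by (simp add: pointwise_act_obj_def swap_def)
  also have "\<dots> \<in> Obj D"
  proof (rule diagramI)
    fix b c d assume b: "b \<in> EObj C" and c: "c \<in> EObj C" and d: "d \<in> EObj C"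
    let ?E = "H c d" and ?F = "H b c" and ?Xb = "dobj X b" and ?Xc = "dobj X c"
    have "((K \<rhd> dact X (b, d)) \<bullet> swap (H b d) K ?Xb) \<bullet> (EComp C b c d \<lhd> (K \<star> ?Xb)) =
        (K \<rhd> dact X (b, d)) \<bullet> (K \<rhd> EComp C b c d \<lhd> ?Xb) \<bullet> swap (?E \<otimes>\<^bsub>V\<^esub> ?F) K ?Xb"
      using b c d K X swap_natural[of "EComp C b c d" "Ident V K" "Ident M ?Xb" "?E \<otimes>\<^bsub>V\<^esub> ?F" K ?Xb "H b d" K ?Xb]
      by (simp add: M.Comp_Comp)
    also have "\<dots> = ((K \<rhd> dact X (c, d)) \<bullet> (K \<rhd> ?E \<rhd> dact X (b, c)) \<bullet> (K \<rhd> act_assoc A ?E ?F ?Xb)) \<bullet>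
        swap (?E \<otimes>\<^bsub>V\<^esub> ?F) K ?Xb"
      using b c d K X diagramD(5)[OF X b c d] by (intro M.Comp_eq_Arr) (auto simp: whisker_left_Comp)
    also have "\<dots> = (K \<rhd> dact X (c, d)) \<bullet> (K \<rhd> ?E \<rhd> dact X (b, c)) \<bullet> (K \<rhd> act_assoc A ?E ?F ?Xb) \<bullet>
        swap (?E \<otimes>\<^bsub>V\<^esub> ?F) K ?Xb"
      using b c d K X by (simp add: M.Comp_Comp)
    also have "(K \<rhd> act_assoc A ?E ?F ?Xb) \<bullet> swap (?E \<otimes>\<^bsub>V\<^esub> ?F) K ?Xb =
        swap ?E K (?F \<star> ?Xb) \<bullet> (?E \<rhd> swap ?F K ?Xb) \<bullet> act_assoc A ?E ?F (K \<star> ?Xb)"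
      by (rule swap_tensor_left) (use b c d K X in auto)
    also have "(K \<rhd> ?E \<rhd> dact X (b, c)) \<bullet> \<dots> =
        swap ?E K ?Xc \<bullet> (?E \<rhd> K \<rhd> dact X (b, c)) \<bullet> (?E \<rhd> swap ?F K ?Xb) \<bullet> act_assoc A ?E ?F (K \<star> ?Xb)"
      using b c d K X swap_natural[of "Ident V ?E" "Ident V K" "dact X (b, c)" ?E K "?F \<star> ?Xb" ?E K ?Xc]
      by (intro M.Comp_eq_Comp) auto
    finally show "((K \<rhd> dact X (b, d)) \<bullet> swap (H b d) K ?Xb) \<bullet> (EComp C b c d \<lhd> (K \<star> ?Xb)) =
        ((K \<rhd> dact X (c, d)) \<bullet> swap ?E K ?Xc) \<bullet> (?E \<rhd> ((K \<rhd> dact X (b, c)) \<bullet> swap ?F K ?Xb)) \<bullet>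
        act_assoc A ?E ?F (K \<star> ?Xb)"
      using b c d K X by (simp add: M.Comp_Comp whisker_left_Comp[symmetric])
  next
    fix c assume c: "c \<in> EObj C"
    have "((K \<rhd> dact X (c, c)) \<bullet> swap (H c c) K (dobj X c)) \<bullet> (EIdent C c \<lhd> (K \<star> dobj X c)) =
        (K \<rhd> dact X (c, c)) \<bullet> (K \<rhd> EIdent C c \<lhd> dobj X c) \<bullet> swap \<I>\<^bsub>V\<^esub> K (dobj X c)"
      using c K X swap_natural[of "EIdent C c" "Ident V K" "Ident M (dobj X c)" "\<I>\<^bsub>V\<^esub>" K "dobj X c" "H c c" K "dobj X c"]
      by (simp add: M.Comp_Comp)
    also have "\<dots> = (K \<rhd> act_unit A (dobj X c)) \<bullet> swap \<I>\<^bsub>V\<^esub> K (dobj X c)"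
      using c K X diagramD(6)[OF X c] by (intro M.Comp_eq_Arr) (auto simp: whisker_left_Comp)
    also have "\<dots> = act_unit A (K \<star> dobj X c)" using c K X by (simp add: swap_unit_left)
    finally show "((K \<rhd> dact X (c, c)) \<bullet> swap (H c c) K (dobj X c)) \<bullet> (EIdent C c \<lhd> (K \<star> dobj X c)) =
        act_unit A (K \<star> dobj X c)" .
  qed (use K X in \<open>auto simp: in_hom_iff\<close>)
  finally show ?thesis .
qed

lemma AD_simps [simp]:
  "act_obj AD K X = P K X"
  "ddom (act_arr AD k f) = P (Dom V k) (ddom f)" "dcod (act_arr AD k f) = P (Cod V k) (dcod f)"
  "c \<in> EObj C \<Longrightarrow> dmap (act_arr AD k f) c = k \<diamondop> dmap f c"
  "ddom (act_assoc AD K L X) = P (K \<otimes>\<^bsub>V\<^esub> L) X" "dcod (act_assoc AD K L X) = P K (P L X)"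
  "c \<in> EObj C \<Longrightarrow> dmap (act_assoc AD K L X) c = act_assoc A K L (dobj X c)"
  "ddom (act_unit AD X) = P \<I>\<^bsub>V\<^esub> X" "dcod (act_unit AD X) = X"
  "c \<in> EObj C \<Longrightarrow> dmap (act_unit AD X) c = act_unit A (dobj X c)"
  by (auto simp: pointwise_action_def)

lemma act_arr_D [simp]:
  assumes k: "k \<in> Arr V" and f: "f \<in> Arr D"
  shows "act_arr AD k f \<in> Arr D"
proof -
  have "\<lparr>ddom = P (Dom V k) (ddom f), dcod = P (Cod V k) (dcod f), dmap = (\<lambda>c\<in>EObj C. k \<diamondop> dmap f c)\<rparr>
      \<in> hom D (P (Dom V k) (ddom f)) (P (Cod V k) (dcod f))"
  proof (rule diagram_mapI)
    fix c d assume c: "c \<in> EObj C" and d: "d \<in> EObj C"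
    let ?X = "ddom f" and ?Y = "dcod f" and ?K = "Dom V k" and ?L = "Cod V k"
    have "(k \<diamondop> dmap f d) \<bullet> (?K \<rhd> dact ?X (c, d)) \<bullet> swap (H c d) ?K (dobj ?X c) =
        (?L \<rhd> dact ?Y (c, d)) \<bullet> (k \<diamondop> (H c d \<rhd> dmap f c)) \<bullet> swap (H c d) ?K (dobj ?X c)"
      using k f c d diagram_mapD(6)[OF f c d] by (intro M.Comp_eq_Comp) (auto simp: act_interchange)
    also have "(k \<diamondop> (H c d \<rhd> dmap f c)) \<bullet> swap (H c d) ?K (dobj ?X c) =
        swap (H c d) ?L (dobj ?Y c) \<bullet> (H c d \<rhd> (k \<diamondop> dmap f c))"
      by (rule swap_natural[symmetric]) (use k f c d in auto)
    finally show "(k \<diamondop> dmap f d) \<bullet> dact (P ?K ?X) (c, d) = dact (P ?L ?Y) (c, d) \<bullet> (H c d \<rhd> (k \<diamondop> dmap f c))"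
      using k f c d by (simp add: M.Comp_Comp)
  qed (use k f in \<open>auto simp: in_hom_iff\<close>)
  then show ?thesis by (simp add: pointwise_action_def in_hom_iff)
qed

lemma act_assoc_D [simp]:
  assumes K: "K \<in> Obj V" and L: "L \<in> Obj V" and X: "X \<in> Obj D"
  shows "act_assoc AD K L X \<in> Arr D"
proof -
  have "\<lparr>ddom = P (K \<otimes>\<^bsub>V\<^esub> L) X, dcod = P K (P L X), dmap = (\<lambda>c\<in>EObj C. act_assoc A K L (dobj X c))\<rparr>
      \<in> hom D (P (K \<otimes>\<^bsub>V\<^esub> L) X) (P K (P L X))"
  proof (rule diagram_mapI)
    fix c d assume c: "c \<in> EObj C" and d: "d \<in> EObj C"
    let ?E = "H c d" and ?Xc = "dobj X c"
    have "act_assoc A K L (dobj X d) \<bullet> ((K \<otimes>\<^bsub>V\<^esub> L) \<rhd> dact X (c, d)) \<bullet> swap ?E (K \<otimes>\<^bsub>V\<^esub> L) ?Xc =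
        (K \<rhd> L \<rhd> dact X (c, d)) \<bullet> act_assoc A K L (?E \<star> ?Xc) \<bullet> swap ?E (K \<otimes>\<^bsub>V\<^esub> L) ?Xc"
      using K L X c d act_assoc_nat[of "Ident V K" "Ident V L" "dact X (c, d)" K L "?E \<star> ?Xc" K L "dobj X d"]
      by (intro M.Comp_eq_Comp) (auto simp: V.tensor_Ident)
    also have "act_assoc A K L (?E \<star> ?Xc) \<bullet> swap ?E (K \<otimes>\<^bsub>V\<^esub> L) ?Xc =
        (K \<rhd> swap ?E L ?Xc) \<bullet> swap ?E K (L \<star> ?Xc) \<bullet> (?E \<rhd> act_assoc A K L ?Xc)"
      by (rule swap_tensor_right) (use K L X c d in auto)
    finally show "act_assoc A K L (dobj X d) \<bullet> dact (P (K \<otimes>\<^bsub>V\<^esub> L) X) (c, d) =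
        dact (P K (P L X)) (c, d) \<bullet> (?E \<rhd> act_assoc A K L ?Xc)"
      using K L X c d by (simp add: M.Comp_Comp whisker_left_Comp[symmetric])
  qed (use K L X in \<open>auto simp: in_hom_iff\<close>)
  then show ?thesis by (simp add: pointwise_action_def in_hom_iff)
qed

text \<open>Naturality of the unit isomorphism in \<open>M\<close> reduces the claim to
  \<open>swap_unit_right\<close>.\<close>

lemma act_unit_D [simp]:
  assumes X: "X \<in> Obj D"
  shows "act_unit AD X \<in> Arr D"
proof -
  have "\<lparr>ddom = P \<I>\<^bsub>V\<^esub> X, dcod = X, dmap = (\<lambda>c\<in>EObj C. act_unit A (dobj X c))\<rparr> \<in> hom D (P \<I>\<^bsub>V\<^esub> X) X"
  proof (rule diagram_mapI)
    fix c d assume c: "c \<in> EObj C" and d: "d \<in> EObj C"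
    have "act_unit A (dobj X d) \<bullet> (\<I>\<^bsub>V\<^esub> \<rhd> dact X (c, d)) \<bullet> swap (H c d) \<I>\<^bsub>V\<^esub> (dobj X c) =
        dact X (c, d) \<bullet> act_unit A (H c d \<star> dobj X c) \<bullet> swap (H c d) \<I>\<^bsub>V\<^esub> (dobj X c)"
      using X c d act_unit_nat[of "dact X (c, d)" "H c d \<star> dobj X c" "dobj X d"] by (intro M.Comp_eq_Comp) auto
    then show "act_unit A (dobj X d) \<bullet> dact (P \<I>\<^bsub>V\<^esub> X) (c, d) = dact X (c, d) \<bullet> (H c d \<rhd> act_unit A (dobj X c))"
      using X c d by (simp add: swap_unit_right)
  qed (use X in \<open>auto simp: in_hom_iff\<close>)
  then show ?thesis by (simp add: pointwise_action_def in_hom_iff)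
qed


text \<open>Once the maps involved are known to be maps of diagrams, the equations hold pointwise by
  the corresponding axioms of the action on \<open>M\<close>.\<close>

lemma monoidal_action_D: "monoidal_action V D AD"
proof (intro monoidal_action.intro monoidal_action_axioms.intro V.symmetric_monoidal_category_axioms category_D)
  fix K L N X
  assume K: "K \<in> Obj V"
  show "act_obj AD K X \<in> Obj D" if "X \<in> Obj D" using K that by simp
  show "act_arr AD (Ident V K) (Ident D X) = Ident D (act_obj AD K X)" if "X \<in> Obj D"
    by (rule diagram_map_eqI) (use K that D.Arr_Ident in auto)
  show "act_arr AD (Ident V K) (act_unit AD X) \<cdot>\<^bsub>D\<^esub> act_assoc AD K \<I>\<^bsub>V\<^esub> X = act_arr AD (runit V K) (Ident D X)"
    if "X \<in> Obj D"
    by (rule diagram_map_eqI) (use K that D.Arr_Ident act_triangle in auto)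
  assume L: "L \<in> Obj V"
  show "act_assoc AD K L X \<in> hom D (act_obj AD (K \<otimes>\<^bsub>V\<^esub> L) X) (act_obj AD K (act_obj AD L X))" if "X \<in> Obj D"
    using K L that by (simp add: in_hom_iff)
  show "iso D (act_assoc AD K L X)" if "X \<in> Obj D"
    by (rule isoI_pointwise) (use K L that in auto)
  assume N: "N \<in> Obj V"
  show "act_assoc AD K L (act_obj AD N X) \<cdot>\<^bsub>D\<^esub> act_assoc AD (K \<otimes>\<^bsub>V\<^esub> L) N X =
      act_arr AD (Ident V K) (act_assoc AD L N X) \<cdot>\<^bsub>D\<^esub> act_assoc AD K (L \<otimes>\<^bsub>V\<^esub> N) X \<cdot>\<^bsub>D\<^esub>
        act_arr AD (assoc V K L N) (Ident D X)" if "X \<in> Obj D"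
    by (rule diagram_map_eqI) (use K L N that D.Arr_Ident act_pentagon in auto)
next
  fix k K K' f X X' assume "k \<in> hom V K K'" "f \<in> hom D X X'"
  then show "act_arr AD k f \<in> hom D (act_obj AD K X) (act_obj AD K' X')" by (auto simp: in_hom_iff)
next
  fix k K K' k' K'' f X X' f' X''
  assume "k \<in> hom V K K'" "k' \<in> hom V K' K''" "f \<in> hom D X X'" "f' \<in> hom D X' X''"
  then show "act_arr AD (k' \<cdot>\<^bsub>V\<^esub> k) (f' \<cdot>\<^bsub>D\<^esub> f) = act_arr AD k' f' \<cdot>\<^bsub>D\<^esub> act_arr AD k f"
    by (intro diagram_map_eqI) (auto simp: in_hom_iff act_interchange)
next
  fix k K K' l L L' f X X'
  assume "k \<in> hom V K K'" "l \<in> hom V L L'" "f \<in> hom D X X'"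
  then show "act_assoc AD K' L' X' \<cdot>\<^bsub>D\<^esub> act_arr AD (k \<odot>\<^bsub>V\<^esub> l) f = act_arr AD k (act_arr AD l f) \<cdot>\<^bsub>D\<^esub> act_assoc AD K L X"
    by (intro diagram_map_eqI) (auto simp: in_hom_iff act_assoc_nat)
next
  fix X assume X: "X \<in> Obj D"
  show "act_unit AD X \<in> hom D (act_obj AD \<I>\<^bsub>V\<^esub> X) X" using X by (simp add: in_hom_iff)
  show "iso D (act_unit AD X)" by (rule isoI_pointwise) (use X in auto)
  fix L assume L: "L \<in> Obj V"
  show "act_unit AD (act_obj AD L X) \<cdot>\<^bsub>D\<^esub> act_assoc AD \<I>\<^bsub>V\<^esub> L X = act_arr AD (lunit V L) (Ident D X)"
    by (rule diagram_map_eqI) (use X L D.Arr_Ident act_lunit in auto)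
next
  fix f X X' assume "f \<in> hom D X X'"
  then show "act_unit AD X' \<cdot>\<^bsub>D\<^esub> act_arr AD (Ident V \<I>\<^bsub>V\<^esub>) f = f \<cdot>\<^bsub>D\<^esub> act_unit AD X"
    by (intro diagram_map_eqI) (auto simp: in_hom_iff act_unit_nat)
qed

end

text \<open>Initial diagrams are the pointwise initial ones, so both halves reduce to the action on
  \<open>M\<close>.\<close>

lemma (in cocontinuous_diagrams) action_preserves_initial_D:
  assumes ex: "\<exists>Z. initial M Z" and pres: "action_preserves_initial V M A"
  shows "action_preserves_initial V D AD"
  unfolding action_preserves_initial_def
proof (intro conjI ballI allI impI)
  show "initial D (act_obj AD K Z)" if K: "K \<in> Obj V" and Z: "initial D Z" for K Z
  proof (rule D_initialI[OF ex])
    show "act_obj AD K Z \<in> Obj D" using K Z by (simp add: initial_def)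
    show "initial M (dobj (act_obj AD K Z) c)" if c: "c \<in> EObj C" for c
      using pres K D_initial_pointwise[OF ex Z c] c by (simp add: action_preserves_initial_def)
  qed
  show "initial D (act_obj AD Z X)" if X: "X \<in> Obj D" and Z: "initial V Z" for X Z
  proof (rule D_initialI[OF ex])
    show "act_obj AD Z X \<in> Obj D" using X Z by (simp add: initial_def)
    show "initial M (dobj (act_obj AD Z X) c)" if c: "c \<in> EObj C" for c
      using pres Z X c by (simp add: action_preserves_initial_def)
  qed
qed

theorem theorem1:
  fixes \<kappa> :: "'s rel"
    and V :: "('vo, 'va) moncat"
    and M :: "('o, 'a) cat"
    and G :: "'o set" and Cf W :: "'a set"
    and A :: "('vo, 'va, 'o, 'a) action"
    and C :: "('c, 'vo, 'va) ecat"
  assumes "universe_cardinal \<kappa>"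
    and "symmetric_monoidal_category V" and "cocomplete \<kappa> V" and "tensor_preserves_colimits \<kappa> V"
    and "cofibration_V_category \<kappa> V M G Cf W A"
    and "\<forall>X\<in>G. cofibrant M Cf X"
    and "action_preserves_colimits \<kappa> V M A"
    and "enriched_category V C" and "small \<kappa> (EObj C)" and "locally_flat V M Cf W A C"
  shows "cofibration_V_category \<kappa> V (diagram_cat V M A C) (pointwise_good V M A C G)
    (projective_cofibrations \<kappa> V M A C G Cf) (pointwise_weq V M A C W)
    (pointwise_action V M A C)"
proof -
  interpret monoidal_action V M A using assms(5) by (simp add: cofibration_V_category_def)
  interpret enriched_category V C by fact
  interpret projective_diagrams V M A C \<kappa> G Cf W
    by unfold_locales (use assms in \<open>auto simp: cofibration_V_category_def\<close>)
  show ?thesis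
    unfolding cofibration_V_category_def
    using cofibration_category_D monoidal_action_D action_preserves_initial_D[OF initial_M] assms(5)
    by (simp add: cofibration_V_category_def)
qed

end
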